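(* Let $p\in(1,\infty)$ and $s\ge0$. The diameter $\operatorname{diam}_{s,p}\operatorname{Diff}(S^1)$ is zero for $s\le 1/p$, finite but non-zero for $1/p<s<1+1/p$, and infinite for $s\ge 1+1/p$.
   Context: $S^1=\mathbb{R}/\mathbb{Z}$. For $s=k+\sigma$ ($k\in\mathbb{N}_0$, $\sigma\in[0,1)$) the $W^{s,p}$ norm of a function on $\mathbb{R}^n$ is $\|f\|_{W^{k,p}}+\big(\iint\frac{|D^kf(x)-D^kf(y)|^p}{|x-y|^{n+\sigma p}}dx\,dy\big)^{1/p}$ (second term omitted if $\sigma=0$); on a closed manifold such as $S^1$ the norm of a vector field is defined via a fixed finite cover by coordinate balls and a subordinate partition of unity $\rho_\alpha$ as $(\sum_\alpha\|\rho_\alpha X\text{ in coordinates}\|_{W^{s,p}(\mathbb{R}^n)}^2)^{1/2}$ (choices give equivalent norms). $\operatorname{Diff}(S^1)$ is the identity component of the smooth diffeomorphism group; the length of a path $\varphi_t$ is $\int_0^1\|\partial_t\varphi_t\circ\varphi_t^{-1}\|_{W^{s,p}}dt$, $\operatorname{dist}_{s,p}$ is the infimum of lengths, and $\operatorname{diam}_{s,p}$ the supremum of distances. *)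

theory Defs
  imports "HOL-Analysis.Analysis" "HOL-Probability.Probability"
begin

fun Ck :: "nat \<Rightarrow> ('a::euclidean_space \<Rightarrow> real) \<Rightarrow> bool" where
  "Ck 0 f = continuous_on UNIV f"
| "Ck (Suc k) f = ((\<forall>z. f differentiable at z) \<and>
      (\<forall>i\<in>Basis. Ck k (\<lambda>z. frechet_derivative f (at z) i)))"

definition smooth :: "('a::euclidean_space \<Rightarrow> real) \<Rightarrow> bool" where
  "smooth f = (\<forall>k. Ck k f)"

definition enn_rpow :: "ennreal \<Rightarrow> real \<Rightarrow> ennreal" where
  "enn_rpow x a = (if x = \<infinity> then \<infinity> else ennreal (enn2real x powr a))"

definition Lp_norm :: "real \<Rightarrow> (real \<Rightarrow> real) \<Rightarrow> ennreal" where
  "Lp_norm p g = enn_rpow (\<integral>\<^sup>+ x. ennreal (\<bar>g x\<bar> powr p) \<partial>lborel) (1 / p)"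

definition W_norm_R :: "real \<Rightarrow> real \<Rightarrow> (real \<Rightarrow> real) \<Rightarrow> ennreal" where
  "W_norm_R s p f =
     (let k = nat \<lfloor>s\<rfloor>; \<sigma> = s - real k; Dk = (deriv ^^ k) f in
       (\<Sum>j\<le>k. Lp_norm p ((deriv ^^ j) f))
       + (if \<sigma> = 0 then 0 else
           enn_rpow (\<integral>\<^sup>+ z. ennreal (\<bar>Dk (fst z) - Dk (snd z)\<bar> powr p
                                   / \<bar>fst z - snd z\<bar> powr (1 + \<sigma> * p))
                     \<partial>(lborel \<Otimes>\<^sub>M lborel)) (1 / p)))"

text \<open>Vector fields on S^1 are 1-periodic functions on R.
  A chart datum (c, r, \<rho>): the coordinate ball is the image of the interval
  ]c-r, c+r[ (0 < r \<le> 1/2) under the projection R \<rightarrow> R/Z, with the identity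
  coordinate; \<rho> is the (1-periodic) partition-of-unity function, compactly
  supported inside the ball.\<close>

definition admissible_pu :: "(real \<times> real \<times> (real \<Rightarrow> real)) list \<Rightarrow> bool" where
  "admissible_pu P =
     ((\<forall>(c, r, \<rho>) \<in> set P.
         0 < r \<and> r \<le> 1/2 \<and> smooth \<rho> \<and> (\<forall>x. \<rho> (x + 1) = \<rho> x) \<and> (\<forall>x. 0 \<le> \<rho> x) \<and>
         (\<exists>\<delta>>0. \<forall>x. \<rho> x \<noteq> 0 \<longrightarrow> (\<exists>n::int. \<bar>x - c - real_of_int n\<bar> \<le> r - \<delta>)))
      \<and> (\<forall>x. (\<Sum>(c, r, \<rho>)\<leftarrow>P. \<rho> x) = 1))"

definition local_rep :: "real \<Rightarrow> real \<Rightarrow> (real \<Rightarrow> real) \<Rightarrow> (real \<Rightarrow> real) \<Rightarrow> (real \<Rightarrow> real)" where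
  "local_rep c r \<rho> X = (\<lambda>x. if \<bar>x - c\<bar> < r then \<rho> x * X x else 0)"

definition W_norm_S1 ::
  "(real \<times> real \<times> (real \<Rightarrow> real)) list \<Rightarrow> real \<Rightarrow> real \<Rightarrow> (real \<Rightarrow> real) \<Rightarrow> ennreal" where
  "W_norm_S1 P s p X =
     enn_rpow (\<Sum>(c, r, \<rho>)\<leftarrow>P. (W_norm_R s p (local_rep c r \<rho> X))^2) (1/2)"

text \<open>Identity component of Diff(S^1) = orientation preserving diffeomorphisms,
  represented by their lifts g : R \<rightarrow> R (smooth, g' > 0, g(x+1) = g(x)+1).
  Lifts of the same diffeomorphism differ by an integer translation.\<close>
definition diff_lift :: "(real \<Rightarrow> real) \<Rightarrow> bool" where
  "diff_lift g = (smooth g \<and> (\<forall>x. deriv g x > 0) \<and> (\<forall>x. g (x + 1) = g x + 1))"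

definition diff_path :: "(real \<Rightarrow> real \<Rightarrow> real) \<Rightarrow> bool" where
  "diff_path \<Phi> = (smooth (\<lambda>z::real\<times>real. \<Phi> (fst z) (snd z)) \<and> (\<forall>t\<in>{0..1}. diff_lift (\<Phi> t)))"

definition path_velocity :: "(real \<Rightarrow> real \<Rightarrow> real) \<Rightarrow> real \<Rightarrow> (real \<Rightarrow> real)" where
  "path_velocity \<Phi> t = (\<lambda>y. deriv (\<lambda>\<tau>. \<Phi> \<tau> (inv (\<Phi> t) y)) t)"

definition path_length ::
  "(real \<times> real \<times> (real \<Rightarrow> real)) list \<Rightarrow> real \<Rightarrow> real \<Rightarrow> (real \<Rightarrow> real \<Rightarrow> real) \<Rightarrow> ennreal" where
  "path_length P s p \<Phi> =
     (\<integral>\<^sup>+ t. indicator {0..1} t * W_norm_S1 P s p (path_velocity \<Phi> t) \<partial>lborel)"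

text \<open>Distance between the diffeomorphisms with lifts g and h: paths start at the lift g
  and end at some lift h + n of the diffeomorphism represented by h.\<close>
definition diff_dist ::
  "(real \<times> real \<times> (real \<Rightarrow> real)) list \<Rightarrow> real \<Rightarrow> real \<Rightarrow> (real \<Rightarrow> real) \<Rightarrow> (real \<Rightarrow> real) \<Rightarrow> ennreal" where
  "diff_dist P s p g h =
     (INF \<Phi> \<in> {\<Phi>. diff_path \<Phi> \<and> \<Phi> 0 = g \<and> (\<exists>n::int. \<Phi> 1 = (\<lambda>x. h x + real_of_int n))}.
        path_length P s p \<Phi>)"

definition diff_diam ::
  "(real \<times> real \<times> (real \<Rightarrow> real)) list \<Rightarrow> real \<Rightarrow> real \<Rightarrow> ennreal" where
  "diff_diam P s p = (SUP (g, h) \<in> {(g, h). diff_lift g \<and> diff_lift h}. diff_dist P s p g h)"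

end

theory Submission
  imports Defs
begin

text \<open>Upper bounds come from explicit paths. In the critical case \<open>s = 1/p\<close> the norm does not control the supremum:
  a logarithmically flattened bump of height 1 has arbitrarily small norm. Such a bump travelling around the circle carries
  along the points near its crest, so every displacement can be produced at vanishing cost. For \<open>s < 1 + 1/p\<close> the norm of
  \<open>X\<close> is bounded by interpolation between the total variations of \<open>X\<close> and \<open>X'\<close>. This bounds straight lines from \<open>g\<close> to
  \<open>c \<circ> g\<close> for every lift \<open>c\<close> whose derivative is monotone on both half periods, and if the density of \<open>c\<close> is concentrated
  logarithmically at 0, then \<open>c \<circ> g\<close> and \<open>c \<circ> h\<close> are close whenever \<open>g 0 = h 0\<close> is an integer.

  Lower bounds come from comparing averages over dyadic intervals. For \<open>s > 1/p\<close> the norm dominates the supremum, so a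
  half rotation has positive length. For \<open>s \<ge> 1 + 1/p\<close> it dominates a log-Lipschitz modulus of continuity,
  so a velocity field of bounded norm can shrink an arc at most doubly exponentially in time.\<close>

text \<open>The density \<open>1 / \<bar>x\<bar>\<close> is invariant under scaling. Hence the
  unnormalised densities of \<open>c \<circ> g\<close> and \<open>c \<circ> h\<close> differ in
  \<open>L^1\<close> by an amount that stays bounded as the concentration grows, while their common
  normalising factor grows like the logarithm of the concentration. The two derivatives stay
  comparable but need not become close, so only the variation of the velocity is small; for
  \<open>s < 1 + 1/p\<close> a power \<open>1 - \<alpha> > 0\<close> of this small quantity survives
  in the bound for the norm.

  In the critical case a passing bump realises exactly the motions that are translations in some
  coordinate of the circle. An increasing displacement is cut into \<open>n\<close> such motions;
  each misses its target by \<open>O(1/n^2)\<close> together with its first derivative, the misses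
  are closed by straight lines of total length \<open>O(1/n)\<close>, and the bumps can be made as
  cheap as desired once \<open>n\<close> is fixed.

  The thresholds in the lower bounds come from a geometric series over dyadic scales: ratio below 1
  gives a uniform bound, ratio 1 gives one term per scale and hence a logarithm.\<close>

section \<open>Smooth functions\<close>

lemma Ck_SucI:
  assumes "\<And>z. (f has_derivative f' z) (at z)"
    and "\<And>i. i \<in> Basis \<Longrightarrow> Ck k (\<lambda>z. f' z i)"
  shows "Ck (Suc k) f"
proof -
  have "frechet_derivative f (at z) = f' z" for z
    using assms(1) frechet_derivative_at by metis
  then show ?thesis
    using assms by (auto simp: differentiable_def)
qed

lemma Ck_has_derivative:
  "Ck (Suc k) f \<Longrightarrow> (f has_derivative frechet_derivative f (at z)) (at z)"
  using frechet_derivative_works by auto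

lemma Ck_Suc_imp_Ck: "Ck (Suc k) f \<Longrightarrow> Ck k f"
proof (induction k arbitrary: f)
  case 0
  then show ?case
    by (auto intro!: continuous_at_imp_continuous_on differentiable_imp_continuous_within)
qed auto

lemma Ck_const [simp]: "Ck k (\<lambda>_. c)"
proof (induction k arbitrary: c)
  case (Suc k)
  show ?case by (rule Ck_SucI[where f' = "\<lambda>_ _. 0"]) (auto simp: Suc)
qed simp

lemma Ck_add:
  "Ck k f \<Longrightarrow> Ck k g \<Longrightarrow> Ck k (\<lambda>z. f z + g z)"
proof (induction k arbitrary: f g)
  case (Suc k)
  show ?case
    by (rule Ck_SucI[OF has_derivative_add[OF Suc.prems(1)[THEN Ck_has_derivative] Suc.prems(2)[THEN Ck_has_derivative]]])
       (use Suc in auto)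
qed (auto intro: continuous_intros)

lemma Ck_mult:
  "Ck k f \<Longrightarrow> Ck k g \<Longrightarrow> Ck k (\<lambda>z. f z * g z)"
proof (induction k arbitrary: f g)
  case (Suc k)
  show ?case
    by (rule Ck_SucI[OF has_derivative_mult[OF Suc.prems(1)[THEN Ck_has_derivative] Suc.prems(2)[THEN Ck_has_derivative]]])
       (intro Ck_add Suc.IH Suc.prems[THEN Ck_Suc_imp_Ck], use Suc.prems in simp_all)
qed (auto intro: continuous_intros)

lemma Ck_sum: "(\<And>i. i \<in> A \<Longrightarrow> Ck k (f i)) \<Longrightarrow> Ck k (\<lambda>z. \<Sum>i\<in>A. f i z)"
proof (induction A rule: infinite_finite_induct)
  case (insert x F)
  then show ?case using Ck_add[of k "f x" "\<lambda>z. \<Sum>i\<in>F. f i z"] by simp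
qed auto

text \<open>Induction on \<open>k\<close> with \<open>a\<close> fixed: by the chain rule a partial
  derivative of the composite is a finite sum of products of partial derivatives of
  \<open>f\<close>, taken at \<open>a z\<close>, with partial derivatives of the coordinates of
  \<open>a\<close>. The induction hypothesis is applied to the partial derivatives of
  \<open>f\<close>.\<close>

lemma Ck_compose:
  fixes a :: "'a::euclidean_space \<Rightarrow> 'b::euclidean_space" and f :: "'b \<Rightarrow> real"
  assumes "Ck k f" "\<And>i. i \<in> Basis \<Longrightarrow> Ck k (\<lambda>z. a z \<bullet> i)"
  shows "Ck k (\<lambda>z. f (a z))"
  using assms
proof (induction k arbitrary: f)
  case 0
  have "continuous_on UNIV a"
    using 0(2) continuous_on_componentwise by auto
  then show ?case
    using 0(1) continuous_on_compose2[of UNIV f UNIV a] by auto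
next
  case (Suc k)
  \<comment> \<open>\<open>Ck\<close> speaks of real-valued functions only, so the derivative of
    \<open>a\<close> is assembled from those of its coordinates.\<close>
  let ?a' = "\<lambda>z v. \<Sum>j\<in>Basis. frechet_derivative (\<lambda>z. a z \<bullet> j) (at z) v *\<^sub>R j"
  have a: "(a has_derivative ?a' z) (at z)" for z
    by (subst has_derivative_componentwise_within)
       (use Suc.prems(2)[THEN Ck_has_derivative] in \<open>simp add: inner_sum_left inner_Basis if_distrib cong: if_cong\<close>)
  have comp: "((\<lambda>z. f (a z)) has_derivative (\<lambda>v. frechet_derivative f (at (a z)) (?a' z v))) (at z)" for z
    using has_derivative_compose[OF a Suc.prems(1)[THEN Ck_has_derivative]] .
  have lin: "frechet_derivative f (at x) (\<Sum>j\<in>Basis. c j *\<^sub>R j)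
      = (\<Sum>j\<in>Basis. c j * frechet_derivative f (at x) j)" for x c
    using has_derivative_linear[OF Suc.prems(1)[THEN Ck_has_derivative]]
    by (simp add: linear_sum linear_cmul)
  have 1: "Ck k (\<lambda>z. frechet_derivative (\<lambda>z. a z \<bullet> j) (at z) i)"
    if "i \<in> Basis" "j \<in> Basis" for i j
    using Suc.prems(2)[OF that(2)] that(1) by auto
  have 2: "Ck k (\<lambda>z. frechet_derivative f (at (a z)) j)" if "j \<in> Basis" for j
    by (rule Suc.IH[of "\<lambda>x. frechet_derivative f (at x) j"])
       (use Suc.prems(1) that in simp, rule Suc.prems(2)[THEN Ck_Suc_imp_Ck])
  show ?case
  proof (rule Ck_SucI[OF comp])
    fix i :: 'a assume "i \<in> Basis"
    then show "Ck k (\<lambda>z. frechet_derivative f (at (a z)) (?a' z i))"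
      unfolding lin by (intro Ck_sum Ck_mult 1 2)
  qed
qed

lemma smooth_const [simp]: "smooth (\<lambda>_. c)"
  by (simp add: smooth_def)

lemma smooth_add: "smooth f \<Longrightarrow> smooth g \<Longrightarrow> smooth (\<lambda>z. f z + g z)"
  by (simp add: smooth_def Ck_add)

lemma smooth_mult: "smooth f \<Longrightarrow> smooth g \<Longrightarrow> smooth (\<lambda>z. f z * g z)"
  by (simp add: smooth_def Ck_mult)

lemma smooth_uminus: "smooth f \<Longrightarrow> smooth (\<lambda>z. - f z)"
  using smooth_mult[of "\<lambda>_. -1" f] by simp

lemma smooth_diff: "smooth f \<Longrightarrow> smooth g \<Longrightarrow> smooth (\<lambda>z. f z - g z)"
  using smooth_add[of f "\<lambda>z. - g z"] smooth_uminus[of g] by simp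

lemma smooth_compose:
  fixes f :: "real \<Rightarrow> real"
  shows "smooth f \<Longrightarrow> smooth a \<Longrightarrow> smooth (\<lambda>z. f (a z))"
  using Ck_compose[of _ f a] by (auto simp: smooth_def)

lemma smooth_compose2:
  assumes "smooth (\<lambda>z::real\<times>real. f (fst z) (snd z))" "smooth a" "smooth b"
  shows "smooth (\<lambda>z. f (a z) (b z))"
  unfolding smooth_def
proof
  fix k
  show "Ck k (\<lambda>z. f (a z) (b z))"
    using assms by (intro Ck_compose[of k "\<lambda>z::real\<times>real. f (fst z) (snd z)" "\<lambda>z. (a z, b z)", simplified])
      (auto simp: smooth_def Basis_prod_def)
qed

lemma smooth_linear: 
  fixes l :: "'a::euclidean_space \<Rightarrow> real"
  assumes "bounded_linear l" shows "smooth l"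
  unfolding smooth_def
proof
  fix k
  show "Ck k l"
  proof (cases k)
    case 0
    then show ?thesis using assms by (simp add: linear_continuous_on)
  next
    case (Suc n)
    have "Ck (Suc n) l"
      by (rule Ck_SucI[where f' = "\<lambda>_. l"]) (use assms bounded_linear_imp_has_derivative in auto)
    then show ?thesis using Suc by simp
  qed
qed

lemma smooth_fst [simp]: "smooth (fst :: real \<times> real \<Rightarrow> real)"
  and smooth_snd [simp]: "smooth (snd :: real \<times> real \<Rightarrow> real)"
  and smooth_ident [simp]: "smooth (\<lambda>x::real. x)"
  by (rule smooth_linear, simp add: bounded_linear_fst bounded_linear_snd bounded_linear_ident)+

lemma frechet_derivative_one_real:
  fixes f :: "real \<Rightarrow> real"
  assumes "f differentiable at z"
  shows "frechet_derivative f (at z) 1 = deriv f z"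
proof -
  have "(f has_derivative (*) (deriv f z)) (at z)"
    using assms DERIV_deriv_iff_real_differentiable has_field_derivative_def by blast
  then have "frechet_derivative f (at z) = (*) (deriv f z)"
    using frechet_derivative_at by metis
  then show ?thesis by simp
qed

lemma Ck_Suc_real:
  fixes f :: "real \<Rightarrow> real"
  shows "Ck (Suc k) f \<longleftrightarrow> (\<forall>z. f differentiable at z) \<and> Ck k (deriv f)"
proof -
  have "(\<lambda>z. frechet_derivative f (at z) 1) = deriv f" if "\<forall>z. f differentiable at z"
    using that frechet_derivative_one_real by auto
  then show ?thesis by auto
qed

lemma Ck_Suc_DERIV_I:
  fixes f :: "real \<Rightarrow> real"
  assumes "\<And>x. (f has_real_derivative f' x) (at x)" "Ck k f'"
  shows "Ck (Suc k) f"
proof -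
  have "deriv f = f'" using assms(1) DERIV_imp_deriv by blast
  moreover have "\<forall>z. f differentiable at z"
    using assms(1) real_differentiable_def by blast
  ultimately show ?thesis using assms(2) Ck_Suc_real by metis
qed

lemma smooth_DERIV:
  fixes f :: "real \<Rightarrow> real"
  assumes "smooth f" shows "(f has_real_derivative deriv f x) (at x)"
  using assms Ck_Suc_real[of 0 f] DERIV_deriv_iff_real_differentiable by (auto simp: smooth_def)

lemma smooth_deriv:
  fixes f :: "real \<Rightarrow> real"
  assumes "smooth f" shows "smooth (deriv f)"
  using assms Ck_Suc_real unfolding smooth_def by blast

lemma smooth_funpow_deriv:
  fixes f :: "real \<Rightarrow> real"
  assumes "smooth f" shows "smooth ((deriv ^^ k) f)"
  by (induction k) (simp_all add: assms smooth_deriv)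

lemma smooth_DERIV_I:
  fixes f :: "real \<Rightarrow> real"
  assumes "\<And>x. (f has_real_derivative f' x) (at x)" "smooth f'"
  shows "smooth f"
  unfolding smooth_def
proof
  fix k
  show "Ck k f"
    using Ck_Suc_DERIV_I[OF assms(1)] assms(2) Ck_Suc_imp_Ck[of k f] by (simp add: smooth_def)
qed

lemma smooth_continuous_on:
  fixes f :: "'a::euclidean_space \<Rightarrow> real"
  assumes "smooth f" shows "continuous_on S f"
proof -
  have "Ck 0 f" using assms smooth_def by blast
  then show ?thesis using continuous_on_subset by (metis Ck.simps(1) subset_UNIV)
qed

lemma smooth_borel:
  fixes f :: "'a::euclidean_space \<Rightarrow> real"
  assumes "smooth f" shows "f \<in> borel_measurable borel"
  using smooth_continuous_on[OF assms] borel_measurable_continuous_onI by blast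

text \<open>The induction runs over all exponents at once because differentiation replaces
  \<open>a\<close> by \<open>a - 1\<close>.\<close>

lemma smooth_powr:
  fixes f :: "real \<Rightarrow> real"
  assumes "smooth f" "\<And>x. f x > 0"
  shows "smooth (\<lambda>x. f x powr a)"
proof -
  have "Ck k (\<lambda>x. f x powr a)" for k
  proof (induction k arbitrary: a)
    case 0
    show ?case using smooth_continuous_on[OF assms(1)] assms(2)
      by (auto intro!: continuous_intros simp: less_imp_neq[symmetric])
  next
    case (Suc k)
    show ?case
    proof (rule Ck_Suc_DERIV_I)
      show "((\<lambda>x. f x powr a) has_real_derivative a * (f x powr (a - 1) * deriv f x)) (at x)" for x
        using DERIV_powr[OF smooth_DERIV[OF assms(1)] assms(2) DERIV_const, of a x] assms(2)[of x]
        by (simp add: powr_diff field_simps)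
      show "Ck k (\<lambda>x. a * (f x powr (a - 1) * deriv f x))"
        using Suc smooth_deriv[OF assms(1)] by (intro Ck_mult) (auto simp: smooth_def)
    qed
  qed
  then show ?thesis by (simp add: smooth_def)
qed

lemma smooth_divide:
  fixes f g :: "real \<Rightarrow> real"
  assumes "smooth f" "smooth g" "\<And>x. g x > 0"
  shows "smooth (\<lambda>x. f x / g x)"
proof -
  have "(\<lambda>x. f x / g x) = (\<lambda>x. f x * g x powr (-1))"
    using assms(3) by (auto simp: powr_minus_divide less_imp_le)
  then show ?thesis using smooth_mult[OF assms(1) smooth_powr[OF assms(2,3)]] by metis
qed

lemma smooth_ln:
  fixes f :: "real \<Rightarrow> real"
  assumes "smooth f" "\<And>x. f x > 0"
  shows "smooth (\<lambda>x. ln (f x))"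
proof (rule smooth_DERIV_I)
  show "((\<lambda>x. ln (f x)) has_real_derivative deriv f x / f x) (at x)" for x
    using assms by (auto intro!: derivative_eq_intros smooth_DERIV)
  show "smooth (\<lambda>x. deriv f x / f x)"
    using assms by (intro smooth_divide smooth_deriv)
qed

text \<open>The phase is a parameter because differentiation shifts it by \<open>pi / 2\<close>: the
  family is closed under derivatives and the cosine never has to be treated separately.\<close>

lemma smooth_sin_shift: "smooth (\<lambda>x. sin (x + a))"
proof -
  have "Ck k (\<lambda>x. sin (x + a))" for k
  proof (induction k arbitrary: a)
    case (Suc k)
    show ?case
      by (rule Ck_Suc_DERIV_I[where f' = "\<lambda>x. sin (x + (a + pi/2))", OF _ Suc])
         (auto intro!: derivative_eq_intros simp: sin_add[of "_ + a" "pi/2", simplified add.assoc[symmetric]] add.assoc[symmetric])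
  qed (auto intro!: continuous_intros)
  then show ?thesis by (simp add: smooth_def)
qed

lemma smooth_sin: "smooth f \<Longrightarrow> smooth (\<lambda>z. sin (f z))"
  using smooth_compose[OF smooth_sin_shift[of 0]] by simp

lemma smooth_antiderivative:
  fixes f :: "real \<Rightarrow> real"
  assumes "smooth f"
  obtains F where "\<And>x. (F has_real_derivative f x) (at x)" "smooth F"
proof -
  have "isCont f x" for x
    using smooth_continuous_on[OF assms, of UNIV] continuous_on_eq_continuous_at by blast
  then obtain F where F: "\<And>x. (F has_vector_derivative f x) (at x)"
    using einterval_antiderivative[of "-\<infinity>" "\<infinity>" f] by auto
  then have "(F has_real_derivative f x) (at x)" for x
    by (simp add: has_real_derivative_iff_has_vector_derivative)
  then show ?thesis using that smooth_DERIV_I assms by blast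
qed

subsection \<open>A smooth step\<close>

text \<open>The power of \<open>t\<close> in the denominator makes the family closed under
  differentiation up to linear combinations, so that smoothness of \<open>exp (- 1 / t)\<close> at 0
  becomes one induction over all \<open>n\<close>.\<close>

definition flat_exp :: "nat \<Rightarrow> real \<Rightarrow> real" where
  "flat_exp n t = (if t \<le> 0 then 0 else exp (- 1 / t) / t ^ n)"

lemma flat_exp_tendsto_0: "(flat_exp n \<longlongrightarrow> 0) (at 0)"
proof -
  have "((\<lambda>t::real. (1/t) ^ n / exp (1/t)) \<longlongrightarrow> 0) (at_right 0)"
    using filterlim_compose[OF tendsto_power_div_exp_0 filterlim_inverse_at_top_right, of n]
    by (simp add: inverse_eq_divide)
  then have "(flat_exp n \<longlongrightarrow> 0) (at_right 0)"
    by (rule Lim_transform_eventually)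
       (auto simp: eventually_at_filter flat_exp_def exp_minus field_simps)
  moreover have "(flat_exp n \<longlongrightarrow> 0) (at_left 0)"
    by (rule tendsto_eventually) (auto simp: eventually_at_filter flat_exp_def)
  ultimately show ?thesis by (simp add: filterlim_split_at)
qed

lemma flat_exp_DERIV: "(flat_exp n has_real_derivative flat_exp (n + 2) t - real n * flat_exp (n + 1) t) (at t)"
proof -
  consider "t < 0" | "t = 0" | "t > 0" by linarith
  then show ?thesis
  proof cases
    case 1
    have "((\<lambda>_. 0) has_real_derivative 0) (at t)" by simp
    moreover have "\<forall>\<^sub>F s in nhds t. flat_exp n s = 0"
      using eventually_nhds_in_open[of "{..<0}" t] 1 by (auto elim!: eventually_mono simp: flat_exp_def)
    ultimately have "(flat_exp n has_real_derivative 0) (at t)"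
      by (subst DERIV_cong_ev[where g = "\<lambda>_. 0"]) auto
    then show ?thesis using 1 by (simp add: flat_exp_def)
  next
    case 2
    \<comment> \<open>At 0 the difference quotient of \<open>flat_exp n\<close> is the next member
      of the family, whose limit is already known.\<close>
    have "flat_exp (Suc n) h = flat_exp n h / h" for h
      by (simp add: flat_exp_def field_simps)
    then have "((\<lambda>h. flat_exp n h / h) \<longlongrightarrow> 0) (at 0)" using flat_exp_tendsto_0[of "Suc n"]
      by presburger
    then show ?thesis using 2 by (simp add: DERIV_def flat_exp_def)
  next
    case 3
    have "((\<lambda>s. exp (- 1 / s) / s ^ n) has_real_derivative flat_exp (n + 2) t - real n * flat_exp (n + 1) t) (at t)"
    proof -
      have *: "real n * t ^ (n - Suc 0) = real n * t ^ n / t"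
        using 3 by (cases n) auto
      show ?thesis using 3
        by (auto intro!: derivative_eq_intros simp: flat_exp_def * field_simps power2_eq_square)
    qed
    moreover have "\<forall>\<^sub>F s in nhds t. flat_exp n s = exp (- 1 / s) / s ^ n"
      using eventually_nhds_in_open[of "{0<..}" t] 3 by (auto elim!: eventually_mono simp: flat_exp_def)
    ultimately show ?thesis
      by (subst DERIV_cong_ev[where g = "\<lambda>s. exp (- 1 / s) / s ^ n"]) auto
  qed
qed

lemma smooth_flat_exp: "smooth (flat_exp n)"
proof -
  have "Ck k (flat_exp n)" for k
  proof (induction k arbitrary: n)
    case 0
    have "continuous_on UNIV (flat_exp n)"
      by (meson flat_exp_DERIV DERIV_isCont continuous_at_imp_continuous_on)
    then show ?case by simp
  next
    case (Suc k)
    have "Ck k (\<lambda>t. flat_exp (n + 2) t + (- real n) * flat_exp (n + 1) t)"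
      by (intro Ck_add Ck_mult Suc Ck_const)
    then show ?case by (intro Ck_Suc_DERIV_I[OF flat_exp_DERIV]) simp
  qed
  then show ?thesis by (simp add: smooth_def)
qed

text \<open>Normalised antiderivative of a bump that is positive exactly on \<open>]0, 1[\<close>.
  It serves as a change of time that is constant outside the unit interval, so that two paths can be
  glued smoothly.\<close>

lemma smooth_step:
  obtains st :: "real \<Rightarrow> real" where "smooth st" "\<And>t. t \<le> 0 \<Longrightarrow> st t = 0" "\<And>t. t \<ge> 1 \<Longrightarrow> st t = 1"
    "\<And>t. 0 \<le> deriv st t" "\<And>t. 0 \<le> st t" "\<And>t. st t \<le> 1"
proof -
  let ?f = "\<lambda>t. flat_exp 0 t * flat_exp 0 (1 - t)"
  have "smooth (\<lambda>t. flat_exp 0 (1 - t))"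
    using smooth_compose[OF smooth_flat_exp smooth_diff[OF smooth_const smooth_ident]] .
  then have sf: "smooth ?f" using smooth_flat_exp smooth_mult by blast
  obtain S where S: "\<And>x. (S has_real_derivative ?f x) (at x)" "smooth S"
    using smooth_antiderivative[OF sf] by blast
  have f0: "?f t \<ge> 0" for t by (simp add: flat_exp_def)
  have mono: "S a \<le> S b" if "a \<le> b" for a b
    using DERIV_nonneg_imp_nondecreasing[OF that, of S] S(1) f0 by blast
  have "S 0 < S 1"
  proof -
    have "S (1/4) < S (3/4)"
    proof (rule DERIV_pos_imp_increasing, simp)
      fix x :: real assume "1/4 \<le> x" "x \<le> 3/4"
      then have "?f x > 0" by (simp add: flat_exp_def)
      then show "\<exists>y. (S has_real_derivative y) (at x) \<and> 0 < y" using S(1) by blast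
    qed
    then show ?thesis using mono[of 0 "1/4"] mono[of "3/4" 1] by linarith
  qed
  define st where "st t = (S t - S 0) / (S 1 - S 0)" for t
  have D: "(st has_real_derivative ?f t / (S 1 - S 0)) (at t)" for t
    unfolding st_def using S(1) \<open>S 0 < S 1\<close> by (auto intro!: derivative_eq_intros)
  have sm: "smooth st"
    using S(2) \<open>S 0 < S 1\<close> unfolding st_def divide_inverse by (intro smooth_mult smooth_diff) auto
  have 0: "st t = 0" if "t \<le> 0" for t
  proof -
    have "S 0 \<le> S t"
    proof (rule DERIV_nonpos_imp_nonincreasing[OF that])
      fix x :: real assume "t \<le> x" "x \<le> 0"
      then have "?f x \<le> 0" by (simp add: flat_exp_def)
      then show "\<exists>y. (S has_real_derivative y) (at x) \<and> y \<le> 0" using S(1) by blast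
    qed
    then show ?thesis using mono[OF that] by (simp add: st_def)
  qed
  have 1: "st t = 1" if "t \<ge> 1" for t
  proof -
    have "S t \<le> S 1"
    proof (rule DERIV_nonpos_imp_nonincreasing[OF that])
      fix x :: real assume "1 \<le> x" "x \<le> t"
      then have "?f x \<le> 0" by (simp add: flat_exp_def)
      then show "\<exists>y. (S has_real_derivative y) (at x) \<and> y \<le> 0" using S(1) by blast
    qed
    then show ?thesis using mono[OF that] \<open>S 0 < S 1\<close> by (simp add: st_def)
  qed
  have mst: "st a \<le> st b" if "a \<le> b" for a b
    using mono[OF that] \<open>S 0 < S 1\<close> by (simp add: st_def divide_right_mono)
  show ?thesis
  proof
    show "deriv st t \<ge> 0" for t
      using DERIV_imp_deriv[OF D] f0[of t] \<open>S 0 < S 1\<close> by simp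
    show "0 \<le> st t" for t using 0[of t] mst[of 0 t] 0[of 0] by linarith
    show "st t \<le> 1" for t using 1[of t] mst[of t 1] 1[of 1] by linarith
  qed (use sm 0 1 in auto)
qed

section \<open>Periodic functions and lifts of circle diffeomorphisms\<close>

text \<open>The gain \<open>c\<close> treats periodic functions (\<open>c = 0\<close>), lifts
  (\<open>c = 1\<close>) and antiderivatives of periodic functions alike.\<close>

lemma periodic_of_nat:
  fixes f :: "real \<Rightarrow> real"
  assumes "\<And>x. f (x + 1) = f x + c"
  shows "f (x + real n) = f x + real n * c"
proof (induction n)
  case (Suc n)
  show ?case using assms[of "x + real n"] Suc by (simp add: algebra_simps)
qed simp

lemma periodic_of_int:
  fixes f :: "real \<Rightarrow> real"
  assumes "\<And>x. f (x + 1) = f x + c"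
  shows "f (x + real_of_int n) = f x + real_of_int n * c"
proof (cases "n \<ge> 0")
  case True
  then show ?thesis using periodic_of_nat[of f c x "nat n", OF assms] by simp
next
  case False
  then show ?thesis using periodic_of_nat[of f c "x + real_of_int n" "nat (- n)", OF assms]
    by (simp add: algebra_simps)
qed

lemma periodic_frac:
  fixes f :: "real \<Rightarrow> real"
  assumes "\<And>x. f (x + 1) = f x"
  shows "f (frac x) = f x"
proof -
  have "f (x + real_of_int (- \<lfloor>x\<rfloor>)) = f x + real_of_int (- \<lfloor>x\<rfloor>) * 0"
    by (rule periodic_of_int) (simp add: assms)
  then show ?thesis by (simp add: frac_def)
qed

lemma continuous_periodic_bounded:
  fixes f :: "real \<Rightarrow> real"
  assumes "continuous_on UNIV f" "\<And>x. f (x + 1) = f x"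
  obtains B where "B > 0" "\<And>x. \<bar>f x\<bar> \<le> B"
proof -
  have "bounded (f ` {0..1})"
    by (intro compact_imp_bounded compact_continuous_image continuous_on_subset[OF assms(1)]) auto
  then obtain B where B: "B > 0" "\<And>x. x \<in> {0..1} \<Longrightarrow> \<bar>f x\<bar> \<le> B"
    by (auto simp: bounded_pos)
  have "\<bar>f x\<bar> \<le> B" for x
    using B(2)[of "frac x"] periodic_frac[of f, OF assms(2)] frac_ge_0[of x] frac_lt_1[of x] by auto
  then show ?thesis using B(1) that by blast
qed

lemma continuous_periodic_pos_lower_bound:
  fixes f :: "real \<Rightarrow> real"
  assumes "continuous_on UNIV f" "\<And>x. f (x + 1) = f x" "\<And>x. f x > 0"
  obtains m where "m > 0" "\<And>x. m \<le> f x"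
proof -
  have "continuous_on UNIV (\<lambda>x. 1 / f x)"
    using assms(3) by (intro continuous_intros assms(1)) (auto simp: less_imp_neq[symmetric])
  moreover have "1 / f (x + 1) = 1 / f x" for x by (simp add: assms(2))
  ultimately obtain B where B: "B > 0" "\<And>x. \<bar>1 / f x\<bar> \<le> B"
    by (rule continuous_periodic_bounded) blast
  have "1 / B \<le> f x" for x
    using B(2)[of x] B(1) assms(3)[of x] by (simp add: field_simps)
  then show ?thesis using that[of "1 / B"] B(1) by simp
qed

lemma continuous_antiderivative:
  fixes f :: "real \<Rightarrow> real"
  assumes "continuous_on UNIV f"
  obtains F where "\<And>x. (F has_real_derivative f x) (at x)"
proof -
  have "isCont f x" for x
    using assms continuous_on_eq_continuous_at by blast
  then obtain F where F: "\<And>x. (F has_vector_derivative f x) (at x)"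
    using einterval_antiderivative[of "-\<infinity>" "\<infinity>" f] by auto
  show ?thesis
    by (rule that[of F]) (simp add: F has_real_derivative_iff_has_vector_derivative)
qed

lemma integral_DERIV:
  fixes f :: "real \<Rightarrow> real"
  assumes "\<And>x. (F has_real_derivative f x) (at x)" "a \<le> b"
  shows "(f has_integral F b - F a) {a..b}"
  using assms fundamental_theorem_of_calculus
  by (metis has_real_derivative_iff_has_vector_derivative has_vector_derivative_at_within)

text \<open>The increment of an antiderivative over a moving period has derivative 0.\<close>

lemma integral_periodic_shift:
  fixes f :: "real \<Rightarrow> real"
  assumes "continuous_on UNIV f" "\<And>x. f (x + 1) = f x"
  shows "integral {a..a + 1} f = integral {0..1} f"
proof -
  obtain F where F: "\<And>x. (F has_real_derivative f x) (at x)"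
    using continuous_antiderivative[OF assms(1)] by blast
  have "((\<lambda>x. F (x + 1) - F x) has_real_derivative 0) (at x)" for x
    using DERIV_diff[OF F[of "x + 1", unfolded DERIV_shift] F[of x]] assms(2) by simp
  then have "F (a + 1) - F a = F (0 + 1) - F 0"
    using DERIV_isconst_all[of "\<lambda>x. F (x + 1) - F x" a 0] by blast
  then show ?thesis
    using integral_DERIV[OF F, of a "a + 1"] integral_DERIV[OF F, of 0 1]
    by (simp add: integral_unique)
qed

lemma deriv_shift:
  fixes f :: "real \<Rightarrow> real"
  assumes "smooth f" "\<And>x. f (x + 1) = f x + c"
  shows "deriv f (x + 1) = deriv f x"
proof -
  have "(\<lambda>x. f (x + 1) - c) = f" using assms(2) by auto
  moreover have "((\<lambda>x. f (x + 1) - c) has_real_derivative deriv f (x + 1)) (at x)"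
    using smooth_DERIV[OF assms(1), of "x + 1"]
    by (auto intro!: derivative_eq_intros simp: DERIV_shift)
  ultimately have "(f has_real_derivative deriv f (x + 1)) (at x)" by (simp only:)
  then show ?thesis using DERIV_imp_deriv by metis
qed

section \<open>Lifts of circle diffeomorphisms\<close>

lemma diff_lift_smooth: "diff_lift g \<Longrightarrow> smooth g"
  and diff_lift_deriv_pos: "diff_lift g \<Longrightarrow> deriv g x > 0"
  and diff_lift_shift: "diff_lift g \<Longrightarrow> g (x + 1) = g x + 1"
  by (auto simp: diff_lift_def)

lemma diff_lift_DERIV: "diff_lift g \<Longrightarrow> (g has_real_derivative deriv g x) (at x)"
  by (simp add: diff_lift_smooth smooth_DERIV)

lemma diff_lift_continuous: "diff_lift g \<Longrightarrow> continuous_on S g"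
  by (simp add: diff_lift_smooth smooth_continuous_on)

lemma diff_lift_deriv_shift: "diff_lift g \<Longrightarrow> deriv g (x + 1) = deriv g x"
  by (rule deriv_shift[where c = 1]) (auto simp: diff_lift_def)

lemma diff_liftI:
  assumes "smooth g" "\<And>x. (g has_real_derivative g' x) (at x)" "\<And>x. g' x > 0" "\<And>x. g (x + 1) = g x + 1"
  shows "diff_lift g"
  using assms DERIV_imp_deriv[OF assms(2)] by (simp add: diff_lift_def)

lemma diff_lift_of_int: "diff_lift g \<Longrightarrow> g (x + real_of_int n) = g x + real_of_int n"
  using periodic_of_int[of g 1] by (simp add: diff_lift_def)

lemma diff_lift_strict_mono: "diff_lift g \<Longrightarrow> strict_mono g"
  by (rule strict_monoI, rule DERIV_pos_imp_increasing)
     (auto intro: diff_lift_DERIV diff_lift_deriv_pos)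

lemma diff_lift_less_iff: "diff_lift g \<Longrightarrow> g x < g y \<longleftrightarrow> x < y"
  using diff_lift_strict_mono strict_mono_less by blast

lemma diff_lift_bij: assumes "diff_lift g" shows "bij g"
proof (rule bijI)
  show "inj g" using diff_lift_strict_mono[OF assms] by (rule strict_mono_imp_inj_on)
  show "surj g"
  proof (rule surjI[of _ "\<lambda>y. SOME x. g x = y"])
    fix y
    define n where "n = \<lfloor>y - g 0\<rfloor>"
    have e: "g (of_int n) = g 0 + of_int n"
      using diff_lift_of_int[OF assms, of 0 n] by simp
    have "g (of_int n) \<le> y" using e unfolding n_def by linarith
    moreover have "y \<le> g (of_int n + 1)"
      using e unfolding diff_lift_shift[OF assms] n_def by linarith
    ultimately have "\<exists>x\<ge>of_int n. x \<le> of_int n + 1 \<and> g x = y"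
      by (intro IVT') (auto intro: diff_lift_continuous[OF assms])
    then show "g (SOME x. g x = y) = y" by (metis (mono_tags, lifting) someI_ex)
  qed
qed

lemma inv_diff_lift [simp]: "diff_lift g \<Longrightarrow> inv g (g x) = x"
  and diff_lift_inv_eq [simp]: "diff_lift g \<Longrightarrow> g (inv g y) = y"
  by (simp_all add: diff_lift_bij bij_is_inj bij_is_surj inv_f_f surj_f_inv_f)

lemma inv_diff_lift_DERIV:
  assumes "diff_lift g"
  shows "(inv g has_real_derivative 1 / deriv g (inv g y)) (at y)"
proof -
  have "isCont (inv g) (g x)" for x
    by (rule isCont_inverse_function[where d = 1])
       (auto simp: assms intro: DERIV_isCont[OF diff_lift_DERIV[OF assms]])
  from this[of "inv g y"] have "isCont (inv g) y" using assms by simp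
  then show ?thesis
    using DERIV_inverse_function[OF diff_lift_DERIV[OF assms], where x = y and a = "y - 1" and b = "y + 1"] 
      diff_lift_deriv_pos[OF assms, of "inv g y"] assms
    by (simp add: inverse_eq_divide)
qed

lemma diff_lift_inv:
  assumes "diff_lift g" shows "diff_lift (inv g)"
proof (rule diff_liftI[OF _ inv_diff_lift_DERIV[OF assms]])
  \<comment> \<open>Bootstrapping: the derivative of \<open>inv g\<close> is a smooth function of
    \<open>inv g\<close> itself, so each round gains one order.\<close>
  have "Ck k (inv g)" for k
  proof (induction k)
    case 0
    have "continuous_on UNIV (inv g)"
      by (intro continuous_at_imp_continuous_on ballI DERIV_isCont[OF inv_diff_lift_DERIV[OF assms]])
    then show ?case by simp
  next
    case (Suc k)
    have "smooth (\<lambda>x. 1 / deriv g x)"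
      using assms by (intro smooth_divide smooth_deriv) (auto simp: diff_lift_def)
    then have "Ck k (\<lambda>x. 1 / deriv g (inv g x))"
      using Ck_compose[where f = "\<lambda>x. 1 / deriv g x" and a = "inv g" and k = k] Suc
      by (simp add: smooth_def)
    then show ?case by (rule Ck_Suc_DERIV_I[OF inv_diff_lift_DERIV[OF assms]])
  qed
  then show "smooth (inv g)" by (simp add: smooth_def)
  show "0 < 1 / deriv g (inv g x)" for x
    using diff_lift_deriv_pos[OF assms] by simp
  show "inv g (x + 1) = inv g x + 1" for x
  proof -
    have "g (inv g x + 1) = x + 1" using assms by (simp add: diff_lift_shift)
    then show ?thesis using inv_diff_lift[OF assms, of "inv g x + 1"] by simp
  qed
qed

lemma diff_lift_compose:
  assumes "diff_lift g" "diff_lift h"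
  shows "diff_lift (\<lambda>x. g (h x))"
proof (rule diff_liftI)
  show "((\<lambda>x. g (h x)) has_real_derivative deriv g (h x) * deriv h x) (at x)" for x
    using DERIV_chain2[OF diff_lift_DERIV[OF assms(1)] diff_lift_DERIV[OF assms(2)]] .
  show "smooth (\<lambda>x. g (h x))" by (intro smooth_compose[of g h] diff_lift_smooth assms)
  show "0 < deriv g (h x) * deriv h x" for x using assms by (simp add: diff_lift_deriv_pos)
  show "g (h (x + 1)) = g (h x) + 1" for x using assms by (simp add: diff_lift_shift)
qed

lemma diff_lift_ident: "diff_lift (\<lambda>x. x)"
  by (rule diff_liftI[where g' = "\<lambda>_. 1"]) auto

lemma diff_lift_add_const:
  assumes "diff_lift g" shows "diff_lift (\<lambda>x. g x + c)"
proof (rule diff_liftI)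
  show "((\<lambda>x. g x + c) has_real_derivative deriv g x + 0) (at x)" for x
    by (intro DERIV_add diff_lift_DERIV assms DERIV_const)
qed (use assms in \<open>auto intro: smooth_add diff_lift_smooth simp: diff_lift_shift diff_lift_deriv_pos\<close>)

lemma convex_comb_pos:
  fixes a b t :: real
  assumes "a > 0" "b > 0" "0 \<le> t" "t \<le> 1" shows "(1 - t) * a + t * b > 0"
  using assms by (cases "t = 1") (auto intro!: add_pos_nonneg)

lemma diff_lift_convex:
  assumes "diff_lift g" "diff_lift h" "0 \<le> t" "t \<le> 1"
  shows "diff_lift (\<lambda>x. (1 - t) * g x + t * h x)"
proof (rule diff_liftI[where g' = "\<lambda>x. (1 - t) * deriv g x + t * deriv h x"])
  show "0 < (1 - t) * deriv g x + t * deriv h x" for x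
    using convex_comb_pos assms diff_lift_deriv_pos by blast
  show "(1 - t) * g (x + 1) + t * h (x + 1) = (1 - t) * g x + t * h x + 1" for x
    unfolding diff_lift_shift[OF assms(1)] diff_lift_shift[OF assms(2)] by (simp add: algebra_simps)
  show "smooth (\<lambda>x. (1 - t) * g x + t * h x)"
    by (intro smooth_add smooth_mult smooth_const diff_lift_smooth assms)
  show "((\<lambda>x. (1 - t) * g x + t * h x) has_real_derivative (1 - t) * deriv g x + t * deriv h x) (at x)" for x
    by (intro DERIV_add DERIV_cmult diff_lift_DERIV assms)
qed

text \<open>A lift maps a period onto an interval of length 1 starting at \<open>g 0\<close>, and
  periodicity of \<open>f\<close> moves that interval back to \<open>[0, 1]\<close>.\<close>

lemma integral_diff_lift_substitution:
  fixes f :: "real \<Rightarrow> real"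
  assumes "diff_lift g" "continuous_on UNIV f" "\<And>x. f (x + 1) = f x"
  shows "integral {0..1} (\<lambda>x. f (g x) * deriv g x) = integral {0..1} f"
proof -
  obtain F where F: "\<And>x. (F has_real_derivative f x) (at x)"
    using continuous_antiderivative[OF assms(2)] by blast
  have "((\<lambda>x. f (g x) * deriv g x) has_integral F (g 1) - F (g 0)) {0..1}"
    using integral_DERIV[where F = "\<lambda>x. F (g x)" and a = 0 and b = 1, OF DERIV_chain2[OF F diff_lift_DERIV[OF assms(1)]]]
    by simp
  moreover have "F (g 1) - F (g 0) = integral {g 0..g 0 + 1} f"
    using integral_DERIV[OF F, of "g 0" "g 0 + 1"] diff_lift_shift[OF assms(1), of 0]
    by (simp add: integral_unique)
  ultimately show ?thesis
    using integral_periodic_shift[of f, OF assms(2,3), of "g 0"] by (simp add: integral_unique)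
qed

text \<open>Velocities of paths are functions of \<open>inv g\<close>. This returns their integrals
  to the coordinate of the source, where no inverse occurs.\<close>

lemma integral_inv_diff_lift:
  fixes q :: "real \<Rightarrow> real"
  assumes "diff_lift g" "continuous_on UNIV q" "\<And>x. q (x + 1) = q x"
  shows "integral {0..1} (\<lambda>y. q (inv g y)) = integral {0..1} (\<lambda>x. q x * deriv g x)"
proof -
  have "continuous_on UNIV (\<lambda>y. q (inv g y))"
    using continuous_on_compose2[OF assms(2) diff_lift_continuous[OF diff_lift_inv[OF assms(1)]], of UNIV] by auto
  moreover have "q (inv g (x + 1)) = q (inv g x)" for x
    using diff_lift_shift[OF diff_lift_inv[OF assms(1)]] assms(3) by simp
  ultimately show ?thesis
    using integral_diff_lift_substitution[OF assms(1), of "\<lambda>y. q (inv g y)"] assms(1) by simp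
qed

section \<open>Bounds for the norm\<close>

lemma enn_rpow_ennreal: "0 \<le> x \<Longrightarrow> enn_rpow (ennreal x) a = ennreal (x powr a)"
  by (simp add: enn_rpow_def)

lemma enn_rpow_top [simp]: "enn_rpow \<top> a = \<top>"
  by (simp add: enn_rpow_def)

lemma ennreal_cases_real: obtains (real) r where "0 \<le> r" "x = ennreal r" | (inf) "x = \<infinity>"
  by (cases x) auto

lemma enn_rpow_mono: "x \<le> y \<Longrightarrow> 0 \<le> a \<Longrightarrow> enn_rpow x a \<le> enn_rpow y a"
  by (cases x rule: ennreal_cases_real; cases y rule: ennreal_cases_real)
     (auto simp: enn_rpow_ennreal powr_mono2 top_unique)

lemma enn_rpow_cmult:
  assumes "0 \<le> c" "0 < a"
  shows "enn_rpow (ennreal c * x) a = ennreal (c powr a) * enn_rpow x a"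
proof (cases x rule: ennreal_cases_real)
  case (real r)
  then show ?thesis using assms
    by (simp add: enn_rpow_ennreal powr_mult flip: ennreal_mult)
next
  case inf
  show ?thesis
  proof (cases "c = 0")
    case True
    then show ?thesis using assms enn_rpow_ennreal[of 0 a] by simp
  next
    case False
    then show ?thesis using assms inf by (simp add: ennreal_mult_top)
  qed
qed

lemma enn_rpow_le_ennreal:
  assumes "x \<le> ennreal b" "0 \<le> a" "0 \<le> b"
  shows "enn_rpow x a \<le> ennreal (b powr a)"
  using enn_rpow_mono[OF assms(1,2)] enn_rpow_ennreal[OF assms(3), of a] by simp

lemma enn_rpow_square_half: "enn_rpow (x ^ 2) (1/2) = x"
  by (cases x rule: ennreal_cases_real)
     (auto simp: enn_rpow_ennreal ennreal_power powr_half_sqrt power_eq_top_ennreal enn_rpow_def)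

lemma powr_add_le:
  fixes a b p :: real
  assumes "0 \<le> a" "0 \<le> b" "0 \<le> p"
  shows "(a + b) powr p \<le> 2 powr p * (a powr p + b powr p)"
proof -
  have "(a + b) powr p \<le> (2 * max a b) powr p"
    using assms by (intro powr_mono2) auto
  also have "\<dots> = 2 powr p * (max a b) powr p" using assms by (simp add: powr_mult)
  also have "\<dots> \<le> 2 powr p * (a powr p + b powr p)" by (auto simp: max_def)
  finally show ?thesis .
qed

lemma powr_add3_le:
  fixes a b c p :: real
  assumes "0 \<le> a" "0 \<le> b" "0 \<le> c" "0 \<le> p"
  shows "(a + b + c) powr p \<le> 4 powr p * (a powr p + b powr p + c powr p)"
proof -
  have 1: "1 \<le> (2::real) powr p" using assms(4) by (simp add: ge_one_powr_ge_zero)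
  have "(a + b + c) powr p \<le> 2 powr p * ((a + b) powr p + c powr p)"
    using assms by (intro powr_add_le) auto
  also have "\<dots> \<le> 2 powr p * (2 powr p * (a powr p + b powr p) + 2 powr p * c powr p)"
    using powr_add_le[OF assms(1,2,4)] mult_right_mono[OF 1, of "c powr p"] by (intro mult_left_mono add_mono) auto
  also have "\<dots> = 4 powr p * (a powr p + b powr p + c powr p)"
    using powr_mult[of 2 2 p] by (simp add: algebra_simps)
  finally show ?thesis .
qed

section \<open>Integrals over a period and over the half line\<close>

lemma continuous_on_abs_powr:
  fixes f :: "real \<Rightarrow> real"
  shows "continuous_on S f \<Longrightarrow> p > 0 \<Longrightarrow> continuous_on S (\<lambda>x. \<bar>f x\<bar> powr p)"
  by (rule continuous_on_powr') (auto intro: continuous_intros)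

lemma nn_integral_continuous_Icc:
  fixes f :: "real \<Rightarrow> real"
  assumes "continuous_on UNIV f" "\<And>x. 0 \<le> f x"
  shows "(\<integral>\<^sup>+x. ennreal (f x) * indicator {a..b} x \<partial>lborel) = ennreal (integral {a..b} f)"
proof -
  have "(f has_integral integral {a..b} f) {a..b}"
    using continuous_on_subset[OF assms(1)] integrable_continuous_real by (auto simp: has_integral_integral)
  then show ?thesis
    using nn_integral_has_integral_lebesgue'[of "{a..b}" f] assms(2) by blast
qed

lemma integral_shift_periodic:
  fixes f :: "real \<Rightarrow> real"
  assumes "continuous_on UNIV f" "\<And>x. f (x + 1) = f x"
  shows "integral {0..1} (\<lambda>x. f (x + h)) = integral {0..1} f"
proof -
  obtain F where F: "\<And>x. (F has_real_derivative f x) (at x)"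
    using continuous_antiderivative[OF assms(1)] by blast
  have "((\<lambda>x. F (x + h)) has_real_derivative f (x + h)) (at x)" for x
    using F[of "x + h"] by (simp add: DERIV_shift)
  then have "integral {0..1} (\<lambda>x. f (x + h)) = F (h + 1) - F h"
    using integral_DERIV[of "\<lambda>x. F (x + h)" "\<lambda>x. f (x + h)" 0 1] by (simp add: integral_unique add.commute)
  also have "\<dots> = integral {h..h+1} f"
    using integral_DERIV[OF F, of h "h + 1"] by (simp add: integral_unique)
  finally show ?thesis using integral_periodic_shift[of f, OF assms] by simp
qed

lemma integral_two_periods:
  fixes f :: "real \<Rightarrow> real"
  assumes "continuous_on UNIV f" "\<And>x. f (x + 1) = f x"
  shows "integral {a..a + 2} f = 2 * integral {0..1} f"
proof -
  have "integral {a..a+1} f + integral {a+1..a+2} f = integral {a..a+2} f"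
    by (rule Henstock_Kurzweil_Integration.integral_combine)
       (auto intro!: integrable_continuous_real continuous_on_subset[OF assms(1)])
  moreover have "integral {a+1..a+2} f = integral {0..1} f"
    using integral_periodic_shift[of f "a + 1", OF assms] by (simp add: add.assoc)
  ultimately show ?thesis using integral_periodic_shift[of f a, OF assms] by simp
qed

lemma nn_integral_shift:
  fixes f :: "real \<Rightarrow> ennreal"
  assumes "f \<in> borel_measurable borel"
  shows "(\<integral>\<^sup>+x. f (x + a) \<partial>lborel) = (\<integral>\<^sup>+x. f x \<partial>lborel)"
  using nn_integral_real_affine[OF assms, of 1 a] by (simp add: add.commute)

text \<open>An antiderivative \<open>G\<close> of \<open>\<bar>deriv f\<bar>\<close> dominates the
  increments of \<open>f\<close>. Since \<open>G\<close> gains the same amount over every period, a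
  second antiderivative \<open>H\<close> evaluates the integral of \<open>G (x + h) - G x\<close>
  exactly; this takes the place of an exchange of integrals.\<close>

lemma integral_abs_diff_le:
  fixes f :: "real \<Rightarrow> real"
  assumes "smooth f" "\<And>x. f (x + 1) = f x" "0 \<le> h"
  shows "integral {0..1} (\<lambda>x. \<bar>f (x + h) - f x\<bar>) \<le> h * integral {0..1} (\<lambda>x. \<bar>deriv f x\<bar>)"
proof -
  let ?I = "integral {0..1} (\<lambda>x. \<bar>deriv f x\<bar>)"
  have cont: "continuous_on S f" "continuous_on S (deriv f)" for S
    using assms(1) smooth_deriv smooth_continuous_on by blast+
  have per: "\<bar>deriv f (x + 1)\<bar> = \<bar>deriv f x\<bar>" for x
    using deriv_shift[OF assms(1), of 0] assms(2) by simp
  have cabs: "continuous_on S (\<lambda>x. \<bar>deriv f x\<bar>)" for S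
    by (intro continuous_intros cont)
  obtain G where G: "\<And>x. (G has_real_derivative \<bar>deriv f x\<bar>) (at x)"
    using continuous_antiderivative[OF cabs] by blast
  have cG: "continuous_on S G" for S
    using DERIV_isCont[OF G] continuous_at_imp_continuous_on by blast
  obtain H where H: "\<And>x. (H has_real_derivative G x) (at x)"
    using continuous_antiderivative[OF cG] by blast
  have le: "\<bar>f (x + h) - f x\<bar> \<le> G (x + h) - G x" for x
  proof -
    have "G x - f x \<le> G (x + h) - f (x + h)"
    proof (rule DERIV_nonneg_imp_nondecreasing[of x "x + h" "\<lambda>y. G y - f y"])
      fix y
      have "((\<lambda>y. G y - f y) has_real_derivative \<bar>deriv f y\<bar> - deriv f y) (at y)"
        by (intro DERIV_diff G smooth_DERIV assms)
      then show "\<exists>d. ((\<lambda>y. G y - f y) has_real_derivative d) (at y) \<and> 0 \<le> d" by force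
    qed (use assms in auto)
    moreover have "G x + f x \<le> G (x + h) + f (x + h)"
    proof (rule DERIV_nonneg_imp_nondecreasing[of x "x + h" "\<lambda>y. G y + f y"])
      fix y
      have "((\<lambda>y. G y + f y) has_real_derivative \<bar>deriv f y\<bar> + deriv f y) (at y)"
        by (intro DERIV_add G smooth_DERIV assms)
      then show "\<exists>d. ((\<lambda>y. G y + f y) has_real_derivative d) (at y) \<and> 0 \<le> d" by force
    qed (use assms in auto)
    ultimately show ?thesis by linarith
  qed
  have Gper: "G (y + 1) - G y = ?I" for y
    using integral_DERIV[OF G, of y "y + 1"] integral_periodic_shift[of "\<lambda>x. \<bar>deriv f x\<bar>" y, OF cabs per]
    by (simp add: integral_unique)
  have "((\<lambda>h. H (h + 1) - H h - h * ?I) has_real_derivative 0) (at y)" for y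
  proof -
    have "((\<lambda>h. H (h + 1)) has_real_derivative G (y + 1)) (at y)"
      using H[of "y + 1"] by (simp add: DERIV_shift)
    then have "((\<lambda>h. H (h + 1) - H h - h * ?I) has_real_derivative G (y + 1) - G y - ?I) (at y)"
      by (auto intro!: derivative_eq_intros H)
    then show ?thesis using Gper by simp
  qed
  then have eq: "H (h + 1) - H h - h * ?I = H (0 + 1) - H 0 - 0 * ?I"
    using DERIV_isconst_all[of "\<lambda>h. H (h + 1) - H h - h * ?I" h 0] by blast
  have "((\<lambda>x. H (x + h) - H x) has_real_derivative G (x + h) - G x) (at x)" for x
    using DERIV_diff[OF H[of "x + h", unfolded DERIV_shift] H[of x]] .
  then have hi: "((\<lambda>x. G (x + h) - G x) has_integral (H (1 + h) - H 1) - (H (0 + h) - H 0)) {0..1}"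
    using integral_DERIV[of "\<lambda>x. H (x + h) - H x" "\<lambda>x. G (x + h) - G x" 0 1] by simp
  have "integral {0..1} (\<lambda>x. \<bar>f (x + h) - f x\<bar>) \<le> (H (1 + h) - H 1) - (H (0 + h) - H 0)"
  proof (rule has_integral_le[OF integrable_integral hi])
    show "(\<lambda>x. \<bar>f (x + h) - f x\<bar>) integrable_on {0..1}"
      by (intro integrable_continuous_real continuous_intros cont(1) continuous_on_compose2[OF cont(1)[of UNIV]]) auto
  qed (use le in auto)
  then show ?thesis using eq by (simp add: algebra_simps)
qed

text \<open>The half line is split at 1: the first exponent is integrable at 0 because
  \<open>q < \<mu>\<close>, the second at infinity because \<open>0 < q\<close>.\<close>

lemma nn_integral_powr_bound:
  fixes A B q \<mu> :: real
  assumes "0 \<le> A" "0 \<le> B" "0 < q" "q < \<mu>"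
    and g: "g \<in> borel_measurable borel"
    and "\<And>h. 0 < h \<Longrightarrow> h \<le> 1 \<Longrightarrow> g h \<le> ennreal (A * h powr (\<mu> - q - 1))"
    and "\<And>h. 1 < h \<Longrightarrow> g h \<le> ennreal (B * h powr (- q - 1))"
  shows "(\<integral>\<^sup>+h. g h * indicator {0<..} h \<partial>lborel) \<le> ennreal (A / (\<mu> - q) + B / q)"
proof -
  have 1: "(\<integral>\<^sup>+h. ennreal (A * h powr (\<mu> - q - 1)) * indicator {0..1} h \<partial>lborel) = ennreal (A / (\<mu> - q))"
  proof -
    have "((\<lambda>h. A * h powr (\<mu> - q - 1)) has_integral A * (1 powr (\<mu> - q - 1 + 1) / (\<mu> - q - 1 + 1))) {0..1}"
      using assms by (intro has_integral_mult_right has_integral_powr_from_0) auto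
    then show ?thesis
      using nn_integral_has_integral_lebesgue'[of "{0..1}" "\<lambda>h. A * h powr (\<mu> - q - 1)" "A / (\<mu> - q)"] assms
      by simp
  qed
  have 2: "(\<integral>\<^sup>+h. ennreal (B * h powr (- q - 1)) * indicator {1..} h \<partial>lborel) = ennreal (B / q)"
  proof -
    have "((\<lambda>h. B * h powr (- q - 1)) has_integral B * (- (1 powr (- q - 1 + 1)) / (- q - 1 + 1))) {1..}"
      using assms by (intro has_integral_mult_right has_integral_powr_to_inf) auto
    then show ?thesis
      using nn_integral_has_integral_lebesgue'[of "{1..}" "\<lambda>h. B * h powr (- q - 1)" "B / q"] assms
      by simp
  qed
  have "(\<integral>\<^sup>+h. g h * indicator {0<..} h \<partial>lborel) \<le>
      (\<integral>\<^sup>+h. ennreal (A * h powr (\<mu> - q - 1)) * indicator {0..1} h + ennreal (B * h powr (- q - 1)) * indicator {1..} h \<partial>lborel)"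
  proof (rule nn_integral_mono)
    fix h :: real
    consider "h \<le> 0" | "0 < h" "h \<le> 1" | "1 < h" by linarith
    then show "g h * indicator {0<..} h \<le> ennreal (A * h powr (\<mu> - q - 1)) * indicator {0..1} h + ennreal (B * h powr (- q - 1)) * indicator {1..} h"
    proof cases
      case 2
      then show ?thesis using assms(6)[OF 2] by (auto intro: add_increasing2)
    qed (use assms in auto)
  qed
  also have "\<dots> = ennreal (A / (\<mu> - q)) + ennreal (B / q)"
    by (subst nn_integral_add) (use 1 2 in auto)
  finally show ?thesis using assms by (simp add: ennreal_plus)
qed

text \<open>The double integral is rewritten in the difference variable \<open>h\<close>. Small
  \<open>h\<close> is controlled by the modulus of continuity in \<open>L^p\<close>, large
  \<open>h\<close> by the triangle inequality and the \<open>L^p\<close> norm. The factor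
  \<open>1 / (\<mu> - q)\<close> is kept explicit because the critical case lets it blow up.\<close>

lemma gagliardo_bound:
  fixes f :: "real \<Rightarrow> real" and p q A B \<mu> :: real
  assumes f[measurable]: "f \<in> borel_measurable borel"
    and p: "0 \<le> p" and q: "0 < q" "q < \<mu>" and "0 \<le> A" "0 \<le> B"
    and A: "\<And>h. 0 < h \<Longrightarrow> h \<le> 1 \<Longrightarrow> (\<integral>\<^sup>+x. ennreal (\<bar>f (x + h) - f x\<bar> powr p) \<partial>lborel) \<le> ennreal (A * h powr \<mu>)"
    and B: "(\<integral>\<^sup>+x. ennreal (\<bar>f x\<bar> powr p) \<partial>lborel) \<le> ennreal B"
  shows "(\<integral>\<^sup>+ z. ennreal (\<bar>f (fst z) - f (snd z)\<bar> powr p / \<bar>fst z - snd z\<bar> powr (1 + q)) \<partial>(lborel \<Otimes>\<^sub>M lborel))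
      \<le> ennreal (2 * (A / (\<mu> - q) + 2 powr p * (2 * B) / q))"
proof -
  let ?F = "\<lambda>x h. ennreal (\<bar>f (x + h) - f x\<bar> powr p / \<bar>h\<bar> powr (1 + q))"
  define g where "g h = (\<integral>\<^sup>+x. ?F x h \<partial>lborel)" for h
  have geq: "g h = (\<integral>\<^sup>+x. ennreal (\<bar>f (x + h) - f x\<bar> powr p) \<partial>lborel) * ennreal (1 / \<bar>h\<bar> powr (1 + q))" for h
    unfolding g_def by (subst nn_integral_multc[symmetric]) (auto simp flip: ennreal_mult)
  have gm[measurable]: "g \<in> borel_measurable borel"
    unfolding g_def by measurable
  \<comment> \<open>Translating \<open>x\<close> by \<open>h\<close> exchanges the two points, so
    only positive \<open>h\<close> has to be estimated.\<close>
  have gsym: "g (- h) = g h" for h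
    using nn_integral_shift[of "\<lambda>x. ?F x (-h)" h] unfolding g_def by (simp add: abs_minus_commute)
  have "(\<integral>\<^sup>+ z. ennreal (\<bar>f (fst z) - f (snd z)\<bar> powr p / \<bar>fst z - snd z\<bar> powr (1 + q)) \<partial>(lborel \<Otimes>\<^sub>M lborel))
      = (\<integral>\<^sup>+x. \<integral>\<^sup>+y. ennreal (\<bar>f x - f y\<bar> powr p / \<bar>x - y\<bar> powr (1 + q)) \<partial>lborel \<partial>lborel)"
    by (subst lborel.nn_integral_fst[symmetric]) auto
  also have "\<dots> = (\<integral>\<^sup>+x. \<integral>\<^sup>+h. ?F x h \<partial>lborel \<partial>lborel)"
  proof (rule nn_integral_cong)
    fix x :: real
    show "(\<integral>\<^sup>+y. ennreal (\<bar>f x - f y\<bar> powr p / \<bar>x - y\<bar> powr (1 + q)) \<partial>lborel) = (\<integral>\<^sup>+h. ?F x h \<partial>lborel)"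
      by (subst nn_integral_shift[symmetric, of _ x]) (auto simp: abs_minus_commute add.commute)
  qed
  also have "\<dots> = (\<integral>\<^sup>+h. g h \<partial>lborel)"
    unfolding g_def by (rule lborel_pair.Fubini') measurable
  also have "\<dots> \<le> (\<integral>\<^sup>+h. g h * indicator {0<..} h + g h * indicator {..<0} h \<partial>lborel)"
  proof (rule nn_integral_mono)
    fix h :: real
    \<comment> \<open>At \<open>h = 0\<close> the integrand is \<open>0 / 0\<close>, which is 0
      here; the diagonal contributes nothing.\<close>
    show "g h \<le> g h * indicator {0<..} h + g h * indicator {..<0} h"
      by (cases "h = 0") (auto simp: g_def split: split_indicator)
  qed
  also have "\<dots> = (\<integral>\<^sup>+h. g h * indicator {0<..} h \<partial>lborel) + (\<integral>\<^sup>+h. g h * indicator {..<0} h \<partial>lborel)"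
    by (rule nn_integral_add) auto
  also have "(\<integral>\<^sup>+h. g h * indicator {..<0} h \<partial>lborel) = (\<integral>\<^sup>+h. g h * indicator {0<..} h \<partial>lborel)"
    using nn_integral_real_affine[of "\<lambda>h. g h * indicator {..<0} h" "-1" 0] 
    by (simp add: gsym indicator_def if_distrib cong: if_cong)
  finally have le: "(\<integral>\<^sup>+ z. ennreal (\<bar>f (fst z) - f (snd z)\<bar> powr p / \<bar>fst z - snd z\<bar> powr (1 + q)) \<partial>(lborel \<Otimes>\<^sub>M lborel))
     \<le> (\<integral>\<^sup>+h. g h * indicator {0<..} h \<partial>lborel) + (\<integral>\<^sup>+h. g h * indicator {0<..} h \<partial>lborel)" .
  have "(\<integral>\<^sup>+h. g h * indicator {0<..} h \<partial>lborel) \<le> ennreal (A / (\<mu> - q) + (2 powr p * (2 * B)) / q)"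
  proof (rule nn_integral_powr_bound)
    fix h :: real assume h: "0 < h" "h \<le> 1"
    have "g h \<le> ennreal (A * h powr \<mu>) * ennreal (1 / \<bar>h\<bar> powr (1 + q))"
      unfolding geq by (intro mult_right_mono A h) auto
    also have "\<dots> = ennreal (A * h powr (\<mu> - q - 1))"
      using h \<open>0 \<le> A\<close> by (simp add: ennreal_mult[symmetric] powr_diff powr_add field_simps)
    finally show "g h \<le> ennreal (A * h powr (\<mu> - q - 1))" .
  next
    fix h :: real assume h: "1 < h"
    have "(\<integral>\<^sup>+x. ennreal (\<bar>f (x + h) - f x\<bar> powr p) \<partial>lborel) 
       \<le> (\<integral>\<^sup>+x. ennreal (2 powr p) * (ennreal (\<bar>f (x + h)\<bar> powr p) + ennreal (\<bar>f x\<bar> powr p)) \<partial>lborel)"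
    proof (rule nn_integral_mono)
      fix x
      have "\<bar>f (x + h) - f x\<bar> powr p \<le> (\<bar>f (x + h)\<bar> + \<bar>f x\<bar>) powr p"
        using p by (intro powr_mono2) auto
      also have "\<dots> \<le> 2 powr p * (\<bar>f (x + h)\<bar> powr p + \<bar>f x\<bar> powr p)"
        using p by (intro powr_add_le) auto
      finally show "ennreal (\<bar>f (x + h) - f x\<bar> powr p) \<le> ennreal (2 powr p) * (ennreal (\<bar>f (x + h)\<bar> powr p) + ennreal (\<bar>f x\<bar> powr p))"
        by (simp add: ennreal_mult[symmetric] flip: ennreal_plus)
    qed
    also have "\<dots> = ennreal (2 powr p) * ((\<integral>\<^sup>+x. ennreal (\<bar>f (x + h)\<bar> powr p) \<partial>lborel) + (\<integral>\<^sup>+x. ennreal (\<bar>f x\<bar> powr p) \<partial>lborel))"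
      by (subst nn_integral_cmult, simp, subst nn_integral_add) auto
    also have "(\<integral>\<^sup>+x. ennreal (\<bar>f (x + h)\<bar> powr p) \<partial>lborel) = (\<integral>\<^sup>+x. ennreal (\<bar>f x\<bar> powr p) \<partial>lborel)"
      by (rule nn_integral_shift) measurable
    also have "ennreal (2 powr p) * ((\<integral>\<^sup>+x. ennreal (\<bar>f x\<bar> powr p) \<partial>lborel) + (\<integral>\<^sup>+x. ennreal (\<bar>f x\<bar> powr p) \<partial>lborel))
        \<le> ennreal (2 powr p) * (ennreal B + ennreal B)"
      by (intro mult_left_mono add_mono B) auto
    also have "\<dots> = ennreal (2 powr p * (2 * B))"
      using \<open>0 \<le> B\<close> by (simp add: ennreal_mult[symmetric] flip: ennreal_plus)
    finally have "g h \<le> ennreal (2 powr p * (2 * B)) * ennreal (1 / \<bar>h\<bar> powr (1 + q))"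
      unfolding geq by (intro mult_right_mono) auto
    also have "\<dots> = ennreal (2 powr p * (2 * B) * h powr (- q - 1))"
      using h \<open>0 \<le> B\<close> by (simp add: ennreal_mult[symmetric] powr_diff powr_minus powr_add field_simps)
    finally show "g h \<le> ennreal (2 powr p * (2 * B) * h powr (- q - 1))" .
  qed (use assms in auto)
  note le2 = this
  have "(\<integral>\<^sup>+h. g h * indicator {0<..} h \<partial>lborel) + (\<integral>\<^sup>+h. g h * indicator {0<..} h \<partial>lborel)
    \<le> ennreal (A / (\<mu> - q) + (2 powr p * (2 * B)) / q) + ennreal (A / (\<mu> - q) + (2 powr p * (2 * B)) / q)"
    by (rule add_mono[OF le2 le2])
  also have "\<dots> = ennreal (2 * (A / (\<mu> - q) + 2 powr p * (2 * B) / q))"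
    using assms by (subst ennreal_plus[symmetric]) auto
  finally show ?thesis using le by (meson order_trans)
qed

definition smooth_periodic :: "(real \<Rightarrow> real) \<Rightarrow> bool" where
  "smooth_periodic X \<longleftrightarrow> smooth X \<and> (\<forall>x. X (x + 1) = X x)"

lemma smooth_periodicD:
  assumes "smooth_periodic X"
  shows "smooth X" "X (x + 1) = X x" "continuous_on S X"
  using assms smooth_continuous_on by (auto simp: smooth_periodic_def)

lemma smooth_periodic_deriv: "smooth_periodic X \<Longrightarrow> smooth_periodic (deriv X)"
  using deriv_shift[of X 0] smooth_deriv by (simp add: smooth_periodic_def)

lemma smooth_periodic_bounded:
  assumes "smooth_periodic X"
  obtains B where "B > 0" "\<And>x. \<bar>X x\<bar> \<le> B"
  using continuous_periodic_bounded[of X] smooth_periodicD[OF assms] by metis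

lemma smooth_DERIV_lipschitz:
  fixes f :: "real \<Rightarrow> real"
  assumes "smooth f" "\<And>x. \<bar>deriv f x\<bar> \<le> B"
  shows "\<bar>f x - f y\<bar> \<le> B * \<bar>x - y\<bar>"
  using field_differentiable_bound[of UNIV f "deriv f" B y x] assms smooth_DERIV
  by (auto simp: norm_minus_commute abs_minus_commute)

subsection \<open>Localisation\<close>

text \<open>\<open>local_rep\<close> with the product \<open>\<rho> x * X x\<close> treated as one
  function; in this form the operation commutes with differentiation.\<close>

definition cutoff :: "real \<Rightarrow> real \<Rightarrow> (real \<Rightarrow> real) \<Rightarrow> real \<Rightarrow> real" where
  "cutoff c r Z = (\<lambda>x. if \<bar>x - c\<bar> < r then Z x else 0)"

text \<open>A whole neighbourhood of the boundary \<open>\<bar>x - c\<bar> = r\<close> is asked for: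
  cutting off there creates no jump, and derivatives inherit the property.\<close>

definition vanishes_near :: "real \<Rightarrow> real \<Rightarrow> real \<Rightarrow> (real \<Rightarrow> real) \<Rightarrow> bool" where
  "vanishes_near c r \<delta> Z \<longleftrightarrow> (\<forall>x. r - \<delta> < \<bar>x - c\<bar> \<and> \<bar>x - c\<bar> < r + \<delta> \<longrightarrow> Z x = 0)"

lemma local_rep_cutoff: "local_rep c r \<rho> X = cutoff c r (\<lambda>x. \<rho> x * X x)"
  by (simp add: local_rep_def cutoff_def)

lemma vanishes_near_mult: "vanishes_near c r \<delta> \<rho> \<Longrightarrow> vanishes_near c r \<delta> (\<lambda>x. \<rho> x * X x)"
  by (simp add: vanishes_near_def)

lemma open_annulus: "open {x::real. a < \<bar>x - c\<bar> \<and> \<bar>x - c\<bar> < b}"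
  by (intro open_Collect_conj open_Collect_less continuous_intros)

lemma vanishes_near_deriv:
  assumes "vanishes_near c r \<delta> Z"
  shows "vanishes_near c r \<delta> (deriv Z)"
  unfolding vanishes_near_def
proof (intro allI impI)
  fix x assume x: "r - \<delta> < \<bar>x - c\<bar> \<and> \<bar>x - c\<bar> < r + \<delta>"
  have "(Z has_real_derivative 0) (at x)"
    by (rule has_field_derivative_transform_within_open[OF DERIV_const[where k = 0] open_annulus[of "r - \<delta>" c "r + \<delta>"]])
       (use x assms in \<open>auto simp: vanishes_near_def\<close>)
  then show "deriv Z x = 0" by (rule DERIV_imp_deriv)
qed

lemma cutoff_DERIV:
  assumes "smooth Z" "vanishes_near c r \<delta> Z" "\<delta> > 0"
  shows "(cutoff c r Z has_real_derivative cutoff c r (deriv Z) x) (at x)"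
proof (cases "\<bar>x - c\<bar> < r")
  case True
  have "open {y. \<bar>y - c\<bar> < r}" by (intro open_Collect_less continuous_intros)
  then have "(cutoff c r Z has_real_derivative deriv Z x) (at x)"
    by (rule has_field_derivative_transform_within_open[OF smooth_DERIV[OF assms(1)]])
       (use True in \<open>auto simp: cutoff_def\<close>)
  then show ?thesis using True by (simp add: cutoff_def)
next
  case False
  have "open {y. r - \<delta> < \<bar>y - c\<bar>}" by (intro open_Collect_less continuous_intros)
  then have "(cutoff c r Z has_real_derivative 0) (at x)"
    by (rule has_field_derivative_transform_within_open[OF DERIV_const[where k = 0]])
       (use False assms in \<open>auto simp: cutoff_def vanishes_near_def\<close>)
  then show ?thesis using False by (simp add: cutoff_def)
qed

lemma vanishes_near_funpow_deriv:
  "vanishes_near c r \<delta> Z \<Longrightarrow> vanishes_near c r \<delta> ((deriv ^^ k) Z)"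
  by (induction k) (auto intro: vanishes_near_deriv)

lemma cutoff_funpow_deriv:
  assumes "smooth Z" "vanishes_near c r \<delta> Z" "\<delta> > 0"
  shows "(deriv ^^ k) (cutoff c r Z) = cutoff c r ((deriv ^^ k) Z)"
proof (induction k)
  case (Suc k)
  have "deriv (cutoff c r ((deriv ^^ k) Z)) x = cutoff c r (deriv ((deriv ^^ k) Z)) x" for x
    by (rule DERIV_imp_deriv[OF cutoff_DERIV])
       (use assms smooth_funpow_deriv vanishes_near_funpow_deriv in auto)
  then show ?case using Suc by auto
qed simp

lemma smooth_cutoff:
  assumes "smooth Z" "vanishes_near c r \<delta> Z" "\<delta> > 0"
  shows "smooth (cutoff c r Z)"
proof -
  have "Ck k (cutoff c r Z)" if "smooth Z" "vanishes_near c r \<delta> Z" for k Z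
    using that
  proof (induction k arbitrary: Z)
    case 0
    have "continuous_on UNIV (cutoff c r Z)"
      by (intro continuous_at_imp_continuous_on ballI DERIV_isCont[OF cutoff_DERIV[OF 0 assms(3)]])
    then show ?case by simp
  next
    case (Suc k)
    show ?case
      by (rule Ck_Suc_DERIV_I[OF cutoff_DERIV[OF Suc.prems assms(3)]])
         (intro Suc.IH smooth_deriv vanishes_near_deriv Suc.prems)
  qed
  then show ?thesis using assms by (simp add: smooth_def)
qed

lemma admissible_puD:
  assumes "admissible_pu P" "(c, r, \<rho>) \<in> set P"
  obtains \<delta> where "0 < \<delta>" "vanishes_near c r \<delta> \<rho>"
    "\<And>x. \<rho> x \<noteq> 0 \<Longrightarrow> \<exists>n::int. \<bar>x - c - real_of_int n\<bar> \<le> r - \<delta>"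
    "0 < r" "r \<le> 1/2" "smooth_periodic \<rho>" "\<And>x. 0 \<le> \<rho> x"
proof -
  have *: "0 < r" "r \<le> 1/2" "smooth_periodic \<rho>" "\<And>x. 0 \<le> \<rho> x"
    "\<exists>\<delta>>0. \<forall>x. \<rho> x \<noteq> 0 \<longrightarrow> (\<exists>n::int. \<bar>x - c - real_of_int n\<bar> \<le> r - \<delta>)"
    using assms unfolding admissible_pu_def smooth_periodic_def by fastforce+
  then obtain \<delta> where \<delta>: "\<delta> > 0" "\<And>x. \<rho> x \<noteq> 0 \<Longrightarrow> \<exists>n::int. \<bar>x - c - real_of_int n\<bar> \<le> r - \<delta>"
    by blast
  \<comment> \<open>A nonzero integer translate of the support is excluded by
    \<open>r \<le> 1/2\<close>: near the boundary
    \<open>\<bar>x - c - n\<bar> > 1 - r - \<delta> \<ge> r - \<delta>\<close> for every integer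
    \<open>n \<noteq> 0\<close>.\<close>
  have "vanishes_near c r \<delta> \<rho>"
    unfolding vanishes_near_def
  proof (intro allI impI, rule ccontr)
    fix x assume x: "r - \<delta> < \<bar>x - c\<bar> \<and> \<bar>x - c\<bar> < r + \<delta>" and "\<rho> x \<noteq> 0"
    then obtain n :: int where n: "\<bar>x - c - real_of_int n\<bar> \<le> r - \<delta>" using \<delta>(2) by blast
    show False
    proof (cases "n = 0")
      case True
      then show ?thesis using n x by simp
    next
      case False
      then have "1 \<le> \<bar>n\<bar>" by simp
      then have "1 \<le> \<bar>real_of_int n\<bar>" by linarith
      then show ?thesis using n x *(2) by linarith
    qed
  qed
  then show ?thesis using that \<delta> * by blast
qed

lemma local_rep_smooth:
  assumes "admissible_pu P" "(c, r, \<rho>) \<in> set P" "smooth X"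
  shows "smooth (local_rep c r \<rho> X)"
proof -
  obtain \<delta> where "0 < \<delta>" "vanishes_near c r \<delta> \<rho>" "smooth_periodic \<rho>"
    using admissible_puD[OF assms(1,2)] by metis
  then show ?thesis
    unfolding local_rep_cutoff
    by (intro smooth_cutoff[where \<delta> = \<delta>] smooth_mult vanishes_near_mult assms) (auto simp: smooth_periodic_def)
qed

text \<open>Inside the ball this is the discrete product rule. If exactly one of the two points lies
  in the ball, then either \<open>\<rho>\<close> vanishes there or the points are at least
  \<open>\<delta>\<close> apart, and in that case a factor \<open>h / \<delta> \<ge> 1\<close> may
  be inserted.\<close>

lemma cutoff_diff_bound:
  assumes "0 < r" "\<delta> > 0" "vanishes_near c r \<delta> \<rho>"
    and L: "\<And>x. \<bar>\<rho> x\<bar> \<le> L" "\<And>x y. \<bar>\<rho> x - \<rho> y\<bar> \<le> L * \<bar>x - y\<bar>" "0 < h"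
  shows "\<bar>cutoff c r (\<lambda>x. \<rho> x * X x) (x + h) - cutoff c r (\<lambda>x. \<rho> x * X x) x\<bar>
     \<le> L * \<bar>X (x + h) - X x\<bar> + (L + L / \<delta>) * h * \<bar>X x\<bar> + (L + L / \<delta>) * h * \<bar>X (x + h)\<bar>"
proof -
  have L0: "0 \<le> L" using L(1)[of 0] by linarith
  have nn: "0 \<le> L * \<bar>X (x + h) - X x\<bar>" "0 \<le> L * h * \<bar>X x\<bar>" "0 \<le> L * h * \<bar>X (x + h)\<bar>"
    "0 \<le> L / \<delta> * h * \<bar>X x\<bar>" "0 \<le> L / \<delta> * h * \<bar>X (x + h)\<bar>"
    using L0 assms by auto
  have far: "L * \<bar>X y\<bar> \<le> L / \<delta> * h * \<bar>X y\<bar>" if "\<delta> \<le> h" for y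
  proof -
    have "1 \<le> h / \<delta>" using that assms by simp
    then have "L * \<bar>X y\<bar> * 1 \<le> L * \<bar>X y\<bar> * (h / \<delta>)" using L0 by (intro mult_left_mono) auto
    then show ?thesis by (simp add: algebra_simps)
  qed
  consider (bb) "\<bar>x + h - c\<bar> < r" "\<bar>x - c\<bar> < r" | (bo) "\<not> \<bar>x + h - c\<bar> < r" "\<bar>x - c\<bar> < r"
    | (ob) "\<bar>x + h - c\<bar> < r" "\<not> \<bar>x - c\<bar> < r" | (oo) "\<not> \<bar>x + h - c\<bar> < r" "\<not> \<bar>x - c\<bar> < r" by blast
  then show ?thesis
  proof cases
    case bb
    have "\<rho> (x + h) * X (x + h) - \<rho> x * X x = \<rho> (x + h) * (X (x + h) - X x) + (\<rho> (x + h) - \<rho> x) * X x"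
      by (simp add: algebra_simps)
    then have "\<bar>\<rho> (x + h) * X (x + h) - \<rho> x * X x\<bar> \<le> \<bar>\<rho> (x + h)\<bar> * \<bar>X (x + h) - X x\<bar> + \<bar>\<rho> (x + h) - \<rho> x\<bar> * \<bar>X x\<bar>"
      by (metis abs_mult abs_triangle_ineq)
    also have "\<dots> \<le> L * \<bar>X (x + h) - X x\<bar> + (L * h) * \<bar>X x\<bar>"
      using L(1)[of "x + h"] L(2)[of "x + h" x] L(3) by (intro add_mono mult_right_mono) auto
    finally show ?thesis using bb nn by (simp add: cutoff_def algebra_simps)
  next
    case bo
    have "\<bar>\<rho> x * X x\<bar> \<le> L / \<delta> * h * \<bar>X x\<bar>"
    proof (cases "\<rho> x = 0")
      case False
      then have "\<bar>x - c\<bar> \<le> r - \<delta>" using assms bo unfolding vanishes_near_def by force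
      then have "\<delta> \<le> h" using bo L(3) by linarith
      then show ?thesis using far[of x] mult_right_mono[OF L(1), of "\<bar>X x\<bar>" x] by (simp add: abs_mult)
    qed (use nn in auto)
    then show ?thesis using bo nn by (simp add: cutoff_def algebra_simps)
  next
    case ob
    have "\<bar>\<rho> (x + h) * X (x + h)\<bar> \<le> L / \<delta> * h * \<bar>X (x + h)\<bar>"
    proof (cases "\<rho> (x + h) = 0")
      case False
      then have "\<bar>x + h - c\<bar> \<le> r - \<delta>" using assms ob unfolding vanishes_near_def by force
      then have "\<delta> \<le> h" using ob L(3) by linarith
      then show ?thesis using far[of "x + h"] mult_right_mono[OF L(1), of "\<bar>X (x + h)\<bar>" "x + h"] by (simp add: abs_mult)
    qed (use nn in auto)
    then show ?thesis using ob nn by (simp add: cutoff_def algebra_simps)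
  next
    case oo
    then show ?thesis using nn by (simp add: cutoff_def algebra_simps)
  qed
qed

text \<open>Carries the \<open>L^p\<close> norm and the \<open>L^p\<close> modulus of continuity
  from the circle to one chart, with a constant that depends on the chart and on \<open>p\<close>
  but not on \<open>X\<close>. The summand with \<open>h powr p\<close> comes from the increments of
  \<open>\<rho>\<close>.\<close>

lemma cutoff_power_bounds:
  assumes "0 < r" "r \<le> 1/2" "smooth_periodic \<rho>" "\<delta> > 0" "vanishes_near c r \<delta> \<rho>" "1 < p"
  obtains C where "C > 0"
    "\<And>X. smooth_periodic X \<Longrightarrow> (\<integral>\<^sup>+x. ennreal (\<bar>cutoff c r (\<lambda>x. \<rho> x * X x) x\<bar> powr p) \<partial>lborel)
        \<le> ennreal (C * integral {0..1} (\<lambda>x. \<bar>X x\<bar> powr p))"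
    "\<And>X h. smooth_periodic X \<Longrightarrow> 0 < h \<Longrightarrow> h \<le> 1 \<Longrightarrow>
       (\<integral>\<^sup>+x. ennreal (\<bar>cutoff c r (\<lambda>x. \<rho> x * X x) (x + h) - cutoff c r (\<lambda>x. \<rho> x * X x) x\<bar> powr p) \<partial>lborel)
        \<le> ennreal (C * (integral {0..1} (\<lambda>x. \<bar>X (x + h) - X x\<bar> powr p) + h powr p * integral {0..1} (\<lambda>x. \<bar>X x\<bar> powr p)))"
proof -
  obtain L1 where L1: "L1 > 0" "\<And>x. \<bar>\<rho> x\<bar> \<le> L1" by (rule smooth_periodic_bounded[OF assms(3)]) blast
  obtain L2 where L2: "L2 > 0" "\<And>x. \<bar>deriv \<rho> x\<bar> \<le> L2"
    by (rule smooth_periodic_bounded[OF smooth_periodic_deriv[OF assms(3)]]) blast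
  define L where "L = L1 + L2"
  have L: "L > 0" "\<And>x. \<bar>\<rho> x\<bar> \<le> L" "\<And>x y. \<bar>\<rho> x - \<rho> y\<bar> \<le> L * \<bar>x - y\<bar>"
  proof -
    show "L > 0" using L1 L2 by (simp add: L_def)
    show "\<bar>\<rho> x\<bar> \<le> L" for x using L1(2)[of x] L2(1) by (simp add: L_def)
    show "\<bar>\<rho> x - \<rho> y\<bar> \<le> L * \<bar>x - y\<bar>" for x y
      using smooth_DERIV_lipschitz[OF smooth_periodicD(1)[OF assms(3)] L2(2), of x y] L1(1)
        mult_right_mono[of L2 L "\<bar>x - y\<bar>"] by (simp add: L_def)
  qed
  define M where "M = L + L / \<delta>"
  have M: "M > 0" using L assms by (simp add: M_def add_pos_pos)
  define C where "C = 2 * 4 powr p * (L powr p + 2 * M powr p)"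
  have p0: "0 < p" using assms by simp
  have one: "1 \<le> 2 * (4::real) powr p" using ge_one_powr_ge_zero[of 4 p] p0 by simp
  have C: "C > 0" "L powr p \<le> C" "2 * (4 powr p * L powr p) \<le> C" "4 * (4 powr p * M powr p) \<le> C"
  proof -
    show "C > 0" using L M by (simp add: C_def add_pos_pos)
    show "L powr p \<le> C" unfolding C_def using mult_mono[of 1 "2 * 4 powr p" "L powr p" "L powr p + 2 * M powr p"] one by simp
    show "2 * (4 powr p * L powr p) \<le> C" "4 * (4 powr p * M powr p) \<le> C" by (simp_all add: C_def algebra_simps)
  qed
  show ?thesis
  proof (rule that[OF C(1)])
    fix X assume X: "smooth_periodic X"
    have cX: "continuous_on UNIV (\<lambda>x. \<bar>X x\<bar> powr p)"
      by (intro continuous_on_abs_powr smooth_periodicD[OF X] p0)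
    have perX: "\<bar>X (x + 1)\<bar> powr p = \<bar>X x\<bar> powr p" for x using smooth_periodicD(2)[OF X] by simp
    let ?I = "integral {0..1} (\<lambda>x. \<bar>X x\<bar> powr p)"
    have I0: "?I \<ge> 0" by (rule integral_nonneg) (intro integrable_continuous_real continuous_on_subset[OF cX] subset_UNIV, simp)
    let ?f = "cutoff c r (\<lambda>x. \<rho> x * X x)"
    \<comment> \<open>The ball lies in the period centred at \<open>c\<close>, because
      \<open>r \<le> 1/2\<close>.\<close>
    have "(\<integral>\<^sup>+x. ennreal (\<bar>?f x\<bar> powr p) \<partial>lborel) \<le> (\<integral>\<^sup>+x. ennreal (L powr p * \<bar>X x\<bar> powr p) * indicator {c - 1/2..c - 1/2 + 1} x \<partial>lborel)"
    proof (rule nn_integral_mono)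
      fix x
      show "ennreal (\<bar>?f x\<bar> powr p) \<le> ennreal (L powr p * \<bar>X x\<bar> powr p) * indicator {c - 1/2..c - 1/2 + 1} x"
      proof (cases "\<bar>x - c\<bar> < r")
        case True
        then have "x \<in> {c - 1/2..c - 1/2 + 1}" using assms by auto
        moreover have "\<bar>\<rho> x * X x\<bar> powr p \<le> (L * \<bar>X x\<bar>) powr p"
          using L p0 by (intro powr_mono2) (auto simp: abs_mult intro: mult_right_mono)
        ultimately show ?thesis using True L by (simp add: cutoff_def powr_mult)
      qed (use p0 in \<open>simp add: cutoff_def\<close>)
    qed
    also have "\<dots> = ennreal (integral {c - 1/2..c - 1/2 + 1} (\<lambda>x. L powr p * \<bar>X x\<bar> powr p))"
      by (rule nn_integral_continuous_Icc) (intro continuous_on_mult_left cX, simp)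
    also have "integral {c - 1/2..c - 1/2 + 1} (\<lambda>x. L powr p * \<bar>X x\<bar> powr p) = L powr p * ?I"
      using integral_periodic_shift[of "\<lambda>x. \<bar>X x\<bar> powr p" "c - 1/2", OF cX perX] by simp
    also have "ennreal (L powr p * ?I) \<le> ennreal (C * ?I)"
      using C I0 by (intro ennreal_leI mult_right_mono) auto
    finally show "(\<integral>\<^sup>+x. ennreal (\<bar>?f x\<bar> powr p) \<partial>lborel) \<le> ennreal (C * ?I)" .
    fix h :: real assume h: "0 < h" "h \<le> 1"
    let ?D = "\<lambda>x. \<bar>X (x + h) - X x\<bar> powr p"
    have cXh: "continuous_on UNIV (\<lambda>x. X (x + h))"
      by (rule continuous_on_compose2[OF smooth_periodicD(3)[OF X, of UNIV]]) (auto intro!: continuous_intros)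
    have cD: "continuous_on UNIV ?D"
      by (intro continuous_on_abs_powr continuous_intros smooth_periodicD[OF X] p0 cXh)
    have cS: "continuous_on UNIV (\<lambda>x. \<bar>X (x + h)\<bar> powr p)"
      by (intro continuous_on_abs_powr continuous_intros p0 cXh)
    have per1: "X (x + 1 + h) = X (x + h)" for x
      using smooth_periodicD(2)[OF X, of "x + h"] by (simp add: algebra_simps)
    let ?J = "integral {0..1} ?D"
    have J0: "?J \<ge> 0" by (rule integral_nonneg) (intro integrable_continuous_real continuous_on_subset[OF cD] subset_UNIV, simp)
    let ?T = "\<lambda>x. 4 powr p * L powr p * ?D x + 4 powr p * M powr p * h powr p * \<bar>X x\<bar> powr p
        + 4 powr p * M powr p * h powr p * \<bar>X (x + h)\<bar> powr p"
    have cT: "continuous_on UNIV ?T" by (intro continuous_on_add continuous_on_mult_left cD cX cS)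
    \<comment> \<open>If \<open>x\<close> is outside \<open>[c - 3/2, c + 1/2]\<close>, then neither
      \<open>x\<close> nor \<open>x + h\<close> lies in the ball, as \<open>h \<le> 1\<close> and
      \<open>r \<le> 1/2\<close>. So two periods suffice.\<close>
    have "(\<integral>\<^sup>+x. ennreal (\<bar>?f (x + h) - ?f x\<bar> powr p) \<partial>lborel) \<le> (\<integral>\<^sup>+x. ennreal (?T x) * indicator {c - 3/2..c - 3/2 + 2} x \<partial>lborel)"
    proof (rule nn_integral_mono)
      fix x
      show "ennreal (\<bar>?f (x + h) - ?f x\<bar> powr p) \<le> ennreal (?T x) * indicator {c - 3/2..c - 3/2 + 2} x"
      proof (cases "x \<in> {c - 3/2..c - 3/2 + 2}")
        case True
        have "\<bar>?f (x + h) - ?f x\<bar> powr p \<le> (L * \<bar>X (x + h) - X x\<bar> + M * h * \<bar>X x\<bar> + M * h * \<bar>X (x + h)\<bar>) powr p"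
          unfolding M_def using p0 assms L h by (intro powr_mono2 cutoff_diff_bound) auto
        also have "\<dots> \<le> 4 powr p * ((L * \<bar>X (x + h) - X x\<bar>) powr p + (M * h * \<bar>X x\<bar>) powr p + (M * h * \<bar>X (x + h)\<bar>) powr p)"
          using L M h p0 by (intro powr_add3_le) auto
        also have "\<dots> = ?T x" using L M h by (simp add: powr_mult algebra_simps)
        finally show ?thesis using True by (simp add: ennreal_leI del: ennreal_plus)
      next
        case False
        then have x: "x < c - 3/2 \<or> x > c + 1/2" by auto
        have "\<not> \<bar>x - c\<bar> < r" using x assms(2) h by linarith
        moreover have "\<not> \<bar>x + h - c\<bar> < r" using x assms(2) h by linarith
        ultimately show ?thesis using p0 by (simp add: cutoff_def)
      qed
    qed
    also have "\<dots> = ennreal (integral {c - 3/2..c - 3/2 + 2} ?T)"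
      by (rule nn_integral_continuous_Icc[OF cT]) (use L M in auto)
    also have "integral {c - 3/2..c - 3/2 + 2} ?T = 2 * integral {0..1} ?T"
      by (rule integral_two_periods[OF cT]) (simp only: per1 smooth_periodicD(2)[OF X])
    also have "integral {0..1} ?T = 4 powr p * L powr p * ?J + 4 powr p * M powr p * h powr p * ?I + 4 powr p * M powr p * h powr p * ?I"
    proof -
      have "integral {0..1} (\<lambda>x. \<bar>X (x + h)\<bar> powr p) = ?I"
        using integral_shift_periodic[of "\<lambda>x. \<bar>X x\<bar> powr p" h, OF cX perX] by simp
      then have "((\<lambda>x. \<bar>X (x + h)\<bar> powr p) has_integral ?I) {0..1}"
        using integrable_integral[OF integrable_continuous_real[OF continuous_on_subset[OF cS subset_UNIV]], of 0 1] by simp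
      moreover have "(?D has_integral ?J) {0..1}"
        by (intro integrable_integral integrable_continuous_real continuous_on_subset[OF cD] subset_UNIV)
      moreover have "((\<lambda>x. \<bar>X x\<bar> powr p) has_integral ?I) {0..1}"
        by (intro integrable_integral integrable_continuous_real continuous_on_subset[OF cX] subset_UNIV)
      ultimately show ?thesis
        by (intro integral_unique has_integral_add has_integral_mult_right)
    qed
    also have "2 * (4 powr p * L powr p * ?J + 4 powr p * M powr p * h powr p * ?I + 4 powr p * M powr p * h powr p * ?I)
        = 2 * (4 powr p * L powr p) * ?J + 4 * (4 powr p * M powr p) * (h powr p * ?I)"
      by (simp add: algebra_simps)
    also have "ennreal \<dots> \<le> ennreal (C * ?J + C * (h powr p * ?I))"
      using C J0 I0 by (intro ennreal_leI add_mono mult_right_mono) auto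
    also have "C * ?J + C * (h powr p * ?I) = C * (?J + h powr p * ?I)" by (simp add: algebra_simps)
    finally show "(\<integral>\<^sup>+x. ennreal (\<bar>?f (x + h) - ?f x\<bar> powr p) \<partial>lborel) \<le> ennreal (C * (?J + h powr p * ?I))" .
  qed
qed

subsection \<open>Homogeneity and comparison with the charts\<close>

text \<open>Estimates are proved chart by chart; as \<open>Q\<close> is monotone in its constant,
  one constant then serves the whole finite atlas.\<close>

lemma finite_uniform_constant:
  fixes Q :: "'a \<Rightarrow> real \<Rightarrow> bool"
  assumes "finite S" "\<And>a. a \<in> S \<Longrightarrow> \<exists>C. Q a C" "\<And>a C C'. Q a C \<Longrightarrow> C \<le> C' \<Longrightarrow> Q a C'"
  shows "\<exists>C>0. \<forall>a\<in>S. Q a C"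
  using assms(1,2)
proof (induction S rule: finite_induct)
  case empty
  show ?case by (rule exI[of _ 1]) auto
next
  case (insert b S)
  obtain C1 where "C1 > 0" "\<forall>a\<in>S. Q a C1" using insert by auto
  moreover obtain C2 where "Q b C2" using insert by auto
  ultimately show ?case using assms(3)
    by (intro exI[of _ "max C1 C2"]) (auto intro: max.cobounded1 max.cobounded2)
qed

lemma W_norm_S1_le:
  assumes "\<And>c r \<rho>. (c, r, \<rho>) \<in> set P \<Longrightarrow> W_norm_R s p (local_rep c r \<rho> X) \<le> ennreal B" "0 \<le> B"
  shows "W_norm_S1 P s p X \<le> ennreal (sqrt (real (length P)) * B)"
proof -
  have "(\<Sum>(c, r, \<rho>)\<leftarrow>P. (W_norm_R s p (local_rep c r \<rho> X))^2) \<le> (\<Sum>_\<leftarrow>P. ennreal (B^2))"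
  proof (rule sum_list_mono)
    fix a assume a: "a \<in> set P"
    obtain c r \<rho> where "a = (c, r, \<rho>)" by (cases a)
    then show "(case a of (c, r, \<rho>) \<Rightarrow> (W_norm_R s p (local_rep c r \<rho> X))^2) \<le> ennreal (B^2)"
      using assms a power_mono[OF assms(1)[of c r \<rho>], of 2] by (simp add: ennreal_power)
  qed
  also have "\<dots> = ennreal (real (length P) * B^2)"
    by (simp add: sum_list_triv ennreal_mult' ennreal_of_nat_eq_real_of_nat)
  finally have "W_norm_S1 P s p X \<le> ennreal ((real (length P) * B^2) powr (1/2))"
    unfolding W_norm_S1_def by (rule enn_rpow_le_ennreal) auto
  then show ?thesis using assms(2) by (simp add: powr_half_sqrt real_sqrt_mult)
qed

lemma W_norm_S1_ge:
  assumes "(c, r, \<rho>) \<in> set P"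
  shows "W_norm_R s p (local_rep c r \<rho> X) \<le> W_norm_S1 P s p X"
proof -
  have "(W_norm_R s p (local_rep c r \<rho> X))^2 \<le> (\<Sum>(c, r, \<rho>)\<leftarrow>P. (W_norm_R s p (local_rep c r \<rho> X))^2)"
    by (rule member_le_sum_list) (use assms in \<open>(force | simp)+\<close>)
  then show ?thesis
    unfolding W_norm_S1_def using enn_rpow_mono[of "(W_norm_R s p (local_rep c r \<rho> X))^2" _ "1/2"]
    by (simp add: enn_rpow_square_half)
qed

lemma funpow_deriv_cmult:
  assumes "smooth f"
  shows "(deriv ^^ k) (\<lambda>x. a * f x) = (\<lambda>x. a * (deriv ^^ k) f x)"
proof (induction k)
  case (Suc k)
  have "deriv (\<lambda>x. a * (deriv ^^ k) f x) x = a * deriv ((deriv ^^ k) f) x" for x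
    by (intro DERIV_imp_deriv DERIV_cmult smooth_DERIV smooth_funpow_deriv assms)
  then show ?case using Suc by auto
qed simp

lemma Lp_norm_cmult:
  assumes [measurable]: "g \<in> borel_measurable borel" and "0 < p"
  shows "Lp_norm p (\<lambda>x. a * g x) = ennreal \<bar>a\<bar> * Lp_norm p g"
proof -
  have "(\<integral>\<^sup>+ x. ennreal (\<bar>a * g x\<bar> powr p) \<partial>lborel) = ennreal (\<bar>a\<bar> powr p) * (\<integral>\<^sup>+ x. ennreal (\<bar>g x\<bar> powr p) \<partial>lborel)"
    by (subst nn_integral_cmult[symmetric]) (auto simp: abs_mult powr_mult ennreal_mult)
  then show ?thesis
    unfolding Lp_norm_def using assms by (simp add: enn_rpow_cmult powr_powr)
qed

lemma W_norm_R_cmult: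
  assumes "smooth f" "0 < p"
  shows "W_norm_R s p (\<lambda>x. a * f x) = ennreal \<bar>a\<bar> * W_norm_R s p f"
proof -
  define k where "k = nat \<lfloor>s\<rfloor>"
  define g where "g = (deriv ^^ k) f"
  define q where "q = 1 + (s - real k) * p"
  have [measurable]: "g \<in> borel_measurable borel"
    unfolding g_def by (intro smooth_borel smooth_funpow_deriv assms)
  have "(\<integral>\<^sup>+ z. ennreal (\<bar>a * g (fst z) - a * g (snd z)\<bar> powr p / \<bar>fst z - snd z\<bar> powr q) \<partial>(lborel \<Otimes>\<^sub>M lborel))
     = (\<integral>\<^sup>+ z. ennreal (\<bar>a\<bar> powr p) * ennreal (\<bar>g (fst z) - g (snd z)\<bar> powr p / \<bar>fst z - snd z\<bar> powr q) \<partial>(lborel \<Otimes>\<^sub>M lborel))"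
    by (rule nn_integral_cong) (simp add: abs_mult powr_mult flip: ennreal_mult right_diff_distrib)
  also have "\<dots> = ennreal (\<bar>a\<bar> powr p) * (\<integral>\<^sup>+ z. ennreal (\<bar>g (fst z) - g (snd z)\<bar> powr p / \<bar>fst z - snd z\<bar> powr q) \<partial>(lborel \<Otimes>\<^sub>M lborel))"
    by (rule nn_integral_cmult) measurable
  finally have 1: "enn_rpow (\<integral>\<^sup>+ z. ennreal (\<bar>a * g (fst z) - a * g (snd z)\<bar> powr p / \<bar>fst z - snd z\<bar> powr q) \<partial>(lborel \<Otimes>\<^sub>M lborel)) (1 / p)
     = ennreal \<bar>a\<bar> * enn_rpow (\<integral>\<^sup>+ z. ennreal (\<bar>g (fst z) - g (snd z)\<bar> powr p / \<bar>fst z - snd z\<bar> powr q) \<partial>(lborel \<Otimes>\<^sub>M lborel)) (1 / p)"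
    using assms by (simp add: enn_rpow_cmult powr_powr)
  have "(\<Sum>j\<le>k. Lp_norm p ((deriv ^^ j) (\<lambda>x. a * f x))) = (\<Sum>j\<le>k. ennreal \<bar>a\<bar> * Lp_norm p ((deriv ^^ j) f))"
    unfolding funpow_deriv_cmult[OF assms(1)]
    by (intro sum.cong Lp_norm_cmult smooth_borel smooth_funpow_deriv assms refl)
  then show ?thesis
    unfolding W_norm_R_def Let_def funpow_deriv_cmult[OF assms(1)] k_def[symmetric] g_def[symmetric] q_def[symmetric]
    using 1 by (simp add: sum_distrib_left distrib_left)
qed

text \<open>Applied with \<open>a\<close> the speed of a change of time: this is why lengths survive
  reparametrisation and reversal of a path.\<close>

lemma W_norm_S1_cmult:
  assumes "admissible_pu P" "smooth X" "0 < p"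
  shows "W_norm_S1 P s p (\<lambda>y. a * X y) = ennreal \<bar>a\<bar> * W_norm_S1 P s p X"
proof -
  have "(\<Sum>(c, r, \<rho>)\<leftarrow>P. (W_norm_R s p (local_rep c r \<rho> (\<lambda>y. a * X y)))^2)
     = (\<Sum>v\<leftarrow>P. ennreal (a^2) * (case v of (c, r, \<rho>) \<Rightarrow> (W_norm_R s p (local_rep c r \<rho> X))^2))"
  proof (rule arg_cong[where f = sum_list], rule map_cong[OF refl])
    fix v assume v: "v \<in> set P"
    obtain c r \<rho> where [simp]: "v = (c, r, \<rho>)" by (cases v)
    have "local_rep c r \<rho> (\<lambda>y. a * X y) = (\<lambda>x. a * local_rep c r \<rho> X x)"
      by (auto simp: local_rep_def)
    then have "W_norm_R s p (local_rep c r \<rho> (\<lambda>y. a * X y)) = ennreal \<bar>a\<bar> * W_norm_R s p (local_rep c r \<rho> X)"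
      using W_norm_R_cmult[OF local_rep_smooth[OF assms(1) _ assms(2)] assms(3)] v by simp
    then show "(case v of (c, r, \<rho>) \<Rightarrow> (W_norm_R s p (local_rep c r \<rho> (\<lambda>y. a * X y)))^2)
       = ennreal (a^2) * (case v of (c, r, \<rho>) \<Rightarrow> (W_norm_R s p (local_rep c r \<rho> X))^2)"
      by (simp add: power_mult_distrib ennreal_power)
  qed
  also have "\<dots> = ennreal (a^2) * (\<Sum>(c, r, \<rho>)\<leftarrow>P. (W_norm_R s p (local_rep c r \<rho> X))^2)"
    by (rule sum_list_const_mult)
  finally show ?thesis
    unfolding W_norm_S1_def by (simp add: enn_rpow_cmult powr_half_sqrt)
qed

subsection \<open>Upper bounds in terms of the sup norm and the total variation\<close>

lemma powr_le_mult_abs: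
  fixes a M p :: real
  assumes "\<bar>a\<bar> \<le> M" "1 \<le> p"
  shows "\<bar>a\<bar> powr p \<le> M powr (p - 1) * \<bar>a\<bar>"
proof (cases "a = 0")
  case False
  then have "\<bar>a\<bar> powr p = \<bar>a\<bar> powr (p - 1) * \<bar>a\<bar>" by (simp add: powr_mult_base powr_diff)
  also have "\<dots> \<le> M powr (p - 1) * \<bar>a\<bar>" using assms by (intro mult_right_mono powr_mono2) auto
  finally show ?thesis .
qed (use assms in auto)

text \<open>Interpolation of \<open>L^p\<close> between the sup norm and \<open>L^1\<close>. Through
  it a total variation enters a bound for a norm with exponent \<open>p\<close>.\<close>

lemma integral_powr_le:
  fixes f :: "real \<Rightarrow> real"
  assumes "continuous_on UNIV f" "\<And>x. \<bar>f x\<bar> \<le> M" "1 < p" "integral {0..1} (\<lambda>x. \<bar>f x\<bar>) \<le> I"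
  shows "integral {0..1} (\<lambda>x. \<bar>f x\<bar> powr p) \<le> M powr (p - 1) * I"
proof -
  have c: "continuous_on UNIV (\<lambda>x. \<bar>f x\<bar>)" by (intro continuous_on_rabs assms)
  have "integral {0..1} (\<lambda>x. \<bar>f x\<bar> powr p) \<le> integral {0..1} (\<lambda>x. M powr (p - 1) * \<bar>f x\<bar>)"
  proof (rule integral_le)
    show "(\<lambda>x. \<bar>f x\<bar> powr p) integrable_on {0..1}"
      by (intro integrable_continuous_real continuous_on_subset[OF continuous_on_abs_powr[OF assms(1)]]) (use assms in auto)
    show "(\<lambda>x. M powr (p - 1) * \<bar>f x\<bar>) integrable_on {0..1}"
      by (intro integrable_continuous_real continuous_on_mult_left continuous_on_subset[OF c]) auto
    show "\<bar>f x\<bar> powr p \<le> M powr (p - 1) * \<bar>f x\<bar>" for x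
      using assms by (intro powr_le_mult_abs) auto
  qed
  also have "\<dots> = M powr (p - 1) * integral {0..1} (\<lambda>x. \<bar>f x\<bar>)" by simp
  also have "\<dots> \<le> M powr (p - 1) * I" using assms by (intro mult_left_mono) auto
  finally show ?thesis .
qed

lemma continuous_on_shift_diff:
  fixes X :: "real \<Rightarrow> real"
  assumes "smooth_periodic X" shows "continuous_on UNIV (\<lambda>x. X (x + h) - X x)"
proof -
  have "continuous_on UNIV (\<lambda>x. X (x + h))"
    by (rule continuous_on_compose2[OF smooth_periodicD(3)[OF assms, of UNIV]]) (auto intro!: continuous_intros)
  then show ?thesis by (intro continuous_on_diff smooth_periodicD[OF assms])
qed

lemma integral_abs_diff_le_mult:
  assumes "smooth_periodic f" "0 \<le> h" "integral {0..1} (\<lambda>x. \<bar>deriv f x\<bar>) \<le> N"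
  shows "integral {0..1} (\<lambda>x. \<bar>f (x + h) - f x\<bar>) \<le> h * N"
  by (rule order_trans[OF integral_abs_diff_le mult_left_mono[OF assms(3,2)]])
     (use assms smooth_periodicD in auto)

lemma integral_abs_powr_nonneg:
  fixes f :: "real \<Rightarrow> real"
  assumes "continuous_on UNIV f" "0 < p"
  shows "0 \<le> integral {0..1} (\<lambda>x. \<bar>f x\<bar> powr p)"
  by (rule integral_nonneg[OF integrable_continuous_real[OF continuous_on_subset[OF continuous_on_abs_powr[OF assms] subset_UNIV]]]) auto

lemma W_norm_R_less_1:
  assumes "0 \<le> s" "s < 1"
  shows "W_norm_R s p f = Lp_norm p f + (if s = 0 then 0 else
     enn_rpow (\<integral>\<^sup>+ z. ennreal (\<bar>f (fst z) - f (snd z)\<bar> powr p / \<bar>fst z - snd z\<bar> powr (1 + s * p)) \<partial>(lborel \<Otimes>\<^sub>M lborel)) (1 / p))"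
proof -
  have "\<lfloor>s\<rfloor> = 0" using assms by linarith
  then show ?thesis by (simp add: W_norm_R_def)
qed

lemma W_norm_R_less_2:
  assumes "1 \<le> s" "s < 2"
  shows "W_norm_R s p f = Lp_norm p f + Lp_norm p (deriv f) + (if s = 1 then 0 else
     enn_rpow (\<integral>\<^sup>+ z. ennreal (\<bar>deriv f (fst z) - deriv f (snd z)\<bar> powr p / \<bar>fst z - snd z\<bar> powr (1 + (s - 1) * p)) \<partial>(lborel \<Otimes>\<^sub>M lborel)) (1 / p))"
proof -
  have "\<lfloor>s\<rfloor> = 1" using assms by linarith
  then show ?thesis by (simp add: W_norm_R_def Let_def)
qed

lemma Lp_norm_le:
  assumes "(\<integral>\<^sup>+ x. ennreal (\<bar>g x\<bar> powr p) \<partial>lborel) \<le> ennreal B" "0 \<le> B" "0 < p"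
  shows "Lp_norm p g \<le> ennreal (B powr (1 / p))"
  unfolding Lp_norm_def using assms by (intro enn_rpow_le_ennreal) auto

text \<open>A modulus of continuity in \<open>L^p\<close> with exponent \<open>\<mu>\<close> above
  \<open>s * p\<close> makes the Gagliardo integral converge. The constant is uniform in
  \<open>\<mu>\<close> and the loss \<open>1 / (\<mu> - s * p)\<close> is displayed, because the
  critical case lets the exponent tend to 1.\<close>

lemma W_norm_S1_bound_less_1:
  assumes "1 < p" "0 \<le> s" "s < 1" "admissible_pu P"
  obtains C where "0 < C"
    "\<And>X A B \<mu>. smooth_periodic X \<Longrightarrow> 0 \<le> A \<Longrightarrow> 0 \<le> B \<Longrightarrow> s * p < \<mu> \<Longrightarrow> \<mu> \<le> p \<Longrightarrow>
      (\<And>h. 0 < h \<Longrightarrow> h \<le> 1 \<Longrightarrow> integral {0..1} (\<lambda>x. \<bar>X (x + h) - X x\<bar> powr p) \<le> A * h powr \<mu>) \<Longrightarrow>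
      integral {0..1} (\<lambda>x. \<bar>X x\<bar> powr p) \<le> B \<Longrightarrow>
      W_norm_S1 P s p X \<le> ennreal (C * ((A + B) / (\<mu> - s * p)) powr (1 / p))"
proof -
  define Q where "Q v C \<longleftrightarrow> 0 \<le> C \<and> (\<forall>X A B \<mu>. smooth_periodic X \<longrightarrow> 0 \<le> A \<longrightarrow> 0 \<le> B \<longrightarrow> s * p < \<mu> \<longrightarrow> \<mu> \<le> p \<longrightarrow>
      (\<forall>h. 0 < h \<longrightarrow> h \<le> 1 \<longrightarrow> integral {0..1} (\<lambda>x. \<bar>X (x + h) - X x\<bar> powr p) \<le> A * h powr \<mu>) \<longrightarrow>
      integral {0..1} (\<lambda>x. \<bar>X x\<bar> powr p) \<le> B \<longrightarrow>
      (case v of (c, r, \<rho>) \<Rightarrow> W_norm_R s p (local_rep c r \<rho> X)) \<le> ennreal (C * ((A + B) / (\<mu> - s * p)) powr (1 / p)))"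
    for v :: "real \<times> real \<times> (real \<Rightarrow> real)" and C
  have "\<exists>C>0. \<forall>v\<in>set P. Q v C"
  proof (rule finite_uniform_constant)
    fix v assume v: "v \<in> set P"
    obtain c r \<rho> where [simp]: "v = (c, r, \<rho>)" by (cases v)
    obtain \<delta> where d: "0 < \<delta>" "vanishes_near c r \<delta> \<rho>" "0 < r" "r \<le> 1/2" "smooth_periodic \<rho>"
      by (rule admissible_puD[OF assms(4) v[simplified]]) blast
    obtain K where K: "K > 0"
      "\<And>X. smooth_periodic X \<Longrightarrow> (\<integral>\<^sup>+x. ennreal (\<bar>cutoff c r (\<lambda>x. \<rho> x * X x) x\<bar> powr p) \<partial>lborel)
        \<le> ennreal (K * integral {0..1} (\<lambda>x. \<bar>X x\<bar> powr p))"
      "\<And>X h. smooth_periodic X \<Longrightarrow> 0 < h \<Longrightarrow> h \<le> 1 \<Longrightarrow>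
       (\<integral>\<^sup>+x. ennreal (\<bar>cutoff c r (\<lambda>x. \<rho> x * X x) (x + h) - cutoff c r (\<lambda>x. \<rho> x * X x) x\<bar> powr p) \<partial>lborel)
        \<le> ennreal (K * (integral {0..1} (\<lambda>x. \<bar>X (x + h) - X x\<bar> powr p) + h powr p * integral {0..1} (\<lambda>x. \<bar>X x\<bar> powr p)))"
      by (rule cutoff_power_bounds[OF d(3,4,5,1,2) assms(1)]) blast
    define C1 where "C1 = (if s = 0 then 0 else 2 * (K + 2 powr p * (2 * (K * p)) / (s * p)))"
    have C1: "0 \<le> C1" using K(1) assms by (auto simp: C1_def)
    define C where "C = (K * p) powr (1 / p) + C1 powr (1 / p)"
    have "W_norm_R s p (local_rep c r \<rho> X) \<le> ennreal (C * ((A + B) / (\<mu> - s * p)) powr (1 / p))"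
      if X: "smooth_periodic X" and AB: "0 \<le> A" "0 \<le> B" and m: "s * p < \<mu>" "\<mu> \<le> p"
        and hA: "\<And>h. 0 < h \<Longrightarrow> h \<le> 1 \<Longrightarrow> integral {0..1} (\<lambda>x. \<bar>X (x + h) - X x\<bar> powr p) \<le> A * h powr \<mu>"
        and hB: "integral {0..1} (\<lambda>x. \<bar>X x\<bar> powr p) \<le> B" for X A B \<mu>
    proof -
      let ?f = "cutoff c r (\<lambda>x. \<rho> x * X x)"
      let ?q = "s * p"
      define E where "E = (A + B) / (\<mu> - ?q)"
      have q0: "0 \<le> ?q" using assms by simp
      have E0: "0 \<le> E" using AB m by (simp add: E_def)
      \<comment> \<open>The divisor \<open>\<mu> - s * p\<close> is at most \<open>p\<close>, so a
        term in \<open>B\<close> alone is absorbed by \<open>E\<close> as well.\<close>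
      have BE: "B \<le> p * E"
      proof -
        have "B * (\<mu> - ?q) \<le> (A + B) * p" using AB m q0 by (intro mult_mono) auto
        then show ?thesis using m by (simp add: E_def field_simps)
      qed
      have I1: "(\<integral>\<^sup>+x. ennreal (\<bar>?f x\<bar> powr p) \<partial>lborel) \<le> ennreal (K * B)"
        using order_trans[OF K(2)[OF X]] ennreal_leI[OF mult_left_mono[OF hB]] K(1) by auto
      have "Lp_norm p ?f \<le> ennreal ((K * p * E) powr (1 / p))"
      proof (rule Lp_norm_le)
        show "(\<integral>\<^sup>+x. ennreal (\<bar>?f x\<bar> powr p) \<partial>lborel) \<le> ennreal (K * p * E)"
          using order_trans[OF I1] ennreal_leI[OF mult_left_mono[OF BE, of K]] K(1) by (auto simp: mult.assoc)
      qed (use K E0 assms in auto)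
      then have L: "Lp_norm p ?f \<le> ennreal ((K * p) powr (1 / p) * E powr (1 / p))"
        using K E0 assms by (simp add: powr_mult)
      show ?thesis
      proof (cases "s = 0")
        case True
        then show ?thesis using L assms by (simp add: W_norm_R_less_1 local_rep_cutoff C_def C1_def E_def)
      next
        case False
        then have q: "0 < ?q" using assms by simp
        have sm: "?f \<in> borel_measurable borel"
          using local_rep_smooth[OF assms(4) v[simplified] smooth_periodicD(1)[OF X]] smooth_borel
          unfolding local_rep_cutoff by blast
        have G: "(\<integral>\<^sup>+ z. ennreal (\<bar>?f (fst z) - ?f (snd z)\<bar> powr p / \<bar>fst z - snd z\<bar> powr (1 + ?q)) \<partial>(lborel \<Otimes>\<^sub>M lborel))
           \<le> ennreal (2 * (K * (A + B) / (\<mu> - ?q) + 2 powr p * (2 * (K * B)) / ?q))"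
        proof (rule gagliardo_bound[OF sm _ q m(1) _ _ _ I1])
          fix h :: real assume h: "0 < h" "h \<le> 1"
          have hp: "h powr p \<le> h powr \<mu>" using h m by (intro powr_mono') auto
          have "integral {0..1} (\<lambda>x. \<bar>X (x + h) - X x\<bar> powr p) + h powr p * integral {0..1} (\<lambda>x. \<bar>X x\<bar> powr p) \<le> A * h powr \<mu> + h powr \<mu> * B"
            by (intro add_mono hA h mult_mono hp hB integral_abs_powr_nonneg smooth_periodicD[OF X]) (use assms in auto)
          from mult_left_mono[OF this, of K]
          have "K * (integral {0..1} (\<lambda>x. \<bar>X (x + h) - X x\<bar> powr p) + h powr p * integral {0..1} (\<lambda>x. \<bar>X x\<bar> powr p)) \<le> K * (A + B) * h powr \<mu>"
            using K(1) by (simp add: algebra_simps)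
          then show "(\<integral>\<^sup>+x. ennreal (\<bar>?f (x + h) - ?f x\<bar> powr p) \<partial>lborel) \<le> ennreal (K * (A + B) * h powr \<mu>)"
            using order_trans[OF K(3)[OF X h]] ennreal_leI by blast
        qed (use K AB assms in auto)
        have "2 * (K * (A + B) / (\<mu> - ?q) + 2 powr p * (2 * (K * B)) / ?q) \<le> C1 * E"
        proof -
          have "2 powr p * (2 * (K * B)) / ?q \<le> 2 powr p * (2 * (K * (p * E))) / ?q"
            using q K(1) by (intro divide_right_mono mult_left_mono BE) auto
          then have "2 * (K * E + 2 powr p * (2 * (K * B)) / ?q) \<le> 2 * (K * E + 2 powr p * (2 * (K * (p * E))) / ?q)" by simp
          also have "\<dots> = C1 * E" using False by (simp add: C1_def distrib_left distrib_right mult.assoc)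
          finally show ?thesis by (simp add: E_def)
        qed
        then have "enn_rpow (\<integral>\<^sup>+ z. ennreal (\<bar>?f (fst z) - ?f (snd z)\<bar> powr p / \<bar>fst z - snd z\<bar> powr (1 + ?q)) \<partial>(lborel \<Otimes>\<^sub>M lborel)) (1 / p)
           \<le> ennreal ((C1 * E) powr (1 / p))"
          using G C1 E0 assms by (intro enn_rpow_le_ennreal) (auto intro: order_trans ennreal_leI)
        also have "(C1 * E) powr (1 / p) = C1 powr (1 / p) * E powr (1 / p)" using C1 E0 by (simp add: powr_mult)
        finally have "W_norm_R s p ?f \<le> ennreal ((K * p) powr (1 / p) * E powr (1 / p)) + ennreal (C1 powr (1 / p) * E powr (1 / p))"
          unfolding W_norm_R_less_1[OF assms(2,3)] using False L by (simp add: add_mono)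
        also have "\<dots> = ennreal (C * E powr (1 / p))"
          by (simp add: C_def algebra_simps flip: ennreal_plus)
        finally show ?thesis by (simp add: local_rep_cutoff E_def)
      qed
    qed
    moreover have "0 \<le> C" by (simp add: C_def)
    ultimately show "\<exists>C. Q v C" unfolding Q_def by (intro exI[of _ C]) auto
  next
    fix v C C' assume "Q v C" "C \<le> (C' :: real)"
    have *: "x \<le> ennreal (C' * e)" if "x \<le> ennreal (C * e)" "0 \<le> e" for x e
      using order_trans[OF that(1) ennreal_leI[OF mult_right_mono[OF \<open>C \<le> C'\<close> that(2)]]] .
    have **: "0 \<le> C'" using \<open>Q v C\<close> \<open>C \<le> C'\<close> by (simp add: Q_def)
    show "Q v C'"
      unfolding Q_def
      apply (intro conjI allI impI **)
      apply (rule *[OF _ powr_ge_zero])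
      apply (rule \<open>Q v C\<close>[unfolded Q_def, THEN conjunct2, rule_format])
      apply assumption+
      apply blast+
      done
  qed simp
  then obtain C where C: "C > 0" "\<And>v. v \<in> set P \<Longrightarrow> Q v C" by blast
  show ?thesis
  \<comment> \<open>The summand 1 keeps the constant positive also for an empty list.\<close>
  proof (rule that[of "(sqrt (real (length P)) + 1) * C"])
    fix X A B \<mu>
    assume a: "smooth_periodic X" "0 \<le> A" "0 \<le> B" "s * p < \<mu>" "\<mu> \<le> p"
      "\<And>h. 0 < h \<Longrightarrow> h \<le> 1 \<Longrightarrow> integral {0..1} (\<lambda>x. \<bar>X (x + h) - X x\<bar> powr p) \<le> A * h powr \<mu>"
      "integral {0..1} (\<lambda>x. \<bar>X x\<bar> powr p) \<le> B"
    let ?E = "((A + B) / (\<mu> - s * p)) powr (1 / p)"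
    have "W_norm_R s p (local_rep c r \<rho> X) \<le> ennreal (C * ?E)" if "(c, r, \<rho>) \<in> set P" for c r \<rho>
      using C(2)[OF that] a unfolding Q_def by simp
    then have "W_norm_S1 P s p X \<le> ennreal (sqrt (real (length P)) * (C * ?E))"
      using C(1) by (intro W_norm_S1_le) auto
    also have "\<dots> \<le> ennreal ((sqrt (real (length P)) + 1) * C * ?E)"
      using C(1) by (intro ennreal_leI) (simp add: algebra_simps)
    finally show "W_norm_S1 P s p X \<le> ennreal ((sqrt (real (length P)) + 1) * C * ?E)" .
  qed (use C(1) in \<open>simp add: add_nonneg_pos\<close>)
qed


text \<open>With \<open>\<mu> = p\<close>: the increment over \<open>h\<close> is at most
  \<open>K * h\<close> pointwise and \<open>h * N\<close> in \<open>L^1\<close>, hence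
  \<open>K powr (p - 1) * N * h powr p\<close> for the \<open>p\<close>-th powers. Slope
  \<open>K\<close> and variation \<open>N\<close> are kept apart so that a steep field of small
  variation can be recognised as cheap.\<close>

lemma W_norm_S1_bound_lipschitz:
  assumes "1 < p" "0 \<le> s" "s < 1" "admissible_pu P"
  obtains C where "0 < C"
    "\<And>X K N. smooth_periodic X \<Longrightarrow> 0 \<le> K \<Longrightarrow> 0 \<le> N \<Longrightarrow> (\<And>x. \<bar>X x\<bar> \<le> K) \<Longrightarrow> (\<And>x. \<bar>deriv X x\<bar> \<le> K) \<Longrightarrow> (\<And>x. \<bar>X x\<bar> \<le> N) \<Longrightarrow>
      integral {0..1} (\<lambda>x. \<bar>deriv X x\<bar>) \<le> N \<Longrightarrow>
      W_norm_S1 P s p X \<le> ennreal (C * (K powr (p - 1) * N) powr (1 / p))"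
proof -
  obtain C where C: "0 < C"
    "\<And>X A B \<mu>. smooth_periodic X \<Longrightarrow> 0 \<le> A \<Longrightarrow> 0 \<le> B \<Longrightarrow> s * p < \<mu> \<Longrightarrow> \<mu> \<le> p \<Longrightarrow>
      (\<And>h. 0 < h \<Longrightarrow> h \<le> 1 \<Longrightarrow> integral {0..1} (\<lambda>x. \<bar>X (x + h) - X x\<bar> powr p) \<le> A * h powr \<mu>) \<Longrightarrow>
      integral {0..1} (\<lambda>x. \<bar>X x\<bar> powr p) \<le> B \<Longrightarrow>
      W_norm_S1 P s p X \<le> ennreal (C * ((A + B) / (\<mu> - s * p)) powr (1 / p))"
    by (rule W_norm_S1_bound_less_1[OF assms]) blast
  have sp: "s * p < p" using assms by simp
  define c where "c = (2 / (p - s * p)) powr (1 / p)"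
  show ?thesis
  proof (rule that[of "C * c"])
    show "0 < C * c" using C(1) sp assms by (simp add: c_def)
    fix X K N
    assume X: "smooth_periodic X" and "0 \<le> K" "0 \<le> N" "\<And>x. \<bar>X x\<bar> \<le> K" "\<And>x. \<bar>deriv X x\<bar> \<le> K" "\<And>x. \<bar>X x\<bar> \<le> N"
      "integral {0..1} (\<lambda>x. \<bar>deriv X x\<bar>) \<le> N"
    let ?A = "K powr (p - 1) * N"
    have "W_norm_S1 P s p X \<le> ennreal (C * ((?A + ?A) / (p - s * p)) powr (1 / p))"
    proof (rule C(2)[OF X _ _ sp])
      have "integral {0..1} (\<lambda>x. \<bar>X x\<bar>) \<le> integral {0..1} (\<lambda>x::real. N)"
        by (intro integral_le integrable_continuous_real continuous_on_rabs smooth_periodicD[OF X])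
           (use \<open>\<And>x. \<bar>X x\<bar> \<le> N\<close> in auto)
      then show "integral {0..1} (\<lambda>x. \<bar>X x\<bar> powr p) \<le> ?A"
        using \<open>\<And>x. \<bar>X x\<bar> \<le> K\<close> assms by (intro integral_powr_le smooth_periodicD[OF X]) auto
      fix h :: real assume h: "0 < h" "h \<le> 1"
      have "integral {0..1} (\<lambda>x. \<bar>X (x + h) - X x\<bar> powr p) \<le> (K * h) powr (p - 1) * (h * N)"
      proof (rule integral_powr_le[OF continuous_on_shift_diff[OF X] _ assms(1)])
        show "\<bar>X (x + h) - X x\<bar> \<le> K * h" for x
          using smooth_DERIV_lipschitz[OF smooth_periodicD(1)[OF X] \<open>\<And>x. \<bar>deriv X x\<bar> \<le> K\<close>, of "x + h" x] h by simp
        show "integral {0..1} (\<lambda>x. \<bar>X (x + h) - X x\<bar>) \<le> h * N"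
          using h \<open>integral {0..1} (\<lambda>x. \<bar>deriv X x\<bar>) \<le> N\<close> by (intro integral_abs_diff_le_mult[OF X]) auto
      qed
      also have "(K * h) powr (p - 1) * (h * N) = ?A * (h powr (p - 1) * h powr 1)"
        using h \<open>0 \<le> K\<close> by (simp add: powr_mult)
      also have "\<dots> = ?A * h powr p" using h by (simp add: powr_diff)
      finally show "integral {0..1} (\<lambda>x. \<bar>X (x + h) - X x\<bar> powr p) \<le> ?A * h powr p" .
    qed (use \<open>0 \<le> N\<close> in auto)
    also have "((?A + ?A) / (p - s * p)) powr (1 / p) = (2 / (p - s * p) * ?A) powr (1 / p)"
      by (simp add: field_simps)
    also have "\<dots> = c * ?A powr (1 / p)"
      using sp \<open>0 \<le> N\<close> by (subst powr_mult) (auto simp: c_def)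
    finally show "W_norm_S1 P s p X \<le> ennreal (C * c * ?A powr (1 / p))" by (simp add: mult.assoc)
  qed
qed

text \<open>Used for the increments of a derivative, which have the two bounds \<open>h * V\<close>
  and \<open>2 * N\<close>; a weighted geometric mean of them is a power of
  \<open>h\<close>.\<close>

lemma min_le_powr_mult:
  fixes a b \<alpha> :: real
  assumes "0 \<le> a" "0 \<le> b" "0 \<le> \<alpha>" "\<alpha> \<le> 1"
  shows "min a b \<le> a powr \<alpha> * b powr (1 - \<alpha>)"
proof (cases "min a b = 0")
  case False
  then have "min a b > 0" using assms by (auto simp: min_def)
  then have "min a b = min a b powr \<alpha> * min a b powr (1 - \<alpha>)" by (simp flip: powr_add)
  also have "\<dots> \<le> a powr \<alpha> * b powr (1 - \<alpha>)"
    using assms by (intro mult_mono powr_mono2) auto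
  finally show ?thesis .
qed simp

text \<open>For \<open>s \<ge> 1\<close> the increments of \<open>deriv X\<close> are in
  \<open>L^1\<close> at most \<open>h * V\<close> and at most \<open>2 * N\<close>, hence at most a
  constant times \<open>h powr \<alpha> * V powr \<alpha> * N powr (1 - \<alpha>)\<close>; the sup
  bound \<open>K\<close> raises this to \<open>L^p\<close>. Convergence asks for
  \<open>\<alpha> > (s - 1) * p\<close>, and some \<open>\<alpha> < 1\<close> satisfies this because
  \<open>s < 1 + 1/p\<close>. For \<open>s < 1\<close> the Lipschitz bound gives the claim with
  \<open>\<alpha> = 0\<close>.\<close>

lemma W_norm_S1_bound_total_variation:
  assumes "1 < p" "0 \<le> s" "s < 1 + 1 / p" "admissible_pu P"
  obtains C \<alpha> where "0 < C" "0 \<le> \<alpha>" "\<alpha> < 1"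
    "\<And>X K N V. smooth_periodic X \<Longrightarrow> 0 \<le> K \<Longrightarrow> 0 < N \<Longrightarrow> N \<le> V \<Longrightarrow> (\<And>x. \<bar>X x\<bar> \<le> K) \<Longrightarrow> (\<And>x. \<bar>deriv X x\<bar> \<le> K) \<Longrightarrow> (\<And>x. \<bar>X x\<bar> \<le> N) \<Longrightarrow>
      integral {0..1} (\<lambda>x. \<bar>deriv X x\<bar>) \<le> N \<Longrightarrow> integral {0..1} (\<lambda>x. \<bar>deriv (deriv X) x\<bar>) \<le> V \<Longrightarrow>
      W_norm_S1 P s p X \<le> ennreal (C * (K powr (p - 1) * (V powr \<alpha> * N powr (1 - \<alpha>))) powr (1 / p))"
proof (cases "s < 1")
  case True
  obtain C where C: "0 < C"
    "\<And>X K N. smooth_periodic X \<Longrightarrow> 0 \<le> K \<Longrightarrow> 0 \<le> N \<Longrightarrow> (\<And>x. \<bar>X x\<bar> \<le> K) \<Longrightarrow> (\<And>x. \<bar>deriv X x\<bar> \<le> K) \<Longrightarrow> (\<And>x. \<bar>X x\<bar> \<le> N) \<Longrightarrow>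
      integral {0..1} (\<lambda>x. \<bar>deriv X x\<bar>) \<le> N \<Longrightarrow>
      W_norm_S1 P s p X \<le> ennreal (C * (K powr (p - 1) * N) powr (1 / p))"
    by (rule W_norm_S1_bound_lipschitz[OF assms(1,2) True assms(4)]) blast
  show ?thesis
  proof (rule that[of C 0])
    fix X K N V
    assume "smooth_periodic X" "0 \<le> K" "0 < N" "N \<le> V" "\<And>x. \<bar>X x\<bar> \<le> K" "\<And>x. \<bar>deriv X x\<bar> \<le> K" "\<And>x. \<bar>X x\<bar> \<le> N"
      "integral {0..1} (\<lambda>x. \<bar>deriv X x\<bar>) \<le> N"
    then show "W_norm_S1 P s p X \<le> ennreal (C * (K powr (p - 1) * (V powr 0 * N powr (1 - 0))) powr (1 / p))"
      using C(2)[of X K N] by simp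
  qed (use C in auto)
next
  case False
  then have s1: "1 \<le> s" by simp
  have "1 / p < 1" using assms(1) by simp
  then have s2: "s < 2" using assms(3) by linarith
  define q where "q = (s - 1) * p"
  have q: "0 \<le> q" "q < 1"
  proof -
    show "0 \<le> q" using s1 assms(1) by (simp add: q_def)
    have "s - 1 < 1 / p" using assms(3) by simp
    then show "q < 1" using assms(1) by (simp add: q_def pos_less_divide_eq)
  qed
  \<comment> \<open>The midpoint between \<open>q\<close> and 1: above \<open>q\<close> for
    convergence, below 1 so that a positive power of \<open>N\<close> remains.\<close>
  define \<alpha> where "\<alpha> = (1 + q) / 2"
  have \<alpha>: "q < \<alpha>" "0 < \<alpha>" "\<alpha> < 1" using q by (auto simp: \<alpha>_def)
  define Q where "Q v C \<longleftrightarrow> 0 \<le> C \<and> (\<forall>X K N V. smooth_periodic X \<longrightarrow> 0 \<le> K \<longrightarrow> 0 < N \<longrightarrow> N \<le> V \<longrightarrow> (\<forall>x. \<bar>X x\<bar> \<le> K) \<longrightarrow> (\<forall>x. \<bar>deriv X x\<bar> \<le> K) \<longrightarrow> (\<forall>x. \<bar>X x\<bar> \<le> N) \<longrightarrow>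
      integral {0..1} (\<lambda>x. \<bar>deriv X x\<bar>) \<le> N \<longrightarrow> integral {0..1} (\<lambda>x. \<bar>deriv (deriv X) x\<bar>) \<le> V \<longrightarrow>
      (case v of (c, r, \<rho>) \<Rightarrow> W_norm_R s p (local_rep c r \<rho> X)) \<le> ennreal (C * (K powr (p - 1) * (V powr \<alpha> * N powr (1 - \<alpha>))) powr (1 / p)))"
    for v :: "real \<times> real \<times> (real \<Rightarrow> real)" and C
  have "\<exists>C>0. \<forall>v\<in>set P. Q v C"
  proof (rule finite_uniform_constant)
    fix v assume v: "v \<in> set P"
    obtain c r \<rho> where [simp]: "v = (c, r, \<rho>)" by (cases v)
    obtain \<delta> where d: "0 < \<delta>" "vanishes_near c r \<delta> \<rho>" "0 < r" "r \<le> 1/2" "smooth_periodic \<rho>"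
      by (rule admissible_puD[OF assms(4) v[simplified]]) blast
    obtain K1 where K1: "K1 > 0"
      "\<And>X. smooth_periodic X \<Longrightarrow> (\<integral>\<^sup>+x. ennreal (\<bar>cutoff c r (\<lambda>x. \<rho> x * X x) x\<bar> powr p) \<partial>lborel)
        \<le> ennreal (K1 * integral {0..1} (\<lambda>x. \<bar>X x\<bar> powr p))"
      "\<And>X h. smooth_periodic X \<Longrightarrow> 0 < h \<Longrightarrow> h \<le> 1 \<Longrightarrow>
       (\<integral>\<^sup>+x. ennreal (\<bar>cutoff c r (\<lambda>x. \<rho> x * X x) (x + h) - cutoff c r (\<lambda>x. \<rho> x * X x) x\<bar> powr p) \<partial>lborel)
        \<le> ennreal (K1 * (integral {0..1} (\<lambda>x. \<bar>X (x + h) - X x\<bar> powr p) + h powr p * integral {0..1} (\<lambda>x. \<bar>X x\<bar> powr p)))"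
      by (rule cutoff_power_bounds[OF d(3,4,5,1,2) assms(1)]) blast
    \<comment> \<open>The derivative of \<open>\<rho> x * X x\<close> has two summands; this second
      transfer, with \<open>deriv \<rho>\<close> in place of \<open>\<rho>\<close>, is for the one
      in which \<open>\<rho>\<close> is differentiated.\<close>
    obtain K2 where K2: "K2 > 0"
      "\<And>X. smooth_periodic X \<Longrightarrow> (\<integral>\<^sup>+x. ennreal (\<bar>cutoff c r (\<lambda>x. deriv \<rho> x * X x) x\<bar> powr p) \<partial>lborel)
        \<le> ennreal (K2 * integral {0..1} (\<lambda>x. \<bar>X x\<bar> powr p))"
      "\<And>X h. smooth_periodic X \<Longrightarrow> 0 < h \<Longrightarrow> h \<le> 1 \<Longrightarrow>
       (\<integral>\<^sup>+x. ennreal (\<bar>cutoff c r (\<lambda>x. deriv \<rho> x * X x) (x + h) - cutoff c r (\<lambda>x. deriv \<rho> x * X x) x\<bar> powr p) \<partial>lborel)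
        \<le> ennreal (K2 * (integral {0..1} (\<lambda>x. \<bar>X (x + h) - X x\<bar> powr p) + h powr p * integral {0..1} (\<lambda>x. \<bar>X x\<bar> powr p)))"
      by (rule cutoff_power_bounds[OF d(3,4) smooth_periodic_deriv[OF d(5)] d(1) vanishes_near_deriv[OF d(2)] assms(1)]) blast
    define D where "D = 2 powr p * (K1 + K2)"
    have D: "0 < D" "K1 \<le> D"
    proof -
      show "0 < D" using K1 K2 by (simp add: D_def add_pos_pos)
      have "1 * K1 \<le> 2 powr p * (K1 + K2)"
        using K1 K2 assms ge_one_powr_ge_zero[of 2 p] by (intro mult_mono) auto
      then show "K1 \<le> D" by (simp add: D_def)
    qed
    define C1 where "C1 = (if s = 1 then 0 else 2 * (D * (2 powr p + 1) / (\<alpha> - q) + 2 powr p * (2 * D) / q))"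
    have C1: "0 \<le> C1" using D q \<alpha> by (auto simp: C1_def)
    define C where "C = 2 * D powr (1 / p) + C1 powr (1 / p)"
    have "W_norm_R s p (local_rep c r \<rho> X) \<le> ennreal (C * (K powr (p - 1) * (V powr \<alpha> * N powr (1 - \<alpha>))) powr (1 / p))"
      if X: "smooth_periodic X" and K: "0 \<le> K" "\<And>x. \<bar>X x\<bar> \<le> K" "\<And>x. \<bar>deriv X x\<bar> \<le> K" and N: "0 < N" "N \<le> V" "\<And>x. \<bar>X x\<bar> \<le> N"
        "integral {0..1} (\<lambda>x. \<bar>deriv X x\<bar>) \<le> N" and V: "integral {0..1} (\<lambda>x. \<bar>deriv (deriv X) x\<bar>) \<le> V" for X K N V
    proof -
      define M where "M = V powr \<alpha> * N powr (1 - \<alpha>)"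
      define E where "E = K powr (p - 1) * M"
      \<comment> \<open>Since \<open>N \<le> V\<close>, every term that carries \<open>N\<close>
        alone is absorbed by the mixed quantity \<open>M\<close>.\<close>
      have NM: "N \<le> M"
      proof -
        have "N = N powr \<alpha> * N powr (1 - \<alpha>)" using N by (simp flip: powr_add)
        also have "\<dots> \<le> M" unfolding M_def using N \<alpha> by (intro mult_right_mono powr_mono2) auto
        finally show ?thesis .
      qed
      have E0: "0 \<le> E" using NM N by (simp add: E_def)
      note X' = smooth_periodic_deriv[OF X]
      let ?g = "cutoff c r (\<lambda>x. \<rho> x * X x)"
      let ?a = "cutoff c r (\<lambda>x. deriv \<rho> x * X x)"
      let ?b = "cutoff c r (\<lambda>x. \<rho> x * deriv X x)"
      let ?f = "\<lambda>x. ?a x + ?b x"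
      have dg: "deriv ?g = ?f"
      proof
        fix x
        have DZ: "((\<lambda>x. \<rho> x * X x) has_real_derivative deriv \<rho> x * X x + deriv X x * \<rho> x) (at x)" for x
          by (intro DERIV_mult smooth_DERIV smooth_periodicD[OF X] smooth_periodicD[OF d(5)])
        have "deriv ?g x = cutoff c r (deriv (\<lambda>x. \<rho> x * X x)) x"
          by (intro DERIV_imp_deriv cutoff_DERIV[where \<delta> = \<delta>] smooth_mult vanishes_near_mult d smooth_periodicD[OF X] smooth_periodicD[OF d(5)])
        then show "deriv ?g x = ?f x" using DERIV_imp_deriv[OF DZ] by (simp add: cutoff_def)
      qed
      have smg: "smooth ?g"
        using local_rep_smooth[OF assms(4) v[simplified] smooth_periodicD(1)[OF X]] unfolding local_rep_cutoff .
      have "smooth ?f" using smooth_deriv[OF smg] unfolding dg .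
      then have bf: "?f \<in> borel_measurable borel" by (rule smooth_borel)
      have ba: "?a \<in> borel_measurable borel"
        by (intro smooth_borel smooth_cutoff[where \<delta> = \<delta>] smooth_mult vanishes_near_mult vanishes_near_deriv d smooth_deriv smooth_periodicD[OF X] smooth_periodicD[OF d(5)])
      have bb: "?b \<in> borel_measurable borel"
        by (intro smooth_borel smooth_cutoff[where \<delta> = \<delta>] smooth_mult vanishes_near_mult d smooth_deriv smooth_periodicD[OF X] smooth_periodicD[OF d(5)])
      have IX: "integral {0..1} (\<lambda>x. \<bar>X x\<bar> powr p) \<le> E"
      proof -
        have "integral {0..1} (\<lambda>x. \<bar>X x\<bar>) \<le> integral {0..1} (\<lambda>x::real. N)"
          by (intro integral_le integrable_continuous_real continuous_on_rabs smooth_periodicD[OF X])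
             (use N in auto)
        then show ?thesis unfolding E_def using K NM assms by (intro integral_powr_le smooth_periodicD[OF X]) auto
      qed
      have IX': "integral {0..1} (\<lambda>x. \<bar>deriv X x\<bar> powr p) \<le> E"
        unfolding E_def using K NM N assms by (intro integral_powr_le smooth_periodicD[OF X']) auto
      have DX: "integral {0..1} (\<lambda>x. \<bar>X (x + h) - X x\<bar> powr p) \<le> E * h powr \<alpha>" if h: "0 < h" "h \<le> 1" for h
      proof -
        have "integral {0..1} (\<lambda>x. \<bar>X (x + h) - X x\<bar> powr p) \<le> (K * h) powr (p - 1) * (h * M)"
        proof (rule integral_powr_le[OF continuous_on_shift_diff[OF X] _ assms(1)])
          show "\<bar>X (x + h) - X x\<bar> \<le> K * h" for x
            using smooth_DERIV_lipschitz[OF smooth_periodicD(1)[OF X] K(3), of "x + h" x] h by simp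
          show "integral {0..1} (\<lambda>x. \<bar>X (x + h) - X x\<bar>) \<le> h * M"
            using h order_trans[OF N(4) NM] by (intro integral_abs_diff_le_mult[OF X]) auto
        qed
        also have "(K * h) powr (p - 1) * (h * M) = E * (h powr (p - 1) * h powr 1)"
          using h K by (simp add: powr_mult E_def)
        also have "\<dots> = E * h powr p" using h by (simp add: powr_diff)
        also have "\<dots> \<le> E * h powr \<alpha>" using h \<alpha> assms E0 by (intro mult_left_mono powr_mono') auto
        finally show ?thesis .
      qed
      have DX': "integral {0..1} (\<lambda>x. \<bar>deriv X (x + h) - deriv X x\<bar> powr p) \<le> 2 powr p * E * h powr \<alpha>" if h: "0 < h" "h \<le> 1" for h
      proof -
        have "integral {0..1} (\<lambda>x. \<bar>deriv X (x + h) - deriv X x\<bar> powr p) \<le> (2 * K) powr (p - 1) * ((h * V) powr \<alpha> * (2 * N) powr (1 - \<alpha>))"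
        proof (rule integral_powr_le[OF continuous_on_shift_diff[OF X'] _ assms(1)])
          show "\<bar>deriv X (x + h) - deriv X x\<bar> \<le> 2 * K" for x
            using K(3)[of "x + h"] K(3)[of x] by linarith
          have "integral {0..1} (\<lambda>x. \<bar>deriv X (x + h) - deriv X x\<bar>) \<le> h * V"
            using h V by (intro integral_abs_diff_le_mult[OF X']) auto
          moreover have "integral {0..1} (\<lambda>x. \<bar>deriv X (x + h) - deriv X x\<bar>) \<le> 2 * N"
          proof -
            have cabs: "continuous_on UNIV (\<lambda>x. \<bar>deriv X x\<bar>)" by (intro continuous_on_rabs smooth_periodicD[OF X'])
            have cs: "continuous_on UNIV (\<lambda>x. \<bar>deriv X (x + h)\<bar>)"
              by (rule continuous_on_compose2[OF cabs]) (auto intro!: continuous_intros)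
            have "integral {0..1} (\<lambda>x. \<bar>deriv X (x + h) - deriv X x\<bar>) \<le> integral {0..1} (\<lambda>x. \<bar>deriv X (x + h)\<bar> + \<bar>deriv X x\<bar>)"
              by (intro integral_le integrable_continuous_real continuous_on_add continuous_on_subset[OF cabs] continuous_on_subset[OF cs]
                    continuous_on_rabs continuous_on_subset[OF continuous_on_shift_diff[OF X']] subset_UNIV) auto
            also have "\<dots> = integral {0..1} (\<lambda>x. \<bar>deriv X (x + h)\<bar>) + integral {0..1} (\<lambda>x. \<bar>deriv X x\<bar>)"
              by (intro Henstock_Kurzweil_Integration.integral_add integrable_continuous_real continuous_on_subset[OF cabs] continuous_on_subset[OF cs] subset_UNIV)
            also have "integral {0..1} (\<lambda>x. \<bar>deriv X (x + h)\<bar>) = integral {0..1} (\<lambda>x. \<bar>deriv X x\<bar>)"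
              using integral_shift_periodic[OF cabs, of h] smooth_periodicD(2)[OF X'] by simp
            finally show ?thesis using N by simp
          qed
          ultimately have "integral {0..1} (\<lambda>x. \<bar>deriv X (x + h) - deriv X x\<bar>) \<le> min (h * V) (2 * N)" by simp
          also have "\<dots> \<le> (h * V) powr \<alpha> * (2 * N) powr (1 - \<alpha>)"
            using h N \<alpha> by (intro min_le_powr_mult) auto
          finally show "integral {0..1} (\<lambda>x. \<bar>deriv X (x + h) - deriv X x\<bar>) \<le> (h * V) powr \<alpha> * (2 * N) powr (1 - \<alpha>)" .
        qed
        also have "\<dots> = (2 powr (p - 1) * 2 powr (1 - \<alpha>)) * (E * h powr \<alpha>)"
          using K h N by (simp add: powr_mult E_def M_def)
        also have "\<dots> \<le> 2 powr p * (E * h powr \<alpha>)"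
          using E0 \<alpha> by (intro mult_right_mono) (auto simp flip: powr_add)
        finally show ?thesis by (simp add: mult.assoc)
      qed
      have sum_le: "(\<integral>\<^sup>+x. ennreal (\<bar>u x + w x\<bar> powr p) \<partial>lborel) \<le> ennreal (2 powr p * (U + W))"
        if [measurable]: "u \<in> borel_measurable borel" "w \<in> borel_measurable borel"
          and "(\<integral>\<^sup>+x. ennreal (\<bar>u x\<bar> powr p) \<partial>lborel) \<le> ennreal U" "(\<integral>\<^sup>+x. ennreal (\<bar>w x\<bar> powr p) \<partial>lborel) \<le> ennreal W" "0 \<le> U" "0 \<le> W"
        for u w :: "real \<Rightarrow> real" and U W
      proof -
        have "(\<integral>\<^sup>+x. ennreal (\<bar>u x + w x\<bar> powr p) \<partial>lborel) \<le> (\<integral>\<^sup>+x. ennreal (2 powr p) * (ennreal (\<bar>u x\<bar> powr p) + ennreal (\<bar>w x\<bar> powr p)) \<partial>lborel)"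
        proof (rule nn_integral_mono)
          fix x
          have "\<bar>u x + w x\<bar> powr p \<le> (\<bar>u x\<bar> + \<bar>w x\<bar>) powr p" using assms by (intro powr_mono2) auto
          also have "\<dots> \<le> 2 powr p * (\<bar>u x\<bar> powr p + \<bar>w x\<bar> powr p)" using assms by (intro powr_add_le) auto
          finally show "ennreal (\<bar>u x + w x\<bar> powr p) \<le> ennreal (2 powr p) * (ennreal (\<bar>u x\<bar> powr p) + ennreal (\<bar>w x\<bar> powr p))"
            by (simp add: ennreal_mult[symmetric] flip: ennreal_plus)
        qed
        also have "\<dots> = ennreal (2 powr p) * ((\<integral>\<^sup>+x. ennreal (\<bar>u x\<bar> powr p) \<partial>lborel) + (\<integral>\<^sup>+x. ennreal (\<bar>w x\<bar> powr p) \<partial>lborel))"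
          by (subst nn_integral_cmult, simp, subst nn_integral_add) auto
        also have "\<dots> \<le> ennreal (2 powr p) * (ennreal U + ennreal W)"
          by (intro mult_left_mono add_mono that) auto
        also have "\<dots> = ennreal (2 powr p * (U + W))"
          using that by (simp add: ennreal_mult[symmetric] flip: ennreal_plus)
        finally show ?thesis .
      qed
      have I1: "(\<integral>\<^sup>+x. ennreal (\<bar>?g x\<bar> powr p) \<partial>lborel) \<le> ennreal (D * E)"
        using order_trans[OF K1(2)[OF X]] ennreal_leI[OF mult_mono[OF D(2) IX]] D E0 integral_abs_powr_nonneg[OF smooth_periodicD(3)[OF X]] assms by auto
      have If: "(\<integral>\<^sup>+x. ennreal (\<bar>?f x\<bar> powr p) \<partial>lborel) \<le> ennreal (D * E)"
      proof -
        have "(\<integral>\<^sup>+x. ennreal (\<bar>?f x\<bar> powr p) \<partial>lborel) \<le> ennreal (2 powr p * (K2 * E + K1 * E))"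
          by (rule sum_le[OF ba bb order_trans[OF K2(2)[OF X]] order_trans[OF K1(2)[OF X']]])
             (use K1 K2 IX IX' E0 in \<open>auto intro!: ennreal_leI mult_left_mono\<close>)
        then show ?thesis by (simp add: D_def algebra_simps)
      qed
      have L: "Lp_norm p ?g \<le> ennreal (D powr (1 / p) * E powr (1 / p))" "Lp_norm p ?f \<le> ennreal (D powr (1 / p) * E powr (1 / p))"
        using Lp_norm_le[OF I1] Lp_norm_le[OF If] D E0 assms by (auto simp: powr_mult)
      show ?thesis
      proof (cases "s = 1")
        case True
        have "W_norm_R s p ?g \<le> ennreal (D powr (1 / p) * E powr (1 / p)) + ennreal (D powr (1 / p) * E powr (1 / p))"
          unfolding W_norm_R_less_2[OF s1 s2] dg using True L by (simp add: add_mono)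
        also have "\<dots> = ennreal (C * E powr (1 / p))"
          using True by (simp add: C_def C1_def algebra_simps flip: ennreal_plus)
        finally show ?thesis by (simp add: local_rep_cutoff E_def M_def)
      next
        case False
        then have q0: "0 < q" using s1 assms by (simp add: q_def)
        have G: "(\<integral>\<^sup>+ z. ennreal (\<bar>?f (fst z) - ?f (snd z)\<bar> powr p / \<bar>fst z - snd z\<bar> powr (1 + q)) \<partial>(lborel \<Otimes>\<^sub>M lborel))
           \<le> ennreal (2 * (D * (2 powr p + 1) * E / (\<alpha> - q) + 2 powr p * (2 * (D * E)) / q))"
        proof (rule gagliardo_bound[OF bf _ q0 \<alpha>(1) _ _ _ If])
          fix h :: real assume h: "0 < h" "h \<le> 1"
          have hp: "h powr p \<le> h powr \<alpha>" using h \<alpha> assms by (intro powr_mono') auto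
          let ?Ra = "\<lambda>x. ?a (x + h) - ?a x" and ?Rb = "\<lambda>x. ?b (x + h) - ?b x"
          have Ia: "(\<integral>\<^sup>+x. ennreal (\<bar>?Ra x\<bar> powr p) \<partial>lborel) \<le> ennreal (K2 * ((2 powr p + 1) * E * h powr \<alpha>))"
          proof (rule order_trans[OF K2(3)[OF X h]], intro ennreal_leI mult_left_mono)
            have "h powr p * integral {0..1} (\<lambda>x. \<bar>X x\<bar> powr p) \<le> h powr \<alpha> * E"
              by (intro mult_mono hp IX integral_abs_powr_nonneg smooth_periodicD[OF X]) (use assms in auto)
            moreover have "E * h powr \<alpha> \<le> 2 powr p * E * h powr \<alpha>"
              using mult_right_mono[of 1 "2 powr p" "E * h powr \<alpha>"] E0 assms ge_one_powr_ge_zero[of 2 p] by simp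
            ultimately show "integral {0..1} (\<lambda>x. \<bar>X (x + h) - X x\<bar> powr p) + h powr p * integral {0..1} (\<lambda>x. \<bar>X x\<bar> powr p) \<le> (2 powr p + 1) * E * h powr \<alpha>"
              using DX[OF h] by (simp add: algebra_simps)
          qed (use K2 in auto)
          have Ib: "(\<integral>\<^sup>+x. ennreal (\<bar>?Rb x\<bar> powr p) \<partial>lborel) \<le> ennreal (K1 * ((2 powr p + 1) * E * h powr \<alpha>))"
          proof (rule order_trans[OF K1(3)[OF X' h]], intro ennreal_leI mult_left_mono)
            have "h powr p * integral {0..1} (\<lambda>x. \<bar>deriv X x\<bar> powr p) \<le> h powr \<alpha> * E"
              by (intro mult_mono hp IX' integral_abs_powr_nonneg smooth_periodicD[OF X']) (use assms in auto)
            then show "integral {0..1} (\<lambda>x. \<bar>deriv X (x + h) - deriv X x\<bar> powr p) + h powr p * integral {0..1} (\<lambda>x. \<bar>deriv X x\<bar> powr p) \<le> (2 powr p + 1) * E * h powr \<alpha>"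
              using DX'[OF h] by (simp add: algebra_simps)
          qed (use K1 in auto)
          have [measurable]: "?a \<in> borel_measurable borel" "?b \<in> borel_measurable borel" by (fact ba bb)+
          have "(\<integral>\<^sup>+x. ennreal (\<bar>?Ra x + ?Rb x\<bar> powr p) \<partial>lborel) \<le> ennreal (2 powr p * (K2 * ((2 powr p + 1) * E * h powr \<alpha>) + K1 * ((2 powr p + 1) * E * h powr \<alpha>)))"
            by (rule sum_le[OF _ _ Ia Ib]) (use K1 K2 E0 in \<open>measurable, auto\<close>)
          then show "(\<integral>\<^sup>+x. ennreal (\<bar>?f (x + h) - ?f x\<bar> powr p) \<partial>lborel) \<le> ennreal (D * (2 powr p + 1) * E * h powr \<alpha>)"
            by (simp add: D_def algebra_simps)
        qed (use D E0 assms in auto)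
        have "2 * (D * (2 powr p + 1) * E / (\<alpha> - q) + 2 powr p * (2 * (D * E)) / q) = C1 * E"
          using False by (simp add: C1_def algebra_simps)
        then have "enn_rpow (\<integral>\<^sup>+ z. ennreal (\<bar>?f (fst z) - ?f (snd z)\<bar> powr p / \<bar>fst z - snd z\<bar> powr (1 + q)) \<partial>(lborel \<Otimes>\<^sub>M lborel)) (1 / p)
           \<le> ennreal ((C1 * E) powr (1 / p))"
          using G C1 E0 assms by (intro enn_rpow_le_ennreal) auto
        also have "(C1 * E) powr (1 / p) = C1 powr (1 / p) * E powr (1 / p)" using C1 E0 by (simp add: powr_mult)
        finally have "W_norm_R s p ?g \<le> ennreal (D powr (1 / p) * E powr (1 / p)) + ennreal (D powr (1 / p) * E powr (1 / p)) + ennreal (C1 powr (1 / p) * E powr (1 / p))"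
          unfolding W_norm_R_less_2[OF s1 s2] dg using False L by (simp add: add_mono q_def)
        also have "\<dots> = ennreal (C * E powr (1 / p))"
          by (simp add: C_def algebra_simps flip: ennreal_plus)
        finally show ?thesis by (simp add: local_rep_cutoff E_def M_def)
      qed
    qed
    moreover have "0 \<le> C" by (simp add: C_def)
    ultimately show "\<exists>C. Q v C" unfolding Q_def by (intro exI[of _ C]) auto
  next
    fix v C C' assume "Q v C" "C \<le> (C' :: real)"
    have *: "x \<le> ennreal (C' * e)" if "x \<le> ennreal (C * e)" "0 \<le> e" for x e
      using order_trans[OF that(1) ennreal_leI[OF mult_right_mono[OF \<open>C \<le> C'\<close> that(2)]]] .
    have **: "0 \<le> C'" using \<open>Q v C\<close> \<open>C \<le> C'\<close> by (simp add: Q_def)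
    show "Q v C'"
      unfolding Q_def
      apply (intro conjI allI impI **)
      apply (rule *[OF _ powr_ge_zero])
      apply (rule \<open>Q v C\<close>[unfolded Q_def, THEN conjunct2, rule_format])
      apply assumption+
      apply blast+
      done
  qed simp
  then obtain C where C: "C > 0" "\<And>v. v \<in> set P \<Longrightarrow> Q v C" by blast
  show ?thesis
  proof (rule that[of "(sqrt (real (length P)) + 1) * C" \<alpha>])
    fix X K N V
    assume a: "smooth_periodic X" "0 \<le> K" "0 < N" "N \<le> V" "\<And>x. \<bar>X x\<bar> \<le> K" "\<And>x. \<bar>deriv X x\<bar> \<le> K" "\<And>x. \<bar>X x\<bar> \<le> N"
      "integral {0..1} (\<lambda>x. \<bar>deriv X x\<bar>) \<le> N" "integral {0..1} (\<lambda>x. \<bar>deriv (deriv X) x\<bar>) \<le> V"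
    let ?E = "(K powr (p - 1) * (V powr \<alpha> * N powr (1 - \<alpha>))) powr (1 / p)"
    have "W_norm_R s p (local_rep c r \<rho> X) \<le> ennreal (C * ?E)" if "(c, r, \<rho>) \<in> set P" for c r \<rho>
      using C(2)[OF that] a unfolding Q_def by simp
    then have "W_norm_S1 P s p X \<le> ennreal (sqrt (real (length P)) * (C * ?E))"
      using C(1) by (intro W_norm_S1_le) auto
    also have "\<dots> \<le> ennreal ((sqrt (real (length P)) + 1) * C * ?E)"
      using C(1) by (intro ennreal_leI) (simp add: algebra_simps)
    finally show "W_norm_S1 P s p X \<le> ennreal ((sqrt (real (length P)) + 1) * C * ?E)" .
  qed (use C(1) \<alpha> in \<open>auto simp: add_nonneg_pos\<close>)
qed

section \<open>Paths of bounded length\<close>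

text \<open>The time derivative at a fixed point is the total derivative of \<open>\<Phi>\<close> in
  the direction \<open>(1, 0)\<close>, so it inherits joint smoothness.\<close>

lemma smooth_partial:
  assumes "smooth (\<lambda>z::real\<times>real. \<Phi> (fst z) (snd z))"
  shows smooth_partial_DERIV: "((\<lambda>\<tau>. \<Phi> \<tau> x) has_real_derivative deriv (\<lambda>\<tau>. \<Phi> \<tau> x) t) (at t)"
    and smooth_partial_smooth: "smooth (\<lambda>z::real\<times>real. deriv (\<lambda>\<tau>. \<Phi> \<tau> (snd z)) (fst z))"
proof -
  let ?F = "\<lambda>z::real\<times>real. \<Phi> (fst z) (snd z)"
  let ?V = "\<lambda>z. frechet_derivative ?F (at z) (1, 0)"
  have C: "Ck k ?F" for k using assms by (simp add: smooth_def)
  have D: "((\<lambda>\<tau>. \<Phi> \<tau> x) has_real_derivative ?V (t, x)) (at t)" for t x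
  proof -
    have 1: "((\<lambda>\<tau>. (\<tau>, x)) has_derivative (\<lambda>h. (h, 0))) (at t)"
      by (auto intro!: derivative_eq_intros)
    have 2: "(?F has_derivative frechet_derivative ?F (at (t, x))) (at (t, x))"
      using C Ck_has_derivative by blast
    have "((\<lambda>\<tau>. ?F (\<tau>, x)) has_derivative (\<lambda>h. frechet_derivative ?F (at (t, x)) (h, 0))) (at t)"
      using has_derivative_compose[OF 1 2] .
    moreover have "(\<lambda>h. frechet_derivative ?F (at (t, x)) (h, 0)) = (*) (?V (t, x))"
    proof
      show "frechet_derivative ?F (at (t, x)) (h, 0) = ?V (t, x) * h" for h
        using linear_cmul[OF has_derivative_linear[OF 2], of h "(1, 0)"] by (simp add: mult.commute)
    qed
    ultimately show ?thesis by (simp add: has_field_derivative_def)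
  qed
  show "((\<lambda>\<tau>. \<Phi> \<tau> x) has_real_derivative deriv (\<lambda>\<tau>. \<Phi> \<tau> x) t) (at t)"
    using D[where t = t and x = x] by (simp only: DERIV_imp_deriv[OF D])
  have eq: "(\<lambda>z::real\<times>real. deriv (\<lambda>\<tau>. \<Phi> \<tau> (snd z)) (fst z)) = ?V"
    using DERIV_imp_deriv[OF D] by auto
  have "(1, 0) \<in> (Basis :: (real \<times> real) set)" by (simp add: Basis_prod_def)
  then have "Ck k ?V" for k using C[of "Suc k"] by simp
  then show "smooth (\<lambda>z::real\<times>real. deriv (\<lambda>\<tau>. \<Phi> \<tau> (snd z)) (fst z))"
    unfolding eq smooth_def by blast
qed

lemma diff_path_diff_lift: "diff_path \<Phi> \<Longrightarrow> t \<in> {0..1} \<Longrightarrow> diff_lift (\<Phi> t)"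
  by (simp add: diff_path_def)

lemma diff_path_DERIV:
  assumes "diff_path \<Phi>"
  shows "((\<lambda>\<tau>. \<Phi> \<tau> x) has_real_derivative deriv (\<lambda>\<tau>. \<Phi> \<tau> x) t) (at t)"
  using smooth_partial_DERIV assms unfolding diff_path_def by blast

lemma smooth_path_velocity:
  assumes "diff_path \<Phi>" "t \<in> {0..1}"
  shows "smooth (path_velocity \<Phi> t)"
proof -
  have "smooth (\<lambda>y. (\<lambda>a b. deriv (\<lambda>\<tau>. \<Phi> \<tau> b) a) ((\<lambda>_. t) y) (inv (\<Phi> t) y))"
    by (rule smooth_compose2[OF smooth_partial_smooth])
       (use assms diff_lift_smooth[OF diff_lift_inv] in \<open>auto simp: diff_path_def\<close>)
  then show ?thesis by (simp add: path_velocity_def)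
qed

text \<open>Says that a path from \<open>g\<close> to \<open>h\<close> has length at most
  \<open>L\<close>, witnessed by a measurable majorant \<open>m\<close> of its speed. Measurability
  of the speed itself is never established, and integrals of \<open>m\<close> can be added and
  substituted. The end point is a lift, not a diffeomorphism of the circle, so that paths can be
  concatenated.\<close>

definition reach ::
  "(real \<times> real \<times> (real \<Rightarrow> real)) list \<Rightarrow> real \<Rightarrow> real \<Rightarrow> (real \<Rightarrow> real) \<Rightarrow> (real \<Rightarrow> real) \<Rightarrow> ennreal \<Rightarrow> bool" where
  "reach P s p g h L \<longleftrightarrow> (\<exists>\<Phi> m. diff_path \<Phi> \<and> \<Phi> 0 = g \<and> \<Phi> 1 = h \<and> m \<in> borel_measurable borel \<and>
     (\<forall>t\<in>{0..1}. W_norm_S1 P s p (path_velocity \<Phi> t) \<le> m t) \<and> (\<integral>\<^sup>+t. m t * indicator {0..1} t \<partial>lborel) \<le> L)"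

lemma reachI:
  assumes "diff_path \<Phi>" "\<Phi> 0 = g" "\<Phi> 1 = h" and m[measurable]: "m \<in> borel_measurable borel"
    and W: "\<And>t. 0 < t \<Longrightarrow> t < 1 \<Longrightarrow> W_norm_S1 P s p (path_velocity \<Phi> t) \<le> m t"
    and L: "(\<integral>\<^sup>+t. m t * indicator {0..1} t \<partial>lborel) \<le> L"
  shows "reach P s p g h L"
proof -
  \<comment> \<open>The two end times form a null set, so an infinite bound there is free; the
    estimate is demanded at interior times only.\<close>
  define m' where "m' t = (if t = 0 \<or> t = 1 then \<infinity> else m t)" for t
  have [measurable]: "m' \<in> borel_measurable borel" unfolding m'_def by measurable
  have "AE t in lborel. t \<noteq> 0 \<and> t \<noteq> (1::real)"
    using AE_lborel_singleton[of 0] AE_lborel_singleton[of 1] by eventually_elim auto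
  then have "(\<integral>\<^sup>+t. m' t * indicator {0..1} t \<partial>lborel) = (\<integral>\<^sup>+t. m t * indicator {0..1} t \<partial>lborel)"
    by (intro nn_integral_cong_AE, eventually_elim) (auto simp: m'_def)
  moreover have "\<forall>t\<in>{0..1}. W_norm_S1 P s p (path_velocity \<Phi> t) \<le> m' t"
    using W by (auto simp: m'_def)
  ultimately show ?thesis
    unfolding reach_def using assms by (intro exI[of _ \<Phi>] exI[of _ m']) auto
qed

lemma reach_mono: "reach P s p g h L \<Longrightarrow> L \<le> L' \<Longrightarrow> reach P s p g h L'"
  unfolding reach_def by (elim exE conjE, intro exI conjI) (assumption | rule order_trans)+

lemma diff_dist_le_reach:
  assumes "reach P s p g (\<lambda>x. h x + real_of_int n) L"
  shows "diff_dist P s p g h \<le> L"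
proof -
  obtain \<Phi> m where *: "diff_path \<Phi>" "\<Phi> 0 = g" "\<Phi> 1 = (\<lambda>x. h x + real_of_int n)" "m \<in> borel_measurable borel"
    "\<forall>t\<in>{0..1}. W_norm_S1 P s p (path_velocity \<Phi> t) \<le> m t" "(\<integral>\<^sup>+t. m t * indicator {0..1} t \<partial>lborel) \<le> L"
    using assms unfolding reach_def by blast
  have "diff_dist P s p g h \<le> path_length P s p \<Phi>"
    unfolding diff_dist_def by (rule INF_lower) (use * in auto)
  also have "\<dots> \<le> (\<integral>\<^sup>+t. m t * indicator {0..1} t \<partial>lborel)"
    unfolding path_length_def using *(5) by (intro nn_integral_mono) (auto split: split_indicator)
  finally show ?thesis using *(6) by simp
qed

text \<open>Agreement near \<open>t\<close> is enough because a concatenation coincides only locally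
  with a reparametrisation of one of its pieces.\<close>

lemma path_velocity_reparam:
  assumes "diff_path \<Phi>" "\<forall>\<^sub>F \<tau> in nhds t. \<Psi> \<tau> = \<Phi> (a \<tau>)" "(a has_real_derivative a') (at t)"
  shows "path_velocity \<Psi> t = (\<lambda>y. a' * path_velocity \<Phi> (a t) y)"
proof
  fix y
  have e: "\<Psi> t = \<Phi> (a t)" using assms(2) eventually_nhds_x_imp_x by blast
  let ?x = "inv (\<Phi> (a t)) y"
  have "((\<lambda>\<tau>. \<Phi> (a \<tau>) ?x) has_real_derivative deriv (\<lambda>\<tau>. \<Phi> \<tau> ?x) (a t) * a') (at t)"
    by (rule DERIV_chain2[OF diff_path_DERIV[OF assms(1)] assms(3)])
  moreover have "\<forall>\<^sub>F \<tau> in nhds t. \<Psi> \<tau> ?x = \<Phi> (a \<tau>) ?x"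
    using assms(2) by eventually_elim simp
  ultimately have "((\<lambda>\<tau>. \<Psi> \<tau> ?x) has_real_derivative deriv (\<lambda>\<tau>. \<Phi> \<tau> ?x) (a t) * a') (at t)"
    by (subst DERIV_cong_ev[OF refl]) auto
  then show "path_velocity \<Psi> t y = a' * path_velocity \<Phi> (a t) y"
    unfolding path_velocity_def e by (simp add: DERIV_imp_deriv)
qed

text \<open>Each path is run through a step function of time that is flat at its ends. Lengths add
  because the speed is homogeneous in the rate of the time change, which substitution then
  removes.\<close>

lemma reach_trans:
  assumes P: "admissible_pu P" "0 < p" and "reach P s p g k L1" "reach P s p k h L2"
  shows "reach P s p g h (L1 + L2)"
proof -
  obtain \<Phi>1 m1 where 1: "diff_path \<Phi>1" "\<Phi>1 0 = g" "\<Phi>1 1 = k" and [measurable]: "m1 \<in> borel_measurable borel"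
    and m1: "\<forall>t\<in>{0..1}. W_norm_S1 P s p (path_velocity \<Phi>1 t) \<le> m1 t" "(\<integral>\<^sup>+t. m1 t * indicator {0..1} t \<partial>lborel) \<le> L1"
    using assms(3) unfolding reach_def by blast
  obtain \<Phi>2 m2 where 2: "diff_path \<Phi>2" "\<Phi>2 0 = k" "\<Phi>2 1 = h" and [measurable]: "m2 \<in> borel_measurable borel"
    and m2: "\<forall>t\<in>{0..1}. W_norm_S1 P s p (path_velocity \<Phi>2 t) \<le> m2 t" "(\<integral>\<^sup>+t. m2 t * indicator {0..1} t \<partial>lborel) \<le> L2"
    using assms(4) unfolding reach_def by blast
  obtain st :: "real \<Rightarrow> real" where st: "smooth st" "\<And>t. t \<le> 0 \<Longrightarrow> st t = 0" "\<And>t. t \<ge> 1 \<Longrightarrow> st t = 1"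
    "\<And>t. 0 \<le> deriv st t" "\<And>t. 0 \<le> st t" "\<And>t. st t \<le> 1"
    by (rule smooth_step) blast
  define a where "a t = st (2 * t)" for t
  define b where "b t = st (2 * t - 1)" for t
  define a' where "a' t = 2 * deriv st (2 * t)" for t
  define b' where "b' t = 2 * deriv st (2 * t - 1)" for t
  have Da: "(a has_real_derivative a' t) (at t)" for t
  proof -
    have "((\<lambda>t. 2 * t) has_real_derivative 2) (at t)" by (auto intro!: derivative_eq_intros)
    from DERIV_chain2[OF smooth_DERIV[OF st(1)] this] show ?thesis
      unfolding a_def a'_def by (simp only: mult.commute)
  qed
  have Db: "(b has_real_derivative b' t) (at t)" for t
  proof -
    have "((\<lambda>t. 2 * t - 1) has_real_derivative 2) (at t)" by (auto intro!: derivative_eq_intros)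
    from DERIV_chain2[OF smooth_DERIV[OF st(1)] this] show ?thesis
      unfolding b_def b'_def by (simp only: mult.commute)
  qed
  have lin: "smooth (\<lambda>t::real. 2 * t)" "smooth (\<lambda>t::real. 2 * t - 1)"
    using smooth_mult[OF smooth_const smooth_ident] smooth_diff[OF smooth_mult[OF smooth_const smooth_ident] smooth_const]
    by blast+
  have sa: "smooth a" "smooth b"
    using smooth_compose[OF st(1) lin(1)] smooth_compose[OF st(1) lin(2)] by (simp_all add: a_def[abs_def] b_def[abs_def])
  have ab01: "a t \<in> {0..1}" "b t \<in> {0..1}" for t using st by (auto simp: a_def b_def)
  have a0: "a' t \<ge> 0" "b' t \<ge> 0" for t using st by (auto simp: a'_def b'_def)
  have ca: "continuous_on S a'" "continuous_on S b'" for S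
  proof -
    show "continuous_on S a'"
      unfolding a'_def by (intro continuous_on_mult_left smooth_continuous_on smooth_compose[OF smooth_deriv[OF st(1)] lin(1)])
    show "continuous_on S b'"
      unfolding b'_def by (intro continuous_on_mult_left smooth_continuous_on smooth_compose[OF smooth_deriv[OF st(1)] lin(2)])
  qed
  have bm[measurable]: "a \<in> borel_measurable borel" "b \<in> borel_measurable borel" 
     "a' \<in> borel_measurable borel" "b' \<in> borel_measurable borel"
    using smooth_borel[OF sa(1)] smooth_borel[OF sa(2)] borel_measurable_continuous_onI[OF ca(1)] borel_measurable_continuous_onI[OF ca(2)]
    by auto
  \<comment> \<open>A sum instead of a case distinction: on each half one of the two paths rests at
    \<open>k\<close> and cancels against \<open>- k x\<close>, so joint smoothness on the whole
    plane needs no matching of derivatives at \<open>t = 1/2\<close>.\<close>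
  define \<Psi> where "\<Psi> t x = \<Phi>1 (a t) x + \<Phi>2 (b t) x - k x" for t x
  have \<Psi>1: "\<Psi> t = \<Phi>1 (a t)" if "t \<le> 1/2" for t
    using that st(2)[of "2 * t - 1"] 2(2) by (auto simp: \<Psi>_def b_def)
  have \<Psi>2: "\<Psi> t = \<Phi>2 (b t)" if "1/2 \<le> t" for t
    using that st(3)[of "2 * t"] 1(3) by (auto simp: \<Psi>_def a_def)
  have dp: "diff_path \<Psi>"
    unfolding diff_path_def
  proof (intro conjI ballI)
    have "smooth (\<lambda>z::real\<times>real. \<Phi>1 (a (fst z)) (snd z))"
      by (intro smooth_compose2[of \<Phi>1 "\<lambda>z. a (fst z)" snd] smooth_compose[OF sa(1)] smooth_fst smooth_snd)
         (use 1 in \<open>simp add: diff_path_def\<close>)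
    moreover have "smooth (\<lambda>z::real\<times>real. \<Phi>2 (b (fst z)) (snd z))"
      by (intro smooth_compose2[of \<Phi>2 "\<lambda>z. b (fst z)" snd] smooth_compose[OF sa(2)] smooth_fst smooth_snd)
         (use 2 in \<open>simp add: diff_path_def\<close>)
    moreover have "smooth (\<lambda>z::real\<times>real. k (snd z))"
      using 2 diff_path_diff_lift[OF 2(1), of 0] by (intro smooth_compose[of k, OF diff_lift_smooth smooth_snd]) auto
    ultimately show "smooth (\<lambda>z::real\<times>real. \<Psi> (fst z) (snd z))"
      unfolding \<Psi>_def by (intro smooth_add smooth_diff)
    fix t :: real
    show "diff_lift (\<Psi> t)"
      using \<Psi>1[of t] \<Psi>2[of t] diff_path_diff_lift[OF 1(1) ab01(1)] diff_path_diff_lift[OF 2(1) ab01(2)]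
      by (cases "t \<le> 1/2") auto
  qed
  \<comment> \<open>The single time \<open>1/2\<close>, where neither local formula for the velocity
    applies, receives the value \<open>\<infinity>\<close> at no cost.\<close>
  define m where "m t = (if t < 1/2 then m1 (a t) * ennreal (a' t) else if t > 1/2 then m2 (b t) * ennreal (b' t) else \<infinity>)" for t
  have [measurable]: "m \<in> borel_measurable borel" unfolding m_def by measurable
  show ?thesis
  proof (rule reachI[OF dp])
    show "\<Psi> 0 = g" using \<Psi>1[of 0] 1 st(2)[of 0] by (simp add: a_def)
    show "\<Psi> 1 = h" using \<Psi>2[of 1] 2 st(3)[of 1] by (simp add: b_def)
    fix t :: real
    consider "t < 1/2" | "t > 1/2" | "t = 1/2" by linarith
    then show "W_norm_S1 P s p (path_velocity \<Psi> t) \<le> m t"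
    proof cases
      case 1
      have "\<forall>\<^sub>F \<tau> in nhds t. \<Psi> \<tau> = \<Phi>1 (a \<tau>)"
        using eventually_nhds_in_open[of "{..<1/2}" t] 1 \<Psi>1 by (auto elim!: eventually_mono)
      then have v: "path_velocity \<Psi> t = (\<lambda>y. a' t * path_velocity \<Phi>1 (a t) y)"
        by (rule path_velocity_reparam[OF \<open>diff_path \<Phi>1\<close> _ Da])
      have "W_norm_S1 P s p (path_velocity \<Psi> t) = ennreal \<bar>a' t\<bar> * W_norm_S1 P s p (path_velocity \<Phi>1 (a t))"
        unfolding v by (intro W_norm_S1_cmult smooth_path_velocity P \<open>diff_path \<Phi>1\<close> ab01)
      also have "\<dots> \<le> ennreal (a' t) * m1 (a t)"
        using m1(1) ab01 a0(1)[of t] by (intro mult_mono) auto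
      finally show ?thesis using 1 by (simp add: m_def mult.commute)
    next
      case 2
      have "\<forall>\<^sub>F \<tau> in nhds t. \<Psi> \<tau> = \<Phi>2 (b \<tau>)"
        using eventually_nhds_in_open[of "{1/2<..}" t] 2 \<Psi>2 by (auto elim!: eventually_mono)
      then have v: "path_velocity \<Psi> t = (\<lambda>y. b' t * path_velocity \<Phi>2 (b t) y)"
        by (rule path_velocity_reparam[OF \<open>diff_path \<Phi>2\<close> _ Db])
      have "W_norm_S1 P s p (path_velocity \<Psi> t) = ennreal \<bar>b' t\<bar> * W_norm_S1 P s p (path_velocity \<Phi>2 (b t))"
        unfolding v by (intro W_norm_S1_cmult smooth_path_velocity P \<open>diff_path \<Phi>2\<close> ab01)
      also have "\<dots> \<le> ennreal (b' t) * m2 (b t)"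
        using m2(1) ab01 a0(2)[of t] by (intro mult_mono) auto
      finally show ?thesis using 2 by (simp add: m_def mult.commute)
    qed (simp add: m_def)
  next
    have I1: "(\<integral>\<^sup>+t. m1 (a t) * ennreal (a' t) * indicator {0..1/2} t \<partial>lborel) = (\<integral>\<^sup>+t. m1 t * indicator {0..1} t \<partial>lborel)"
      using nn_integral_substitution_aux[of m1 0 "1/2" a a'] Da ca a0 st(2)[of 0] st(3)[of 1] by (simp add: a_def)
    have I2: "(\<integral>\<^sup>+t. m2 (b t) * ennreal (b' t) * indicator {1/2..1} t \<partial>lborel) = (\<integral>\<^sup>+t. m2 t * indicator {0..1} t \<partial>lborel)"
      using nn_integral_substitution_aux[of m2 "1/2" 1 b b'] Db ca a0 st(2)[of 0] st(3)[of 1] by (simp add: b_def)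
    have "(\<integral>\<^sup>+t. m t * indicator {0..1} t \<partial>lborel) \<le> (\<integral>\<^sup>+t. m1 (a t) * ennreal (a' t) * indicator {0..1/2} t + m2 (b t) * ennreal (b' t) * indicator {1/2..1} t \<partial>lborel)"
      using AE_lborel_singleton[of "1/2::real"]
      by (intro nn_integral_mono_AE, eventually_elim) (auto simp: m_def split: split_indicator)
    also have "\<dots> = (\<integral>\<^sup>+t. m1 t * indicator {0..1} t \<partial>lborel) + (\<integral>\<^sup>+t. m2 t * indicator {0..1} t \<partial>lborel)"
      by (subst nn_integral_add) (auto simp: I1 I2)
    also have "\<dots> \<le> L1 + L2" by (intro add_mono m1 m2)
    finally show "(\<integral>\<^sup>+t. m t * indicator {0..1} t \<partial>lborel) \<le> L1 + L2" .
  qed measurable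
qed

lemma reach_sym:
  assumes P: "admissible_pu P" "0 < p" and "reach P s p g h L"
  shows "reach P s p h g L"
proof -
  obtain \<Phi> m where 1: "diff_path \<Phi>" "\<Phi> 0 = g" "\<Phi> 1 = h" and [measurable]: "m \<in> borel_measurable borel"
    and m: "\<forall>t\<in>{0..1}. W_norm_S1 P s p (path_velocity \<Phi> t) \<le> m t" "(\<integral>\<^sup>+t. m t * indicator {0..1} t \<partial>lborel) \<le> L"
    using assms(3) unfolding reach_def by blast
  show ?thesis
  proof (rule reachI[where \<Phi> = "\<lambda>t. \<Phi> (1 - t)" and m = "\<lambda>t. m (1 - t)"])
    have "smooth (\<lambda>z::real\<times>real. \<Phi> (1 - fst z) (snd z))"
      using 1 by (intro smooth_compose2[of \<Phi> "\<lambda>z. 1 - fst z" snd] smooth_diff) (auto simp: diff_path_def)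
    then show "diff_path (\<lambda>t. \<Phi> (1 - t))" using 1 by (simp add: diff_path_def)
    fix t :: real assume t: "0 < t" "t < 1"
    have D: "((\<lambda>t::real. 1 - t) has_real_derivative -1) (at t)" by (auto intro!: derivative_eq_intros)
    have "path_velocity (\<lambda>t. \<Phi> (1 - t)) t = (\<lambda>y. -1 * path_velocity \<Phi> (1 - t) y)"
      by (rule path_velocity_reparam[OF 1(1) _ D]) simp
    then have "W_norm_S1 P s p (path_velocity (\<lambda>t. \<Phi> (1 - t)) t) = ennreal \<bar>-1\<bar> * W_norm_S1 P s p (path_velocity \<Phi> (1 - t))"
      using t by (simp only:) (intro W_norm_S1_cmult smooth_path_velocity P 1, auto)
    then show "W_norm_S1 P s p (path_velocity (\<lambda>t. \<Phi> (1 - t)) t) \<le> m (1 - t)" using m(1) t by simp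
  next
    have "(\<integral>\<^sup>+t. m t * indicator {0..1} t \<partial>lborel) = (\<integral>\<^sup>+t. m (1 - t) * indicator {0..1} (1 - t) \<partial>lborel)"
      using nn_integral_real_affine[of "\<lambda>t. m t * indicator {0..1} t" "-1" 1] by simp
    also have "\<dots> = (\<integral>\<^sup>+t. m (1 - t) * indicator {0..1} t \<partial>lborel)"
      by (intro nn_integral_cong) (auto split: split_indicator)
    finally show "(\<integral>\<^sup>+t. m (1 - t) * indicator {0..1} t \<partial>lborel) \<le> L" using m(2) by simp
  qed (use 1 in auto)
qed

lemma reach_refl:
  assumes "admissible_pu P" "0 < p" "diff_lift g"
  shows "reach P s p g g 0"
proof (rule reachI[where \<Phi> = "\<lambda>_. g" and m = "\<lambda>_. 0"])
  show "diff_path (\<lambda>_. g)"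
    using assms smooth_compose[OF diff_lift_smooth[OF assms(3)] smooth_snd] by (simp add: diff_path_def)
  have "path_velocity (\<lambda>_. g) t = (\<lambda>y. 0 * (0::real))" for t by (auto simp: path_velocity_def)
  then show "W_norm_S1 P s p (path_velocity (\<lambda>_. g) t) \<le> 0" for t
    using W_norm_S1_cmult[OF assms(1) smooth_const assms(2), of s 0 0] by simp
qed auto

lemma reach_chain:
  assumes "admissible_pu P" "0 < p" "diff_lift (f 0)" "\<And>i. i < n \<Longrightarrow> reach P s p (f i) (f (Suc i)) (ennreal L)" "0 \<le> L"
  shows "reach P s p (f 0) (f n) (ennreal (real n * L))"
  using assms(4)
proof (induction n)
  case 0
  then show ?case using reach_refl[OF assms(1-3)] by simp
next
  case (Suc n)
  have "reach P s p (f 0) (f (Suc n)) (ennreal (real n * L) + ennreal L)"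
    by (rule reach_trans[OF assms(1,2) Suc.IH Suc.prems]) (use Suc.prems in auto)
  then show ?case using assms(5) by (simp add: algebra_simps flip: ennreal_plus)
qed

subsection \<open>Affine paths\<close>

lemma affine_path_velocity:
  assumes "diff_lift g" "diff_lift h"
  defines "\<Phi> \<equiv> \<lambda>t x. (1 - t) * g x + t * h x"
  shows "diff_path \<Phi>"
    "path_velocity \<Phi> t = (\<lambda>y. h (inv (\<Phi> t) y) - g (inv (\<Phi> t) y))"
proof -
  note sg = diff_lift_smooth[OF assms(1)] and sh = diff_lift_smooth[OF assms(2)]
  have "smooth (\<lambda>z::real\<times>real. \<Phi> (fst z) (snd z))"
    unfolding \<Phi>_def by (intro smooth_add smooth_mult smooth_diff smooth_compose[OF sg] smooth_compose[OF sh]) auto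
  then show "diff_path \<Phi>"
    using diff_lift_convex[OF assms(1,2)] unfolding diff_path_def \<Phi>_def by auto
  have "((\<lambda>\<tau>. \<Phi> \<tau> x) has_real_derivative h x - g x) (at t)" for x
    unfolding \<Phi>_def by (auto intro!: derivative_eq_intros)
  then show "path_velocity \<Phi> t = (\<lambda>y. h (inv (\<Phi> t) y) - g (inv (\<Phi> t) y))"
    unfolding path_velocity_def by (auto intro: DERIV_imp_deriv)
qed

text \<open>\<open>Q\<close> is the derivative of the velocity seen from the source of the path.
  Total variation does not change under the change of variable \<open>\<psi>\<close>, so the
  variation of \<open>X\<close> is the \<open>L^1\<close> distance of the derivatives for every
  \<open>t\<close>, and the variation of \<open>deriv X\<close> is that of \<open>Q\<close>.\<close>

lemma affine_velocity_facts:
  assumes gh: "diff_lift g" "diff_lift h" and t: "0 \<le> t" "t \<le> 1"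
  defines "\<psi> \<equiv> \<lambda>x. (1 - t) * g x + t * h x"
  defines "X \<equiv> \<lambda>y. h (inv \<psi> y) - g (inv \<psi> y)"
  defines "Q \<equiv> \<lambda>x. (deriv h x - deriv g x) / ((1 - t) * deriv g x + t * deriv h x)"
  shows "smooth_periodic X" "deriv X y = Q (inv \<psi> y)"
    "integral {0..1} (\<lambda>x. \<bar>deriv X x\<bar>) = integral {0..1} (\<lambda>x. \<bar>deriv h x - deriv g x\<bar>)"
    "integral {0..1} (\<lambda>x. \<bar>deriv (deriv X) x\<bar>) = integral {0..1} (\<lambda>x. \<bar>deriv Q x\<bar>)"
    "smooth_periodic Q"
proof -
  have \<psi>: "diff_lift \<psi>" unfolding \<psi>_def by (intro diff_lift_convex assms)
  note i\<psi> = diff_lift_inv[OF \<psi>]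
  have \<psi>': "deriv \<psi> x = (1 - t) * deriv g x + t * deriv h x" for x
    unfolding \<psi>_def by (intro DERIV_imp_deriv DERIV_add DERIV_cmult diff_lift_DERIV gh)
  have pos: "(1 - t) * deriv g x + t * deriv h x > 0" for x
    using diff_lift_deriv_pos[OF \<psi>] \<psi>' by simp
  have "smooth (\<lambda>x. h x - g x)" by (intro smooth_diff diff_lift_smooth gh)
  then have "smooth X" unfolding X_def by (rule smooth_compose[OF _ diff_lift_smooth[OF i\<psi>], of "\<lambda>x. h x - g x"])
  moreover have "X (x + 1) = X x" for x
    unfolding X_def diff_lift_shift[OF i\<psi>] diff_lift_shift[OF gh(1)] diff_lift_shift[OF gh(2)] by simp
  ultimately show "smooth_periodic X" by (simp add: smooth_periodic_def)
  have "smooth Q" unfolding Q_def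
    by (intro smooth_divide smooth_diff smooth_add smooth_mult smooth_const smooth_deriv diff_lift_smooth gh pos)
  moreover have Qper: "Q (x + 1) = Q x" for x
    unfolding Q_def diff_lift_deriv_shift[OF gh(1)] diff_lift_deriv_shift[OF gh(2)] by simp
  ultimately show sQ: "smooth_periodic Q" by (simp add: smooth_periodic_def)
  have DX: "(X has_real_derivative Q (inv \<psi> y)) (at y)" for y
  proof -
    have "((\<lambda>x. h x - g x) has_real_derivative deriv h x - deriv g x) (at x)" for x
      by (intro DERIV_diff diff_lift_DERIV gh)
    from DERIV_chain2[OF this inv_diff_lift_DERIV[OF \<psi>], of y] show ?thesis
      unfolding X_def Q_def by (simp add: \<psi>')
  qed
  show dX: "deriv X y = Q (inv \<psi> y)" for y using DERIV_imp_deriv[OF DX] .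
  then have dX_eq: "deriv X = (\<lambda>y. Q (inv \<psi> y))" by auto
  have "integral {0..1} (\<lambda>x. \<bar>deriv X x\<bar>) = integral {0..1} (\<lambda>x. \<bar>Q x\<bar> * deriv \<psi> x)"
    unfolding dX
    by (rule integral_inv_diff_lift[OF \<psi>, of "\<lambda>x. \<bar>Q x\<bar>"])
       (use Qper in \<open>auto intro!: continuous_on_rabs smooth_periodicD[OF sQ]\<close>)
  also have "(\<lambda>x. \<bar>Q x\<bar> * deriv \<psi> x) = (\<lambda>x. \<bar>deriv h x - deriv g x\<bar>)"
    using pos by (auto simp: Q_def \<psi>' abs_mult less_imp_neq[symmetric] abs_of_pos)
  finally show "integral {0..1} (\<lambda>x. \<bar>deriv X x\<bar>) = integral {0..1} (\<lambda>x. \<bar>deriv h x - deriv g x\<bar>)" .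
  note sQ' = smooth_periodic_deriv[OF sQ]
  have ddX: "deriv (deriv X) y = deriv Q (inv \<psi> y) / deriv \<psi> (inv \<psi> y)" for y
    unfolding dX_eq
    using DERIV_chain2[OF smooth_DERIV[OF smooth_periodicD(1)[OF sQ]] inv_diff_lift_DERIV[OF \<psi>], of y]
    by (simp add: DERIV_imp_deriv)
  have "integral {0..1} (\<lambda>x. \<bar>deriv (deriv X) x\<bar>) = integral {0..1} (\<lambda>x. \<bar>deriv Q x / deriv \<psi> x\<bar> * deriv \<psi> x)"
    unfolding ddX
  proof (rule integral_inv_diff_lift[OF \<psi>, of "\<lambda>x. \<bar>deriv Q x / deriv \<psi> x\<bar>"])
    show "continuous_on UNIV (\<lambda>x. \<bar>deriv Q x / deriv \<psi> x\<bar>)"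
      using diff_lift_deriv_pos[OF \<psi>]
      by (intro continuous_on_rabs continuous_on_divide smooth_periodicD[OF sQ'] smooth_continuous_on smooth_deriv diff_lift_smooth[OF \<psi>])
         (auto simp: less_imp_neq[symmetric])
    show "\<bar>deriv Q (x + 1) / deriv \<psi> (x + 1)\<bar> = \<bar>deriv Q x / deriv \<psi> x\<bar>" for x
      by (simp add: smooth_periodicD(2)[OF sQ'] diff_lift_deriv_shift[OF \<psi>])
  qed
  also have "(\<lambda>x. \<bar>deriv Q x / deriv \<psi> x\<bar> * deriv \<psi> x) = (\<lambda>x. \<bar>deriv Q x\<bar>)"
  proof
    show "\<bar>deriv Q x / deriv \<psi> x\<bar> * deriv \<psi> x = \<bar>deriv Q x\<bar>" for x
      using diff_lift_deriv_pos[OF \<psi>, of x] by simp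
  qed
  finally show "integral {0..1} (\<lambda>x. \<bar>deriv (deriv X) x\<bar>) = integral {0..1} (\<lambda>x. \<bar>deriv Q x\<bar>)" .
qed

lemma reach_affine:
  assumes "diff_lift g" "diff_lift h" "m \<in> borel_measurable borel"
    "\<And>t. 0 < t \<Longrightarrow> t < 1 \<Longrightarrow> W_norm_S1 P s p (\<lambda>y. h (inv (\<lambda>x. (1 - t) * g x + t * h x) y) - g (inv (\<lambda>x. (1 - t) * g x + t * h x) y)) \<le> m t"
    "(\<integral>\<^sup>+t. m t * indicator {0..1} t \<partial>lborel) \<le> L"
  shows "reach P s p g h L"
  by (rule reachI[OF affine_path_velocity(1)[OF assms(1,2)] _ _ assms(3) _ assms(5)])
     (use assms(4) affine_path_velocity(2)[OF assms(1,2)] in auto)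

section \<open>Transport by a travelling logarithmic bump\<close>

text \<open>Up to \<open>pi / 3\<close> the cosine is at least \<open>1/2\<close>. Beyond, the sine
  is at least \<open>sqrt 3 / 2 \<ge> 4/5\<close>, while \<open>x / 2 \<le> 4/5\<close>.\<close>

lemma half_le_sin:
  fixes x :: real
  assumes "0 \<le> x" "x \<le> pi / 2"
  shows "x / 2 \<le> sin x"
proof (cases "x \<le> pi / 3")
  case True
  have "sin 0 - 0 / 2 \<le> sin x - x / 2"
  proof (rule DERIV_nonneg_imp_nondecreasing[OF assms(1), of "\<lambda>x. sin x - x / 2"])
    fix y assume y: "0 \<le> y" "y \<le> x"
    have "cos (pi / 3) \<le> cos y" using y True by (intro cos_monotone_0_pi_le) auto
    then have "0 \<le> cos y - 1 / 2" by (simp add: cos_60)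
    moreover have "((\<lambda>x. sin x - x / 2) has_real_derivative cos y - 1 / 2) (at y)"
      by (auto intro!: derivative_eq_intros)
    ultimately show "\<exists>d. ((\<lambda>x. sin x - x / 2) has_real_derivative d) (at y) \<and> 0 \<le> d" by blast
  qed
  then show ?thesis by simp
next
  case False
  have "sin (pi / 3) \<le> sin x" using False assms by (intro sin_monotone_2pi_le) auto
  moreover have "(8 / 5 :: real) \<le> sqrt 3" by (rule real_le_rsqrt) (simp add: power2_eq_square)
  moreover have "x \<le> 8 / 5"
  proof -
    have "pi \<le> 16 / 5" using pi_approx(2) by simp
    then show ?thesis using assms(2) by linarith
  qed
  ultimately show ?thesis by (simp add: sin_60)
qed

text \<open>Together with \<open>abs_sin_pi_diff_le\<close> this makes
  \<open>\<bar>sin (pi * z)\<bar>\<close> a substitute for the distance to the nearest integer; its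
  square is smooth and periodic.\<close>

lemma min_le_abs_sin_pi:
  fixes z :: real
  assumes "0 \<le> z" "z \<le> 1"
  shows "min z (1 - z) \<le> \<bar>sin (pi * z)\<bar>"
proof (cases "z \<le> 1/2")
  case True
  have "pi * z \<le> pi / 2" using True by (simp add: mult_left_le)
  then have "pi * z / 2 \<le> sin (pi * z)" using assms by (intro half_le_sin) auto
  moreover have "z \<le> pi * z / 2" using mult_right_mono[of 2 pi z] pi_ge_two assms by simp
  ultimately show ?thesis by linarith
next
  case False
  have "pi * (1 - z) \<le> pi / 2" using False by (simp add: mult_left_le)
  then have "pi * (1 - z) / 2 \<le> sin (pi * (1 - z))" using assms by (intro half_le_sin) auto
  moreover have "sin (pi * (1 - z)) = sin (pi * z)" by (simp add: right_diff_distrib sin_diff)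
  moreover have "1 - z \<le> pi * (1 - z) / 2" using mult_right_mono[of 2 pi "1 - z"] pi_ge_two assms by simp
  ultimately show ?thesis by linarith
qed

lemma abs_sin_pi_diff_le: "\<bar>sin (pi * x)\<bar> - \<bar>sin (pi * y)\<bar> \<le> 4 * \<bar>x - y :: real\<bar>"
proof -
  have "norm (sin (pi * x) - sin (pi * y)) \<le> 1 * norm (pi * x - pi * y)"
    by (rule field_differentiable_bound[of UNIV sin cos]) (auto intro!: derivative_eq_intros)
  then have "\<bar>sin (pi * x) - sin (pi * y)\<bar> \<le> pi * \<bar>x - y\<bar>"
    by (simp add: abs_mult flip: right_diff_distrib)
  also have "\<dots> \<le> 4 * \<bar>x - y\<bar>" using pi_less_4 by (intro mult_right_mono) auto
  finally show ?thesis by linarith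
qed

text \<open>Near 0 the logarithm is bounded by a power with exponent \<open>1 / (2 * p)\<close>,
  whose \<open>p\<close>-th power is integrable; at infinity it decays like \<open>1 / v\<close> and
  \<open>p > 1\<close>. The bound is uniform in \<open>k\<close>, including
  \<open>k = 0\<close>.\<close>

lemma nn_integral_ln_powr_le:
  fixes p k :: real
  assumes p: "1 < p" and k: "0 \<le> k"
  shows "(\<integral>\<^sup>+v. ennreal (ln (1 + 1 / (k + v)) powr p) * indicator {0<..} v \<partial>lborel)
     \<le> ennreal ((2 * p) powr p * sqrt 2 / (1 / 2) + 1 / (p - 1))"
proof -
  have "(\<integral>\<^sup>+v. ennreal (ln (1 + 1 / (k + v)) powr p) * indicator {0<..} v \<partial>lborel)
     \<le> ennreal ((2 * p) powr p * sqrt 2 / ((p - 1 + 1 / 2) - (p - 1)) + 1 / (p - 1))"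
  proof (rule nn_integral_powr_bound)
    fix v :: real assume v: "0 < v" "v \<le> 1"
    have "1 + 1 / (k + v) \<le> 1 + 1 / v" using v k by (simp add: frac_le)
    also have "\<dots> \<le> 2 / v" using v by (simp add: field_simps)
    finally have "ln (1 + 1 / (k + v)) \<le> ln (2 / v)" using v k by (subst ln_le_cancel_iff) (auto intro: add_pos_nonneg)
    also have "\<dots> \<le> (2 / v) powr (1 / (2 * p)) / (1 / (2 * p))" using v p by (intro ln_powr_bound) auto
    finally have "ln (1 + 1 / (k + v)) powr p \<le> (2 * p * (2 / v) powr (1 / (2 * p))) powr p"
      using v k p by (intro powr_mono2) (auto simp: mult.commute)
    also have "\<dots> = (2 * p) powr p * (2 / v) powr (1 / 2)"
      using p v by (simp add: powr_mult powr_powr)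
    also have "(2 / v) powr (1 / 2) = sqrt 2 * v powr (- (1 / 2))"
      using v by (simp add: powr_divide powr_half_sqrt powr_minus_divide)
    finally show "ennreal (ln (1 + 1 / (k + v)) powr p) \<le> ennreal ((2 * p) powr p * sqrt 2 * v powr (p - 1 + 1 / 2 - (p - 1) - 1))"
      by (intro ennreal_leI) (simp add: mult.assoc)
  next
    fix v :: real assume v: "1 < v"
    have "ln (1 + 1 / (k + v)) \<le> 1 / (k + v)" using v k by (intro ln_add_one_self_le_self) auto
    also have "\<dots> \<le> 1 / v" using v k by (simp add: frac_le)
    finally have "ln (1 + 1 / (k + v)) powr p \<le> (1 / v) powr p" using v k p by (intro powr_mono2) auto
    also have "\<dots> = v powr (- p)" using v by (simp add: powr_minus_divide powr_divide)
    finally show "ennreal (ln (1 + 1 / (k + v)) powr p) \<le> ennreal (1 * v powr (- (p - 1) - 1))"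
      by (intro ennreal_leI) simp
  qed (use assms in auto)
  then show ?thesis by simp
qed

text \<open>Complements the previous estimate when \<open>k\<close> is small: linearising the
  logarithm gains the full factor \<open>k powr p\<close>.\<close>

lemma nn_integral_ln_powr_le':
  fixes p k :: real
  assumes p: "1 < p" and k: "0 < k"
  shows "(\<integral>\<^sup>+v. ennreal (ln (1 + k / (1 + v)) powr p) * indicator {0<..} v \<partial>lborel)
     \<le> ennreal (k powr p / 1 + k powr p / (p - 1))"
proof -
  have *: "ln (1 + k / (1 + v)) powr p \<le> k powr p * (1 / (1 + v)) powr p" if "0 < v" for v
  proof -
    have "ln (1 + k / (1 + v)) \<le> k / (1 + v)" using that k by (intro ln_add_one_self_le_self) auto
    then have "ln (1 + k / (1 + v)) powr p \<le> (k * (1 / (1 + v))) powr p"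
      using that k p by (intro powr_mono2) auto
    also have "\<dots> = k powr p * (1 / (1 + v)) powr p"
      by (rule powr_mult)
    finally show ?thesis .
  qed
  have "(\<integral>\<^sup>+v. ennreal (ln (1 + k / (1 + v)) powr p) * indicator {0<..} v \<partial>lborel)
     \<le> ennreal (k powr p / (p - (p - 1)) + k powr p / (p - 1))"
  proof (rule nn_integral_powr_bound)
    fix v :: real assume v: "0 < v" "v \<le> 1"
    have "(1 / (1 + v)) powr p \<le> 1" using v p by (intro powr_le1) auto
    then have "k powr p * (1 / (1 + v)) powr p \<le> k powr p * 1" by (intro mult_left_mono) auto
    then show "ennreal (ln (1 + k / (1 + v)) powr p) \<le> ennreal (k powr p * v powr (p - (p - 1) - 1))"
      using *[OF v(1)] v by (intro ennreal_leI) simp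
  next
    fix v :: real assume v: "1 < v"
    have "(1 / (1 + v)) powr p \<le> (1 / v) powr p" using v p by (intro powr_mono2) (auto simp: frac_le)
    also have "\<dots> = v powr (- p)" using v by (simp add: powr_minus_divide powr_divide)
    finally have "k powr p * (1 / (1 + v)) powr p \<le> k powr p * v powr (- p)" by (intro mult_left_mono) auto
    then show "ennreal (ln (1 + k / (1 + v)) powr p) \<le> ennreal (k powr p * v powr (- (p - 1) - 1))"
      using *[of v] v by (intro ennreal_leI) simp
  qed (use assms in auto)
  then show ?thesis by simp
qed

lemma nn_integral_scale:
  fixes f :: "real \<Rightarrow> ennreal"
  assumes "f \<in> borel_measurable borel" "0 < c"
  shows "(\<integral>\<^sup>+w. f w * indicator {0<..} w \<partial>lborel) = ennreal c * (\<integral>\<^sup>+v. f (c * v) * indicator {0<..} v \<partial>lborel)"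
proof -
  have "indicator {0<..} (c * v) = (indicator {0<..} v :: ennreal)" for v
    using assms(2) by (simp add: indicator_def zero_less_mult_iff)
  then show ?thesis
    using nn_integral_real_affine[of "\<lambda>w. f w * indicator {0<..} w" c 0] assms by simp
qed

lemma continuous_on_ln_sin_powr:
  fixes \<epsilon> H p :: real
  assumes e: "0 < \<epsilon>" "0 < H" and "1 < p"
  shows "continuous_on UNIV (\<lambda>z. ln (1 + H / (\<epsilon> + \<bar>sin (pi * z)\<bar>)) powr p)"
proof -
  have pos: "0 < \<epsilon> + \<bar>sin (pi * z)\<bar>" for z using e by (simp add: add_pos_nonneg)
  then have gt: "1 + H / (\<epsilon> + \<bar>sin (pi * z)\<bar>) > 1" for z using e by simp
  have ne: "\<epsilon> + \<bar>sin (pi * z)\<bar> \<noteq> 0" for z using pos[of z] by linarith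
  have ne2: "1 + H / (\<epsilon> + \<bar>sin (pi * z)\<bar>) \<noteq> 0" for z using gt[of z] by linarith
  have c1: "continuous_on UNIV (\<lambda>z. \<epsilon> + \<bar>sin (pi * z)\<bar>)" by (intro continuous_intros)
  have c2: "continuous_on UNIV (\<lambda>z. 1 + H / (\<epsilon> + \<bar>sin (pi * z)\<bar>))"
    by (intro continuous_on_add continuous_on_const continuous_on_divide c1) (use ne in blast)
  have "continuous_on UNIV (\<lambda>z. ln (1 + H / (\<epsilon> + \<bar>sin (pi * z)\<bar>)))"
    by (intro continuous_on_ln c2) (use ne2 in blast)
  from continuous_on_abs_powr[OF this, of p]
  have "continuous_on UNIV (\<lambda>z. \<bar>ln (1 + H / (\<epsilon> + \<bar>sin (pi * z)\<bar>))\<bar> powr p)" using assms by simp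
  moreover have "\<bar>ln (1 + H / (\<epsilon> + \<bar>sin (pi * z)\<bar>))\<bar> = ln (1 + H / (\<epsilon> + \<bar>sin (pi * z)\<bar>))" for z
    using gt[of z] by (intro abs_of_nonneg ln_ge_zero) linarith
  ultimately show ?thesis by (simp only:)
qed

text \<open>The same integral is rescaled in two ways. The unit \<open>H\<close> gives a multiple of
  \<open>H\<close>, which is enough for \<open>\<epsilon> \<le> H\<close>; the unit
  \<open>\<epsilon>\<close> gives a multiple of \<open>H * (H / \<epsilon>) powr (p - 1)\<close>,
  which is enough for \<open>H < \<epsilon>\<close> since \<open>\<mu> \<le> p - 1\<close>. The
  first power of \<open>H\<close> is the critical one, and the factor
  \<open>(H / \<epsilon>) powr \<mu>\<close> is the small surplus that makes the Gagliardo integral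
  converge.\<close>

lemma integral_ln_sin_powr_le:
  assumes "1 < p"
  obtains C where "0 < C"
    "\<And>\<epsilon> H \<mu>. 0 < \<epsilon> \<Longrightarrow> 0 < H \<Longrightarrow> 0 \<le> \<mu> \<Longrightarrow> \<mu> \<le> p - 1 \<Longrightarrow>
      integral {0..1} (\<lambda>z. ln (1 + H / (\<epsilon> + \<bar>sin (pi * z)\<bar>)) powr p) \<le> C * H * (H / \<epsilon>) powr \<mu>"
proof -
  define C1 where "C1 = (2 * p) powr p * sqrt 2 / (1 / 2) + 1 / (p - 1)"
  define C2 where "C2 = 1 + 1 / (p - 1)"
  have C12: "0 < C1" "0 < C2" using assms by (auto simp: C1_def C2_def add_pos_pos)
  have main: "integral {0..1} (\<lambda>z. ln (1 + H / (\<epsilon> + \<bar>sin (pi * z)\<bar>)) powr p) \<le> 2 * (C1 + C2) * H * (H / \<epsilon>) powr \<mu>"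
    if e: "0 < \<epsilon>" "0 < H" "0 \<le> \<mu>" "\<mu> \<le> p - 1" for \<epsilon> H \<mu>
  proof -
    define G where "G w = ln (1 + H / (\<epsilon> + w)) powr p" for w
    have [measurable]: "G \<in> borel_measurable borel" unfolding G_def by measurable
    let ?I = "\<integral>\<^sup>+w. ennreal (G w) * indicator {0<..} w \<partial>lborel"
    have Ga: "?I \<le> ennreal (H * C1)"
    proof -
      have "G (H * v) = ln (1 + 1 / (\<epsilon> / H + v)) powr p" for v
      proof -
        have "H / (\<epsilon> + H * v) = 1 / (\<epsilon> / H + v)" using e by (simp add: field_simps)
        then show ?thesis by (simp add: G_def)
      qed
      then have "?I = ennreal H * (\<integral>\<^sup>+v. ennreal (ln (1 + 1 / (\<epsilon> / H + v)) powr p) * indicator {0<..} v \<partial>lborel)"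
        using nn_integral_scale[of "\<lambda>w. ennreal (G w)" H] e by simp
      also have "\<dots> \<le> ennreal H * ennreal C1"
        unfolding C1_def using assms e by (intro mult_left_mono nn_integral_ln_powr_le) auto
      finally show ?thesis using e C12 by (simp add: ennreal_mult)
    qed
    have Gb: "?I \<le> ennreal (\<epsilon> * ((H / \<epsilon>) powr p * C2))"
    proof -
      have "G (\<epsilon> * v) = ln (1 + (H / \<epsilon>) / (1 + v)) powr p" for v
      proof -
        have *: "\<epsilon> + \<epsilon> * v = \<epsilon> * (1 + v)" by (simp add: algebra_simps)
        have "H / (\<epsilon> + \<epsilon> * v) = (H / \<epsilon>) / (1 + v)" unfolding * by simp
        then show ?thesis unfolding G_def by (simp only:)
      qed
      then have "?I = ennreal \<epsilon> * (\<integral>\<^sup>+v. ennreal (ln (1 + (H / \<epsilon>) / (1 + v)) powr p) * indicator {0<..} v \<partial>lborel)"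
        using nn_integral_scale[of "\<lambda>w. ennreal (G w)" \<epsilon>] e by simp
      also have "\<dots> \<le> ennreal \<epsilon> * ennreal ((H / \<epsilon>) powr p / 1 + (H / \<epsilon>) powr p / (p - 1))"
        using assms e by (intro mult_left_mono nn_integral_ln_powr_le') auto
      also have "(H / \<epsilon>) powr p / 1 + (H / \<epsilon>) powr p / (p - 1) = (H / \<epsilon>) powr p * C2"
        by (simp add: C2_def distrib_left)
      finally show ?thesis using e C12 by (simp add: ennreal_mult)
    qed
    have Gle: "?I \<le> ennreal ((C1 + C2) * H * (H / \<epsilon>) powr \<mu>)"
    proof (cases "\<epsilon> \<le> H")
      case True
      then have "1 \<le> (H / \<epsilon>) powr \<mu>" using e by (intro ge_one_powr_ge_zero) auto
      then have "H * C1 * 1 \<le> H * (C1 + C2) * (H / \<epsilon>) powr \<mu>" using C12 e by (intro mult_mono) auto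
      then show ?thesis using order_trans[OF Ga ennreal_leI] by (simp add: ac_simps)
    next
      case False
      have "(H / \<epsilon>) powr p = H / \<epsilon> * (H / \<epsilon>) powr (p - 1)" using e by (simp add: powr_diff)
      moreover have "(H / \<epsilon>) powr (p - 1) \<le> (H / \<epsilon>) powr \<mu>" using e False by (intro powr_mono') auto
      ultimately have "\<epsilon> * ((H / \<epsilon>) powr p * C2) \<le> H * C2 * (H / \<epsilon>) powr \<mu>"
        using e C12 by simp
      also have "\<dots> \<le> H * (C1 + C2) * (H / \<epsilon>) powr \<mu>" using C12 e by (intro mult_mono) auto
      finally show ?thesis using order_trans[OF Gb ennreal_leI] by (simp add: ac_simps)
    qed
    note cf = continuous_on_ln_sin_powr[OF e(1,2) assms]
    have "ennreal (integral {0..1} (\<lambda>z. ln (1 + H / (\<epsilon> + \<bar>sin (pi * z)\<bar>)) powr p))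
       = (\<integral>\<^sup>+z. ennreal (ln (1 + H / (\<epsilon> + \<bar>sin (pi * z)\<bar>)) powr p) * indicator {0..1} z \<partial>lborel)"
      by (rule nn_integral_continuous_Icc[OF cf, symmetric]) simp
    \<comment> \<open>The integrand decreases in \<open>\<bar>sin (pi * z)\<bar>\<close>, which is
      at least \<open>z\<close> or at least \<open>1 - z\<close>; so the contributions from the two
      ends of the period dominate it.\<close>
    also have "\<dots> \<le> (\<integral>\<^sup>+z. ennreal (G z) * indicator {0<..} z + ennreal (G (1 - z)) * indicator {0<..} (1 - z) \<partial>lborel)"
    proof (rule nn_integral_mono_AE)
      have Gmono: "ln (1 + H / (\<epsilon> + b)) powr p \<le> G a" if "0 \<le> a" "a \<le> b" for a b
        unfolding G_def using that e assms
        by (intro powr_mono2 ln_mono add_mono divide_left_mono mult_pos_pos add_pos_nonneg order_refl) (auto intro: add_pos_nonneg)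
      have "AE z in lborel. z \<noteq> 0 \<and> z \<noteq> (1::real)"
        using AE_lborel_singleton[of 0] AE_lborel_singleton[of 1] by eventually_elim auto
      then show "AE z in lborel. ennreal (ln (1 + H / (\<epsilon> + \<bar>sin (pi * z)\<bar>)) powr p) * indicator {0..1} z
         \<le> ennreal (G z) * indicator {0<..} z + ennreal (G (1 - z)) * indicator {0<..} (1 - z)"
      proof eventually_elim
        case (elim z)
        show ?case
        proof (cases "z \<in> {0..1}")
          case True
          then have "min z (1 - z) \<le> \<bar>sin (pi * z)\<bar>" by (intro min_le_abs_sin_pi) auto
          then have "z \<le> \<bar>sin (pi * z)\<bar> \<or> 1 - z \<le> \<bar>sin (pi * z)\<bar>" by linarith
          then have "ln (1 + H / (\<epsilon> + \<bar>sin (pi * z)\<bar>)) powr p \<le> G z \<or> ln (1 + H / (\<epsilon> + \<bar>sin (pi * z)\<bar>)) powr p \<le> G (1 - z)"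
            using Gmono True by auto
          then show ?thesis using True elim by (auto intro: add_increasing add_increasing2 ennreal_leI)
        qed simp
      qed
    qed
    also have "\<dots> = ?I + (\<integral>\<^sup>+z. ennreal (G (1 - z)) * indicator {0<..} (1 - z) \<partial>lborel)"
      by (rule nn_integral_add) measurable
    also have "(\<integral>\<^sup>+z. ennreal (G (1 - z)) * indicator {0<..} (1 - z) \<partial>lborel) = ?I"
      using nn_integral_real_affine[of "\<lambda>z. ennreal (G z) * indicator {0<..} z" "-1" 1] by simp
    also have "?I + ?I \<le> ennreal ((C1 + C2) * H * (H / \<epsilon>) powr \<mu>) + ennreal ((C1 + C2) * H * (H / \<epsilon>) powr \<mu>)"
      by (intro add_mono Gle)
    also have "\<dots> = ennreal (2 * (C1 + C2) * H * (H / \<epsilon>) powr \<mu>)"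
      using C12 e by (simp flip: ennreal_plus)
    finally show ?thesis using C12 e by (subst (asm) ennreal_le_iff) auto
  qed
  show ?thesis by (rule that[of "2 * (C1 + C2)"]) (use C12 main in auto)
qed

text \<open>The profile \<open>log_bump \<epsilon>\<close> equals 1 at the integers and decays like \<open>ln (1 / \<bar>z\<bar>) / ln (1 / \<epsilon>)\<close> away from
  the scale \<open>\<epsilon>\<close>. Its critical norm tends to 0 with \<open>\<epsilon>\<close> because no single scale carries a fixed share of its variation.\<close>

definition log_bump :: "real \<Rightarrow> real \<Rightarrow> real" where
  "log_bump \<epsilon> z = ln ((\<epsilon>\<^sup>2 + 1) / (\<epsilon>\<^sup>2 + (sin (pi * z))\<^sup>2)) / ln (1 + 1 / \<epsilon>\<^sup>2)"

lemma log_bump_arg: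
  assumes "0 < \<epsilon>"
  shows "0 < \<epsilon>\<^sup>2 + (sin (pi * z))\<^sup>2" "1 \<le> (\<epsilon>\<^sup>2 + 1) / (\<epsilon>\<^sup>2 + (sin (pi * z))\<^sup>2)" "0 < ln (1 + 1 / \<epsilon>\<^sup>2)"
proof -
  show pos: "0 < \<epsilon>\<^sup>2 + (sin (pi * z))\<^sup>2" using assms by (simp add: add_pos_nonneg)
  have "(sin (pi * z))\<^sup>2 \<le> 1" by (simp add: abs_square_le_1)
  then show "1 \<le> (\<epsilon>\<^sup>2 + 1) / (\<epsilon>\<^sup>2 + (sin (pi * z))\<^sup>2)" using pos by simp
  show "0 < ln (1 + 1 / \<epsilon>\<^sup>2)" using assms by (intro ln_gt_zero) simp
qed

lemma smooth_log_bump: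
  assumes "0 < \<epsilon>" shows "smooth (log_bump \<epsilon>)"
proof -
  have s: "smooth (\<lambda>z. sin (pi * z))" by (intro smooth_sin smooth_mult smooth_const smooth_ident)
  then have "smooth (\<lambda>z. \<epsilon>\<^sup>2 + (sin (pi * z))\<^sup>2)"
    unfolding power2_eq_square[of "sin _"] by (intro smooth_add smooth_const smooth_mult)
  then have "smooth (\<lambda>z. (\<epsilon>\<^sup>2 + 1) / (\<epsilon>\<^sup>2 + (sin (pi * z))\<^sup>2))"
    by (intro smooth_divide smooth_const log_bump_arg assms)
  then have "smooth (\<lambda>z. ln ((\<epsilon>\<^sup>2 + 1) / (\<epsilon>\<^sup>2 + (sin (pi * z))\<^sup>2)))"
    by (rule smooth_ln) (use log_bump_arg(2)[OF assms] less_le_trans zero_less_one in blast)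
  then show ?thesis unfolding log_bump_def[abs_def] divide_inverse[of "ln _"]
    by (intro smooth_mult smooth_const)
qed

lemma log_bump_periodic: "log_bump \<epsilon> (z + 1) = log_bump \<epsilon> z"
proof -
  have "sin (pi * (z + 1)) = - sin (pi * z)" by (simp add: distrib_left)
  then show ?thesis by (simp add: log_bump_def)
qed

lemma log_bump_bounds:
  assumes "0 < \<epsilon>"
  shows "0 \<le> log_bump \<epsilon> z" "log_bump \<epsilon> z \<le> 1"
proof -
  show "0 \<le> log_bump \<epsilon> z" using log_bump_arg(2,3)[OF assms] by (simp add: log_bump_def)
  have "(\<epsilon>\<^sup>2 + 1) / (\<epsilon>\<^sup>2 + (sin (pi * z))\<^sup>2) \<le> (\<epsilon>\<^sup>2 + 1) / \<epsilon>\<^sup>2"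
    using assms by (intro divide_left_mono) (auto simp: add_pos_nonneg)
  also have "\<dots> = 1 + 1 / \<epsilon>\<^sup>2" using assms by (simp add: field_simps)
  finally have "ln ((\<epsilon>\<^sup>2 + 1) / (\<epsilon>\<^sup>2 + (sin (pi * z))\<^sup>2)) \<le> ln (1 + 1 / \<epsilon>\<^sup>2)"
    using log_bump_arg(2)[OF assms, of z] by (intro ln_mono) auto
  then show "log_bump \<epsilon> z \<le> 1" using log_bump_arg(3)[OF assms] by (simp add: log_bump_def)
qed

text \<open>Trades the smooth profile \<open>\<epsilon>^2 + s^2\<close> for the linear
  \<open>\<epsilon> + s\<close>, whose logarithmic integrals are known. The constant 3 works because
  \<open>3 * (\<epsilon>^2 + s^2) - 2 * s * (\<epsilon> + s) = (\<epsilon> - s)^2 + 2 *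
  \<epsilon>^2\<close>.\<close>

lemma ln_square_diff_le:
  fixes \<epsilon> a b :: real
  assumes "0 < \<epsilon>" "0 \<le> b" "b \<le> a"
  shows "ln (\<epsilon>\<^sup>2 + a\<^sup>2) - ln (\<epsilon>\<^sup>2 + b\<^sup>2) \<le> 3 * ln (1 + (a - b) / (\<epsilon> + b))"
proof -
  have "3 * ln (\<epsilon> + b) - ln (\<epsilon>\<^sup>2 + b\<^sup>2) \<le> 3 * ln (\<epsilon> + a) - ln (\<epsilon>\<^sup>2 + a\<^sup>2)"
  proof (rule DERIV_nonneg_imp_nondecreasing[OF assms(3), of "\<lambda>s. 3 * ln (\<epsilon> + s) - ln (\<epsilon>\<^sup>2 + s\<^sup>2)"])
    fix s assume s: "b \<le> s" "s \<le> a"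
    then have pos: "0 < \<epsilon> + s" "0 < \<epsilon>\<^sup>2 + s\<^sup>2" using assms by (auto simp: add_pos_nonneg)
    have "((\<lambda>s. 3 * ln (\<epsilon> + s) - ln (\<epsilon>\<^sup>2 + s\<^sup>2)) has_real_derivative 3 / (\<epsilon> + s) - 2 * s / (\<epsilon>\<^sup>2 + s\<^sup>2)) (at s)"
      using pos by (auto intro!: derivative_eq_intros)
    moreover have "0 \<le> 3 / (\<epsilon> + s) - 2 * s / (\<epsilon>\<^sup>2 + s\<^sup>2)"
    proof -
      have "2 * s * (\<epsilon> + s) \<le> 3 * (\<epsilon>\<^sup>2 + s\<^sup>2)"
      proof -
        have "0 \<le> (\<epsilon> - s)\<^sup>2 + 2 * \<epsilon>\<^sup>2" by simp
        then show ?thesis by (simp add: power2_eq_square algebra_simps)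
      qed
      then have "2 * s / (\<epsilon>\<^sup>2 + s\<^sup>2) \<le> 3 / (\<epsilon> + s)" using pos by (simp add: frac_le_eq divide_simps)
      then show ?thesis by simp
    qed
    ultimately show "\<exists>d. ((\<lambda>s. 3 * ln (\<epsilon> + s) - ln (\<epsilon>\<^sup>2 + s\<^sup>2)) has_real_derivative d) (at s) \<and> 0 \<le> d" by blast
  qed
  moreover have "1 + (a - b) / (\<epsilon> + b) = (\<epsilon> + a) / (\<epsilon> + b)" using assms by (simp add: field_simps)
  moreover have "ln ((\<epsilon> + a) / (\<epsilon> + b)) = ln (\<epsilon> + a) - ln (\<epsilon> + b)" using assms by (simp add: ln_div)
  ultimately show ?thesis by simp
qed

text \<open>The comparison of logarithms is based at the point with the smaller sine. Adding the
  terms for both points spares the later integrals the question which one that is.\<close>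

lemma log_bump_diff_le:
  assumes "0 < \<epsilon>" "\<bar>x - y\<bar> \<le> d"
  shows "\<bar>log_bump \<epsilon> x - log_bump \<epsilon> y\<bar> \<le> 3 / ln (1 + 1 / \<epsilon>\<^sup>2) *
    (ln (1 + 4 * d / (\<epsilon> + \<bar>sin (pi * x)\<bar>)) + ln (1 + 4 * d / (\<epsilon> + \<bar>sin (pi * y)\<bar>)))"
proof -
  let ?\<Lambda> = "ln (1 + 1 / \<epsilon>\<^sup>2)"
  note arg = log_bump_arg[OF assms(1)]
  have d0: "0 \<le> d" using assms by linarith
  have nn: "0 \<le> ln (1 + 4 * d / (\<epsilon> + \<bar>sin (pi * u)\<bar>))" for u
    using assms d0 by (intro ln_ge_zero) (auto intro!: divide_nonneg_nonneg)
  have one: "\<bar>log_bump \<epsilon> x - log_bump \<epsilon> y\<bar> \<le> 3 / ?\<Lambda> * ln (1 + 4 * d / (\<epsilon> + \<bar>sin (pi * y)\<bar>))"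
    if "\<bar>x - y\<bar> \<le> d" "\<bar>sin (pi * y)\<bar> \<le> \<bar>sin (pi * x)\<bar>" for x y
  proof -
    have eq: "log_bump \<epsilon> u = (ln (\<epsilon>\<^sup>2 + 1) - ln (\<epsilon>\<^sup>2 + (sin (pi * u))\<^sup>2)) / ?\<Lambda>" for u
    proof -
      have "0 < \<epsilon>\<^sup>2 + 1" by (simp add: add_nonneg_pos)
      then show ?thesis unfolding log_bump_def using arg(1)[of u] by (simp add: ln_div)
    qed
    let ?L = "ln (\<epsilon>\<^sup>2 + (sin (pi * x))\<^sup>2) - ln (\<epsilon>\<^sup>2 + (sin (pi * y))\<^sup>2)"
    have "(sin (pi * y))\<^sup>2 \<le> (sin (pi * x))\<^sup>2" using that(2) by (simp add: abs_le_square_iff)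
    then have L0: "0 \<le> ?L" using arg(1)[of y] by simp
    have "?L \<le> 3 * ln (1 + (\<bar>sin (pi * x)\<bar> - \<bar>sin (pi * y)\<bar>) / (\<epsilon> + \<bar>sin (pi * y)\<bar>))"
      using ln_square_diff_le[of \<epsilon> "\<bar>sin (pi * y)\<bar>" "\<bar>sin (pi * x)\<bar>"] assms that by simp
    also have "\<dots> \<le> 3 * ln (1 + 4 * d / (\<epsilon> + \<bar>sin (pi * y)\<bar>))"
      using abs_sin_pi_diff_le[of x y] that assms
      by (intro mult_left_mono ln_mono add_mono divide_right_mono) (auto intro!: add_pos_nonneg divide_nonneg_nonneg)
    finally have "?L \<le> 3 * ln (1 + 4 * d / (\<epsilon> + \<bar>sin (pi * y)\<bar>))" .
    moreover have "log_bump \<epsilon> x - log_bump \<epsilon> y = - (?L / ?\<Lambda>)" unfolding eq by (simp add: diff_divide_distrib)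
    ultimately show ?thesis using L0 arg(3) by (simp add: divide_right_mono)
  qed
  have "3 / ?\<Lambda> > 0" using arg by simp
  then show ?thesis
    using one[of x y] one[of y x] assms(2) nn[of x] nn[of y]
      mult_left_mono[of "ln (1 + 4 * d / (\<epsilon> + \<bar>sin (pi * x)\<bar>))" "ln (1 + 4 * d / (\<epsilon> + \<bar>sin (pi * x)\<bar>)) + ln (1 + 4 * d / (\<epsilon> + \<bar>sin (pi * y)\<bar>))" "3 / ?\<Lambda>"]
      mult_left_mono[of "ln (1 + 4 * d / (\<epsilon> + \<bar>sin (pi * y)\<bar>))" "ln (1 + 4 * d / (\<epsilon> + \<bar>sin (pi * x)\<bar>)) + ln (1 + 4 * d / (\<epsilon> + \<bar>sin (pi * y)\<bar>))" "3 / ?\<Lambda>"]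
    by (cases "\<bar>sin (pi * y)\<bar> \<le> \<bar>sin (pi * x)\<bar>") (auto simp: abs_minus_commute)
qed

lemma log_bump_le:
  assumes "0 < \<epsilon>"
  shows "log_bump \<epsilon> x \<le> 3 / ln (1 + 1 / \<epsilon>\<^sup>2) * ln (1 + 1 / (\<epsilon> + \<bar>sin (pi * x)\<bar>))"
proof -
  note arg = log_bump_arg[OF assms]
  have "ln (\<epsilon>\<^sup>2 + 1\<^sup>2) - ln (\<epsilon>\<^sup>2 + \<bar>sin (pi * x)\<bar>\<^sup>2) \<le> 3 * ln (1 + (1 - \<bar>sin (pi * x)\<bar>) / (\<epsilon> + \<bar>sin (pi * x)\<bar>))"
    using assms by (intro ln_square_diff_le) auto
  also have "\<dots> \<le> 3 * ln (1 + 1 / (\<epsilon> + \<bar>sin (pi * x)\<bar>))"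
    using assms by (intro mult_left_mono ln_mono add_mono divide_right_mono) (auto intro!: add_pos_nonneg divide_nonneg_nonneg)
  finally have "ln (\<epsilon>\<^sup>2 + 1) - ln (\<epsilon>\<^sup>2 + (sin (pi * x))\<^sup>2) \<le> 3 * ln (1 + 1 / (\<epsilon> + \<bar>sin (pi * x)\<bar>))" by simp
  moreover have "ln ((\<epsilon>\<^sup>2 + 1) / (\<epsilon>\<^sup>2 + (sin (pi * x))\<^sup>2)) = ln (\<epsilon>\<^sup>2 + 1) - ln (\<epsilon>\<^sup>2 + (sin (pi * x))\<^sup>2)"
  proof -
    have "0 < \<epsilon>\<^sup>2 + 1" by (simp add: add_nonneg_pos)
    then show ?thesis using arg(1)[of x] by (simp add: ln_div)
  qed
  ultimately show ?thesis unfolding log_bump_def using arg(3) by (simp add: divide_right_mono)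
qed

text \<open>With \<open>\<epsilon> = exp (- 1 / \<mu>)\<close> the logarithmic increments carry a
  factor of order \<open>\<mu>\<close>, while \<open>(1 / \<epsilon>) powr \<mu> = exp 1\<close>
  stays bounded. So the \<open>L^p\<close> modulus has exponent \<open>1 + \<mu>\<close> and a
  constant of order \<open>\<mu> powr p\<close>. The Gagliardo integral costs a factor of at most
  \<open>1 / \<mu>\<close>, and the \<open>p\<close>-th root leaves
  \<open>\<mu> powr (1 - 1 / p)\<close>, which tends to 0.\<close>

lemma travelling_bump_norm:
  assumes p: "1 < p" and s: "0 \<le> s" "s \<le> 1 / p" and P: "admissible_pu P" and A: "diff_lift A" and T: "0 < T"
  obtains C where "0 < C"
    "\<And>\<mu> \<theta> \<tau>. 0 < \<mu> \<Longrightarrow> \<mu> \<le> 1 \<Longrightarrow> \<mu> \<le> p - 1 \<Longrightarrow> 0 \<le> \<theta> \<Longrightarrow> \<theta> \<le> 1 \<Longrightarrow>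
      W_norm_S1 P s p (\<lambda>y. T * deriv A (inv A y) * (\<theta> * log_bump (exp (- 1 / \<mu>)) (inv A y - \<tau>)))
        \<le> ennreal (C * \<mu> powr (1 - 1 / p))"
proof -
  have "1 / p < 1" using p by simp
  then have s1: "s < 1" using s by linarith
  have sp: "s * p \<le> 1" using s p by (simp add: pos_le_divide_eq)
  obtain C0 where C0: "0 < C0"
    "\<And>X A B \<mu>. smooth_periodic X \<Longrightarrow> 0 \<le> A \<Longrightarrow> 0 \<le> B \<Longrightarrow> s * p < \<mu> \<Longrightarrow> \<mu> \<le> p \<Longrightarrow>
      (\<And>h. 0 < h \<Longrightarrow> h \<le> 1 \<Longrightarrow> integral {0..1} (\<lambda>x. \<bar>X (x + h) - X x\<bar> powr p) \<le> A * h powr \<mu>) \<Longrightarrow>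
      integral {0..1} (\<lambda>x. \<bar>X x\<bar> powr p) \<le> B \<Longrightarrow>
      W_norm_S1 P s p X \<le> ennreal (C0 * ((A + B) / (\<mu> - s * p)) powr (1 / p))"
    by (rule W_norm_S1_bound_less_1[OF p s(1) s1 P]) blast
  obtain CI where CI: "0 < CI"
    "\<And>\<epsilon> H \<mu>. 0 < \<epsilon> \<Longrightarrow> 0 < H \<Longrightarrow> 0 \<le> \<mu> \<Longrightarrow> \<mu> \<le> p - 1 \<Longrightarrow>
      integral {0..1} (\<lambda>z. ln (1 + H / (\<epsilon> + \<bar>sin (pi * z)\<bar>)) powr p) \<le> CI * H * (H / \<epsilon>) powr \<mu>"
    by (rule integral_ln_sin_powr_le[OF p]) blast
  note iA = diff_lift_inv[OF A]
  define \<alpha> where "\<alpha> y = T * deriv A (inv A y)" for y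
  have "smooth (\<lambda>y. T * deriv A (inv A y))"
    by (intro smooth_mult smooth_const smooth_compose[OF smooth_deriv[OF diff_lift_smooth[OF A]] diff_lift_smooth[OF iA]])
  then have s\<alpha>: "smooth_periodic \<alpha>"
    unfolding smooth_periodic_def \<alpha>_def by (simp add: diff_lift_shift[OF iA] diff_lift_deriv_shift[OF A])
  obtain a1 where a1: "a1 > 0" "\<And>x. \<bar>\<alpha> x\<bar> \<le> a1" by (rule smooth_periodic_bounded[OF s\<alpha>]) blast
  obtain a2 where a2: "a2 > 0" "\<And>x. \<bar>deriv \<alpha> x\<bar> \<le> a2" by (rule smooth_periodic_bounded[OF smooth_periodic_deriv[OF s\<alpha>]]) blast
  define a where "a = a1 + a2"
  have a: "0 < a" "\<bar>\<alpha> x\<bar> \<le> a" "\<bar>\<alpha> x - \<alpha> y\<bar> \<le> a * \<bar>x - y\<bar>" for x y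
  proof -
    show "0 < a" using a1 a2 by (simp add: a_def)
    show "\<bar>\<alpha> x\<bar> \<le> a" using a1(2)[of x] a2(1) by (simp add: a_def)
    have "\<bar>\<alpha> x - \<alpha> y\<bar> \<le> a2 * \<bar>x - y\<bar>" by (rule smooth_DERIV_lipschitz[OF smooth_periodicD(1)[OF s\<alpha>] a2(2)])
    also have "\<dots> \<le> a * \<bar>x - y\<bar>" using a1(1) by (intro mult_right_mono) (auto simp: a_def)
    finally show "\<bar>\<alpha> x - \<alpha> y\<bar> \<le> a * \<bar>x - y\<bar>" .
  qed
  have sd: "smooth_periodic (deriv A)" "smooth_periodic (deriv (inv A))"
    using A iA by (auto simp: smooth_periodic_def diff_lift_deriv_shift intro: smooth_deriv diff_lift_smooth)
  obtain b where b: "b > 0" "\<And>x. \<bar>deriv A x\<bar> \<le> b" by (rule smooth_periodic_bounded[OF sd(1)]) blast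
  obtain l where l: "l > 0" "\<And>x. \<bar>deriv (inv A) x\<bar> \<le> l" by (rule smooth_periodic_bounded[OF sd(2)]) blast
  define K1 where "K1 = 4 powr p * (2 * a) powr p * (b * CI * 3 * (8 * l * (1 + 4 * l) + 1))"
  have K1: "0 < K1" using a b l CI by (simp add: K1_def add_pos_pos)
  show ?thesis
  proof (rule that[of "C0 * (2 * K1) powr (1 / p)"])
    show "0 < C0 * (2 * K1) powr (1 / p)" using C0 K1 by simp
    fix \<mu> \<theta> \<tau> :: real
    assume m: "0 < \<mu>" "\<mu> \<le> 1" "\<mu> \<le> p - 1" and \<theta>: "0 \<le> \<theta>" "\<theta> \<le> 1"
    \<comment> \<open>Balances both effects of \<open>\<epsilon>\<close>:
      \<open>1 / ln (1 / \<epsilon>)\<close> equals \<open>\<mu>\<close>, and the loss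
      \<open>(1 / \<epsilon>) powr \<mu>\<close> is a constant.\<close>
    define \<epsilon> where "\<epsilon> = exp (- 1 / \<mu>)"
    have e: "0 < \<epsilon>" by (simp add: \<epsilon>_def)
    have ie: "1 / \<epsilon> = exp (1 / \<mu>)" by (simp add: \<epsilon>_def exp_minus inverse_eq_divide)
    have e\<mu>: "(1 / \<epsilon>) powr \<mu> \<le> 3"
    proof -
      have "(1 / \<epsilon>) powr \<mu> = exp 1" unfolding ie using m by (simp add: powr_def)
      then show ?thesis using exp_le by simp
    qed
    define \<kappa> where "\<kappa> = 2 * \<mu>"
    have \<kappa>0: "0 < \<kappa>" using m by (simp add: \<kappa>_def)
    have Lam: "3 / ln (1 + 1 / \<epsilon>\<^sup>2) \<le> \<kappa>"
    proof -
      have "1 / \<epsilon>\<^sup>2 = exp (2 * (1 / \<mu>))" unfolding exp_double ie[symmetric] by (simp add: power_divide)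
      then have "ln (1 / \<epsilon>\<^sup>2) = 2 / \<mu>" by simp
      moreover have "ln (1 / \<epsilon>\<^sup>2) \<le> ln (1 + 1 / \<epsilon>\<^sup>2)" using e by (intro ln_mono) auto
      ultimately have "2 / \<mu> \<le> ln (1 + 1 / \<epsilon>\<^sup>2)" by simp
      then have "3 / ln (1 + 1 / \<epsilon>\<^sup>2) \<le> 3 / (2 / \<mu>)" using m by (intro divide_left_mono mult_pos_pos) (auto intro: less_le_trans[of 0 "2 / \<mu>"])
      then show ?thesis using m by (simp add: \<kappa>_def)
    qed
    \<comment> \<open>The logarithm that dominates the bump: \<open>H = 4 * d\<close> for increments
      between points at distance \<open>d\<close> in the coordinate \<open>inv A\<close>, and
      \<open>H = 1\<close> for the bump itself.\<close>
    define el where "el H y = ln (1 + H / (\<epsilon> + \<bar>sin (pi * (inv A y - \<tau>))\<bar>))" for H y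
    have el0: "0 \<le> el H y" if "0 \<le> H" for H y
      unfolding el_def using that e by (intro ln_ge_zero) (auto intro!: divide_nonneg_nonneg add_nonneg_nonneg)
    have elper: "el H (y + 1) = el H y" for H y
    proof -
      have "pi * (inv A y + 1 - \<tau>) = pi * (inv A y - \<tau>) + pi" by (simp add: algebra_simps)
      then show ?thesis by (simp add: el_def diff_lift_shift[OF iA])
    qed
    have cel0: "continuous_on UNIV (\<lambda>x. ln (1 + H / (\<epsilon> + \<bar>sin (pi * (x - \<tau>))\<bar>)) powr p)" if "0 < H" for H
      by (rule continuous_on_compose2[OF continuous_on_ln_sin_powr[OF e that p], of UNIV "\<lambda>x. x - \<tau>"])
         (auto intro!: continuous_intros)
    have cel: "continuous_on UNIV (\<lambda>y. el H y powr p)" if "0 < H" for H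
      unfolding el_def
      by (rule continuous_on_compose2[OF cel0[OF that], of UNIV "inv A"]) (auto intro!: diff_lift_continuous iA)
    have Iel: "integral {0..1} (\<lambda>y. el H y powr p) \<le> b * CI * H * (H / \<epsilon>) powr \<mu>" if H: "0 < H" for H
    proof -
      let ?q = "\<lambda>x. ln (1 + H / (\<epsilon> + \<bar>sin (pi * (x - \<tau>))\<bar>)) powr p"
      have per0: "ln (1 + H / (\<epsilon> + \<bar>sin (pi * (x + 1))\<bar>)) powr p = ln (1 + H / (\<epsilon> + \<bar>sin (pi * x)\<bar>)) powr p" for x
        by (simp add: distrib_left)
      have perq: "?q (x + 1) = ?q x" for x
        using per0[of "x - \<tau>"] by (simp add: algebra_simps)
      have "integral {0..1} (\<lambda>y. el H y powr p) = integral {0..1} (\<lambda>x. ?q x * deriv A x)"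
        unfolding el_def by (rule integral_inv_diff_lift[OF A cel0[OF H] perq])
      also have "\<dots> \<le> integral {0..1} (\<lambda>x. b * ?q x)"
      proof (rule integral_le)
        show "(\<lambda>x. ?q x * deriv A x) integrable_on {0..1}"
          by (intro integrable_continuous_real continuous_on_mult continuous_on_subset[OF cel0[OF H]] smooth_periodicD[OF sd(1)]) auto
        show "(\<lambda>x. b * ?q x) integrable_on {0..1}"
          by (intro integrable_continuous_real continuous_on_mult_left continuous_on_subset[OF cel0[OF H]]) auto
        show "?q x * deriv A x \<le> b * ?q x" for x
          using mult_right_mono[of "deriv A x" b "?q x"] b(2)[of x] by (simp add: mult.commute)
      qed
      also have "\<dots> = b * integral {0..1} (\<lambda>x. ln (1 + H / (\<epsilon> + \<bar>sin (pi * (x + - \<tau>))\<bar>)) powr p)" by simp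
      also have "integral {0..1} (\<lambda>x. ln (1 + H / (\<epsilon> + \<bar>sin (pi * (x + - \<tau>))\<bar>)) powr p)
          = integral {0..1} (\<lambda>x. ln (1 + H / (\<epsilon> + \<bar>sin (pi * x)\<bar>)) powr p)"
        by (rule integral_shift_periodic[OF continuous_on_ln_sin_powr[OF e H p] per0])
      also have "b * \<dots> \<le> b * (CI * H * (H / \<epsilon>) powr \<mu>)"
        using b m by (intro mult_left_mono CI e H) auto
      finally show ?thesis by (simp add: mult.assoc)
    qed
    define f where "f y = \<theta> * log_bump \<epsilon> (inv A y - \<tau>)" for y
    have f0: "0 \<le> f y" "f y \<le> \<kappa> * el 1 y" for y
    proof -
      show "0 \<le> f y" using \<theta> log_bump_bounds[OF e] by (simp add: f_def)
      have "f y \<le> 1 * log_bump \<epsilon> (inv A y - \<tau>)" unfolding f_def using \<theta> log_bump_bounds[OF e] by (intro mult_right_mono) auto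
      also have "\<dots> \<le> 3 / ln (1 + 1 / \<epsilon>\<^sup>2) * el 1 y" using log_bump_le[OF e, of "inv A y - \<tau>"] by (simp add: el_def)
      also have "\<dots> \<le> \<kappa> * el 1 y" by (intro mult_right_mono Lam el0) simp
      finally show "f y \<le> \<kappa> * el 1 y" .
    qed
    have fd: "\<bar>f (y + h) - f y\<bar> \<le> \<kappa> * (el (4 * (l * h)) (y + h) + el (4 * (l * h)) y)" if h: "0 < h" for y h
    proof -
      have "\<bar>(inv A (y + h) - \<tau>) - (inv A y - \<tau>)\<bar> \<le> l * h"
        using smooth_DERIV_lipschitz[OF diff_lift_smooth[OF iA] l(2), of "y + h" y] h by simp
      note d = log_bump_diff_le[OF e this]
      have "f (y + h) - f y = \<theta> * (log_bump \<epsilon> (inv A (y + h) - \<tau>) - log_bump \<epsilon> (inv A y - \<tau>))"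
        by (simp add: f_def right_diff_distrib)
      then have "\<bar>f (y + h) - f y\<bar> \<le> 1 * \<bar>log_bump \<epsilon> (inv A (y + h) - \<tau>) - log_bump \<epsilon> (inv A y - \<tau>)\<bar>"
        using \<theta> by (simp only: abs_mult) (intro mult_right_mono, auto)
      also have "\<dots> \<le> 3 / ln (1 + 1 / \<epsilon>\<^sup>2) * (el (4 * (l * h)) (y + h) + el (4 * (l * h)) y)"
        using d by (simp add: el_def)
      also have "\<dots> \<le> \<kappa> * (el (4 * (l * h)) (y + h) + el (4 * (l * h)) y)"
        using l h by (intro mult_right_mono Lam add_nonneg_nonneg el0) auto
      finally show ?thesis .
    qed
    define X where "X y = \<alpha> y * f y" for y
    have sX: "smooth_periodic X"
    proof -
      have "smooth (\<lambda>y. log_bump \<epsilon> (inv A y - \<tau>))"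
        by (rule smooth_compose[OF smooth_log_bump[OF e] smooth_diff[OF diff_lift_smooth[OF iA] smooth_const]])
      then have "smooth X" unfolding X_def[abs_def] f_def by (intro smooth_mult smooth_const smooth_periodicD[OF s\<alpha>])
      moreover have "X (y + 1) = X y" for y
      proof -
        have "inv A (y + 1) - \<tau> = (inv A y - \<tau>) + 1" using diff_lift_shift[OF iA] by simp
        then show ?thesis by (simp only: X_def f_def smooth_periodicD(2)[OF s\<alpha>] log_bump_periodic)
      qed
      ultimately show ?thesis by (simp add: smooth_periodic_def)
    qed
    have K1e: "4 powr p * (a * \<kappa>) powr p * (b * CI * 3 * (8 * l * (1 + 4 * l) + 1)) = K1 * \<mu> powr p"
    proof -
      have "(a * \<kappa>) powr p = (2 * a) powr p * \<mu> powr p" using a m by (simp add: \<kappa>_def powr_mult[symmetric] ac_simps)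
      then show ?thesis by (simp add: K1_def)
    qed
    have I1: "integral {0..1} (\<lambda>y. el 1 y powr p) \<le> b * CI * 3"
    proof -
      have "integral {0..1} (\<lambda>y. el 1 y powr p) \<le> b * CI * (1 / \<epsilon>) powr \<mu>" using Iel[of 1] by simp
      also have "\<dots> \<le> b * CI * 3" using b CI e\<mu> by (intro mult_left_mono) auto
      finally show ?thesis .
    qed
    have IB: "integral {0..1} (\<lambda>y. \<bar>X y\<bar> powr p) \<le> K1 * \<mu> powr p"
    proof -
      have "integral {0..1} (\<lambda>y. \<bar>X y\<bar> powr p) \<le> integral {0..1} (\<lambda>y. (a * \<kappa>) powr p * el 1 y powr p)"
      proof (rule integral_le)
        show "(\<lambda>y. \<bar>X y\<bar> powr p) integrable_on {0..1}"
          using p by (intro integrable_continuous_real continuous_on_abs_powr smooth_periodicD[OF sX]) auto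
        show "(\<lambda>y. (a * \<kappa>) powr p * el 1 y powr p) integrable_on {0..1}"
          by (intro integrable_continuous_real continuous_on_mult_left continuous_on_subset[OF cel]) auto
        fix y
        have "\<bar>X y\<bar> \<le> a * (\<kappa> * el 1 y)" unfolding X_def abs_mult using a f0[of y] by (intro mult_mono) auto
        then have "\<bar>X y\<bar> powr p \<le> (a * \<kappa> * el 1 y) powr p" using p by (intro powr_mono2) (auto simp: mult.assoc)
        then show "\<bar>X y\<bar> powr p \<le> (a * \<kappa>) powr p * el 1 y powr p" by (simp add: powr_mult)
      qed
      also have "\<dots> = (a * \<kappa>) powr p * integral {0..1} (\<lambda>y. el 1 y powr p)" by simp
      also have "\<dots> \<le> (a * \<kappa>) powr p * (b * CI * 3)" using I1 by (intro mult_left_mono) auto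
      also have "\<dots> \<le> 4 powr p * (a * \<kappa>) powr p * (b * CI * 3 * (8 * l * (1 + 4 * l) + 1))"
      proof -
        have "1 \<le> (4::real) powr p" using p by (intro ge_one_powr_ge_zero) auto
        moreover have "1 \<le> 8 * l * (1 + 4 * l) + 1" using l by simp
        ultimately have "1 * 1 \<le> 4 powr p * (8 * l * (1 + 4 * l) + 1)" by (intro mult_mono) auto
        then have "(a * \<kappa>) powr p * (b * CI * 3) * 1 \<le> (a * \<kappa>) powr p * (b * CI * 3) * (4 powr p * (8 * l * (1 + 4 * l) + 1))"
          using b CI by (intro mult_left_mono) auto
        then show ?thesis by (simp only: ac_simps mult_1_right mult_1_left)
      qed
      finally show ?thesis unfolding K1e .
    qed
    have IA: "integral {0..1} (\<lambda>y. \<bar>X (y + h) - X y\<bar> powr p) \<le> K1 * \<mu> powr p * h powr (1 + \<mu>)" if h: "0 < h" "h \<le> 1" for h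
    proof -
      let ?H = "4 * (l * h)"
      have H: "0 < ?H" using l h by simp
      let ?R = "\<lambda>y. el ?H y powr p"
      have cR: "continuous_on UNIV (\<lambda>y. ?R (y + h))"
        by (rule continuous_on_compose2[OF cel[OF H]]) (auto intro!: continuous_intros)
      let ?k = "4 powr p * (a * \<kappa>) powr p"
      let ?U = "\<lambda>y. ?k * ?R (y + h) + ?k * ?R y + ?k * h powr p * el 1 y powr p"
      have hasU: "(?U has_integral ?k * integral {0..1} ?R + ?k * integral {0..1} ?R + ?k * h powr p * integral {0..1} (\<lambda>y. el 1 y powr p)) {0..1}"
      proof -
        have "integral {0..1} (\<lambda>y. ?R (y + h)) = integral {0..1} ?R"
          by (rule integral_shift_periodic[OF cel[OF H]]) (simp add: elper)
        then have "((\<lambda>y. ?R (y + h)) has_integral integral {0..1} ?R) {0..1}"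
          using integrable_integral[OF integrable_continuous_real[OF continuous_on_subset[OF cR subset_UNIV]], of 0 1] by simp
        then show ?thesis
          by (intro has_integral_add has_integral_mult_right integrable_integral integrable_continuous_real
              continuous_on_subset[OF cel[OF H] subset_UNIV] continuous_on_subset[OF cel subset_UNIV]) auto
      qed
      have "integral {0..1} (\<lambda>y. \<bar>X (y + h) - X y\<bar> powr p) \<le> ?k * integral {0..1} ?R + ?k * integral {0..1} ?R + ?k * h powr p * integral {0..1} (\<lambda>y. el 1 y powr p)"
      proof (rule has_integral_le[OF integrable_integral hasU])
        show "(\<lambda>y. \<bar>X (y + h) - X y\<bar> powr p) integrable_on {0..1}"
          using p by (intro integrable_continuous_real continuous_on_abs_powr continuous_on_subset[OF continuous_on_shift_diff[OF sX]]) auto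
        fix y
        have "X (y + h) - X y = \<alpha> (y + h) * (f (y + h) - f y) + (\<alpha> (y + h) - \<alpha> y) * f y"
          by (simp add: X_def algebra_simps)
        then have "\<bar>X (y + h) - X y\<bar> \<le> \<bar>\<alpha> (y + h)\<bar> * \<bar>f (y + h) - f y\<bar> + \<bar>\<alpha> (y + h) - \<alpha> y\<bar> * \<bar>f y\<bar>"
          by (metis abs_mult abs_triangle_ineq)
        also have "\<dots> \<le> a * (\<kappa> * (el ?H (y + h) + el ?H y)) + (a * h) * (\<kappa> * el 1 y)"
          using a(2)[of "y + h"] a(3)[of "y + h" y] fd[OF h(1), of y] f0[of y] a(1) h
          by (intro add_mono mult_mono) auto
        also have "\<dots> = a * \<kappa> * el ?H (y + h) + a * \<kappa> * el ?H y + a * \<kappa> * h * el 1 y" by (simp add: algebra_simps)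
        finally have "\<bar>X (y + h) - X y\<bar> powr p \<le> (a * \<kappa> * el ?H (y + h) + a * \<kappa> * el ?H y + a * \<kappa> * h * el 1 y) powr p"
          using p by (intro powr_mono2) auto
        also have "\<dots> \<le> 4 powr p * ((a * \<kappa> * el ?H (y + h)) powr p + (a * \<kappa> * el ?H y) powr p + (a * \<kappa> * h * el 1 y) powr p)"
          using p a \<kappa>0 h H l by (intro powr_add3_le mult_nonneg_nonneg el0) auto
        also have "\<dots> = ?U y" by (simp add: powr_mult algebra_simps)
        finally show "\<bar>X (y + h) - X y\<bar> powr p \<le> ?U y" .
      qed
      also have "\<dots> \<le> ?k * (b * CI * 3 * (8 * l * (1 + 4 * l) + 1) * h powr (1 + \<mu>))"
      proof -
        have h\<mu>: "h powr p \<le> h powr (1 + \<mu>)" using h m by (intro powr_mono') auto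
        \<comment> \<open>Removes \<open>\<mu>\<close> from the exponent, so that the constant is
          uniform for \<open>\<mu> \<le> 1\<close>.\<close>
        have "(4 * l) powr \<mu> \<le> (1 + 4 * l) powr 1"
          using l m powr_mono2[of \<mu> "4 * l" "1 + 4 * l"] powr_mono[of \<mu> 1 "1 + 4 * l"] by simp
        then have l\<mu>: "(4 * l) powr \<mu> \<le> 1 + 4 * l" using l by simp
        have "(?H / \<epsilon>) powr \<mu> = (4 * l) powr \<mu> * h powr \<mu> * (1 / \<epsilon>) powr \<mu>"
          by (simp add: powr_mult[symmetric] mult.assoc)
        also have "\<dots> \<le> (1 + 4 * l) * h powr \<mu> * 3"
          using l\<mu> e\<mu> l by (intro mult_mono) auto
        finally have "b * CI * ?H * (?H / \<epsilon>) powr \<mu> \<le> b * CI * ?H * ((1 + 4 * l) * h powr \<mu> * 3)"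
          using b CI H by (intro mult_left_mono) auto
        also have "\<dots> = b * CI * 3 * (4 * l * (1 + 4 * l)) * h powr (1 + \<mu>)" using h by (simp add: powr_add algebra_simps)
        finally have IR: "integral {0..1} ?R \<le> b * CI * 3 * (4 * l * (1 + 4 * l)) * h powr (1 + \<mu>)"
          using Iel[OF H] by linarith
        have I1': "h powr p * integral {0..1} (\<lambda>y. el 1 y powr p) \<le> h powr (1 + \<mu>) * (b * CI * 3)"
          using b CI by (intro mult_mono' h\<mu> I1 integral_nonneg integrable_continuous_real continuous_on_subset[OF cel]) auto
        have "integral {0..1} ?R + integral {0..1} ?R + h powr p * integral {0..1} (\<lambda>y. el 1 y powr p)
           \<le> b * CI * 3 * (8 * l * (1 + 4 * l) + 1) * h powr (1 + \<mu>)"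
          using IR I1' by (simp add: algebra_simps)
        then have "?k * (integral {0..1} ?R + integral {0..1} ?R + h powr p * integral {0..1} (\<lambda>y. el 1 y powr p))
           \<le> ?k * (b * CI * 3 * (8 * l * (1 + 4 * l) + 1) * h powr (1 + \<mu>))"
          by (intro mult_left_mono) auto
        then show ?thesis by (simp only: distrib_left mult.assoc)
      qed
      also have "\<dots> = K1 * \<mu> powr p * h powr (1 + \<mu>)" unfolding K1e[symmetric] by (simp add: mult.assoc)
      finally show ?thesis .
    qed
    have K\<mu>: "0 \<le> K1 * \<mu> powr p" using K1 by simp
    have "W_norm_S1 P s p X \<le> ennreal (C0 * ((K1 * \<mu> powr p + K1 * \<mu> powr p) / (1 + \<mu> - s * p)) powr (1 / p))"
      by (rule C0(2)[OF sX K\<mu> K\<mu> _ _ IA IB]) (use sp m in auto)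
    also have "\<dots> \<le> ennreal (C0 * (2 * K1 * \<mu> powr (p - 1)) powr (1 / p))"
    proof (intro ennreal_leI mult_left_mono powr_mono2)
      \<comment> \<open>Here \<open>s \<le> 1 / p\<close> enters: it leaves
        \<open>1 + \<mu> - s * p \<ge> \<mu>\<close>.\<close>
      have "(K1 * \<mu> powr p + K1 * \<mu> powr p) / (1 + \<mu> - s * p) \<le> (K1 * \<mu> powr p + K1 * \<mu> powr p) / \<mu>"
        using sp m K1 by (intro divide_left_mono) auto
      also have "\<dots> = 2 * K1 * \<mu> powr (p - 1)" using m by (simp add: powr_diff)
      finally show "(K1 * \<mu> powr p + K1 * \<mu> powr p) / (1 + \<mu> - s * p) \<le> 2 * K1 * \<mu> powr (p - 1)" .
    qed (use C0 K1 sp m p in auto)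
    also have "C0 * (2 * K1 * \<mu> powr (p - 1)) powr (1 / p) = C0 * (2 * K1) powr (1 / p) * \<mu> powr (1 - 1 / p)"
      using p by (simp add: powr_mult powr_powr diff_divide_distrib)
    finally show "W_norm_S1 P s p (\<lambda>y. T * deriv A (inv A y) * (\<theta> * log_bump (exp (- 1 / \<mu>)) (inv A y - \<tau>)))
       \<le> ennreal (C0 * (2 * K1) powr (1 / p) * \<mu> powr (1 - 1 / p))"
      by (simp add: X_def[abs_def] \<alpha>_def f_def \<epsilon>_def)
  qed
qed

section \<open>The amplitude of the bump and the motion that it drives\<close>

lemma ln_divide_pos: "0 < a \<Longrightarrow> 0 < b \<Longrightarrow> ln (a / b) = ln a - ln (b :: real)"
  by (simp add: ln_div)

text \<open>The integral is the displacement produced by one passage of the wave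
  \<open>\<theta> * log_bump \<epsilon>\<close>. It is continuous in the amplitude and 0 at
  \<open>\<theta> = 0\<close>. It diverges as \<open>\<theta>\<close> tends to 1, since
  \<open>1 - log_bump \<epsilon>\<close> vanishes to second order at the crest. So each
  \<open>\<eta>\<close> is attained, however narrow the bump is.\<close>

lemma log_bump_flux:
  assumes e: "0 < \<epsilon>" and \<eta>: "0 < \<eta>"
  obtains \<theta> where "0 \<le> \<theta>" "\<theta> < 1" "integral {0..1} (\<lambda>z. \<theta> * log_bump \<epsilon> z / (1 - \<theta> * log_bump \<epsilon> z)) = \<eta>"
proof -
  let ?\<phi> = "log_bump \<epsilon>"
  note b = log_bump_bounds[OF e]
  \<comment> \<open>Second order constant at the crest: \<open>ln (1 + x) \<le> x\<close>, and 16
    comes from \<open>\<bar>sin (pi * z)\<bar> \<le> 4 * \<bar>z\<bar>\<close>.\<close>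
  define c where "c = 16 / (\<epsilon>\<^sup>2 * ln (1 + 1 / \<epsilon>\<^sup>2))"
  have c0: "0 \<le> c" using log_bump_arg(3)[OF e] by (simp add: c_def)
  have \<phi>c: "1 - ?\<phi> z \<le> c * z\<^sup>2" for z
  proof -
    let ?\<sigma> = "(sin (pi * z))\<^sup>2"
    have pos: "0 < \<epsilon>\<^sup>2 + 1" "0 < \<epsilon>\<^sup>2 + ?\<sigma>" "0 < \<epsilon>\<^sup>2" using e by (simp_all add: add_pos_nonneg)
    have "1 + 1 / \<epsilon>\<^sup>2 = (\<epsilon>\<^sup>2 + 1) / \<epsilon>\<^sup>2" using e by (simp add: field_simps)
    then have L: "ln (1 + 1 / \<epsilon>\<^sup>2) = ln (\<epsilon>\<^sup>2 + 1) - ln (\<epsilon>\<^sup>2)" by (simp only: ln_divide_pos[OF pos(1,3)])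
    have "1 + ?\<sigma> / \<epsilon>\<^sup>2 = (\<epsilon>\<^sup>2 + ?\<sigma>) / \<epsilon>\<^sup>2" using e by (simp add: field_simps)
    then have "ln (1 + ?\<sigma> / \<epsilon>\<^sup>2) = ln (\<epsilon>\<^sup>2 + ?\<sigma>) - ln (\<epsilon>\<^sup>2)" by (simp only: ln_divide_pos[OF pos(2,3)])
    moreover have "ln ((\<epsilon>\<^sup>2 + 1) / (\<epsilon>\<^sup>2 + ?\<sigma>)) = ln (\<epsilon>\<^sup>2 + 1) - ln (\<epsilon>\<^sup>2 + ?\<sigma>)" by (rule ln_divide_pos[OF pos(1,2)])
    ultimately have "1 - ?\<phi> z = ln (1 + ?\<sigma> / \<epsilon>\<^sup>2) / ln (1 + 1 / \<epsilon>\<^sup>2)"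
      using log_bump_arg(3)[OF e] L by (simp add: log_bump_def field_simps)
    also have "ln (1 + ?\<sigma> / \<epsilon>\<^sup>2) \<le> ?\<sigma> / \<epsilon>\<^sup>2" by (intro ln_add_one_self_le_self) simp
    also have "?\<sigma> \<le> (4 * z)\<^sup>2"
    proof -
      have "\<bar>sin (pi * z)\<bar> \<le> \<bar>pi * z\<bar>" by (rule abs_sin_x_le_abs_x)
      also have "\<dots> \<le> \<bar>4 * z\<bar>" using pi_less_4 by (simp add: abs_mult mult_right_mono)
      finally show ?thesis by (simp add: abs_le_square_iff)
    qed
    finally show ?thesis using log_bump_arg(3)[OF e] by (simp add: c_def divide_right_mono power_mult_distrib field_simps)
  qed
  \<comment> \<open>With amplitude \<open>1 - d^2\<close> the denominator is at most
    \<open>d^2 * (1 + c) \<le> 1/4\<close> on \<open>[0, d]\<close>, so the numerator is at least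
    \<open>1/2\<close> and the integral at least \<open>1 / (2 * d * (1 + c))\<close>, which this
    \<open>d\<close> makes equal to \<open>1 + \<eta>\<close>.\<close>
  define d where "d = 1 / (2 * (1 + c) * (1 + \<eta>))"
  have d: "0 < d" "d * (1 + c) \<le> 1 / 2" "d \<le> 1 / 2" "\<eta> \<le> 1 / (2 * d * (1 + c))"
  proof -
    show "0 < d" using c0 \<eta> by (simp add: d_def)
    have "d * k = 1 / (2 * (1 + \<eta>))" if "k = 1 + c" "k \<noteq> 0" for k
      using that(2) unfolding d_def that(1)[symmetric] by simp
    then have dc: "d * (1 + c) = 1 / (2 * (1 + \<eta>))" using c0 by simp
    show dc2: "d * (1 + c) \<le> 1 / 2" unfolding dc using \<eta> by (simp add: divide_le_eq)
    have "d * 1 \<le> d * (1 + c)" using c0 \<open>0 < d\<close> by (intro mult_left_mono) auto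
    then show "d \<le> 1 / 2" using dc2 by linarith
    have "1 / (2 * d * (1 + c)) = 1 + \<eta>" unfolding mult.assoc dc using \<eta> by simp
    then show "\<eta> \<le> 1 / (2 * d * (1 + c))" by simp
  qed
  define F where "F \<theta> z = \<theta> * ?\<phi> z / (1 - \<theta> * ?\<phi> z)" for \<theta> z
  define \<theta>1 where "\<theta>1 = 1 - d\<^sup>2"
  have "d\<^sup>2 < 1" using d by (simp add: power_less_one_iff abs_square_less_1)
  then have \<theta>1: "0 \<le> \<theta>1" "\<theta>1 < 1" using d by (simp_all add: \<theta>1_def)
  have lt: "\<theta> * ?\<phi> z \<le> \<theta>1" if "0 \<le> \<theta>" "\<theta> \<le> \<theta>1" for \<theta> z
    using mult_mono[OF that(2) b(2)[of z]] b(1)[of z] \<theta>1 by simp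
  have c\<phi>: "continuous_on S ?\<phi>" for S using smooth_log_bump[OF e] smooth_continuous_on by blast
  have nz: "\<forall>v\<in>{0..\<theta>1} \<times> cbox 0 1. 1 - fst v * ?\<phi> (snd v) \<noteq> 0"
  proof
    fix v assume "v \<in> {0..\<theta>1} \<times> cbox (0::real) 1"
    then have "0 \<le> fst v" "fst v \<le> \<theta>1" by auto
    from lt[OF this, of "snd v"] show "1 - fst v * ?\<phi> (snd v) \<noteq> 0" using \<theta>1 by linarith
  qed
  have cont2: "continuous_on ({0..\<theta>1} \<times> cbox 0 1) (\<lambda>(\<theta>, z). F \<theta> z)"
  proof -
    have "continuous_on ({0..\<theta>1} \<times> cbox 0 1) (\<lambda>v. ?\<phi> (snd v))"
      by (rule continuous_on_compose2[OF c\<phi>[of UNIV]]) (auto intro!: continuous_intros)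
    then have "continuous_on ({0..\<theta>1} \<times> cbox 0 1) (\<lambda>v. fst v * ?\<phi> (snd v) / (1 - fst v * ?\<phi> (snd v)))"
      by (intro continuous_on_divide nz continuous_on_mult continuous_on_diff continuous_on_fst continuous_on_id continuous_on_const)
    then show ?thesis by (simp add: F_def case_prod_beta)
  qed
  have cont: "continuous_on {0..\<theta>1} (\<lambda>\<theta>. integral {0..1} (F \<theta>))"
    using integral_continuous_on_param[OF cont2] by simp
  have cF: "continuous_on S (F \<theta>1)" for S
  proof -
    have "1 - \<theta>1 * ?\<phi> z \<noteq> 0" for z using lt[of \<theta>1 z] \<theta>1 by linarith
    then show ?thesis unfolding F_def by (intro continuous_on_divide continuous_on_mult continuous_on_diff continuous_on_const c\<phi>) auto
  qed
  have F0: "0 \<le> F \<theta>1 z" for z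
    using lt[of \<theta>1 z] \<theta>1 b(1)[of z] by (auto simp: F_def intro!: divide_nonneg_nonneg mult_nonneg_nonneg)
  have "\<eta> \<le> integral {0..d} (\<lambda>z. 1 / (2 * (d\<^sup>2 * (1 + c))))"
  proof -
    have "d * (1 / (2 * (d\<^sup>2 * k))) = 1 / (2 * d * k)" for k
      using d(1) by (simp add: power2_eq_square)
    moreover have "integral {0..d} (\<lambda>z. k) = d * k" for k :: real using d(1) by simp
    ultimately show ?thesis using d(4) by (simp only:)
  qed
  also have "\<dots> \<le> integral {0..d} (F \<theta>1)"
  proof (rule integral_le)
    fix z assume z: "z \<in> {0..d}"
    have "z\<^sup>2 \<le> d\<^sup>2" using z by (intro power_mono) auto
    then have "c * z\<^sup>2 \<le> c * d\<^sup>2" using c0 by (intro mult_left_mono)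
    then have 1: "1 - ?\<phi> z \<le> c * d\<^sup>2" using \<phi>c[of z] by linarith
    have "\<theta>1 * (1 - ?\<phi> z) \<le> 1 * (1 - ?\<phi> z)" using \<theta>1 b(2)[of z] by (intro mult_right_mono) auto
    then have up: "1 - \<theta>1 * ?\<phi> z \<le> d\<^sup>2 * (1 + c)" using 1 by (simp add: \<theta>1_def algebra_simps)
    have "d\<^sup>2 * (1 + c) = d * (d * (1 + c))" by (simp add: power2_eq_square)
    also have "\<dots> \<le> 1/2 * (1/2)" using d c0 by (intro mult_mono) auto
    finally have "1 / 2 \<le> \<theta>1 * ?\<phi> z" using up by linarith
    moreover have "0 < 1 - \<theta>1 * ?\<phi> z" using lt[of \<theta>1 z] \<theta>1 by linarith
    ultimately have "(1 / 2) / (d\<^sup>2 * (1 + c)) \<le> F \<theta>1 z"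
      unfolding F_def using up by (intro frac_le) auto
    then show "1 / (2 * (d\<^sup>2 * (1 + c))) \<le> F \<theta>1 z" by simp
  qed (auto intro!: integrable_continuous_real cF)
  also have "\<dots> \<le> integral {0..1} (F \<theta>1)"
    using d F0 by (intro integral_subset_le) (auto intro!: integrable_continuous_real cF)
  finally have "\<eta> \<le> integral {0..1} (F \<theta>1)" .
  moreover have "integral {0..1} (F 0) \<le> \<eta>" using \<eta> by (simp add: F_def[abs_def])
  ultimately obtain \<theta> where "0 \<le> \<theta>" "\<theta> \<le> \<theta>1" "integral {0..1} (F \<theta>) = \<eta>"
    using IVT'[of "\<lambda>\<theta>. integral {0..1} (F \<theta>)" 0 \<eta> \<theta>1, OF _ _ \<theta>1(1) cont] by blast
  then show ?thesis using that[of \<theta>] \<theta>1 by (simp add: F_def[abs_def])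
qed

text \<open>A wave \<open>u(y - t T)\<close> carries the path \<open>t T + E(G(x) - t)\<close> with \<open>G' = 1 / (T (1 - u))\<close> and \<open>E = G\<^sup>-\<^sup>1\<close>;
  after time 1 it has moved every point by \<open>T - 1\<close>.\<close>

lemma reach_conjugated_translation:
  assumes p: "1 < p" and s: "0 \<le> s" "s \<le> 1 / p" and P: "admissible_pu P"
    and A: "diff_lift A" and B: "diff_lift B" and \<eta>: "0 < \<eta>" and r: "0 < r"
  shows "reach P s p (\<lambda>x. A (B x)) (\<lambda>x. A (B x + \<eta>)) (ennreal r)"
proof -
  \<comment> \<open>This speed of the wave makes the mean of \<open>1 / (T * (1 - u))\<close> equal
    to 1, so that \<open>G\<close> is a lift.\<close>
  define T where "T = 1 + \<eta>"
  have T: "0 < T" using \<eta> by (simp add: T_def)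
  obtain C where C: "0 < C" "\<And>\<mu> \<theta> \<tau>. 0 < \<mu> \<Longrightarrow> \<mu> \<le> 1 \<Longrightarrow> \<mu> \<le> p - 1 \<Longrightarrow> 0 \<le> \<theta> \<Longrightarrow> \<theta> \<le> 1 \<Longrightarrow>
      W_norm_S1 P s p (\<lambda>y. T * deriv A (inv A y) * (\<theta> * log_bump (exp (- 1 / \<mu>)) (inv A y - \<tau>)))
        \<le> ennreal (C * \<mu> powr (1 - 1 / p))"
    by (rule travelling_bump_norm[OF p s P A T]) blast
  define q where "q = 1 - 1 / p"
  have q: "0 < q" using p by (simp add: q_def)
  define \<mu> where "\<mu> = min (min 1 (p - 1)) ((r / C) powr (1 / q))"
  have m: "0 < \<mu>" "\<mu> \<le> 1" "\<mu> \<le> p - 1" "C * \<mu> powr q \<le> r"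
  proof -
    show "0 < \<mu>" using p r C by (simp add: \<mu>_def)
    show "\<mu> \<le> 1" "\<mu> \<le> p - 1" by (simp_all add: \<mu>_def)
    have "\<mu> powr q \<le> ((r / C) powr (1 / q)) powr q"
      using \<open>0 < \<mu>\<close> q by (intro powr_mono2) (auto simp: \<mu>_def)
    also have "\<dots> = r / C" using q r C by (simp add: powr_powr)
    finally show "C * \<mu> powr q \<le> r" using C(1) by (simp add: field_simps)
  qed
  define \<epsilon> where "\<epsilon> = exp (- 1 / \<mu>)"
  have e: "0 < \<epsilon>" by (simp add: \<epsilon>_def)
  \<comment> \<open>The permitted cost has already fixed \<open>\<epsilon>\<close>; the amplitude is
    then adjusted to produce exactly the displacement \<open>\<eta>\<close>.\<close>
  obtain \<theta> where \<theta>: "0 \<le> \<theta>" "\<theta> < 1" "integral {0..1} (\<lambda>z. \<theta> * log_bump \<epsilon> z / (1 - \<theta> * log_bump \<epsilon> z)) = \<eta>"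
    by (rule log_bump_flux[OF e \<eta>]) blast
  define u where "u z = \<theta> * log_bump \<epsilon> z" for z
  have u1: "u z < 1" for z
  proof -
    have "u z \<le> \<theta> * 1" unfolding u_def using log_bump_bounds[OF e] \<theta> by (intro mult_left_mono) auto
    then show ?thesis using \<theta> by simp
  qed
  have su: "smooth u" unfolding u_def[abs_def] by (intro smooth_mult smooth_const smooth_log_bump e)
  have uper: "u (z + 1) = u z" for z by (simp add: u_def log_bump_periodic)
  let ?g = "\<lambda>z. 1 / (T * (1 - u z))"
  have sg: "smooth ?g" using u1 T by (intro smooth_divide smooth_mult smooth_diff smooth_const su) auto
  obtain G where G: "\<And>x. (G has_real_derivative ?g x) (at x)" "smooth G"
    by (rule smooth_antiderivative[OF sg]) blast
  have "G (x + 1) = G x + 1" for x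
  proof -
    have "G (x + 1) - G x = integral {x..x + 1} ?g"
      using integral_DERIV[OF G(1), of x "x + 1"] by (simp add: integral_unique)
    also have "\<dots> = integral {0..1} ?g"
      by (rule integral_periodic_shift[OF smooth_continuous_on[OF sg]]) (simp add: uper)
    also have "?g = (\<lambda>z. (1 / T) * (1 + u z / (1 - u z)))"
    proof
      fix z
      have "1 + u z / (1 - u z) = 1 / (1 - u z)" using u1[of z] by (simp add: field_simps)
      then show "?g z = (1 / T) * (1 + u z / (1 - u z))" by simp
    qed
    also have "integral {0..1} \<dots> = (1 / T) * (1 + \<eta>)"
    proof -
      have "smooth (\<lambda>z. u z / (1 - u z))" using u1 by (intro smooth_divide smooth_diff smooth_const su) auto
      then have "((\<lambda>z. u z / (1 - u z)) has_integral \<eta>) {0..1}"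
        using \<theta>(3) integrable_integral[OF integrable_continuous_real[OF smooth_continuous_on], of "\<lambda>z. u z / (1 - u z)" 0 1]
        by (simp add: u_def)
      moreover have "((\<lambda>z::real. 1::real) has_integral 1) {0..1}"
        using has_integral_const_real[of "1::real" 0 1] by simp
      ultimately show ?thesis by (intro integral_unique has_integral_mult_right has_integral_add)
    qed
    finally show ?thesis using T by (simp add: T_def)
  qed
  then have G': "diff_lift G" using u1 T by (intro diff_liftI[OF G(2) G(1)]) auto
  note iG = diff_lift_inv[OF G']
  have dG: "deriv G x = ?g x" for x using DERIV_imp_deriv[OF G(1)] .
  define E where "E = inv G"
  define \<Phi> where "\<Phi> t x = A (t * T + E (G (B x) - t))" for t x
  have \<Phi>lift: "diff_lift (\<Phi> t)" for t
  proof -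
    have "diff_lift (\<lambda>x. G (B x) + (- t))" by (rule diff_lift_add_const[OF diff_lift_compose[OF G' B]])
    from diff_lift_add_const[OF diff_lift_compose[OF iG this], of "t * T"]
    have "diff_lift (\<lambda>x. E (G (B x) + (- t)) + t * T)" unfolding E_def .
    from diff_lift_compose[OF A this] show ?thesis by (simp add: \<Phi>_def[abs_def] add.commute)
  qed
  have sG: "smooth (\<lambda>z::real\<times>real. G (B (snd z)))"
    by (rule smooth_compose[OF G(2) smooth_compose[OF diff_lift_smooth[OF B] smooth_snd]])
  have sE: "smooth (\<lambda>z::real\<times>real. E (G (B (snd z)) - fst z))"
    unfolding E_def by (rule smooth_compose[OF diff_lift_smooth[OF iG] smooth_diff[OF sG smooth_fst]])
  have "smooth (\<lambda>z::real\<times>real. \<Phi> (fst z) (snd z))"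
    unfolding \<Phi>_def
    by (rule smooth_compose[OF diff_lift_smooth[OF A] smooth_add[OF smooth_mult[OF smooth_fst smooth_const] sE]])
  then have dp: "diff_path \<Phi>" using \<Phi>lift by (simp add: diff_path_def)
  show ?thesis
  proof (rule reachI[OF dp, where m = "\<lambda>_. ennreal r"])
    show "\<Phi> 0 = (\<lambda>x. A (B x))" using G' by (simp add: \<Phi>_def[abs_def] E_def)
    \<comment> \<open>After unit time \<open>G\<close> has been shifted by 1, which is one full turn
      backwards; it reduces the distance \<open>T\<close> travelled by the frame to the net
      displacement \<open>T - 1 = \<eta>\<close>.\<close>
    have "E (G (B x) - 1) = B x - 1" for x
    proof -
      have "E (G (B x) - 1 + 1) = E (G (B x) - 1) + 1" unfolding E_def by (rule diff_lift_shift[OF iG])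
      then show ?thesis using G' by (simp add: E_def)
    qed
    then show "\<Phi> 1 = (\<lambda>x. A (B x + \<eta>))" by (simp add: \<Phi>_def[abs_def] T_def add.commute)
    fix t :: real
    have "path_velocity \<Phi> t y = T * deriv A (inv A y) * (\<theta> * log_bump \<epsilon> (inv A y - t * T))" for y
    proof -
      let ?x = "inv (\<Phi> t) y"
      let ?\<zeta> = "t * T + E (G (B ?x) - t)"
      have "A ?\<zeta> = y" using diff_lift_inv_eq[OF \<Phi>lift[of t], of y] by (simp add: \<Phi>_def)
      then have \<zeta>: "?\<zeta> = inv A y" using A by (metis inv_diff_lift)
      then have E\<zeta>: "E (G (B ?x) - t) = inv A y - t * T" by simp
      have "((\<lambda>\<tau>. E (G (B ?x) - \<tau>)) has_real_derivative (1 / deriv G (E (G (B ?x) - t))) * (- 1)) (at t)"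
        unfolding E_def by (rule DERIV_chain2[OF inv_diff_lift_DERIV[OF G']]) (auto intro!: derivative_eq_intros)
      moreover have "1 / deriv G (E (G (B ?x) - t)) = T * (1 - u (inv A y - t * T))"
        unfolding dG E\<zeta> by simp
      ultimately have "((\<lambda>\<tau>. E (G (B ?x) - \<tau>)) has_real_derivative - (T * (1 - u (inv A y - t * T)))) (at t)" by simp
      then have "((\<lambda>\<tau>. \<tau> * T + E (G (B ?x) - \<tau>)) has_real_derivative T - T * (1 - u (inv A y - t * T))) (at t)"
        by (auto intro!: derivative_eq_intros)
      from DERIV_chain2[OF diff_lift_DERIV[OF A] this]
      have "((\<lambda>\<tau>. \<Phi> \<tau> ?x) has_real_derivative deriv A (inv A y) * (T - T * (1 - u (inv A y - t * T)))) (at t)"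
        unfolding \<Phi>_def \<zeta> .
      then show ?thesis
        unfolding path_velocity_def by (simp add: DERIV_imp_deriv u_def algebra_simps)
    qed
    then have "path_velocity \<Phi> t = (\<lambda>y. T * deriv A (inv A y) * (\<theta> * log_bump (exp (- 1 / \<mu>)) (inv A y - t * T)))"
      by (auto simp: \<epsilon>_def)
    then have "W_norm_S1 P s p (path_velocity \<Phi> t) \<le> ennreal (C * \<mu> powr (1 - 1 / p))"
      using C(2)[OF m(1-3), of \<theta> "t * T"] \<theta> by simp
    also have "\<dots> \<le> ennreal r" using m(4) by (intro ennreal_leI) (simp add: q_def)
    finally show "W_norm_S1 P s p (path_velocity \<Phi> t) \<le> ennreal r" .
  qed (simp_all add: nn_integral_cmult_indicator)
qed

text \<open>For \<open>s < 1\<close> a straight line costs no more than the distance in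
  \<open>C^1\<close>: the quotient \<open>e / m\<close> bounds the velocity, its slope and its
  variation at once. It closes the gaps left by the transport steps.\<close>

lemma reach_affine_C1:
  assumes p: "1 < p" and s: "0 \<le> s" "s < 1" and P: "admissible_pu P"
  obtains C where "0 < C"
    "\<And>g h m e. diff_lift g \<Longrightarrow> diff_lift h \<Longrightarrow> 0 < m \<Longrightarrow> m \<le> 1 \<Longrightarrow> 0 \<le> e \<Longrightarrow> (\<And>x. m \<le> deriv g x) \<Longrightarrow> (\<And>x. m \<le> deriv h x) \<Longrightarrow>
      (\<And>x. \<bar>h x - g x\<bar> \<le> e) \<Longrightarrow> (\<And>x. \<bar>deriv h x - deriv g x\<bar> \<le> e) \<Longrightarrow> reach P s p g h (ennreal (C * (e / m)))"
proof -
  obtain C where C: "0 < C"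
    "\<And>X K N. smooth_periodic X \<Longrightarrow> 0 \<le> K \<Longrightarrow> 0 \<le> N \<Longrightarrow> (\<And>x. \<bar>X x\<bar> \<le> K) \<Longrightarrow> (\<And>x. \<bar>deriv X x\<bar> \<le> K) \<Longrightarrow> (\<And>x. \<bar>X x\<bar> \<le> N) \<Longrightarrow>
      integral {0..1} (\<lambda>x. \<bar>deriv X x\<bar>) \<le> N \<Longrightarrow>
      W_norm_S1 P s p X \<le> ennreal (C * (K powr (p - 1) * N) powr (1 / p))"
    by (rule W_norm_S1_bound_lipschitz[OF p s P]) blast
  show ?thesis
  proof (rule that[OF C(1)])
    fix g h m e
    assume gh: "diff_lift g" "diff_lift h" and m: "0 < m" "m \<le> 1" and e: "(0::real) \<le> e"
      and mg: "\<And>x. m \<le> deriv g x" and mh: "\<And>x. m \<le> deriv h x"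
      and d0: "\<And>x. \<bar>h x - g x\<bar> \<le> e" and d1: "\<And>x. \<bar>deriv h x - deriv g x\<bar> \<le> e"
    have em: "e \<le> e / m" "0 \<le> e / m" using m e by (auto simp: pos_le_divide_eq mult_left_le)
    show "reach P s p g h (ennreal (C * (e / m)))"
    proof (rule reach_affine[OF gh, where m = "\<lambda>_. ennreal (C * (e / m))"])
      fix t :: real assume t: "0 < t" "t < 1"
      let ?\<psi> = "\<lambda>x. (1 - t) * g x + t * h x"
      let ?X = "\<lambda>y. h (inv ?\<psi> y) - g (inv ?\<psi> y)"
      note F = affine_velocity_facts[OF gh less_imp_le[OF t(1)] less_imp_le[OF t(2)]]
      have "W_norm_S1 P s p ?X \<le> ennreal (C * ((e / m) powr (p - 1) * (e / m)) powr (1 / p))"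
      proof (rule C(2)[OF F(1) em(2) em(2)])
        have X: "\<bar>?X x\<bar> \<le> e / m" for x using d0[of "inv ?\<psi> x"] em by linarith
        show "\<bar>?X x\<bar> \<le> e / m" "\<bar>?X x\<bar> \<le> e / m" for x by (rule X)+
        show "\<bar>deriv ?X x\<bar> \<le> e / m" for x
        proof -
          let ?z = "inv ?\<psi> x"
          have "(1 - t) * m + t * m \<le> (1 - t) * deriv g ?z + t * deriv h ?z"
            using t mg mh by (intro add_mono mult_left_mono) auto
          then have "m \<le> (1 - t) * deriv g ?z + t * deriv h ?z" by (simp add: algebra_simps)
          then have "\<bar>(deriv h ?z - deriv g ?z) / ((1 - t) * deriv g ?z + t * deriv h ?z)\<bar> \<le> e / m"
            unfolding abs_divide using m d1[of ?z] e by (intro frac_le) auto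
          then show ?thesis unfolding F(2) .
        qed
        have "integral {0..1} (\<lambda>x. \<bar>deriv h x - deriv g x\<bar>) \<le> integral {0..1} (\<lambda>x::real. e)"
          by (intro integral_le integrable_continuous_real continuous_on_const continuous_on_rabs continuous_on_diff smooth_continuous_on smooth_deriv diff_lift_smooth gh)
             (use d1 in auto)
        then show "integral {0..1} (\<lambda>x. \<bar>deriv ?X x\<bar>) \<le> e / m" unfolding F(3) using em by simp
      qed
      also have "(e / m) powr (p - 1) * (e / m) = (e / m) powr p"
        using e m by (cases "e = 0") (auto simp: powr_diff)
      finally show "W_norm_S1 P s p ?X \<le> ennreal (C * (e / m))" using p e m by (simp add: powr_powr)
    qed (simp_all add: nn_integral_cmult_indicator)
  qed
qed

section \<open>Vanishing distance for s \<le> 1/p\<close>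

text \<open>Let \<open>\<gamma>\<close> be the flow of \<open>w / deriv f\<close> for time
  \<open>\<delta>\<close>. In a coordinate with derivative proportional to
  \<open>deriv f / w\<close> this flow is a translation, so \<open>k = f \<circ> \<gamma>\<close> is
  reached from \<open>f\<close> by a conjugated translation. The rate of change of
  \<open>f \<circ> \<gamma>\<close> in \<open>\<delta>\<close> is \<open>w\<close> at the moved
  point, hence \<open>k\<close> agrees with \<open>f + \<delta> * w\<close> up to second order,
  derivatives included.\<close>

lemma transport_step:
  assumes f: "diff_lift f" and w: "smooth_periodic w" "\<And>x. 0 < w x"
    and m: "0 < m" "m \<le> 1" "1 \<le> M" "\<And>x. m \<le> deriv f x" "\<And>x. deriv f x \<le> M" "\<And>x. \<bar>deriv (deriv f) x\<bar> \<le> M"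
      "\<And>x. m \<le> w x" "\<And>x. w x \<le> M" "\<And>x. \<bar>deriv w x\<bar> \<le> M" "\<And>x. \<bar>deriv (deriv w) x\<bar> \<le> M"
    and \<delta>: "0 < \<delta>" "\<delta> \<le> 1"
  obtains A B \<eta> k where "diff_lift A" "diff_lift B" "0 < \<eta>" "diff_lift k"
    "(\<lambda>x. A (B x)) = f" "(\<lambda>x. A (B x + \<eta>)) = k"
    "\<And>x. m\<^sup>2 / M \<le> deriv k x" "\<And>x. \<bar>(f x + \<delta> * w x) - k x\<bar> \<le> 4 * M ^ 6 / m ^ 4 * \<delta>\<^sup>2"
    "\<And>x. \<bar>(deriv f x + \<delta> * deriv w x) - deriv k x\<bar> \<le> 4 * M ^ 6 / m ^ 4 * \<delta>\<^sup>2"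
proof -
  note sf = diff_lift_smooth[OF f] and sw = smooth_periodicD(1)[OF w(1)]
  let ?b = "\<lambda>x. deriv f x / w x"
  have sb: "smooth ?b" by (intro smooth_divide smooth_deriv sf sw w)
  have bpos: "0 < ?b x" for x using diff_lift_deriv_pos[OF f] w by simp
  have bper: "?b (x + 1) = ?b x" for x
    by (simp only: diff_lift_deriv_shift[OF f] smooth_periodicD(2)[OF w(1)])
  obtain G where G: "\<And>x. (G has_real_derivative ?b x) (at x)" "smooth G"
    by (rule smooth_antiderivative[OF sb]) blast
  define c where "c = integral {0..1} ?b"
  have Gper: "G (x + 1) = G x + c" for x
    using integral_DERIV[OF G(1), of x "x + 1"] integral_periodic_shift[of ?b x, OF smooth_continuous_on[OF sb] bper]
    by (simp add: c_def integral_unique)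
  have Gmono: "G x < G y" if "x < y" for x y
    by (rule DERIV_pos_imp_increasing[OF that]) (use G(1) bpos in blast)
  have c: "0 < c" using Gper[of 0] Gmono[of 0 1] by simp
  \<comment> \<open>Dividing by the gain \<open>c\<close> per period makes \<open>G\<close> a lift
    and turns a shift of \<open>G\<close> by \<open>\<delta>\<close> into a shift of
    \<open>B\<close> by \<open>\<delta> / c\<close>.\<close>
  define B where "B x = G x / c" for x
  have DB: "(B has_real_derivative ?b x / c) (at x)" for x
    unfolding B_def by (rule DERIV_cdivide[OF G(1)])
  have B: "diff_lift B"
  proof (rule diff_liftI[OF _ DB])
    show "smooth B" unfolding B_def[abs_def] divide_inverse by (intro smooth_mult smooth_const G)
    show "0 < ?b x / c" for x by (rule divide_pos_pos[OF bpos c])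
    show "B (x + 1) = B x + 1" for x using c by (simp add: B_def Gper add_divide_distrib)
  qed
  note iB = diff_lift_inv[OF B]
  define A where "A y = f (inv B y)" for y
  have A: "diff_lift A" unfolding A_def by (rule diff_lift_compose[OF f iB])
  define \<eta> where "\<eta> = \<delta> / c"
  have \<eta>: "0 < \<eta>" using \<delta> c by (simp add: \<eta>_def)
  define \<gamma> where "\<gamma> x = inv B (B x + \<eta>)" for x
  define k where "k x = f (\<gamma> x)" for x
  have \<gamma>: "diff_lift \<gamma>" unfolding \<gamma>_def by (rule diff_lift_compose[OF iB diff_lift_add_const[OF B]])
  have k: "diff_lift k" unfolding k_def by (rule diff_lift_compose[OF f \<gamma>])
  have G\<gamma>: "G (\<gamma> x) = G x + \<delta>" for x
  proof -
    have "B (\<gamma> x) = B x + \<eta>" unfolding \<gamma>_def by (rule diff_lift_inv_eq[OF B])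
    then show ?thesis using c by (simp add: B_def \<eta>_def field_simps)
  qed
  have \<gamma>x: "x < \<gamma> x" for x
  proof (rule ccontr)
    assume "\<not> x < \<gamma> x"
    then have "\<gamma> x = x \<or> \<gamma> x < x" by linarith
    then have "G (\<gamma> x) \<le> G x" using Gmono[of "\<gamma> x" x] by auto
    then show False using G\<gamma>[of x] \<delta> by linarith
  qed
  have kD: "deriv k x = deriv f x * (w (\<gamma> x) / w x)" for x
  proof -
    have "(B has_real_derivative ?b x / c) (at x)" by (rule DB)
    then have "((\<lambda>x. B x + \<eta>) has_real_derivative ?b x / c) (at x)" by (auto intro!: derivative_eq_intros)
    from DERIV_chain2[OF inv_diff_lift_DERIV[OF B] this]
    have "(\<gamma> has_real_derivative 1 / deriv B (\<gamma> x) * (?b x / c)) (at x)" by (simp add: \<gamma>_def[abs_def])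
    moreover have "deriv B (\<gamma> x) = ?b (\<gamma> x) / c" using DERIV_imp_deriv[OF DB] .
    ultimately have "(\<gamma> has_real_derivative (w (\<gamma> x) / deriv f (\<gamma> x)) * (deriv f x / w x)) (at x)"
      using c by simp
    from DERIV_chain2[OF diff_lift_DERIV[OF f] this]
    have "(k has_real_derivative deriv f (\<gamma> x) * ((w (\<gamma> x) / deriv f (\<gamma> x)) * (deriv f x / w x))) (at x)"
      by (simp add: k_def[abs_def])
    moreover have "deriv f (\<gamma> x) \<noteq> 0" using diff_lift_deriv_pos[OF f, of "\<gamma> x"] by simp
    ultimately show ?thesis by (simp add: DERIV_imp_deriv)
  qed
  have M0: "0 < M" using m by linarith
  have mM: "m \<le> M" using m by linarith
  define Q where "Q = M / m"
  have Q: "1 \<le> Q" "0 < Q" using m mM by (auto simp: Q_def)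
  have fw0: "0 \<le> deriv f y" "0 \<le> w y" for y
    using diff_lift_deriv_pos[OF f, of y] w(2)[of y] by simp_all
  have bQ: "m / M \<le> ?b y" "?b y \<le> Q" for y
  proof -
    show "m / M \<le> ?b y" using m(4)[of y] m(8)[of y] w(2)[of y] fw0[of y] by (intro frac_le)
    show "?b y \<le> Q" unfolding Q_def using m(1) m(5)[of y] m(7)[of y] M0 by (intro frac_le) simp_all
  qed
  have MVT: "\<exists>\<xi>. x < \<xi> \<and> \<xi> < \<gamma> x \<and> F (\<gamma> x) - F x = (\<gamma> x - x) * F' \<xi>"
    if "\<And>y. (F has_real_derivative F' y) (at y)" for F F' x
    using MVT2[OF \<gamma>x[of x], of F F'] that by blast
  have \<gamma>d: "0 < \<gamma> x - x" "\<gamma> x - x \<le> \<delta> * Q" for x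
  proof -
    show "0 < \<gamma> x - x" using \<gamma>x[of x] by simp
    obtain \<xi> where "G (\<gamma> x) - G x = (\<gamma> x - x) * ?b \<xi>" using MVT[OF G(1)] by blast
    then have e: "(\<gamma> x - x) * ?b \<xi> = \<delta>" using G\<gamma>[of x] by simp
    have "(\<gamma> x - x) * (m / M) \<le> (\<gamma> x - x) * ?b \<xi>" using \<gamma>x[of x] by (intro mult_left_mono bQ) auto
    then have "(\<gamma> x - x) * (m / M) * Q \<le> \<delta> * Q" unfolding e using Q by (intro mult_right_mono) auto
    moreover have "(\<gamma> x - x) * (m / M) * Q = \<gamma> x - x" using m(1) M0 by (simp add: Q_def)
    ultimately show "\<gamma> x - x \<le> \<delta> * Q" by linarith
  qed
  have wd: "\<bar>w y - w x\<bar> \<le> M * (\<delta> * Q)" if "x \<le> y" "y \<le> \<gamma> x" for x y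
  proof -
    have "\<bar>w y - w x\<bar> \<le> M * \<bar>y - x\<bar>" by (rule smooth_DERIV_lipschitz[OF sw m(9)])
    also have "\<dots> \<le> M * (\<delta> * Q)" using that \<gamma>d[of x] M0 by (intro mult_left_mono) auto
    finally show ?thesis .
  qed
  let ?E = "4 * M ^ 6 / m ^ 4"
  \<comment> \<open>All error terms are monomials in \<open>M\<close> and \<open>Q = M / m\<close>;
    they are absorbed by \<open>M^2 * Q^4 = M^6 / m^4\<close>, which is where the constant in the
    statement comes from.\<close>
  have small: "M ^ i * Q ^ j \<le> M ^ 6 / m ^ 4" if "i \<le> 2" "j \<le> 4" for i j
  proof -
    have "M ^ i * Q ^ j \<le> M ^ 2 * Q ^ 4" using that m(3) Q by (intro mult_mono power_increasing) auto
    also have "\<dots> = M ^ 6 / m ^ 4" by (simp add: Q_def power_divide flip: power_add)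
    finally show ?thesis .
  qed
  have e0: "\<bar>(f x + \<delta> * w x) - k x\<bar> \<le> ?E * \<delta>\<^sup>2" for x
  proof -
    \<comment> \<open>Freezing \<open>w\<close> at \<open>x\<close> makes the main term cancel:
      \<open>w x * G\<close> grows by exactly \<open>\<delta> * w x\<close>, and the remaining
      derivative contains the small factor \<open>w \<xi> - w x\<close>.\<close>
    have D: "((\<lambda>y. f y - w x * G y) has_real_derivative deriv f y - w x * ?b y) (at y)" for y
      by (intro DERIV_diff DERIV_cmult diff_lift_DERIV f G)
    obtain \<xi> where \<xi>: "x < \<xi>" "\<xi> < \<gamma> x"
      "(f (\<gamma> x) - w x * G (\<gamma> x)) - (f x - w x * G x) = (\<gamma> x - x) * (deriv f \<xi> - w x * ?b \<xi>)"
      using MVT[OF D] by blast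
    have fw: "deriv f \<xi> - w x * ?b \<xi> = ?b \<xi> * (w \<xi> - w x)" using w(2)[of \<xi>] by (simp add: field_simps)
    have "k x - (f x + \<delta> * w x) = (f (\<gamma> x) - w x * G (\<gamma> x)) - (f x - w x * G x)"
      unfolding G\<gamma> k_def by (simp add: algebra_simps)
    also have "\<dots> = (\<gamma> x - x) * (?b \<xi> * (w \<xi> - w x))" unfolding \<xi>(3) fw ..
    finally have "\<bar>(f x + \<delta> * w x) - k x\<bar> = \<bar>(\<gamma> x - x) * (?b \<xi> * (w \<xi> - w x))\<bar>"
      by (simp only: abs_minus_commute[of "f x + \<delta> * w x" "k x"])
    also have "\<dots> = (\<gamma> x - x) * (?b \<xi> * \<bar>w \<xi> - w x\<bar>)"
      by (simp only: abs_mult[of _ "_ * _"] abs_mult[of "?b \<xi>"] abs_of_pos[OF \<gamma>d(1)] abs_of_pos[OF bpos])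
    also have "\<dots> \<le> (\<delta> * Q) * (Q * (M * (\<delta> * Q)))"
    proof (intro mult_mono wd \<gamma>d)
      show "?b \<xi> \<le> Q" by (rule bQ)
      show "0 \<le> ?b \<xi> * \<bar>w \<xi> - w x\<bar>" using bpos[of \<xi>] by (intro mult_nonneg_nonneg) auto
      show "0 \<le> Q" "0 \<le> \<delta> * Q" using Q \<delta> by simp_all
      show "x \<le> \<xi>" "\<xi> \<le> \<gamma> x" using \<xi> by simp_all
    qed simp
    also have "\<dots> = M ^ 1 * Q ^ 3 * \<delta>\<^sup>2" by (simp add: power2_eq_square power3_eq_cube)
    also have "\<dots> \<le> M ^ 6 / m ^ 4 * \<delta>\<^sup>2" by (intro mult_right_mono small) auto
    also have "\<dots> \<le> ?E * \<delta>\<^sup>2" using M0 m(1) by (intro mult_right_mono) (auto simp: divide_right_mono)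
    finally show ?thesis .
  qed
  have e1: "\<bar>(deriv f x + \<delta> * deriv w x) - deriv k x\<bar> \<le> ?E * \<delta>\<^sup>2" for x
  proof -
    obtain \<xi> where \<xi>: "x < \<xi>" "\<xi> < \<gamma> x" "w (\<gamma> x) - w x = (\<gamma> x - x) * deriv w \<xi>"
      using MVT[OF smooth_DERIV[OF sw]] by blast
    have \<xi>d: "\<bar>deriv w \<xi> - deriv w x\<bar> \<le> M * (\<delta> * Q)"
    proof -
      have "\<bar>deriv w \<xi> - deriv w x\<bar> \<le> M * \<bar>\<xi> - x\<bar>" by (rule smooth_DERIV_lipschitz[OF smooth_deriv[OF sw] m(10)])
      also have "\<dots> \<le> M * (\<delta> * Q)" using \<xi> \<gamma>d[of x] M0 by (intro mult_left_mono) auto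
      finally show ?thesis .
    qed
    \<comment> \<open>Rewrites \<open>\<delta>\<close> as \<open>\<gamma> x - x\<close> times a
      value of the same quotient, so that the first order terms differ only by the choice of the
      intermediate points.\<close>
    obtain \<zeta> where \<zeta>: "x < \<zeta>" "\<zeta> < \<gamma> x" "G (\<gamma> x) - G x = (\<gamma> x - x) * ?b \<zeta>" using MVT[OF G(1)] by blast
    have \<delta>\<zeta>: "\<delta> = (\<gamma> x - x) * ?b \<zeta>" using \<zeta>(3) G\<gamma>[of x] by simp
    have bd: "\<bar>?b x - ?b \<zeta>\<bar> \<le> 2 * Q ^ 2 * (\<delta> * Q)"
    proof -
      have "\<bar>deriv ?b y\<bar> \<le> 2 * Q ^ 2" for y
      proof -
        have "(?b has_real_derivative (deriv (deriv f) y * w y - deriv f y * deriv w y) / (w y * w y)) (at y)"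
          using w(2)[of y] by (intro DERIV_divide smooth_DERIV smooth_deriv sf sw) auto
        then have "deriv ?b y = (deriv (deriv f) y * w y - deriv f y * deriv w y) / (w y * w y)" by (rule DERIV_imp_deriv)
        also have "\<bar>\<dots>\<bar> \<le> (M * M + M * M) / (m * m)"
          unfolding abs_divide
        proof (intro frac_le)
          have "\<bar>deriv (deriv f) y * w y - deriv f y * deriv w y\<bar> \<le> \<bar>deriv (deriv f) y\<bar> * \<bar>w y\<bar> + \<bar>deriv f y\<bar> * \<bar>deriv w y\<bar>"
            by (metis abs_mult abs_triangle_ineq4)
          also have "\<dots> \<le> M * M + M * M"
            using m(5,6,8,9)[of y] fw0[of y] M0 by (intro add_mono mult_mono) simp_all
          finally show "\<bar>deriv (deriv f) y * w y - deriv f y * deriv w y\<bar> \<le> M * M + M * M" .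
          have "m * m \<le> w y * w y" using m(1) m(7)[of y] fw0[of y] by (intro mult_mono) simp_all
          then show "m * m \<le> \<bar>w y * w y\<bar>" by simp
        qed (use m M0 in auto)
        also have "\<dots> = 2 * Q ^ 2" by (simp add: Q_def power2_eq_square)
        finally show ?thesis .
      qed
      then have "\<bar>?b x - ?b \<zeta>\<bar> \<le> 2 * Q ^ 2 * \<bar>x - \<zeta>\<bar>" by (rule smooth_DERIV_lipschitz[OF sb])
      also have "\<dots> \<le> 2 * Q ^ 2 * (\<delta> * Q)" using \<zeta> \<gamma>d[of x] Q by (intro mult_left_mono) auto
      finally show ?thesis .
    qed
    have wx: "w x \<noteq> 0" using w(2)[of x] by simp
    have "deriv k x = deriv f x + ?b x * (w (\<gamma> x) - w x)"
      unfolding kD using wx by (simp add: field_simps)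
    then have dk: "deriv k x = deriv f x + ?b x * ((\<gamma> x - x) * deriv w \<xi>)" unfolding \<xi>(3) .
    have alg: "(u + (d * z) * v) - (u + y * (d * v')) = d * (z * v - y * v')" for u d z v y v' :: real
      by (simp add: algebra_simps)
    have "(deriv f x + \<delta> * deriv w x) - deriv k x = (\<gamma> x - x) * (?b \<zeta> * deriv w x - ?b x * deriv w \<xi>)"
      unfolding dk by (subst \<delta>\<zeta>) (rule alg)
    also have "?b \<zeta> * deriv w x - ?b x * deriv w \<xi> = - ((?b x - ?b \<zeta>) * deriv w x + ?b x * (deriv w \<xi> - deriv w x))"
    proof -
      have "z * v - y * v' = - ((y - z) * v + y * (v' - v))" for z v y v' :: real by (simp add: algebra_simps)
      then show ?thesis .
    qed
    finally have "\<bar>(deriv f x + \<delta> * deriv w x) - deriv k x\<bar> = (\<gamma> x - x) * \<bar>(?b x - ?b \<zeta>) * deriv w x + ?b x * (deriv w \<xi> - deriv w x)\<bar>"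
      using \<gamma>d(1)[of x] by (simp only: abs_mult abs_minus_cancel abs_of_pos)
    also have "\<dots> \<le> (\<delta> * Q) * ((2 * Q ^ 2 * (\<delta> * Q)) * M + Q * (M * (\<delta> * Q)))"
    proof (rule mult_mono[OF \<gamma>d(2)])
      have bx: "\<bar>?b x\<bar> \<le> Q" using bQ(2)[of x] bpos[of x] by linarith
      have "\<bar>(?b x - ?b \<zeta>) * deriv w x + ?b x * (deriv w \<xi> - deriv w x)\<bar>
         \<le> \<bar>?b x - ?b \<zeta>\<bar> * \<bar>deriv w x\<bar> + \<bar>?b x\<bar> * \<bar>deriv w \<xi> - deriv w x\<bar>"
        by (metis abs_mult abs_triangle_ineq)
      also have "\<dots> \<le> (2 * Q ^ 2 * (\<delta> * Q)) * M + Q * (M * (\<delta> * Q))"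
        using Q \<delta> by (intro add_mono mult_mono bd bx m \<xi>d) auto
      finally show "\<bar>(?b x - ?b \<zeta>) * deriv w x + ?b x * (deriv w \<xi> - deriv w x)\<bar> \<le> (2 * Q ^ 2 * (\<delta> * Q)) * M + Q * (M * (\<delta> * Q))" .
    qed (use \<delta> Q in auto)
    also have "\<dots> = (2 * (M ^ 1 * Q ^ 4) + M ^ 1 * Q ^ 3) * \<delta>\<^sup>2"
      by (simp add: power2_eq_square power3_eq_cube numeral_eq_Suc algebra_simps)
    also have "\<dots> \<le> (2 * (M ^ 6 / m ^ 4) + M ^ 6 / m ^ 4) * \<delta>\<^sup>2"
      by (intro mult_right_mono add_mono mult_left_mono small) auto
    also have "\<dots> \<le> ?E * \<delta>\<^sup>2" using M0 m(1) by (intro mult_right_mono) (auto simp: divide_right_mono)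
    finally show ?thesis .
  qed
  show ?thesis
  proof (rule that[OF A B \<eta> k])
    show "(\<lambda>x. A (B x)) = f" using B by (auto simp: A_def)
    show "(\<lambda>x. A (B x + \<eta>)) = k" by (auto simp: A_def k_def \<gamma>_def)
    show "m\<^sup>2 / M \<le> deriv k x" for x
    proof -
      have "m * (m / M) \<le> deriv f x * (w (\<gamma> x) / w x)"
        using m(1) m(4)[of x] m(7)[of "\<gamma> x"] m(8)[of x] w(2)[of x] M0 fw0 by (intro mult_mono frac_le) simp_all
      then show ?thesis unfolding kD by (simp add: power2_eq_square)
    qed
  qed (use e0 e1 in auto)
qed

text \<open>The bump pushes in one direction only, hence the assumption that \<open>h\<close> lies
  above \<open>g\<close>. The segment from \<open>g\<close> to \<open>h\<close> is cut into
  \<open>n\<close> pieces; each takes a transport of cost \<open>r / (2 * n)\<close> and a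
  correction of cost \<open>K / n^2\<close>, in total \<open>r / 2 + K / n\<close>.\<close>

lemma reach_increasing_small:
  assumes p: "1 < p" and s: "0 \<le> s" "s \<le> 1 / p" and P: "admissible_pu P"
    and g: "diff_lift g" and h: "diff_lift h" and gh: "\<And>x. g x < h x" and r: "0 < r"
  shows "reach P s p g h (ennreal r)"
proof -
  have p0: "0 < p" using p by simp
  have "1 / p < 1" using p by simp
  then have s1: "s < 1" using s by linarith
  obtain C where C: "0 < C"
    "\<And>g h m e. diff_lift g \<Longrightarrow> diff_lift h \<Longrightarrow> 0 < m \<Longrightarrow> m \<le> 1 \<Longrightarrow> 0 \<le> e \<Longrightarrow> (\<And>x. m \<le> deriv g x) \<Longrightarrow> (\<And>x. m \<le> deriv h x) \<Longrightarrow>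
      (\<And>x. \<bar>h x - g x\<bar> \<le> e) \<Longrightarrow> (\<And>x. \<bar>deriv h x - deriv g x\<bar> \<le> e) \<Longrightarrow> reach P s p g h (ennreal (C * (e / m)))"
    by (rule reach_affine_C1[OF p s(1) s1 P]) blast
  define w where "w x = h x - g x" for x
  have w: "smooth_periodic w" "\<And>x. 0 < w x"
  proof -
    have "smooth w" unfolding w_def[abs_def] by (rule smooth_diff[OF diff_lift_smooth[OF h] diff_lift_smooth[OF g]])
    then show "smooth_periodic w" by (simp add: smooth_periodic_def w_def diff_lift_shift[OF g] diff_lift_shift[OF h])
    show "0 < w x" for x using gh by (simp add: w_def)
  qed
  have dw: "deriv w x = deriv h x - deriv g x" for x
    unfolding w_def[abs_def] by (intro DERIV_imp_deriv DERIV_diff diff_lift_DERIV g h)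
  have per: "smooth_periodic (deriv g)" "smooth_periodic (deriv h)"
    using g h by (auto simp: smooth_periodic_def diff_lift_deriv_shift intro: smooth_deriv diff_lift_smooth)
  note cp = smooth_periodicD(3) smooth_periodicD(2)
  obtain m1 where m1: "0 < m1" "\<And>x. m1 \<le> deriv g x"
    by (rule continuous_periodic_pos_lower_bound[OF cp(1)[OF per(1)] cp(2)[OF per(1)] diff_lift_deriv_pos[OF g]]) blast
  obtain m2 where m2: "0 < m2" "\<And>x. m2 \<le> deriv h x"
    by (rule continuous_periodic_pos_lower_bound[OF cp(1)[OF per(2)] cp(2)[OF per(2)] diff_lift_deriv_pos[OF h]]) blast
  obtain m3 where m3: "0 < m3" "\<And>x. m3 \<le> w x"
    by (rule continuous_periodic_pos_lower_bound[OF cp(1)[OF w(1)] cp(2)[OF w(1)] w(2)]) blast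
  obtain M1 where M1: "0 < M1" "\<And>x. \<bar>deriv g x\<bar> \<le> M1" by (rule smooth_periodic_bounded[OF per(1)]) blast
  obtain M2 where M2: "0 < M2" "\<And>x. \<bar>deriv h x\<bar> \<le> M2" by (rule smooth_periodic_bounded[OF per(2)]) blast
  obtain M3 where M3: "0 < M3" "\<And>x. \<bar>deriv (deriv g) x\<bar> \<le> M3" by (rule smooth_periodic_bounded[OF smooth_periodic_deriv[OF per(1)]]) blast
  obtain M4 where M4: "0 < M4" "\<And>x. \<bar>deriv (deriv h) x\<bar> \<le> M4" by (rule smooth_periodic_bounded[OF smooth_periodic_deriv[OF per(2)]]) blast
  obtain M5 where M5: "0 < M5" "\<And>x. \<bar>w x\<bar> \<le> M5" by (rule smooth_periodic_bounded[OF w(1)]) blast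
  obtain M6 where M6: "0 < M6" "\<And>x. \<bar>deriv w x\<bar> \<le> M6" by (rule smooth_periodic_bounded[OF smooth_periodic_deriv[OF w(1)]]) blast
  obtain M7 where M7: "0 < M7" "\<And>x. \<bar>deriv (deriv w) x\<bar> \<le> M7"
    by (rule smooth_periodic_bounded[OF smooth_periodic_deriv[OF smooth_periodic_deriv[OF w(1)]]]) blast
  define m where "m = min 1 (min m1 (min m2 m3))"
  define M where "M = 1 + M1 + M2 + M3 + M4 + M5 + M6 + M7"
  have m: "0 < m" "m \<le> 1" "m \<le> m1" "m \<le> m2" "m \<le> m3" using m1 m2 m3 by (auto simp: m_def)
  have M: "1 \<le> M" "M1 \<le> M" "M2 \<le> M" "M3 \<le> M" "M4 \<le> M" "M5 \<le> M" "M6 \<le> M" "M7 \<le> M"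
    using M1 M2 M3 M4 M5 M6 M7 by (auto simp: M_def)
  define E where "E = 4 * M ^ 6 / m ^ 4"
  define m' where "m' = m\<^sup>2 / M"
  have m': "0 < m'" "m' \<le> m"
  proof -
    show "0 < m'" using m M by (simp add: m'_def)
    have "m * m \<le> m * M" using m M by (intro mult_left_mono) auto
    then show "m' \<le> m" using M by (simp add: m'_def power2_eq_square divide_le_eq)
  qed
  have E0: "0 \<le> E" using M by (simp add: E_def)
  define K where "K = C * (E / m')"
  have K0: "0 \<le> K" using C E0 m' by (simp add: K_def)
  define f where "f t x = g x + t * w x" for t x
  have f: "diff_lift (f t)" "deriv (f t) x = (1 - t) * deriv g x + t * deriv h x" if "0 \<le> t" "t \<le> 1" for t x
  proof -
    have eq: "f t = (\<lambda>x. (1 - t) * g x + t * h x)" by (auto simp: f_def w_def algebra_simps)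
    show "diff_lift (f t)" unfolding eq by (rule diff_lift_convex[OF g h that])
    show "deriv (f t) x = (1 - t) * deriv g x + t * deriv h x" unfolding eq
      by (intro DERIV_imp_deriv DERIV_add DERIV_cmult diff_lift_DERIV g h)
  qed
  have conv: "(1 - t) * a + t * b \<le> u" if "0 \<le> t" "t \<le> 1" "a \<le> u" "b \<le> u" for t a b u :: real
    using convex_bound_le[of a u b "1 - t" t] that by simp
  have step: "reach P s p (f t) (f (t + \<delta>)) (ennreal (e + K * \<delta>\<^sup>2))"
    if t: "0 \<le> t" "t + \<delta> \<le> 1" and \<delta>: "0 < \<delta>" and e: "0 < e" for t \<delta> e
  proof -
    have t1: "t \<le> 1" "\<delta> \<le> 1" using t \<delta> by auto
    have lo: "m \<le> deriv (f u) x" if "0 \<le> u" "u \<le> 1" for u x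
    proof -
      have "- deriv g x \<le> - m" "- deriv h x \<le> - m" using m1(2)[of x] m2(2)[of x] m by auto
      from conv[OF that this] show ?thesis unfolding f(2)[OF that] by simp
    qed
    have hi: "deriv (f t) x \<le> M" for x
      unfolding f(2)[OF t(1) t1(1)] using M1(2)[of x] M2(2)[of x] M by (intro conv t t1) auto
    have d2: "\<bar>deriv (deriv (f t)) x\<bar> \<le> M" for x
    proof -
      have "deriv (f t) = (\<lambda>x. (1 - t) * deriv g x + t * deriv h x)" using f(2)[OF t(1) t1(1)] by auto
      moreover have "((\<lambda>x. (1 - t) * deriv g x + t * deriv h x) has_real_derivative (1 - t) * deriv (deriv g) x + t * deriv (deriv h) x) (at x)"
        by (intro DERIV_add DERIV_cmult smooth_DERIV smooth_periodicD[OF per(1)] smooth_periodicD[OF per(2)])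
      ultimately have eq: "deriv (deriv (f t)) x = (1 - t) * deriv (deriv g) x + t * deriv (deriv h) x"
        by (simp add: DERIV_imp_deriv)
      have "deriv (deriv (f t)) x \<le> M"
        unfolding eq using M3(2)[of x] M4(2)[of x] M by (intro conv t t1) auto
      moreover have "(1 - t) * (- deriv (deriv g) x) + t * (- deriv (deriv h) x) \<le> M"
        using M3(2)[of x] M4(2)[of x] M by (intro conv t t1) auto
      ultimately show ?thesis unfolding eq by (simp add: abs_le_iff)
    qed
    have wb: "m \<le> w x" "w x \<le> M" "\<bar>deriv w x\<bar> \<le> M" "\<bar>deriv (deriv w) x\<bar> \<le> M" for x
      using m3(2)[of x] M5(2)[of x] M6(2)[of x] M7(2)[of x] m M by linarith+
    obtain A B \<eta> k where k: "diff_lift A" "diff_lift B" "0 < \<eta>" "diff_lift k"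
      "(\<lambda>x. A (B x)) = f t" "(\<lambda>x. A (B x + \<eta>)) = k"
      "\<And>x. m\<^sup>2 / M \<le> deriv k x" "\<And>x. \<bar>(f t x + \<delta> * w x) - k x\<bar> \<le> 4 * M ^ 6 / m ^ 4 * \<delta>\<^sup>2"
      "\<And>x. \<bar>(deriv (f t) x + \<delta> * deriv w x) - deriv k x\<bar> \<le> 4 * M ^ 6 / m ^ 4 * \<delta>\<^sup>2"
      by (rule transport_step[OF f(1)[OF t(1) t1(1)] w m(1,2) M(1) lo[OF t(1) t1(1)] hi d2 wb \<delta> t1(2)]) blast
    have r1: "reach P s p (f t) k (ennreal e)"
      using reach_conjugated_translation[OF p s P k(1,2,3) e] unfolding k(5,6) .
    have u: "0 \<le> t + \<delta>" "t + \<delta> \<le> 1" using t \<delta> by auto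
    have "reach P s p k (f (t + \<delta>)) (ennreal (C * (E * \<delta>\<^sup>2 / m')))"
    proof (rule C(2)[OF k(4) f(1)[OF u] m'(1)])
      show "m' \<le> 1" using m' m by linarith
      show "m' \<le> deriv k x" for x using k(7) by (simp add: m'_def)
      show "m' \<le> deriv (f (t + \<delta>)) x" for x using lo[OF u, of x] m' by linarith
      show "\<bar>f (t + \<delta>) x - k x\<bar> \<le> E * \<delta>\<^sup>2" for x using k(8)[of x] by (simp add: f_def E_def algebra_simps)
      have "deriv (f (t + \<delta>)) x = deriv (f t) x + \<delta> * deriv w x" for x
        unfolding f(2)[OF u] f(2)[OF t(1) t1(1)] dw by (simp add: algebra_simps)
      then show "\<bar>deriv (f (t + \<delta>)) x - deriv k x\<bar> \<le> E * \<delta>\<^sup>2" for x using k(9)[of x] by (simp add: E_def)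
    qed (use E0 in auto)
    then have "reach P s p (f t) (f (t + \<delta>)) (ennreal e + ennreal (C * (E * \<delta>\<^sup>2 / m')))"
      by (rule reach_trans[OF P p0 r1])
    moreover have "C * (E * \<delta>\<^sup>2 / m') = K * \<delta>\<^sup>2" by (simp add: K_def)
    moreover have "ennreal e + ennreal (K * \<delta>\<^sup>2) = ennreal (e + K * \<delta>\<^sup>2)"
      using e K0 by (intro ennreal_plus[symmetric]) auto
    ultimately show ?thesis by (simp only:)
  qed
  \<comment> \<open>Large enough for \<open>K / n \<le> r / 2\<close>.\<close>
  define n where "n = nat \<lceil>2 * K / r\<rceil> + 1"
  have n: "0 < n" "2 * K / r \<le> real n" by (auto simp: n_def) linarith
  define \<delta> where "\<delta> = 1 / real n"
  define L where "L = r / (2 * real n) + K * \<delta>\<^sup>2"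
  have L0: "0 \<le> L" using r K0 by (simp add: L_def)
  have "reach P s p (f (real 0 * \<delta>)) (f (real n * \<delta>)) (ennreal (real n * L))"
  proof (rule reach_chain[where f = "\<lambda>i. f (real i * \<delta>)", OF P p0 _ _ L0])
    show "diff_lift (f (real 0 * \<delta>))" using f(1)[of 0] by simp
    fix i assume i: "i < n"
    have "real i * \<delta> + \<delta> = (real i + 1) / real n" by (simp add: \<delta>_def add_divide_distrib)
    also have "\<dots> \<le> 1" using i by simp
    finally have "reach P s p (f (real i * \<delta>)) (f (real i * \<delta> + \<delta>)) (ennreal (r / (2 * real n) + K * \<delta>\<^sup>2))"
      using n r by (intro step) (auto simp: \<delta>_def)
    then show "reach P s p (f (real i * \<delta>)) (f (real (Suc i) * \<delta>)) (ennreal L)"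
      by (simp add: L_def algebra_simps)
  qed
  moreover have "f (real 0 * \<delta>) = g" "f (real n * \<delta>) = h"
    using n by (auto simp: f_def w_def \<delta>_def)
  moreover have "real n * L \<le> r"
  proof -
    have "K * 2 \<le> r * real n" using n r by (simp add: divide_le_eq mult.commute)
    then have "K / real n \<le> r / 2" using n by (simp add: field_simps)
    moreover have "real n * L = r / 2 + K / real n" using n by (simp add: L_def \<delta>_def power2_eq_square field_simps)
    ultimately show ?thesis by linarith
  qed
  ultimately show ?thesis using reach_mono ennreal_leI by metis
qed

lemma diff_diam_eq_0:
  assumes "1 < p" "0 \<le> s" "s \<le> 1 / p" "admissible_pu P"
  shows "diff_diam P s p = 0"
proof -
  have "diff_dist P s p g h = 0" if g: "diff_lift g" and h: "diff_lift h" for g h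
  proof -
    have "smooth_periodic (\<lambda>x. g x - h x)"
      using smooth_diff[OF diff_lift_smooth[OF g] diff_lift_smooth[OF h]]
      by (simp add: smooth_periodic_def diff_lift_shift[OF g] diff_lift_shift[OF h])
    then obtain b where b: "\<And>x. \<bar>g x - h x\<bar> \<le> b" by (rule smooth_periodic_bounded) blast
    \<comment> \<open>Another lift of the same diffeomorphism lies above \<open>g\<close>
      everywhere, so every target can be approached by increasing displacements.\<close>
    obtain n :: int where n: "b < real_of_int n" using ex_less_of_int by blast
    have "diff_dist P s p g h \<le> ennreal r" if "0 < r" for r
    proof (rule diff_dist_le_reach)
      show "reach P s p g (\<lambda>x. h x + real_of_int n) (ennreal r)"
      proof (rule reach_increasing_small[OF assms g diff_lift_add_const[OF h] _ that])
        show "g x < h x + real_of_int n" for x using b[of x] n by linarith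
      qed
    qed
    then have "diff_dist P s p g h \<le> 0 + ennreal r" if "0 < r" for r using that by simp
    then have "diff_dist P s p g h \<le> 0" by (rule ennreal_le_epsilon)
    then show ?thesis by simp
  qed
  then have "diff_diam P s p \<le> 0" unfolding diff_diam_def by (intro SUP_least) fastforce
  then show ?thesis by simp
qed

section \<open>Bounded diameter for s < 1 + 1/p\<close>

text \<open>The quotient increases with \<open>d\<close>; the two bounds are its limits at 0 and at
  infinity. They do not depend on \<open>d\<close>, which is what makes the line to
  \<open>c \<circ> g\<close> insensitive to the concentration of \<open>c\<close>.\<close>

lemma convex_ratio_bounds:
  fixes d t :: real
  assumes "0 < d" "0 < t" "t < 1"
  shows "0 < (1 - t) + t * d" "- 1 / (1 - t) \<le> (d - 1) / ((1 - t) + t * d)" "(d - 1) / ((1 - t) + t * d) \<le> 1 / t"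
proof -
  show pos: "0 < (1 - t) + t * d" using assms by (intro add_pos_pos mult_pos_pos) auto
  have "t * (d - 1) \<le> 1 * ((1 - t) + t * d)" using assms by (simp add: algebra_simps)
  then show "(d - 1) / ((1 - t) + t * d) \<le> 1 / t" using pos assms by (simp add: pos_divide_le_eq pos_le_divide_eq mult.commute)
  have "(1 - d) * (1 - t) \<le> 1 * ((1 - t) + t * d)"
    using assms by (simp add: algebra_simps)
  then have "(1 - d) / ((1 - t) + t * d) \<le> 1 / (1 - t)" using pos assms by (simp add: pos_divide_le_eq pos_le_divide_eq)
  moreover have "(d - 1) / ((1 - t) + t * d) = - ((1 - d) / ((1 - t) + t * d))" by (simp add: minus_divide_left)
  ultimately show "- 1 / (1 - t) \<le> (d - 1) / ((1 - t) + t * d)" by simp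
qed

text \<open>Integer shifts reduce the claim to \<open>[0, 1]\<close>, which \<open>c\<close> maps to
  itself.\<close>

lemma diff_lift_minus_ident_le_1:
  assumes "diff_lift c" "c 0 = 0"
  shows "\<bar>c y - y\<bar> \<le> 1"
proof -
  have "c (frac y) = c y - of_int \<lfloor>y\<rfloor>"
    using diff_lift_of_int[OF assms(1), of y "- \<lfloor>y\<rfloor>"] by (simp add: frac_def)
  then have "c y - y = c (frac y) - frac y" by (simp add: frac_def)
  moreover have "0 \<le> c (frac y)" "c (frac y) \<le> 1"
    using diff_lift_less_iff[OF assms(1), of "frac y" 0] diff_lift_less_iff[OF assms(1), of 1 "frac y"]
      diff_lift_shift[OF assms(1), of 0] assms(2) frac_ge_0[of y] frac_lt_1[of y] by (auto simp: not_less[symmetric])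
  ultimately show ?thesis using frac_ge_0[of y] frac_lt_1[of y] by linarith
qed

lemma diff_lift_integral_deriv:
  assumes "diff_lift g" shows "integral {0..1} (deriv g) = 1"
  using integral_DERIV[OF diff_lift_DERIV[OF assms], of 0 1] diff_lift_shift[OF assms, of 0]
  by (simp add: integral_unique)

lemma integral_abs_deriv_unimodal:
  assumes H: "smooth_periodic H" and "\<And>x. 0 \<le> x \<Longrightarrow> x \<le> 1/2 \<Longrightarrow> deriv H x \<le> 0" "\<And>x. 1/2 \<le> x \<Longrightarrow> x \<le> 1 \<Longrightarrow> 0 \<le> deriv H x"
  shows "integral {0..1} (\<lambda>x. \<bar>deriv H x\<bar>) = 2 * (H 0 - H (1/2))"
proof -
  have D: "\<And>x. (H has_real_derivative deriv H x) (at x)" by (rule smooth_DERIV[OF smooth_periodicD(1)[OF H]])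
  have "((\<lambda>x. - deriv H x) has_integral - (H (1/2) - H 0)) {0..1/2}"
    by (rule has_integral_neg[OF integral_DERIV[OF D]]) simp
  then have 1: "((\<lambda>x. \<bar>deriv H x\<bar>) has_integral H 0 - H (1/2)) {0..1/2}"
    using has_integral_cong[of "{0..1/2}" "\<lambda>x. - deriv H x" "\<lambda>x. \<bar>deriv H x\<bar>"] assms(2) by (simp add: abs_of_nonpos)
  have "(deriv H has_integral H 1 - H (1/2)) {1/2..1}" by (rule integral_DERIV[OF D]) simp
  then have 2: "((\<lambda>x. \<bar>deriv H x\<bar>) has_integral H 1 - H (1/2)) {1/2..1}"
    using has_integral_cong[of "{1/2..1}" "deriv H" "\<lambda>x. \<bar>deriv H x\<bar>"] assms(3) by simp
  have "((\<lambda>x. \<bar>deriv H x\<bar>) has_integral (H 0 - H (1/2)) + (H 1 - H (1/2))) {0..1}"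
    by (rule has_integral_combine[OF _ _ 1 2]) auto
  then show ?thesis using smooth_periodicD(2)[OF H, of 0] by (simp add: integral_unique)
qed

text \<open>One of the factors \<open>t\<close> and \<open>1 - t\<close> is at least
  \<open>1/2\<close>, which separates the two singularities.\<close>

lemma nn_integral_beta_bound:
  assumes "0 \<le> \<beta>" "\<beta> < 1"
  shows "(\<integral>\<^sup>+t. ennreal ((1 / (t * (1 - t))) powr \<beta>) * indicator {0..1} t \<partial>lborel) \<le> ennreal (2 powr \<beta> * (2 / (1 - \<beta>)))"
proof -
  have I: "(\<integral>\<^sup>+t. ennreal (t powr (- \<beta>)) * indicator {0..1} t \<partial>lborel) = ennreal (1 / (1 - \<beta>))"
  proof -
    have "((\<lambda>t. t powr (- \<beta>)) has_integral 1 powr (- \<beta> + 1) / (- \<beta> + 1)) {0..1}"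
      using assms by (intro has_integral_powr_from_0) auto
    then show ?thesis
      using nn_integral_has_integral_lebesgue'[of "{0..1}" "\<lambda>t. t powr (- \<beta>)" "1 / (1 - \<beta>)"] by simp
  qed
  have I': "(\<integral>\<^sup>+t. ennreal ((1 - t) powr (- \<beta>)) * indicator {0..1} t \<partial>lborel) = ennreal (1 / (1 - \<beta>))"
  proof -
    have "(\<integral>\<^sup>+t. ennreal (t powr (- \<beta>)) * indicator {0..1} t \<partial>lborel) = (\<integral>\<^sup>+t. ennreal ((1 - t) powr (- \<beta>)) * indicator {0..1} (1 - t) \<partial>lborel)"
      using nn_integral_real_affine[of "\<lambda>t. ennreal (t powr (- \<beta>)) * indicator {0..1} t" "-1" 1] by simp
    also have "\<dots> = (\<integral>\<^sup>+t. ennreal ((1 - t) powr (- \<beta>)) * indicator {0..1} t \<partial>lborel)"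
      by (intro nn_integral_cong) (auto split: split_indicator)
    finally show ?thesis using I by simp
  qed
  have "(\<integral>\<^sup>+t. ennreal ((1 / (t * (1 - t))) powr \<beta>) * indicator {0..1} t \<partial>lborel)
     \<le> (\<integral>\<^sup>+t. ennreal (2 powr \<beta>) * (ennreal (t powr (- \<beta>)) * indicator {0..1} t + ennreal ((1 - t) powr (- \<beta>)) * indicator {0..1} t) \<partial>lborel)"
  proof (rule nn_integral_mono)
    fix t :: real
    show "ennreal ((1 / (t * (1 - t))) powr \<beta>) * indicator {0..1} t
      \<le> ennreal (2 powr \<beta>) * (ennreal (t powr (- \<beta>)) * indicator {0..1} t + ennreal ((1 - t) powr (- \<beta>)) * indicator {0..1} t)"
    proof (cases "0 \<le> t \<and> t \<le> 1")
      case True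
      have "(1 / (t * (1 - t))) powr \<beta> \<le> 2 powr \<beta> * (t powr (- \<beta>) + (1 - t) powr (- \<beta>))"
      \<comment> \<open>At the two ends the left side is 0, by \<open>1 / 0 = 0\<close> and
        \<open>0 powr \<beta> = 0\<close>.\<close>
      proof (cases "t = 0 \<or> t = 1")
        case False
        then have t: "0 < t" "t < 1" using True by auto
        have one: "(1 / (t * (1 - t))) powr \<beta> \<le> 2 powr \<beta> * (t powr (- \<beta>))" if "0 < t" "t \<le> 1/2" for t :: real
        proof -
          have "1 / (t * (1 - t)) \<le> 2 / t" using that by (simp add: field_simps)
          then have "(1 / (t * (1 - t))) powr \<beta> \<le> (2 / t) powr \<beta>" using that assms by (intro powr_mono2) auto
          also have "\<dots> = 2 powr \<beta> * t powr (- \<beta>)" using that by (simp add: powr_divide powr_minus_divide)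
          finally show ?thesis .
        qed
        show ?thesis
        proof (cases "t \<le> 1/2")
          case True
          then show ?thesis using one[OF t(1) True] by (simp add: distrib_left add_increasing2)
        next
          case False
          then show ?thesis using one[of "1 - t"] t by (simp add: distrib_left add_increasing mult.commute)
        qed
      qed auto
      then show ?thesis using True by (simp add: ennreal_mult[symmetric] flip: ennreal_plus)
    qed auto
  qed
  also have "\<dots> = ennreal (2 powr \<beta>) * (ennreal (1 / (1 - \<beta>)) + ennreal (1 / (1 - \<beta>)))"
    by (subst nn_integral_cmult, simp, subst nn_integral_add) (auto simp: I I')
  also have "\<dots> = ennreal (2 powr \<beta> * (2 / (1 - \<beta>)))"
    using assms by (simp add: ennreal_mult[symmetric] flip: ennreal_plus)
  finally show ?thesis .
qed

text \<open>The straight line from \<open>g\<close> to \<open>c \<circ> g\<close> has velocity with derivative of size and variation at most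
  \<open>2 / (t (1 - t))\<close>, whatever the concentration of \<open>c'\<close>; this is integrable in the norm precisely because
  \<open>s < 1 + 1/p\<close>.\<close>

lemma reach_unimodal:
  assumes p: "1 < p" and s: "0 \<le> s" "s < 1 + 1 / p" and P: "admissible_pu P"
  obtains C where "0 < C"
    "\<And>c g. diff_lift c \<Longrightarrow> c 0 = 0 \<Longrightarrow> (\<And>x. 0 \<le> x \<Longrightarrow> x \<le> 1/2 \<Longrightarrow> deriv (deriv c) x \<le> 0) \<Longrightarrow>
      (\<And>x. 1/2 \<le> x \<Longrightarrow> x \<le> 1 \<Longrightarrow> 0 \<le> deriv (deriv c) x) \<Longrightarrow> diff_lift g \<Longrightarrow> reach P s p g (\<lambda>x. c (g x)) (ennreal C)"
proof -
  obtain C0 \<alpha> where C0: "0 < C0" and \<alpha>: "0 \<le> \<alpha>" "\<alpha> < 1" and W: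
    "\<And>X K N V. smooth_periodic X \<Longrightarrow> 0 \<le> K \<Longrightarrow> 0 < N \<Longrightarrow> N \<le> V \<Longrightarrow> (\<And>x. \<bar>X x\<bar> \<le> K) \<Longrightarrow> (\<And>x. \<bar>deriv X x\<bar> \<le> K) \<Longrightarrow> (\<And>x. \<bar>X x\<bar> \<le> N) \<Longrightarrow>
      integral {0..1} (\<lambda>x. \<bar>deriv X x\<bar>) \<le> N \<Longrightarrow> integral {0..1} (\<lambda>x. \<bar>deriv (deriv X) x\<bar>) \<le> V \<Longrightarrow>
      W_norm_S1 P s p X \<le> ennreal (C0 * (K powr (p - 1) * (V powr \<alpha> * N powr (1 - \<alpha>))) powr (1 / p))"
    by (rule W_norm_S1_bound_total_variation[OF p s P]) blast
  \<comment> \<open>Slope and second variation are of size \<open>1 / (t * (1 - t))\<close> and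
    enter the norm with exponents \<open>(p - 1) / p\<close> and \<open>\<alpha> / p\<close>. Their
    sum is below 1 because \<open>\<alpha> < 1\<close>, so the speed is integrable in time.\<close>
  define \<beta> where "\<beta> = (p - 1 + \<alpha>) / p"
  have \<beta>: "0 \<le> \<beta>" "\<beta> < 1" using p \<alpha> by (auto simp: \<beta>_def divide_less_eq)
  define C where "C = C0 * 2 powr (1 / p) * (2 powr \<beta> * (2 / (1 - \<beta>)))"
  have Cpos: "0 < C" using C0 \<beta> by (simp add: C_def)
  show ?thesis
  proof (rule that[OF Cpos])
    fix c g
    assume c: "diff_lift c" "c 0 = 0" and uni: "\<And>x. 0 \<le> x \<Longrightarrow> x \<le> 1/2 \<Longrightarrow> deriv (deriv c) x \<le> 0"
      "\<And>x. 1/2 \<le> x \<Longrightarrow> x \<le> 1 \<Longrightarrow> 0 \<le> deriv (deriv c) x" and g: "diff_lift g"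
    define h where "h x = c (g x)" for x
    have h: "diff_lift h" unfolding h_def by (rule diff_lift_compose[OF c(1) g])
    have h': "deriv h x = deriv c (g x) * deriv g x" for x
      unfolding h_def by (rule DERIV_imp_deriv[OF DERIV_chain2[OF diff_lift_DERIV[OF c(1)] diff_lift_DERIV[OF g]]])
    have D: "smooth_periodic (deriv c)"
      using c(1) by (simp add: smooth_periodic_def diff_lift_deriv_shift smooth_deriv diff_lift_smooth)
    note Dpos = diff_lift_deriv_pos[OF c(1)]
    have "reach P s p g h (ennreal C)"
    proof (rule reach_affine[OF g h, where m = "\<lambda>t. ennreal (C0 * 2 powr (1 / p)) * ennreal ((1 / (t * (1 - t))) powr \<beta>)"])
      fix t :: real assume t: "0 < t" "t < 1"
      let ?\<psi> = "\<lambda>x. (1 - t) * g x + t * h x"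
      let ?X = "\<lambda>y. h (inv ?\<psi> y) - g (inv ?\<psi> y)"
      note F = affine_velocity_facts[OF g h less_imp_le[OF t(1)] less_imp_le[OF t(2)]]
      define B where "B = 1 / (t * (1 - t))"
      have "t * (1 - t) \<le> 1/2 * 1" 
      proof (cases "t \<le> 1/2")
        case True then show ?thesis using t by (intro mult_mono) auto
      next
        case False then have "t * (1 - t) \<le> 1 * (1/2)" using t by (intro mult_mono) auto
        then show ?thesis by simp
      qed
      then have B: "2 \<le> B" "0 < B" using t by (auto simp: B_def le_divide_eq)
      have Bsum: "1 / t + 1 / (1 - t) = B" using t by (simp add: B_def field_simps)
      have Bge: "1 / t \<le> B" "1 / (1 - t) \<le> B"
      proof -
        have "0 \<le> 1 / t" "0 \<le> 1 / (1 - t)" using t by auto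
        then show "1 / t \<le> B" "1 / (1 - t) \<le> B" using Bsum by linarith+
      qed
      \<comment> \<open>Up to the change of variable by \<open>g\<close>, the derivative of the
        velocity is a function of \<open>c\<close> alone. Its variation therefore does not depend on
        \<open>g\<close>.\<close>
      define H where "H y = (deriv c y - 1) / ((1 - t) + t * deriv c y)" for y
      note rb = convex_ratio_bounds[OF Dpos t]
      have sH: "smooth_periodic H"
      proof -
        have "smooth H" unfolding H_def[abs_def]
          by (intro smooth_divide smooth_diff smooth_add smooth_mult smooth_const smooth_periodicD[OF D] rb)
        then show ?thesis by (simp add: smooth_periodic_def H_def smooth_periodicD(2)[OF D])
      qed
      have HD: "deriv H y = deriv (deriv c) y / ((1 - t) + t * deriv c y)\<^sup>2" for y
      proof -
        have nz: "(1 - t) + t * deriv c y \<noteq> 0" using rb(1)[of y] by linarith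
        have "((\<lambda>y. deriv c y - 1) has_real_derivative deriv (deriv c) y - 0) (at y)"
          by (intro DERIV_diff DERIV_const smooth_DERIV smooth_periodicD[OF D])
        moreover have "((\<lambda>y. (1 - t) + t * deriv c y) has_real_derivative 0 + t * deriv (deriv c) y) (at y)"
          by (intro DERIV_add DERIV_const DERIV_cmult smooth_DERIV smooth_periodicD[OF D])
        ultimately have "(H has_real_derivative ((deriv (deriv c) y - 0) * ((1 - t) + t * deriv c y) - (deriv c y - 1) * (0 + t * deriv (deriv c) y))
            / (((1 - t) + t * deriv c y) * ((1 - t) + t * deriv c y))) (at y)"
          unfolding H_def[abs_def] by (rule DERIV_divide) (rule nz)
        then have "deriv H y = ((deriv (deriv c) y - 0) * ((1 - t) + t * deriv c y) - (deriv c y - 1) * (0 + t * deriv (deriv c) y))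
            / (((1 - t) + t * deriv c y) * ((1 - t) + t * deriv c y))"
          by (rule DERIV_imp_deriv)
        moreover have "(u - 0) * ((1 - t) + t * v) - (v - 1) * (0 + t * u) = u" for u v :: real by (simp add: algebra_simps)
        ultimately show ?thesis by (simp only: power2_eq_square)
      qed
      have Qeq: "(\<lambda>x. (deriv h x - deriv g x) / ((1 - t) * deriv g x + t * deriv h x)) = (\<lambda>x. H (g x))"
      proof
        fix x
        have "deriv h x - deriv g x = deriv g x * (deriv c (g x) - 1)"
          "(1 - t) * deriv g x + t * deriv h x = deriv g x * ((1 - t) + t * deriv c (g x))"
          by (simp_all add: h' algebra_simps)
        then show "(deriv h x - deriv g x) / ((1 - t) * deriv g x + t * deriv h x) = H (g x)"
          using diff_lift_deriv_pos[OF g, of x] by (simp add: H_def)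
      qed
      have Hlo: "- (1 / (1 - t)) \<le> H y" for y using rb(2)[of y] by (simp only: H_def minus_divide_left)
      have Hhi: "H y \<le> 1 / t" for y using rb(3)[of y] by (simp only: H_def)
      have HB: "\<bar>H y\<bar> \<le> B" for y
        using Hlo[of y] Hhi[of y] Bge by (intro abs_leI) linarith+
      have "W_norm_S1 P s p ?X \<le> ennreal (C0 * (B powr (p - 1) * ((2 * B) powr \<alpha> * 2 powr (1 - \<alpha>))) powr (1 / p))"
      proof (rule W[OF F(1)])
        have X1: "\<bar>?X x\<bar> \<le> 1" for x unfolding h_def by (rule diff_lift_minus_ident_le_1[OF c])
        show "\<bar>?X x\<bar> \<le> B" for x using X1[of x] B by linarith
        show "\<bar>?X x\<bar> \<le> 2" for x using X1[of x] by linarith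
        show "\<bar>deriv ?X x\<bar> \<le> B" for x unfolding F(2) using HB[of "g (inv ?\<psi> x)"] fun_cong[OF Qeq, of "inv ?\<psi> x"] by simp
        have i: "deriv g integrable_on {0..1}" "deriv h integrable_on {0..1}"
          by (intro integrable_continuous_real smooth_continuous_on smooth_deriv diff_lift_smooth g h)+
        have "integral {0..1} (\<lambda>x. \<bar>deriv h x - deriv g x\<bar>) \<le> integral {0..1} (\<lambda>x. deriv h x + deriv g x)"
        proof (rule integral_le)
          show "(\<lambda>x. \<bar>deriv h x - deriv g x\<bar>) integrable_on {0..1}"
            by (intro integrable_continuous_real continuous_on_rabs continuous_on_diff smooth_continuous_on smooth_deriv diff_lift_smooth g h)
          show "(\<lambda>x. deriv h x + deriv g x) integrable_on {0..1}" by (intro integrable_add i)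
          show "\<bar>deriv h x - deriv g x\<bar> \<le> deriv h x + deriv g x" for x
            using diff_lift_deriv_pos[OF g, of x] diff_lift_deriv_pos[OF h, of x] by linarith
        qed
        also have "\<dots> = 2" using Henstock_Kurzweil_Integration.integral_add[OF i(2,1)] diff_lift_integral_deriv[OF g] diff_lift_integral_deriv[OF h] by simp
        finally show "integral {0..1} (\<lambda>x. \<bar>deriv ?X x\<bar>) \<le> 2" unfolding F(3) .
        have dHg: "deriv (\<lambda>x. H (g x)) x = deriv H (g x) * deriv g x" for x
          by (rule DERIV_imp_deriv[OF DERIV_chain2[OF smooth_DERIV[OF smooth_periodicD(1)[OF sH]] diff_lift_DERIV[OF g]]])
        have "integral {0..1} (\<lambda>x. \<bar>deriv (\<lambda>x. H (g x)) x\<bar>) = integral {0..1} (\<lambda>x. \<bar>deriv H (g x)\<bar> * deriv g x)"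
          unfolding dHg abs_mult abs_of_pos[OF diff_lift_deriv_pos[OF g]] ..
        also have "\<dots> = integral {0..1} (\<lambda>x. \<bar>deriv H x\<bar>)"
          by (rule integral_diff_lift_substitution[OF g, of "\<lambda>x. \<bar>deriv H x\<bar>"])
             (use smooth_periodicD[OF smooth_periodic_deriv[OF sH]] in \<open>auto intro!: continuous_on_rabs\<close>)
        \<comment> \<open>\<open>deriv H\<close> has the sign of the second derivative of
          \<open>c\<close>: \<open>H\<close> falls on the first half period and rises on the second,
          so its variation is twice its oscillation.\<close>
        also have "\<dots> = 2 * (H 0 - H (1/2))"
          by (rule integral_abs_deriv_unimodal[OF sH]) (use uni in \<open>auto simp: HD intro!: divide_nonpos_nonneg divide_nonneg_nonneg\<close>)
        also have "\<dots> \<le> 2 * (1 / t + 1 / (1 - t))" 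
        proof -
          have "- H (1/2) \<le> 1 / (1 - t)" using Hlo[of "1/2"] by (simp only: minus_le_iff)
          from add_mono[OF Hhi[of 0] this] have "H 0 - H (1/2) \<le> 1 / t + 1 / (1 - t)" by (simp only: diff_conv_add_uminus)
          then show ?thesis by (intro mult_left_mono) auto
        qed
        finally show "integral {0..1} (\<lambda>x. \<bar>deriv (deriv ?X) x\<bar>) \<le> 2 * B" unfolding F(4) Qeq Bsum .
      qed (use B in auto)
      also have "B powr (p - 1) * ((2 * B) powr \<alpha> * 2 powr (1 - \<alpha>)) = 2 * B powr (p - 1 + \<alpha>)"
      proof -
        have "(2 * B) powr \<alpha> = 2 powr \<alpha> * B powr \<alpha>" by (rule powr_mult)
        moreover have "2 powr \<alpha> * 2 powr (1 - \<alpha>) = (2::real)" by (simp flip: powr_add)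
        ultimately show ?thesis by (simp add: powr_add ac_simps)
      qed
      also have "(2 * B powr (p - 1 + \<alpha>)) powr (1 / p) = 2 powr (1 / p) * B powr \<beta>"
        by (simp add: powr_mult powr_powr \<beta>_def)
      finally show "W_norm_S1 P s p ?X \<le> ennreal (C0 * 2 powr (1 / p)) * ennreal ((1 / (t * (1 - t))) powr \<beta>)"
        using C0 by (simp add: B_def mult.assoc ennreal_mult)
    next
      have "(\<integral>\<^sup>+t. ennreal (C0 * 2 powr (1 / p)) * ennreal ((1 / (t * (1 - t))) powr \<beta>) * indicator {0..1} t \<partial>lborel)
         = ennreal (C0 * 2 powr (1 / p)) * (\<integral>\<^sup>+t. ennreal ((1 / (t * (1 - t))) powr \<beta>) * indicator {0..1} t \<partial>lborel)"
        by (subst nn_integral_cmult[symmetric]) (auto simp: mult.assoc)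
      also have "\<dots> \<le> ennreal (C0 * 2 powr (1 / p)) * ennreal (2 powr \<beta> * (2 / (1 - \<beta>)))"
        by (intro mult_left_mono nn_integral_beta_bound \<beta>) auto
      also have "\<dots> = ennreal C" unfolding C_def using C0 \<beta> by (intro ennreal_mult[symmetric]) auto
      finally show "(\<integral>\<^sup>+t. ennreal (C0 * 2 powr (1 / p)) * ennreal ((1 / (t * (1 - t))) powr \<beta>) * indicator {0..1} t \<partial>lborel) \<le> ennreal C" .
    qed measurable
    then show "reach P s p g (\<lambda>x. c (g x)) (ennreal C)" by (simp add: h_def[abs_def])
  qed
qed

section \<open>Rotations and the logarithmic density\<close>

lemma reach_rotation:
  assumes p: "1 < p" and s: "0 \<le> s" "s < 1 + 1 / p" and P: "admissible_pu P"
  obtains C where "0 < C" "\<And>g a. diff_lift g \<Longrightarrow> \<bar>a\<bar> \<le> 1 \<Longrightarrow> reach P s p g (\<lambda>x. g x + a) (ennreal C)"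
proof -
  obtain C0 \<alpha> where C0: "0 < C0" and \<alpha>: "0 \<le> \<alpha>" "\<alpha> < 1" and W:
    "\<And>X K N V. smooth_periodic X \<Longrightarrow> 0 \<le> K \<Longrightarrow> 0 < N \<Longrightarrow> N \<le> V \<Longrightarrow> (\<And>x. \<bar>X x\<bar> \<le> K) \<Longrightarrow> (\<And>x. \<bar>deriv X x\<bar> \<le> K) \<Longrightarrow> (\<And>x. \<bar>X x\<bar> \<le> N) \<Longrightarrow>
      integral {0..1} (\<lambda>x. \<bar>deriv X x\<bar>) \<le> N \<Longrightarrow> integral {0..1} (\<lambda>x. \<bar>deriv (deriv X) x\<bar>) \<le> V \<Longrightarrow>
      W_norm_S1 P s p X \<le> ennreal (C0 * (K powr (p - 1) * (V powr \<alpha> * N powr (1 - \<alpha>))) powr (1 / p))"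
    by (rule W_norm_S1_bound_total_variation[OF p s P]) blast
  show ?thesis
  proof (rule that[OF C0])
    fix g a assume g: "diff_lift g" and a: "\<bar>a::real\<bar> \<le> 1"
    have h: "diff_lift (\<lambda>x. g x + a)" by (rule diff_lift_add_const[OF g])
    have "W_norm_S1 P s p (\<lambda>_. a) \<le> ennreal (C0 * (1 powr (p - 1) * (1 powr \<alpha> * 1 powr (1 - \<alpha>))) powr (1 / p))"
      by (rule W) (use a in \<open>auto simp: smooth_periodic_def\<close>)
    then have "W_norm_S1 P s p (\<lambda>_. a) \<le> ennreal C0" by simp
    then show "reach P s p g (\<lambda>x. g x + a) (ennreal C0)"
      by (intro reach_affine[OF g h, where m = "\<lambda>_. ennreal C0"]) (auto simp: nn_integral_cmult_indicator)
  qed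
qed

text \<open>The density is \<open>1 / \<bar>x\<bar>\<close> near the integers, regularised at scale
  \<open>e\<close>, and \<open>Z\<close> is its integral, which grows like
  \<open>ln (1 / e)\<close>. The same family serves both directions: as the concentration in the
  upper bound and as a diffeomorphism far from the identity in the lower bound.\<close>

lemma logarithmic_density:
  fixes e :: real
  assumes e: "0 < e"
  obtains c Z where "diff_lift c" "c 0 = 0" "0 < Z" "ln (1 + 2 / e) / 4 \<le> Z"
    "\<And>x. deriv c x = (e\<^sup>2 + (sin (pi * x))\<^sup>2) powr (- 1 / 2) / Z"
    "\<And>x. 0 \<le> x \<Longrightarrow> x \<le> 1/2 \<Longrightarrow> deriv (deriv c) x \<le> 0" "\<And>x. 1/2 \<le> x \<Longrightarrow> x \<le> 1 \<Longrightarrow> 0 \<le> deriv (deriv c) x"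
proof -
  define q where "q x = e\<^sup>2 + (sin (pi * x))\<^sup>2" for x
  have q0: "0 < q x" for x using e by (simp add: q_def add_pos_nonneg)
  have sq: "smooth q"
  proof -
    have "smooth (\<lambda>x. sin (pi * x))" by (intro smooth_sin smooth_mult smooth_const smooth_ident)
    then show ?thesis unfolding q_def[abs_def] power2_eq_square[of "sin _"] by (intro smooth_add smooth_const smooth_mult)
  qed
  define d where "d x = q x powr (- 1 / 2)" for x
  have sd: "smooth d" unfolding d_def[abs_def] by (rule smooth_powr[OF sq q0])
  have d0: "0 < d x" for x using q0[of x] by (simp add: d_def)
  have dper: "d (x + 1) = d x" for x by (simp add: d_def q_def distrib_left)
  obtain F where F: "\<And>x. (F has_real_derivative d x) (at x)" "smooth F" by (rule smooth_antiderivative[OF sd]) blast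
  define Z where "Z = integral {0..1} d"
  have Fper: "F (x + 1) = F x + Z" for x
    using integral_DERIV[OF F(1), of x "x + 1"] integral_periodic_shift[of d x, OF smooth_continuous_on[OF sd] dper]
    by (simp add: Z_def integral_unique)
  have "ln (1 + 2 / e) / 4 \<le> Z"
  proof -
    \<comment> \<open>On the first half period the density is at least
      \<open>1 / (e + 4 * x)\<close>, again by \<open>\<bar>sin (pi * x)\<bar> \<le> 4 * x\<close>;
      its integral gives the lower bound for \<open>Z\<close>.\<close>
    have "((\<lambda>x. 1 / (e + 4 * x)) has_integral ln (e + 4 * (1/2)) / 4 - ln (e + 4 * 0) / 4) {0..1/2}"
    proof (rule fundamental_theorem_of_calculus)
      fix x :: real assume "x \<in> {0..1/2}"
      then have "0 < e + 4 * x" using e by auto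
      then have "((\<lambda>x. ln (e + 4 * x)) has_real_derivative 4 / (e + 4 * x)) (at x within {0..1/2})"
        by (auto intro!: derivative_eq_intros)
      from DERIV_cdivide[OF this, of 4]
      have "((\<lambda>x. ln (e + 4 * x) / 4) has_real_derivative 4 / (e + 4 * x) / 4) (at x within {0..1/2})" .
      moreover have "4 / b / 4 = 1 / b" for b :: real by simp
      ultimately have "((\<lambda>x. ln (e + 4 * x) / 4) has_real_derivative 1 / (e + 4 * x)) (at x within {0..1/2})" by (simp only:)
      then show "((\<lambda>x. ln (e + 4 * x) / 4) has_vector_derivative 1 / (e + 4 * x)) (at x within {0..1/2})"
        by (simp add: has_real_derivative_iff_has_vector_derivative)
    qed simp
    moreover have "ln (1 + 2 / e) = ln (e + 4 * (1/2)) - ln (e + 4 * 0)"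
    proof -
      have "1 + 2 / e = (e + 4 * (1/2)) / (e + 4 * 0)" using e by (simp add: field_simps)
      then show ?thesis using e by (simp only:) (rule ln_divide_pos, auto)
    qed
    ultimately have I: "((\<lambda>x. 1 / (e + 4 * x)) has_integral ln (1 + 2 / e) / 4) {0..1/2}"
      by (simp add: diff_divide_distrib)
    have "ln (1 + 2 / e) / 4 \<le> integral {0..1/2} d"
    proof (rule has_integral_le[OF I integrable_integral[OF integrable_continuous_real[OF smooth_continuous_on[OF sd]]]])
      fix x :: real assume x: "x \<in> {0..1/2}"
      have "\<bar>sin (pi * x)\<bar> \<le> 4 * x" using abs_sin_pi_diff_le[of x 0] x by simp
      then have "(sin (pi * x))\<^sup>2 \<le> (4 * x)\<^sup>2" using power_mono[of "\<bar>sin (pi * x)\<bar>" "4 * x" 2] by simp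
      then have "q x \<le> e\<^sup>2 + (4 * x)\<^sup>2" by (simp add: q_def)
      also have "\<dots> \<le> (e + 4 * x)\<^sup>2" using x e by (simp add: power2_sum)
      finally have "sqrt (q x) \<le> e + 4 * x" using x e by (intro real_le_lsqrt) auto
      then have "1 / (e + 4 * x) \<le> 1 / sqrt (q x)" using q0[of x] x e by (intro divide_left_mono mult_pos_pos) auto
      also have "1 / sqrt (q x) = d x" using q0[of x] by (simp add: d_def powr_minus_divide powr_half_sqrt)
      finally show "1 / (e + 4 * x) \<le> d x" .
    qed
    also have "\<dots> \<le> Z" unfolding Z_def
      by (rule integral_subset_le) (use d0 in \<open>auto intro!: integrable_continuous_real smooth_continuous_on sd less_imp_le\<close>)
    finally show ?thesis .
  qed
  moreover have "0 < ln (1 + 2 / e) / 4" using e by (intro divide_pos_pos ln_gt_zero) auto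
  ultimately have Z: "0 < Z" "ln (1 + 2 / e) / 4 \<le> Z" by linarith+
  define c where "c x = (F x - F 0) / Z" for x
  have Dc: "(c has_real_derivative d x / Z) (at x)" for x
    using DERIV_cdivide[OF DERIV_diff[OF F(1) DERIV_const[of "F 0"]], of Z x] by (simp add: c_def[abs_def])
  have dc: "deriv c = (\<lambda>x. d x / Z)" using DERIV_imp_deriv[OF Dc] by auto
  have Dd: "(d has_real_derivative (- 1 / 2 * q x powr (- 3 / 2)) * (2 * sin (pi * x) * (cos (pi * x) * pi))) (at x)" for x
  proof -
    have Dq: "(q has_real_derivative 2 * sin (pi * x) * (cos (pi * x) * pi)) (at x)"
      unfolding q_def[abs_def] by (auto intro!: derivative_eq_intros)
    have "((\<lambda>x. q x powr (- 1 / 2)) has_real_derivative (- 1 / 2) * q x powr (- 1 / 2 - of_nat 1) * (2 * sin (pi * x) * (cos (pi * x) * pi))) (at x)"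
      by (rule DERIV_fun_powr[OF Dq q0])
    moreover have "- 1 / 2 - of_nat 1 = (- 3 / 2 :: real)" by simp
    ultimately show ?thesis unfolding d_def[abs_def] by (simp only:)
  qed
  have ddc: "deriv (deriv c) x = (- 1 / 2 * q x powr (- 3 / 2)) * (2 * sin (pi * x) * (cos (pi * x) * pi)) / Z" for x
    unfolding dc by (rule DERIV_imp_deriv[OF DERIV_cdivide[OF Dd]])
  show ?thesis
  proof (rule that[of c Z])
    show "diff_lift c"
    proof (rule diff_liftI[OF _ Dc])
      show "smooth c" unfolding c_def[abs_def] divide_inverse by (intro smooth_mult smooth_diff smooth_const F)
      show "0 < d x / Z" for x using d0 Z by simp
      show "c (x + 1) = c x + 1" for x using Z Fper[of x] by (simp add: c_def field_simps)
    qed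
    show "c 0 = 0" by (simp add: c_def)
    show "deriv c x = (e\<^sup>2 + (sin (pi * x))\<^sup>2) powr (- 1 / 2) / Z" for x by (simp add: dc d_def q_def)
    show "deriv (deriv c) x \<le> 0" if "0 \<le> x" "x \<le> 1/2" for x
    proof -
      have "pi * x \<le> pi / 2" using that by (simp add: mult_left_le)
      moreover have "0 \<le> pi * x" using that by simp
      ultimately have "0 \<le> sin (pi * x)" "0 \<le> cos (pi * x)"
        using pi_ge_zero by - (rule sin_ge_zero cos_ge_zero; linarith)+
      then show ?thesis unfolding ddc using Z by (intro divide_nonpos_pos mult_nonpos_nonneg) auto
    qed
    show "0 \<le> deriv (deriv c) x" if "1/2 \<le> x" "x \<le> 1" for x
    proof -
      have "pi * (1 - x) \<le> pi / 2" using that by (simp add: mult_left_le)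
      moreover have "0 \<le> pi * (1 - x)" using that by simp
      ultimately have "0 \<le> sin (pi * (1 - x))" "0 \<le> cos (pi * (1 - x))"
        using pi_ge_zero by - (rule sin_ge_zero cos_ge_zero; linarith)+
      then have "0 \<le> sin (pi * x)" "0 \<le> - cos (pi * x)" by (simp_all add: right_diff_distrib sin_diff cos_diff)
      then have "0 \<le> 2 * sin (pi * x) * (- cos (pi * x) * pi)" by (intro mult_nonneg_nonneg) auto
      then have "2 * sin (pi * x) * (cos (pi * x) * pi) \<le> 0" by simp
      then show ?thesis unfolding ddc using Z by (intro divide_nonneg_pos mult_nonpos_nonpos) auto
    qed
  qed (use Z in auto)
qed

section \<open>Comparison of two lifts after concentration\<close>

lemma abs_le_quadratic:
  fixes f :: "real \<Rightarrow> real"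
  assumes D: "\<And>x. (f has_real_derivative f' x) (at x)" and "f 0 = 0" "0 \<le> k" "\<And>x. \<bar>f' x\<bar> \<le> k * \<bar>x\<bar>"
  shows "\<bar>f x\<bar> \<le> k * x\<^sup>2"
proof -
  have "norm (f x - f 0) \<le> (k * \<bar>x\<bar>) * norm (x - 0)"
  proof (rule field_differentiable_bound[of "cball (0::real) \<bar>x\<bar>" f f'])
    fix y assume "y \<in> cball (0::real) \<bar>x\<bar>"
    then have "k * \<bar>y\<bar> \<le> k * \<bar>x\<bar>" using assms(3) by (intro mult_left_mono) auto
    then show "norm (f' y) \<le> k * \<bar>x\<bar>" using assms(4)[of y] by simp
  qed (use D in \<open>auto intro: has_field_derivative_at_within\<close>)
  then show ?thesis using assms(2) by (simp add: power2_eq_square mult.assoc)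
qed

text \<open>On the period centred at 0 the point \<open>g x\<close> stays at distance at least
  \<open>m * \<bar>x\<bar>\<close> from every integer, because \<open>g\<close> maps 0 to one of
  them and has slope at least \<open>m\<close>.\<close>

lemma abs_sin_pi_diff_lift_ge:
  assumes g: "diff_lift g" "g 0 = real_of_int k" and m: "\<And>x. m \<le> deriv g x" "0 < m" and x: "\<bar>x\<bar> \<le> 1/2"
  shows "m * \<bar>x\<bar> \<le> \<bar>sin (pi * g x)\<bar>"
proof -
  have low: "m * (y - z) \<le> g y - g z" if "z \<le> y" for y z
  proof -
    have "g z - m * z \<le> g y - m * y"
    proof (rule DERIV_nonneg_imp_nondecreasing[OF that, of "\<lambda>x. g x - m * x"])
      fix u
      have "((\<lambda>x. g x - m * x) has_real_derivative deriv g u - m) (at u)"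
        by (auto intro!: derivative_eq_intros diff_lift_DERIV g)
      then show "\<exists>d. ((\<lambda>x. g x - m * x) has_real_derivative d) (at u) \<and> 0 \<le> d" using m(1)[of u] by force
    qed
    then show ?thesis by (simp add: algebra_simps)
  qed
  define w where "w = \<bar>g x - real_of_int k\<bar>"
  have sw: "\<bar>sin (pi * g x)\<bar> = \<bar>sin (pi * w)\<bar>"
  proof -
    have "sin (pi * (g x - real_of_int k)) = sin (pi * g x) * cos (pi * real_of_int k) - cos (pi * g x) * sin (pi * real_of_int k)"
      by (simp only: right_diff_distrib sin_diff)
    moreover have s0: "sin (pi * real_of_int k) = 0" by (rule sin_npi_int)
    moreover have "\<bar>cos (pi * real_of_int k)\<bar> = 1"
      using sin_cos_squared_add[of "pi * real_of_int k"] unfolding s0 by (simp add: abs_square_eq_1)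
    ultimately have "\<bar>sin (pi * (g x - real_of_int k))\<bar> = \<bar>sin (pi * g x)\<bar>" by (simp add: abs_mult)
    moreover have "\<bar>sin (pi * (g x - real_of_int k))\<bar> = \<bar>sin (pi * w)\<bar>"
    proof (cases "real_of_int k \<le> g x")
      case False
      then have "pi * w = - (pi * (g x - real_of_int k))" by (simp add: w_def algebra_simps)
      then show ?thesis by (simp only: sin_minus abs_minus_cancel)
    qed (simp add: w_def)
    ultimately show ?thesis by simp
  qed
  \<comment> \<open>\<open>w\<close> is the distance of \<open>g x\<close> from \<open>k\<close>,
    and \<open>1 - w\<close> its distance from the next integer on the same side; the latter is at
    least \<open>m * (1 - \<bar>x\<bar>) \<ge> m * \<bar>x\<bar>\<close> for
    \<open>\<bar>x\<bar> \<le> 1/2\<close>.\<close>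
  have "m * \<bar>x\<bar> \<le> w \<and> m * \<bar>x\<bar> \<le> 1 - w"
  proof (cases "0 \<le> x")
    case True
    have "m * x \<le> g x - g 0" using low[of 0 x] True by simp
    moreover have "m * (1 - x) \<le> g 1 - g x" using low[of x 1] x True by simp
    moreover have "m * x \<le> m * (1 - x)" using x True m by (intro mult_left_mono) auto
    moreover have "0 \<le> m * x" using True m by simp
    ultimately show ?thesis using g(2) diff_lift_shift[OF g(1), of 0] True by (auto simp: w_def)
  next
    case False
    have "m * (- x) \<le> g 0 - g x" using low[of x 0] False by simp
    moreover have "m * (x + 1) \<le> g x - g (- 1)" using low[of "- 1" x] x False by simp
    moreover have "m * (- x) \<le> m * (x + 1)" using x False m by (intro mult_left_mono) auto
    moreover have "0 \<le> m * (- x)" using False m by (intro mult_nonneg_nonneg) auto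
    ultimately show ?thesis using g(2) diff_lift_shift[OF g(1), of "- 1"] False by (auto simp: w_def)
  qed
  note mw = this
  have "0 \<le> m * \<bar>x\<bar>" using m by simp
  then have "0 \<le> w" "w \<le> 1" using mw by linarith+
  then have "min w (1 - w) \<le> \<bar>sin (pi * w)\<bar>" by (rule min_le_abs_sin_pi)
  then show ?thesis unfolding sw using mw by linarith
qed

text \<open>Under the scaling \<open>x = e * y / m\<close> the parameter \<open>e\<close> disappears
  from this integrand and from the next one, so both bounds hold uniformly as the integrands
  concentrate.\<close>

lemma integral_quotient_square_le:
  fixes e m :: real
  assumes e: "0 < e" and m: "0 < m"
  shows "integral {- 1/2..1/2} (\<lambda>x. e\<^sup>2 * \<bar>x\<bar> / (e\<^sup>2 + m\<^sup>2 * x\<^sup>2)\<^sup>2) \<le> 1 / m\<^sup>2"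
proof -
  let ?q = "\<lambda>x. e\<^sup>2 + m\<^sup>2 * x\<^sup>2"
  have q: "0 < ?q x" for x using e by (simp add: add_pos_nonneg)
  have qne: "?q x \<noteq> 0" for x using q[of x] by linarith
  let ?Y = "\<lambda>x. - (e\<^sup>2 / (2 * m\<^sup>2 * ?q x))"
  have D: "(?Y has_real_derivative e\<^sup>2 * x / (?q x)\<^sup>2) (at x)" for x
  proof -
    have "((\<lambda>x. ?q x) has_real_derivative 2 * m\<^sup>2 * x) (at x)" by (auto intro!: derivative_eq_intros)
    from DERIV_cmult[OF DERIV_inverse'[OF this qne], of "- (e\<^sup>2 / (2 * m\<^sup>2))"]
    have "((\<lambda>x. - (e\<^sup>2 / (2 * m\<^sup>2)) * inverse (?q x)) has_real_derivative - (e\<^sup>2 / (2 * m\<^sup>2)) * - (inverse (?q x) * (2 * m\<^sup>2 * x) * inverse (?q x))) (at x)" .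
    moreover have alg: "- (a / b) * - (inverse Q * (b * x) * inverse Q) = a * x / Q\<^sup>2" if "b \<noteq> 0" for a b Q :: real
      using that by (simp add: power2_eq_square inverse_eq_divide)
    have "2 * m\<^sup>2 \<noteq> 0" using m by simp
    note alg[OF this, of "e\<^sup>2" "?q x"]
    moreover have alg2: "- (a / b) * inverse Q = - (a / (b * Q))" for a b Q :: real by (simp add: inverse_eq_divide)
    have "(\<lambda>x. - (e\<^sup>2 / (2 * m\<^sup>2)) * inverse (?q x)) = ?Y" by (simp only: alg2)
    ultimately show ?thesis by (simp only:)
  qed
  have Y: "- ?Y x \<ge> 0" "- ?Y 0 = 1 / (2 * m\<^sup>2)" for x
    using less_imp_le[OF q[of x]] e by simp_all
  have 1: "((\<lambda>x. e\<^sup>2 * \<bar>x\<bar> / (?q x)\<^sup>2) has_integral ?Y (1/2) - ?Y 0) {0..1/2}"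
    using has_integral_cong[of "{0..1/2}" "\<lambda>x. e\<^sup>2 * x / (?q x)\<^sup>2" "\<lambda>x. e\<^sup>2 * \<bar>x\<bar> / (?q x)\<^sup>2"] integral_DERIV[OF D, of 0 "1/2"] by simp
  have 2: "((\<lambda>x. e\<^sup>2 * \<bar>x\<bar> / (?q x)\<^sup>2) has_integral - (?Y 0 - ?Y (- 1/2))) {- 1/2..0}"
    using has_integral_cong[of "{- 1/2..0}" "\<lambda>x. - (e\<^sup>2 * x / (?q x)\<^sup>2)" "\<lambda>x. e\<^sup>2 * \<bar>x\<bar> / (?q x)\<^sup>2"]
      has_integral_neg[OF integral_DERIV[OF D, of "- 1/2" 0]] by (simp add: abs_of_nonpos)
  have "((\<lambda>x. e\<^sup>2 * \<bar>x\<bar> / (?q x)\<^sup>2) has_integral - (?Y 0 - ?Y (- 1/2)) + (?Y (1/2) - ?Y 0)) {- 1/2..1/2}"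
    by (rule has_integral_combine[OF _ _ 2 1]) auto
  then have "integral {- 1/2..1/2} (\<lambda>x. e\<^sup>2 * \<bar>x\<bar> / (?q x)\<^sup>2) = - (?Y 0 - ?Y (- 1/2)) + (?Y (1/2) - ?Y 0)"
    by (rule integral_unique)
  also have "\<dots> \<le> 1 / (2 * m\<^sup>2) + 1 / (2 * m\<^sup>2)" using Y(1)[of "1/2"] Y(1)[of "- 1/2"] Y(2) by linarith
  also have "\<dots> = 1 / m\<^sup>2" by simp
  finally show ?thesis .
qed

lemma integral_quotient_le:
  fixes e m :: real
  assumes e: "0 < e" and m: "0 < m"
  shows "integral {- 1/2..1/2} (\<lambda>x. e / (e\<^sup>2 + m\<^sup>2 * x\<^sup>2)) \<le> 4 / m"
proof -
  have D: "((\<lambda>x. arctan (m * x / e) / m) has_real_derivative e / (e\<^sup>2 + m\<^sup>2 * x\<^sup>2)) (at x)" for x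
  proof -
    have "((\<lambda>x. m * x / e) has_real_derivative m / e) (at x)" using e by (auto intro!: derivative_eq_intros)
    from DERIV_cdivide[OF DERIV_chain2[OF DERIV_arctan this], of m]
    have "((\<lambda>x. arctan (m * x / e) / m) has_real_derivative inverse (1 + (m * x / e)\<^sup>2) * (m / e) / m) (at x)" .
    moreover have "inverse (1 + (m * x / e)\<^sup>2) * (m / e) / m = e / (e\<^sup>2 + m\<^sup>2 * x\<^sup>2)"
    proof -
      have "1 + (m * x / e)\<^sup>2 = (e\<^sup>2 + m\<^sup>2 * x\<^sup>2) / e\<^sup>2" using e by (simp add: field_simps power2_eq_square)
      then show ?thesis using e m by (simp add: power2_eq_square)
    qed
    ultimately show ?thesis by simp
  qed
  have "integral {- 1/2..1/2} (\<lambda>x. e / (e\<^sup>2 + m\<^sup>2 * x\<^sup>2)) = arctan (m * (1/2) / e) / m - arctan (m * (- 1/2) / e) / m"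
    by (rule integral_unique[OF integral_DERIV[OF D]]) simp
  also have "\<dots> \<le> 2 / m - (- 2) / m"
  proof (intro diff_mono divide_right_mono)
    show "arctan (m * (1/2) / e) \<le> 2" using arctan_ubound[of "m * (1/2) / e"] pi_less_4 by linarith
    show "- 2 \<le> arctan (m * (- 1/2) / e)" using arctan_lbound[of "m * (- 1/2) / e"] pi_less_4 by linarith
  qed (use m in auto)
  finally show ?thesis by simp
qed

lemma smooth_periodic_le_total_variation:
  assumes X: "smooth_periodic X" "X 0 = 0"
  shows "\<bar>X x\<bar> \<le> integral {0..1} (\<lambda>x. \<bar>deriv X x\<bar>)"
proof -
  have D: "\<And>x. (X has_real_derivative deriv X x) (at x)" by (rule smooth_DERIV[OF smooth_periodicD(1)[OF X(1)]])
  have c: "continuous_on S (\<lambda>x. \<bar>deriv X x\<bar>)" for S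
    by (intro continuous_on_rabs smooth_periodicD[OF smooth_periodic_deriv[OF X(1)]])
  let ?y = "frac x"
  have y: "0 \<le> ?y" "?y \<le> 1" using frac_ge_0[of x] frac_lt_1[of x] by auto
  have I: "(deriv X has_integral X ?y - X 0) {0..?y}" by (rule integral_DERIV[OF D y(1)])
  have "\<bar>integral {0..?y} (deriv X)\<bar> \<le> integral {0..?y} (\<lambda>x. \<bar>deriv X x\<bar>)"
    using integral_norm_bound_integral[of "deriv X" "{0..?y}" "\<lambda>x. \<bar>deriv X x\<bar>"] I c
    by (auto intro: integrable_continuous_real)
  also have "\<dots> \<le> integral {0..1} (\<lambda>x. \<bar>deriv X x\<bar>)"
    using y by (intro integral_subset_le integrable_continuous_real c) auto
  finally have "\<bar>X ?y\<bar> \<le> integral {0..1} (\<lambda>x. \<bar>deriv X x\<bar>)" using integral_unique[OF I] X(2) by simp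
  moreover have "X ?y = X x" by (rule periodic_frac[of X, OF smooth_periodicD(2)[OF X(1)]])
  ultimately show ?thesis by simp
qed

lemma integral_affine_centred:
  fixes F :: "real \<Rightarrow> real"
  assumes "continuous_on {- 1/2..1/2} F"
  shows "integral {- 1/2..1/2} (\<lambda>x. a + b * F x) = a + b * integral {- 1/2..1/2} F"
proof -
  have "((\<lambda>x. a + b * F x) has_integral measure lborel {- 1/2..1/2::real} *\<^sub>R a + b * integral {- 1/2..1/2} F) {- 1/2..1/2}"
    by (intro has_integral_add has_integral_const_real has_integral_mult_right integrable_integral integrable_continuous_real assms)
  then show ?thesis by (simp add: integral_unique)
qed

text \<open>Let \<open>G = c \<circ> g\<close> and \<open>H = c \<circ> h\<close>. The ratio of
  their derivatives is bounded above and below and has bounded variation, uniformly in the scale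
  \<open>e\<close> of \<open>c\<close>, whereas the \<open>L^1\<close> distance of the derivatives
  is at most a constant divided by \<open>Z\<close>. On the straight line from \<open>G\<close> to
  \<open>H\<close> the slope bound and the second variation thus stay fixed while the first
  variation is as small as desired.\<close>

lemma reach_concentrated:
  assumes p: "1 < p" and s: "0 \<le> s" "s < 1 + 1 / p" and P: "admissible_pu P"
    and g: "diff_lift g" "g 0 = real_of_int k" and h: "diff_lift h" "h 0 = real_of_int k" and r: "0 < r"
  obtains c where "diff_lift c" "c 0 = 0"
    "\<And>x. 0 \<le> x \<Longrightarrow> x \<le> 1/2 \<Longrightarrow> deriv (deriv c) x \<le> 0" "\<And>x. 1/2 \<le> x \<Longrightarrow> x \<le> 1 \<Longrightarrow> 0 \<le> deriv (deriv c) x"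
    "reach P s p (\<lambda>x. c (g x)) (\<lambda>x. c (h x)) (ennreal r)"
proof -
  obtain C0 \<alpha> where C0: "0 < C0" and \<alpha>: "0 \<le> \<alpha>" "\<alpha> < 1" and W:
    "\<And>X K N V. smooth_periodic X \<Longrightarrow> 0 \<le> K \<Longrightarrow> 0 < N \<Longrightarrow> N \<le> V \<Longrightarrow> (\<And>x. \<bar>X x\<bar> \<le> K) \<Longrightarrow> (\<And>x. \<bar>deriv X x\<bar> \<le> K) \<Longrightarrow> (\<And>x. \<bar>X x\<bar> \<le> N) \<Longrightarrow>
      integral {0..1} (\<lambda>x. \<bar>deriv X x\<bar>) \<le> N \<Longrightarrow> integral {0..1} (\<lambda>x. \<bar>deriv (deriv X) x\<bar>) \<le> V \<Longrightarrow>
      W_norm_S1 P s p X \<le> ennreal (C0 * (K powr (p - 1) * (V powr \<alpha> * N powr (1 - \<alpha>))) powr (1 / p))"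
    by (rule W_norm_S1_bound_total_variation[OF p s P]) blast
  have per: "smooth_periodic (deriv g)" "smooth_periodic (deriv h)"
    using g h by (auto simp: smooth_periodic_def diff_lift_deriv_shift intro: smooth_deriv diff_lift_smooth)
  obtain m1 where m1: "0 < m1" "\<And>x. m1 \<le> deriv g x"
    by (rule continuous_periodic_pos_lower_bound[OF smooth_periodicD(3)[OF per(1)] smooth_periodicD(2)[OF per(1)] diff_lift_deriv_pos[OF g(1)]]) blast
  obtain m2 where m2: "0 < m2" "\<And>x. m2 \<le> deriv h x"
    by (rule continuous_periodic_pos_lower_bound[OF smooth_periodicD(3)[OF per(2)] smooth_periodicD(2)[OF per(2)] diff_lift_deriv_pos[OF h(1)]]) blast
  obtain M1 where M1: "0 < M1" "\<And>x. \<bar>deriv g x\<bar> \<le> M1" by (rule smooth_periodic_bounded[OF per(1)]) blast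
  obtain M2 where M2: "0 < M2" "\<And>x. \<bar>deriv h x\<bar> \<le> M2" by (rule smooth_periodic_bounded[OF per(2)]) blast
  obtain M3 where M3: "0 < M3" "\<And>x. \<bar>deriv (deriv g) x\<bar> \<le> M3" by (rule smooth_periodic_bounded[OF smooth_periodic_deriv[OF per(1)]]) blast
  obtain M4 where M4: "0 < M4" "\<And>x. \<bar>deriv (deriv h) x\<bar> \<le> M4" by (rule smooth_periodic_bounded[OF smooth_periodic_deriv[OF per(2)]]) blast
  define m where "m = min 1 (min m1 m2)"
  define M where "M = 1 + M1 + M2 + M3 + M4"
  have m: "0 < m" "m \<le> 1" using m1 m2 by (auto simp: m_def)
  have M: "1 \<le> M" "0 < M" using M1 M2 M3 M4 by (auto simp: M_def)
  have gb: "m \<le> deriv g x" "deriv g x \<le> M" "m \<le> deriv h x" "deriv h x \<le> M"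
    "\<bar>deriv (deriv g) x\<bar> \<le> M" "\<bar>deriv (deriv h) x\<bar> \<le> M" "0 \<le> deriv g x" "0 \<le> deriv h x" for x
    using m1(2)[of x] m2(2)[of x] M1 M2 M3 M4 M1(2)[of x] M2(2)[of x] M3(2)[of x] M4(2)[of x] m1(1) m2(1)
    unfolding m_def M_def by linarith+
  have M23: "M \<le> M ^ 3" "M ^ 2 \<le> M ^ 3" using M power_increasing[of 1 3 M] power_increasing[of 2 3 M] by auto
  define Sg where "Sg x = sin (pi * g x)" for x
  define Sh where "Sh x = sin (pi * h x)" for x
  define Cg where "Cg x = cos (pi * g x)" for x
  define Ch where "Ch x = cos (pi * h x)" for x
  have gl: "\<bar>g x - g 0\<bar> \<le> M * \<bar>x\<bar>" "\<bar>h x - h 0\<bar> \<le> M * \<bar>x\<bar>" for x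
    using smooth_DERIV_lipschitz[OF diff_lift_smooth[OF g(1)], of M x 0] smooth_DERIV_lipschitz[OF diff_lift_smooth[OF h(1)], of M x 0]
      gb by (auto simp: abs_of_nonneg)
  have S0: "Sg 0 = 0" "Sh 0 = 0" by (simp_all add: Sg_def Sh_def g h)
  have Sb: "\<bar>Sg x\<bar> \<le> 4 * M * \<bar>x\<bar>" "\<bar>Sh x\<bar> \<le> 4 * M * \<bar>x\<bar>" for x
    using abs_sin_pi_diff_le[of "g x" "g 0"] abs_sin_pi_diff_le[of "h x" "h 0"] gl[of x] S0 by (auto simp: Sg_def Sh_def)
  have S1: "\<bar>Sg x\<bar> \<le> 1" "\<bar>Sh x\<bar> \<le> 1" "\<bar>Cg x\<bar> \<le> 1" "\<bar>Ch x\<bar> \<le> 1" for x by (auto simp: Sg_def Sh_def Cg_def Ch_def)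
  have Cd: "\<bar>Cg x - Ch x\<bar> \<le> 8 * M * \<bar>x\<bar>" for x
  proof -
    have "norm (cos (pi * g x) - cos (pi * h x)) \<le> 1 * norm (pi * g x - pi * h x)"
      by (rule field_differentiable_bound[of UNIV cos "\<lambda>x. - sin x"]) (auto intro!: derivative_eq_intros)
    then have "\<bar>Cg x - Ch x\<bar> \<le> pi * \<bar>g x - h x\<bar>" by (simp add: Cg_def Ch_def abs_mult flip: right_diff_distrib)
    also have "\<dots> \<le> 4 * \<bar>g x - h x\<bar>" using pi_less_4 by (intro mult_right_mono) auto
    also have "\<bar>g x - h x\<bar> \<le> 2 * M * \<bar>x\<bar>" using gl[of x] g(2) h(2) by linarith
    finally show ?thesis by simp
  qed
  have Slow: "m * \<bar>x\<bar> \<le> \<bar>Sg x\<bar>" "m * \<bar>x\<bar> \<le> \<bar>Sh x\<bar>" if "\<bar>x\<bar> \<le> 1/2" for x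
    unfolding Sg_def Sh_def by (intro abs_sin_pi_diff_lift_ge[OF g] abs_sin_pi_diff_lift_ge[OF h] gb m that)+
  have DS: "(Sg has_real_derivative Cg x * (pi * deriv g x)) (at x)" "(Sh has_real_derivative Ch x * (pi * deriv h x)) (at x)"
    "(Cg has_real_derivative - Sg x * (pi * deriv g x)) (at x)" "(Ch has_real_derivative - Sh x * (pi * deriv h x)) (at x)" for x
    unfolding Sg_def[abs_def] Sh_def[abs_def] Cg_def[abs_def] Ch_def[abs_def]
    by (auto intro!: derivative_eq_intros diff_lift_DERIV g h)
  have D2: "(deriv g has_real_derivative deriv (deriv g) x) (at x)" "(deriv h has_real_derivative deriv (deriv h) x) (at x)" for x
    by (intro smooth_DERIV smooth_deriv diff_lift_smooth g h)+
  \<comment> \<open>These combinations are the antisymmetric parts of the numerators below. As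
    \<open>g 0 = h 0\<close>, the first order terms of \<open>Sg\<close> and \<open>Sh\<close>
    cancel in them, and they vanish to second order at 0; without this cancellation the integrals
    would diverge logarithmically in \<open>e\<close>.\<close>
  define W1 where "W1 x = deriv g x * Cg x * Sh x - deriv h x * Ch x * Sg x" for x
  define W2 where "W2 x = deriv h x * Sg x - deriv g x * Sh x" for x
  have W1b: "\<bar>W1 x\<bar> \<le> 24 * M ^ 3 * x\<^sup>2" for x
  proof (rule abs_le_quadratic)
    let ?W = "\<lambda>x. deriv (deriv g) x * Cg x * Sh x - deriv (deriv h) x * Ch x * Sg x + pi * ((deriv h x)\<^sup>2 - (deriv g x)\<^sup>2) * Sg x * Sh x"
    show "(W1 has_real_derivative ?W x) (at x)" for x
      unfolding W1_def[abs_def]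
      by (auto intro!: derivative_eq_intros DS D2 simp: power2_eq_square algebra_simps)
    show "\<bar>?W x\<bar> \<le> 24 * M ^ 3 * \<bar>x\<bar>" for x
    proof -
      have a: "\<bar>deriv (deriv g) x * Cg x * Sh x\<bar> \<le> M * 1 * (4 * M * \<bar>x\<bar>)" "\<bar>deriv (deriv h) x * Ch x * Sg x\<bar> \<le> M * 1 * (4 * M * \<bar>x\<bar>)"
        unfolding abs_mult using M by (intro mult_mono gb S1 Sb; simp)+
      have "(deriv h x)\<^sup>2 \<le> M\<^sup>2" "(deriv g x)\<^sup>2 \<le> M\<^sup>2" using gb[of x] by (intro power_mono; simp)+
      moreover have "0 \<le> (deriv h x)\<^sup>2" "0 \<le> (deriv g x)\<^sup>2" by simp_all
      ultimately have "\<bar>(deriv h x)\<^sup>2 - (deriv g x)\<^sup>2\<bar> \<le> M\<^sup>2" by linarith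
      then have b: "\<bar>pi * ((deriv h x)\<^sup>2 - (deriv g x)\<^sup>2) * Sg x * Sh x\<bar> \<le> 4 * M\<^sup>2 * 1 * (4 * M * \<bar>x\<bar>)"
        unfolding abs_mult using pi_less_4 M by (intro mult_mono S1 Sb; simp)
      have "\<bar>?W x\<bar> \<le> 8 * M\<^sup>2 * \<bar>x\<bar> + 16 * M ^ 3 * \<bar>x\<bar>"
        using a b by (simp add: power2_eq_square power3_eq_cube)
      also have "8 * M\<^sup>2 * \<bar>x\<bar> \<le> 8 * M ^ 3 * \<bar>x\<bar>" using M23 by (intro mult_right_mono) auto
      finally show ?thesis by (simp add: algebra_simps)
    qed
  qed (use M in \<open>auto simp: W1_def S0\<close>)
  have W2b: "\<bar>W2 x\<bar> \<le> 40 * M ^ 3 * x\<^sup>2" for x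
  proof (rule abs_le_quadratic)
    let ?W = "\<lambda>x. deriv (deriv h) x * Sg x - deriv (deriv g) x * Sh x + pi * deriv h x * deriv g x * (Cg x - Ch x)"
    show "(W2 has_real_derivative ?W x) (at x)" for x
      unfolding W2_def[abs_def]
      by (auto intro!: derivative_eq_intros DS D2 simp: algebra_simps)
    show "\<bar>?W x\<bar> \<le> 40 * M ^ 3 * \<bar>x\<bar>" for x
    proof -
      have a: "\<bar>deriv (deriv h) x * Sg x\<bar> \<le> M * (4 * M * \<bar>x\<bar>)" "\<bar>deriv (deriv g) x * Sh x\<bar> \<le> M * (4 * M * \<bar>x\<bar>)"
        unfolding abs_mult using M by (intro mult_mono gb Sb; simp)+
      have b: "\<bar>pi * deriv h x * deriv g x * (Cg x - Ch x)\<bar> \<le> 4 * M * M * (8 * M * \<bar>x\<bar>)"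
        unfolding abs_mult using pi_less_4 M gb[of x] by (intro mult_mono Cd) simp_all
      have "\<bar>?W x\<bar> \<le> 8 * M\<^sup>2 * \<bar>x\<bar> + 32 * M ^ 3 * \<bar>x\<bar>"
        using a b by (simp add: power2_eq_square power3_eq_cube)
      also have "8 * M\<^sup>2 * \<bar>x\<bar> \<le> 8 * M ^ 3 * \<bar>x\<bar>" using M23 by (intro mult_right_mono) auto
      finally show ?thesis by (simp add: algebra_simps)
    qed
  qed (use M in \<open>auto simp: W2_def S0\<close>)
  define \<kappa> where "\<kappa> = 4 * M\<^sup>2 / m\<^sup>2"
  have \<kappa>: "1 \<le> \<kappa>"
  proof -
    have "m\<^sup>2 \<le> 1" "1 \<le> M\<^sup>2" using m M by (auto intro: power_le_one one_le_power)
    then have "m\<^sup>2 \<le> 4 * M\<^sup>2" by linarith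
    then show ?thesis using m by (simp add: \<kappa>_def)
  qed
  \<comment> \<open>All of these depend on \<open>m\<close> and \<open>M\<close> only:
    \<open>c1\<close> and \<open>c2\<close> bound the derivative of the ratio, \<open>c3\<close> and
    \<open>c4\<close> the difference of the unnormalised densities. The scale \<open>e\<close> is
    chosen afterwards.\<close>
  define c1 where "c1 = 2 * M\<^sup>2 / m\<^sup>2 * (4 * M / m) + M / m * (2 * M / m) * (3072 * M ^ 5 / m ^ 4)"
  define c2 where "c2 = M / m * (2 * M / m) * (64 * M\<^sup>2)"
  define c3 where "c3 = 320 * M ^ 5 / (2 * m * m ^ 3)"
  define c4 where "c4 = M\<^sup>2 / (2 * m)"
  define V where "V = \<kappa>\<^sup>2 * (c1 + c2 / m\<^sup>2) + 1"
  define N0 where "N0 = c3 + c4 * (4 / m)"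
  have cpos: "0 \<le> c1" "0 \<le> c2" "0 \<le> c3" "0 \<le> c4" using m M by (auto simp: c1_def c2_def c3_def c4_def)
  have V1: "1 \<le> V" using cpos \<kappa> by (simp add: V_def)
  have N0: "0 \<le> N0" using cpos m by (simp add: N0_def)
  define K where "K = \<kappa>\<^sup>2 + 1"
  \<comment> \<open>Solves the norm bound for the first variation: any variation up to
    \<open>\<nu>\<close> gives a speed of at most \<open>r\<close>.\<close>
  define \<rho> where "\<rho> = r / (C0 * (K powr (p - 1) * V powr \<alpha>) powr (1 / p))"
  have K1: "1 \<le> K" by (simp add: K_def)
  have \<rho>0: "0 < \<rho>" unfolding \<rho>_def using r C0 K1 V1 by (intro divide_pos_pos mult_pos_pos) auto
  define \<nu> where "\<nu> = min 1 (\<rho> powr (p / (1 - \<alpha>)))"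
  have \<nu>: "0 < \<nu>" "\<nu> \<le> 1" using \<rho>0 by (auto simp: \<nu>_def)
  have \<nu>r: "C0 * (K powr (p - 1) * (V powr \<alpha> * \<nu> powr (1 - \<alpha>))) powr (1 / p) \<le> r"
  proof -
    have "(\<nu> powr (1 - \<alpha>)) powr (1 / p) \<le> ((\<rho> powr (p / (1 - \<alpha>))) powr (1 - \<alpha>)) powr (1 / p)"
      using \<nu> p \<alpha> by (intro powr_mono2) (auto simp: \<nu>_def)
    also have "\<dots> = \<rho>" using \<rho>0 p \<alpha> by (simp add: powr_powr)
    finally have "(\<nu> powr (1 - \<alpha>)) powr (1 / p) \<le> \<rho>" .
    then have "C0 * (K powr (p - 1) * V powr \<alpha>) powr (1 / p) * (\<nu> powr (1 - \<alpha>)) powr (1 / p) \<le> C0 * (K powr (p - 1) * V powr \<alpha>) powr (1 / p) * \<rho>"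
      using C0 by (intro mult_left_mono) auto
    also have "\<dots> = r" using C0 K1 V1 by (simp add: \<rho>_def)
    finally show ?thesis by (simp only: powr_mult mult.assoc)
  qed
  \<comment> \<open>Small enough for \<open>Z \<ge> ln (2 / e) / 4 \<ge> N0 / \<nu>\<close>.\<close>
  define e where "e = 2 / exp (4 * (N0 / \<nu>) + 1)"
  have e: "0 < e" by (simp add: e_def)
  obtain c Z where c: "diff_lift c" "c 0 = 0" and Z: "0 < Z" "ln (1 + 2 / e) / 4 \<le> Z"
    and dc: "\<And>x. deriv c x = (e\<^sup>2 + (sin (pi * x))\<^sup>2) powr (- 1 / 2) / Z"
    and uni: "\<And>x. 0 \<le> x \<Longrightarrow> x \<le> 1/2 \<Longrightarrow> deriv (deriv c) x \<le> 0" "\<And>x. 1/2 \<le> x \<Longrightarrow> x \<le> 1 \<Longrightarrow> 0 \<le> deriv (deriv c) x"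
    by (rule logarithmic_density[OF e]) blast
  have ZN: "N0 / Z \<le> \<nu>"
  proof -
    have "ln (2 / e) = 4 * (N0 / \<nu>) + 1" by (simp add: e_def)
    moreover have "ln (2 / e) \<le> ln (1 + 2 / e)" using e by (intro ln_mono) auto
    ultimately have "N0 / \<nu> \<le> Z" using Z(2) by linarith
    then show ?thesis using \<nu> Z by (simp add: divide_le_eq mult.commute)
  qed
  define A where "A x = e\<^sup>2 + (Sh x)\<^sup>2" for x
  define B where "B x = e\<^sup>2 + (Sg x)\<^sup>2" for x
  have AB: "0 < A x" "0 < B x" for x using e by (simp_all add: A_def B_def add_pos_nonneg)
  define G where "G x = c (g x)" for x
  define H where "H x = c (h x)" for x
  have G: "diff_lift G" and H: "diff_lift H"
    unfolding G_def H_def by (rule diff_lift_compose[OF c(1) g(1)], rule diff_lift_compose[OF c(1) h(1)])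
  have G': "deriv G x = deriv g x / sqrt (B x) / Z" and H': "deriv H x = deriv h x / sqrt (A x) / Z" for x
  proof -
    have q: "q powr (- 1 / 2) = 1 / sqrt q" if "0 < q" for q :: real
      using that by (simp add: powr_minus_divide powr_half_sqrt)
    have "deriv G x = deriv c (g x) * deriv g x" "deriv H x = deriv c (h x) * deriv h x"
      unfolding G_def H_def by (intro DERIV_imp_deriv DERIV_chain2 diff_lift_DERIV c g h)+
    then show "deriv G x = deriv g x / sqrt (B x) / Z" "deriv H x = deriv h x / sqrt (A x) / Z"
      using q[OF AB(1)[of x]] q[OF AB(2)[of x]] by (simp_all add: dc A_def B_def Sg_def Sh_def)
  qed
  \<comment> \<open>The derivative of the velocity, seen from the source, is a function of this
    ratio and of \<open>t\<close>; so bounds for \<open>R\<close> and its variation suffice for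
    slope and second variation.\<close>
  define R where "R x = deriv H x / deriv G x" for x
  have sR: "smooth_periodic R"
  proof -
    have "smooth R" unfolding R_def[abs_def]
      by (intro smooth_divide smooth_deriv diff_lift_smooth G H diff_lift_deriv_pos)
    then show ?thesis by (simp add: smooth_periodic_def R_def diff_lift_deriv_shift[OF G] diff_lift_deriv_shift[OF H])
  qed
  define ra where "ra x = deriv h x / deriv g x" for x
  have Rra: "R x = ra x * sqrt (B x / A x)" for x
    using Z AB[of x] diff_lift_deriv_pos[OF g(1), of x] by (simp add: R_def G' H' ra_def real_sqrt_divide field_simps)
  have ra: "ra x \<le> M / m" "m / M \<le> ra x" "0 \<le> ra x" for x
    unfolding ra_def using gb[of x] m M diff_lift_deriv_pos[OF g(1), of x] by (auto intro!: frac_le)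
  \<comment> \<open>On the centred period this quadratic is comparable, with constants free of
    \<open>e\<close>, to both \<open>A\<close> and \<open>B\<close>.\<close>
  let ?q = "\<lambda>x. e\<^sup>2 + m\<^sup>2 * x\<^sup>2"
  have q0: "0 < ?q x" for x using e by (simp add: add_pos_nonneg)
  have qAB: "?q x \<le> A x" "?q x \<le> B x" if "\<bar>x\<bar> \<le> 1/2" for x
  proof -
    have "(m * \<bar>x\<bar>)\<^sup>2 \<le> \<bar>Sg x\<bar>\<^sup>2" "(m * \<bar>x\<bar>)\<^sup>2 \<le> \<bar>Sh x\<bar>\<^sup>2" using Slow[OF that] m by (intro power_mono; simp)+
    then show "?q x \<le> A x" "?q x \<le> B x" by (simp_all add: A_def B_def power_mult_distrib)
  qed
  have ABq: "A x \<le> (4 * M / m)\<^sup>2 * ?q x" "B x \<le> (4 * M / m)\<^sup>2 * ?q x" for x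
  proof -
    have S2: "(Sg x)\<^sup>2 \<le> (4 * M)\<^sup>2 * x\<^sup>2" "(Sh x)\<^sup>2 \<le> (4 * M)\<^sup>2 * x\<^sup>2"
      using power_mono[OF Sb(1)[of x], of 2] power_mono[OF Sb(2)[of x], of 2] by (simp_all add: power_mult_distrib)
    have "1 \<le> 4 * M / m" using m M by (simp add: le_divide_eq)
    then have "1 * e\<^sup>2 \<le> (4 * M / m)\<^sup>2 * e\<^sup>2" by (intro mult_right_mono one_le_power) auto
    moreover have "(4 * M / m)\<^sup>2 * (m\<^sup>2 * x\<^sup>2) = (4 * M)\<^sup>2 * x\<^sup>2" using m by (simp add: power_divide)
    ultimately show "A x \<le> (4 * M / m)\<^sup>2 * ?q x" "B x \<le> (4 * M / m)\<^sup>2 * ?q x"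
      using S2 unfolding A_def B_def distrib_left by linarith+
  qed
  have sq: "sqrt (B x / A x) \<le> 4 * M / m" "m / (4 * M) \<le> sqrt (B x / A x)" if "\<bar>x\<bar> \<le> 1/2" for x
  proof -
    have u: "sqrt (v / w) \<le> 4 * M / m" if "v \<le> (4 * M / m)\<^sup>2 * ?q x" "?q x \<le> w" for v w
    proof (rule real_le_lsqrt)
      have "v \<le> (4 * M / m)\<^sup>2 * w" using that by (meson mult_left_mono order_trans zero_le_power2)
      moreover have "0 < w" using that(2) q0[of x] by linarith
      ultimately show "v / w \<le> (4 * M / m)\<^sup>2" by (simp add: divide_le_eq)
    qed (use m M in auto)
    show "sqrt (B x / A x) \<le> 4 * M / m" by (rule u[OF ABq(2) qAB(1)[OF that]])
    have "sqrt (A x / B x) \<le> 4 * M / m" by (rule u[OF ABq(1) qAB(2)[OF that]])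
    then have "1 / (4 * M / m) \<le> 1 / sqrt (A x / B x)" using AB[of x] m M by (intro divide_left_mono mult_pos_pos) auto
    then show "m / (4 * M) \<le> sqrt (B x / A x)" by (simp add: real_sqrt_divide)
  qed
  have Rb0: "R x \<le> \<kappa> \<and> 1 / \<kappa> \<le> R x" if "\<bar>x\<bar> \<le> 1/2" for x
  proof
    have "R x \<le> M / m * (4 * M / m)" unfolding Rra using ra sq[OF that] m M AB[of x] by (intro mult_mono) auto
    then show "R x \<le> \<kappa>" by (simp add: \<kappa>_def power2_eq_square ac_simps)
    have "m / M * (m / (4 * M)) \<le> R x" unfolding Rra using ra sq[OF that] m M by (intro mult_mono) auto
    then show "1 / \<kappa> \<le> R x" by (simp add: \<kappa>_def power2_eq_square mult.commute)
  qed
  \<comment> \<open>The comparison with \<open>?q\<close> holds on the centred period only;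
    periodicity of \<open>R\<close> extends the bounds by rounding.\<close>
  have Rb: "R x \<le> \<kappa>" "1 / \<kappa> \<le> R x" for x
  proof -
    have "\<bar>x - real_of_int (round x)\<bar> \<le> 1/2" using of_int_round_abs_le[of x] by (simp add: abs_minus_commute)
    moreover have "R (x - real_of_int (round x)) = R x"
      using periodic_of_int[of R 0 x "- round x"] smooth_periodicD(2)[OF sR] by simp
    ultimately show "R x \<le> \<kappa>" "1 / \<kappa> \<le> R x" using Rb0[of "x - real_of_int (round x)"] by simp_all
  qed
  have Rpos: "0 < R x" for x using diff_lift_deriv_pos[OF G, of x] diff_lift_deriv_pos[OF H, of x] by (simp add: R_def)
  have period: "integral {0..1} f = integral {- 1/2..1/2} f" if "continuous_on UNIV f" "\<And>x. f (x + 1) = f x" for f :: "real \<Rightarrow> real"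
    using integral_periodic_shift[of f "- 1/2", OF that] by simp
  have xq: "\<bar>x\<bar> ^ 2 / ?q x \<le> 1 / m ^ 2" for x
    using q0[of x] m by (simp add: divide_simps)
  have cq: "continuous_on UNIV ?q" by (intro continuous_intros)
  have VR: "integral {0..1} (\<lambda>x. \<bar>deriv R x\<bar>) \<le> c1 + c2 / m\<^sup>2"
  proof -
    \<comment> \<open>A bounded part plus a multiple of the quotient whose integral is bounded
      uniformly in \<open>e\<close>.\<close>
    have Rd: "\<bar>deriv R x\<bar> \<le> c1 + c2 * (e\<^sup>2 * \<bar>x\<bar> / (?q x)\<^sup>2)" if x: "\<bar>x\<bar> \<le> 1/2" for x
    proof -
      let ?U = "B x / A x"
      let ?ra' = "(deriv (deriv h) x * deriv g x - deriv h x * deriv (deriv g) x) / (deriv g x * deriv g x)"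
      let ?A' = "2 * Sh x * (Ch x * (pi * deriv h x))" and ?B' = "2 * Sg x * (Cg x * (pi * deriv g x))"
      let ?U' = "(?B' * A x - B x * ?A') / (A x * A x)"
      have gne: "deriv g x \<noteq> 0" using diff_lift_deriv_pos[OF g(1), of x] by simp
      have "(ra has_real_derivative ?ra') (at x)"
        unfolding ra_def[abs_def] by (rule DERIV_divide[OF D2(2) D2(1) gne])
      moreover have DA: "(A has_real_derivative ?A') (at x)" "(B has_real_derivative ?B') (at x)"
        unfolding A_def[abs_def] B_def[abs_def] by (auto intro!: derivative_eq_intros DS)
      have "A x \<noteq> 0" using AB[of x] by simp
      then have "((\<lambda>x. B x / A x) has_real_derivative ?U') (at x)" by (rule DERIV_divide[OF DA(2) DA(1)])
      from DERIV_chain2[OF DERIV_real_sqrt this] AB[of x]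
      have "((\<lambda>x. sqrt (B x / A x)) has_real_derivative inverse (sqrt ?U) / 2 * ?U') (at x)" by simp
      ultimately have "(R has_real_derivative ?ra' * sqrt ?U + inverse (sqrt ?U) / 2 * ?U' * ra x) (at x)"
        unfolding Rra[abs_def] by (rule DERIV_mult)
      then have dR: "deriv R x = ?ra' * sqrt ?U + inverse (sqrt ?U) / 2 * ?U' * ra x" by (rule DERIV_imp_deriv)
      have ra'b: "\<bar>?ra'\<bar> \<le> 2 * M\<^sup>2 / m\<^sup>2"
        unfolding abs_divide
      proof (rule frac_le)
        have "\<bar>deriv (deriv h) x * deriv g x - deriv h x * deriv (deriv g) x\<bar> \<le> \<bar>deriv (deriv h) x\<bar> * \<bar>deriv g x\<bar> + \<bar>deriv h x\<bar> * \<bar>deriv (deriv g) x\<bar>"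
          by (metis abs_mult abs_triangle_ineq4)
        also have "\<dots> \<le> M * M + M * M" using gb[of x] M by (intro add_mono mult_mono) auto
        finally show "\<bar>deriv (deriv h) x * deriv g x - deriv h x * deriv (deriv g) x\<bar> \<le> 2 * M\<^sup>2" by (simp add: power2_eq_square)
        have "m * m \<le> deriv g x * deriv g x" using gb[of x] m by (intro mult_mono) auto
        then show "m\<^sup>2 \<le> \<bar>deriv g x * deriv g x\<bar>" by (simp add: power2_eq_square)
      qed (use m in auto)
      have isq: "\<bar>inverse (sqrt ?U) / 2\<bar> \<le> 2 * M / m"
      proof -
        have "0 < m / (4 * M)" using m M by simp
        then have "inverse (sqrt ?U) \<le> inverse (m / (4 * M))" using sq(2)[OF x] by (intro le_imp_inverse_le) auto
        moreover have "0 \<le> inverse (sqrt ?U)" using AB[of x] by simp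
        ultimately show ?thesis by simp
      qed
      have U'b: "\<bar>?U'\<bar> \<le> 64 * M\<^sup>2 * (e\<^sup>2 * \<bar>x\<bar> / (?q x)\<^sup>2) + 3072 * M ^ 5 / m ^ 4"
      proof -
        \<comment> \<open>The part with \<open>e^2\<close> is of order
          \<open>e^2 * \<bar>x\<bar>\<close> and the rest, containing \<open>W1\<close>, of order
          \<open>x^4\<close>. After division by the square of \<open>?q\<close> the rest is
          bounded.\<close>
        have num: "?B' * A x - B x * ?A' = 2 * pi * (e\<^sup>2 * (deriv g x * Cg x * Sg x - deriv h x * Ch x * Sh x) + Sg x * Sh x * W1 x)"
          by (simp add: A_def B_def W1_def power2_eq_square algebra_simps)
        have n1: "\<bar>deriv g x * Cg x * Sg x - deriv h x * Ch x * Sh x\<bar> \<le> 8 * M\<^sup>2 * \<bar>x\<bar>"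
        proof -
          have "\<bar>deriv g x * Cg x * Sg x\<bar> \<le> M * 1 * (4 * M * \<bar>x\<bar>)" "\<bar>deriv h x * Ch x * Sh x\<bar> \<le> M * 1 * (4 * M * \<bar>x\<bar>)"
            unfolding abs_mult using M gb[of x] by (intro mult_mono S1 Sb; simp)+
          then show ?thesis by (simp add: power2_eq_square)
        qed
        have n2: "\<bar>Sg x * Sh x * W1 x\<bar> \<le> (4 * M * \<bar>x\<bar>) * (4 * M * \<bar>x\<bar>) * (24 * M ^ 3 * x\<^sup>2)"
          unfolding abs_mult using M by (intro mult_mono Sb W1b) auto
        have "\<bar>?B' * A x - B x * ?A'\<bar> \<le> 2 * 4 * (e\<^sup>2 * (8 * M\<^sup>2 * \<bar>x\<bar>) + (4 * M * \<bar>x\<bar>) * (4 * M * \<bar>x\<bar>) * (24 * M ^ 3 * x\<^sup>2))"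
          unfolding num abs_mult[of "2 * pi"]
        proof (rule mult_mono)
          have "\<bar>e\<^sup>2 * (deriv g x * Cg x * Sg x - deriv h x * Ch x * Sh x)\<bar> \<le> e\<^sup>2 * (8 * M\<^sup>2 * \<bar>x\<bar>)"
            unfolding abs_mult[of "e\<^sup>2"] using n1 by (intro mult_mono) auto
          then show "\<bar>e\<^sup>2 * (deriv g x * Cg x * Sg x - deriv h x * Ch x * Sh x) + Sg x * Sh x * W1 x\<bar>
             \<le> e\<^sup>2 * (8 * M\<^sup>2 * \<bar>x\<bar>) + (4 * M * \<bar>x\<bar>) * (4 * M * \<bar>x\<bar>) * (24 * M ^ 3 * x\<^sup>2)"
            using n2 by linarith
        qed (use pi_less_4 in auto)
        also have "\<dots> = 64 * M\<^sup>2 * (e\<^sup>2 * \<bar>x\<bar>) + 3072 * M ^ 5 * (\<bar>x\<bar>\<^sup>2 * \<bar>x\<bar>\<^sup>2)"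
          by (simp add: power2_eq_square numeral_eq_Suc algebra_simps)
        finally have nb: "\<bar>?B' * A x - B x * ?A'\<bar> \<le> 64 * M\<^sup>2 * (e\<^sup>2 * \<bar>x\<bar>) + 3072 * M ^ 5 * (\<bar>x\<bar>\<^sup>2 * \<bar>x\<bar>\<^sup>2)" .
        have "?q x * ?q x \<le> A x * A x" using qAB[OF x] less_imp_le[OF q0[of x]] AB[of x] by (intro mult_mono) auto
        then have "\<bar>?U'\<bar> \<le> (64 * M\<^sup>2 * (e\<^sup>2 * \<bar>x\<bar>) + 3072 * M ^ 5 * (\<bar>x\<bar>\<^sup>2 * \<bar>x\<bar>\<^sup>2)) / (?q x * ?q x)"
          unfolding abs_divide using nb q0[of x] M by (intro frac_le) auto
        also have "\<dots> = 64 * M\<^sup>2 * (e\<^sup>2 * \<bar>x\<bar> / (?q x)\<^sup>2) + 3072 * M ^ 5 * ((\<bar>x\<bar>\<^sup>2 / ?q x) * (\<bar>x\<bar>\<^sup>2 / ?q x))"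
          by (simp add: add_divide_distrib power2_eq_square[of "?q x"])
        also have "(\<bar>x\<bar>\<^sup>2 / ?q x) * (\<bar>x\<bar>\<^sup>2 / ?q x) \<le> (1 / m\<^sup>2) * (1 / m\<^sup>2)"
          using q0[of x] by (intro mult_mono xq) auto
        finally show ?thesis using M by (simp add: mult_left_mono flip: power_add)
      qed
      have "\<bar>deriv R x\<bar> \<le> \<bar>?ra'\<bar> * \<bar>sqrt ?U\<bar> + \<bar>inverse (sqrt ?U) / 2\<bar> * \<bar>?U'\<bar> * \<bar>ra x\<bar>"
        unfolding dR by (rule order_trans[OF abs_triangle_ineq]) (simp only: abs_mult order_refl)
      also have "\<dots> \<le> 2 * M\<^sup>2 / m\<^sup>2 * (4 * M / m) + (2 * M / m) * (64 * M\<^sup>2 * (e\<^sup>2 * \<bar>x\<bar> / (?q x)\<^sup>2) + 3072 * M ^ 5 / m ^ 4) * (M / m)"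
        using sq[OF x] ra[of x] m M AB[of x] by (intro add_mono mult_mono ra'b isq U'b) auto
      also have "\<dots> = c1 + c2 * (e\<^sup>2 * \<bar>x\<bar> / (?q x)\<^sup>2)" by (simp add: c1_def c2_def algebra_simps)
      finally show ?thesis .
    qed
    have cd: "continuous_on S (\<lambda>x. \<bar>deriv R x\<bar>)" for S by (intro continuous_on_rabs smooth_periodicD[OF smooth_periodic_deriv[OF sR]])
    have cr: "continuous_on UNIV (\<lambda>x. e\<^sup>2 * \<bar>x\<bar> / (?q x)\<^sup>2)"
      using cq q0 by (intro continuous_on_divide continuous_on_mult_left continuous_on_rabs continuous_on_id continuous_on_power) (simp_all add: less_imp_neq[symmetric])
    have "integral {0..1} (\<lambda>x. \<bar>deriv R x\<bar>) = integral {- 1/2..1/2} (\<lambda>x. \<bar>deriv R x\<bar>)"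
      by (rule period[OF cd]) (simp add: smooth_periodicD(2)[OF smooth_periodic_deriv[OF sR]])
    also have "\<dots> \<le> integral {- 1/2..1/2} (\<lambda>x. c1 + c2 * (e\<^sup>2 * \<bar>x\<bar> / (?q x)\<^sup>2))"
      by (intro integral_le integrable_continuous_real cd continuous_on_add continuous_on_const continuous_on_mult_left continuous_on_subset[OF cr] Rd) auto
    also have "\<dots> = c1 + c2 * integral {- 1/2..1/2} (\<lambda>x. e\<^sup>2 * \<bar>x\<bar> / (?q x)\<^sup>2)"
      by (rule integral_affine_centred[OF continuous_on_subset[OF cr subset_UNIV]])
    also have "\<dots> \<le> c1 + c2 * (1 / m\<^sup>2)" using cpos by (intro add_left_mono mult_left_mono integral_quotient_square_le e m) auto
    finally show ?thesis by simp
  qed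
  have NI: "integral {0..1} (\<lambda>x. \<bar>deriv H x - deriv G x\<bar>) \<le> \<nu>"
  proof -
    have pw: "\<bar>deriv H x - deriv G x\<bar> \<le> (1 / Z) * (c3 + c4 * (e / ?q x))" if x: "\<bar>x\<bar> \<le> 1/2" for x
    proof -
      let ?a = "sqrt (A x)" and ?b = "sqrt (B x)" and ?s = "sqrt (?q x)"
      have s: "0 < ?s" "?s \<le> ?a" "?s \<le> ?b" "?s * ?s = ?q x" using q0[of x] qAB[OF x] by (auto simp: real_sqrt_mult_self)
      have ab: "?a * ?a = A x" "?b * ?b = B x" using AB[of x] by (auto simp: real_sqrt_mult_self)
      \<comment> \<open>Multiplying by the sum removes the square roots. Thanks to \<open>W2\<close>
        the numerator is of order \<open>e^2 + \<bar>x\<bar>^3\<close>, against a denominator of the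
        order of \<open>?q\<close> to the power \<open>3/2\<close>; what remains is bounded by a
        constant plus a multiple of \<open>e / ?q x\<close>.\<close>
      have num: "(deriv h x * ?b - deriv g x * ?a) * (deriv h x * ?b + deriv g x * ?a)
         = e\<^sup>2 * ((deriv h x)\<^sup>2 - (deriv g x)\<^sup>2) + W2 x * (deriv h x * Sg x + deriv g x * Sh x)"
      proof -
        have key: "(u * b - v * a) * (u * b + v * a) = u * u * (b * b) - v * v * (a * a)" for u v a b :: real by (simp add: algebra_simps)
        have "(deriv h x * ?b - deriv g x * ?a) * (deriv h x * ?b + deriv g x * ?a) = deriv h x * deriv h x * B x - deriv g x * deriv g x * A x"
          by (simp only: key ab)
        then show ?thesis by (simp add: A_def B_def W2_def power2_eq_square algebra_simps)
      qed
      have den: "2 * m * ?s \<le> deriv h x * ?b + deriv g x * ?a"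
      proof -
        have "m * ?s \<le> deriv h x * ?b" "m * ?s \<le> deriv g x * ?a" using gb[of x] s m by (intro mult_mono; simp)+
        then show ?thesis by linarith
      qed
      have numb: "\<bar>e\<^sup>2 * ((deriv h x)\<^sup>2 - (deriv g x)\<^sup>2) + W2 x * (deriv h x * Sg x + deriv g x * Sh x)\<bar> \<le> M\<^sup>2 * e\<^sup>2 + 320 * M ^ 5 * \<bar>x\<bar> ^ 3"
      proof -
        have "(deriv h x)\<^sup>2 \<le> M\<^sup>2" "(deriv g x)\<^sup>2 \<le> M\<^sup>2" using gb[of x] by (intro power_mono; simp)+
        moreover have "0 \<le> (deriv h x)\<^sup>2" "0 \<le> (deriv g x)\<^sup>2" by simp_all
        ultimately have "\<bar>(deriv h x)\<^sup>2 - (deriv g x)\<^sup>2\<bar> \<le> M\<^sup>2" by linarith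
        then have i: "\<bar>e\<^sup>2 * ((deriv h x)\<^sup>2 - (deriv g x)\<^sup>2)\<bar> \<le> e\<^sup>2 * M\<^sup>2" unfolding abs_mult by (intro mult_mono) auto
        have "\<bar>deriv h x * Sg x\<bar> \<le> M * (4 * M * \<bar>x\<bar>)" "\<bar>deriv g x * Sh x\<bar> \<le> M * (4 * M * \<bar>x\<bar>)"
          unfolding abs_mult using gb[of x] M by (intro mult_mono Sb; simp)+
        then have "\<bar>deriv h x * Sg x + deriv g x * Sh x\<bar> \<le> 8 * M\<^sup>2 * \<bar>x\<bar>" by (simp add: power2_eq_square)
        then have "\<bar>W2 x * (deriv h x * Sg x + deriv g x * Sh x)\<bar> \<le> (40 * M ^ 3 * x\<^sup>2) * (8 * M\<^sup>2 * \<bar>x\<bar>)"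
          unfolding abs_mult using M by (intro mult_mono W2b) auto
        also have "\<dots> = 320 * M ^ 5 * \<bar>x\<bar> ^ 3" 
        proof -
          have "(40 * M ^ 3 * y\<^sup>2) * (8 * M\<^sup>2 * y) = 320 * M ^ 5 * y ^ 3" for y :: real by (simp add: numeral_eq_Suc)
          from this[of "\<bar>x\<bar>"] show ?thesis by simp
        qed
        finally show ?thesis using i by (simp add: mult.commute)
      qed
      have "\<bar>deriv h x * ?b - deriv g x * ?a\<bar> * (2 * m * ?s) \<le> \<bar>deriv h x * ?b - deriv g x * ?a\<bar> * \<bar>deriv h x * ?b + deriv g x * ?a\<bar>"
        using den by (intro mult_left_mono) auto
      also have "\<dots> \<le> M\<^sup>2 * e\<^sup>2 + 320 * M ^ 5 * \<bar>x\<bar> ^ 3" using numb unfolding num[symmetric] abs_mult .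
      finally have nb: "\<bar>deriv h x * ?b - deriv g x * ?a\<bar> \<le> (M\<^sup>2 * e\<^sup>2 + 320 * M ^ 5 * \<bar>x\<bar> ^ 3) / (2 * m * ?s)"
        using s m by (simp add: le_divide_eq)
      have "deriv h x / ?a - deriv g x / ?b = (deriv h x * ?b - deriv g x * ?a) / (?a * ?b)"
        using AB[of x] by (simp add: field_simps)
      then have "\<bar>deriv h x / ?a - deriv g x / ?b\<bar> = \<bar>deriv h x * ?b - deriv g x * ?a\<bar> / (?a * ?b)"
        using AB[of x] by (simp add: abs_mult)
      also have "\<dots> \<le> ((M\<^sup>2 * e\<^sup>2 + 320 * M ^ 5 * \<bar>x\<bar> ^ 3) / (2 * m * ?s)) / ?q x"
      proof (rule frac_le[OF _ nb q0])
        have "?s * ?s \<le> ?a * ?b" using s by (intro mult_mono) auto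
        then show "?q x \<le> ?a * ?b" by (simp only: s(4))
        show "0 \<le> (M\<^sup>2 * e\<^sup>2 + 320 * M ^ 5 * \<bar>x\<bar> ^ 3) / (2 * m * ?s)" using M m s by simp
      qed
      also have "\<dots> = c4 * (e * (e / ?s) / ?q x) + c3 * ((m * \<bar>x\<bar> / ?s) * ((m * \<bar>x\<bar>)\<^sup>2 / ?q x))"
      proof -
        have key: "(M\<^sup>2 * e\<^sup>2 + 320 * M ^ 5 * y ^ 3) / (2 * m * \<sigma>) / q
            = M\<^sup>2 / (2 * m) * (e * (e / \<sigma>) / q) + 320 * M ^ 5 / (2 * m * m ^ 3) * ((m * y / \<sigma>) * ((m * y)\<^sup>2 / q))"
          if "\<sigma> \<noteq> 0" "q \<noteq> 0" for y \<sigma> q :: real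
          using that m by (simp add: field_simps power2_eq_square power3_eq_cube)
        show ?thesis unfolding c3_def c4_def by (rule key) (use s(1) q0[of x] in auto)
      qed
      also have "\<dots> \<le> c4 * (e * 1 / ?q x) + c3 * (1 * 1)"
      proof (intro add_mono mult_left_mono divide_right_mono mult_mono)
        have "e \<le> ?s" using e by (intro real_le_rsqrt) simp
        then show "e / ?s \<le> 1" using s by simp
        have "m * \<bar>x\<bar> \<le> ?s" using e m by (intro real_le_rsqrt) (simp add: power_mult_distrib)
        then show "m * \<bar>x\<bar> / ?s \<le> 1" using s by simp
        show "(m * \<bar>x\<bar>)\<^sup>2 / ?q x \<le> 1" using q0[of x] by (simp add: power_mult_distrib)
      qed (use cpos e less_imp_le[OF q0[of x]] m s in auto)
      finally have fin: "\<bar>deriv h x / ?a - deriv g x / ?b\<bar> \<le> c3 + c4 * (e / ?q x)" by simp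
      have "deriv H x - deriv G x = (1 / Z) * (deriv h x / ?a - deriv g x / ?b)" by (simp add: G' H' diff_divide_distrib)
      then have "\<bar>deriv H x - deriv G x\<bar> = (1 / Z) * \<bar>deriv h x / ?a - deriv g x / ?b\<bar>" using Z by (simp add: abs_mult)
      also have "\<dots> \<le> (1 / Z) * (c3 + c4 * (e / ?q x))" using Z fin by (intro mult_left_mono) auto
      finally show ?thesis .
    qed
    have cd: "continuous_on S (\<lambda>x. \<bar>deriv H x - deriv G x\<bar>)" for S
      by (intro continuous_on_rabs continuous_on_diff smooth_continuous_on smooth_deriv diff_lift_smooth G H)
    have cr: "continuous_on UNIV (\<lambda>x. e / ?q x)"
      using q0 by (intro continuous_on_divide continuous_on_const cq) (simp add: less_imp_neq[symmetric])
    have "integral {0..1} (\<lambda>x. \<bar>deriv H x - deriv G x\<bar>) = integral {- 1/2..1/2} (\<lambda>x. \<bar>deriv H x - deriv G x\<bar>)"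
      by (rule period[OF cd]) (simp add: diff_lift_deriv_shift[OF G] diff_lift_deriv_shift[OF H])
    also have "\<dots> \<le> integral {- 1/2..1/2} (\<lambda>x. (1 / Z) * (c3 + c4 * (e / ?q x)))"
      by (intro integral_le integrable_continuous_real cd continuous_on_add continuous_on_const continuous_on_mult_left continuous_on_subset[OF cr] pw) auto
    also have "\<dots> = (1 / Z) * (c3 + c4 * integral {- 1/2..1/2} (\<lambda>x. e / ?q x))"
      by (simp only: integral_mult_right integral_affine_centred[OF continuous_on_subset[OF cr subset_UNIV]])
    also have "\<dots> \<le> (1 / Z) * N0"
      unfolding N0_def using Z cpos by (intro mult_left_mono add_left_mono integral_quotient_le e m) auto
    also have "\<dots> \<le> \<nu>" using ZN by simp
    finally show ?thesis .
  qed
  \<comment> \<open>\<open>G\<close> and \<open>H\<close> agree at 0 because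
    \<open>g 0 = h 0\<close>, so the variation also bounds the displacement.\<close>
  have HG: "\<bar>H x - G x\<bar> \<le> \<nu>" for x
  proof -
    have sX: "smooth_periodic (\<lambda>x. H x - G x)"
      using smooth_diff[OF diff_lift_smooth[OF H] diff_lift_smooth[OF G]]
      by (simp add: smooth_periodic_def diff_lift_shift[OF G] diff_lift_shift[OF H])
    have "deriv (\<lambda>x. H x - G x) x = deriv H x - deriv G x" for x
      by (intro DERIV_imp_deriv DERIV_diff diff_lift_DERIV G H)
    then show ?thesis using smooth_periodic_le_total_variation[OF sX, of x] NI by (simp add: G_def H_def g h)
  qed
  have "reach P s p G H (ennreal r)"
  proof (rule reach_affine[OF G H, where m = "\<lambda>_. ennreal r"])
    fix t :: real assume t: "0 < t" "t < 1"
    let ?\<psi> = "\<lambda>x. (1 - t) * G x + t * H x"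
    let ?X = "\<lambda>y. H (inv ?\<psi> y) - G (inv ?\<psi> y)"
    note F = affine_velocity_facts[OF G H less_imp_le[OF t(1)] less_imp_le[OF t(2)]]
    \<comment> \<open>A convex combination of 1 and \<open>R\<close>, hence at least
      \<open>1 / \<kappa>\<close> for every \<open>t\<close>: unlike on the line to
      \<open>c \<circ> g\<close>, nothing degenerates at the end times.\<close>
    define den where "den x = (1 - t) + t * R x" for x
    have den: "1 / \<kappa> \<le> den x" for x
    proof -
      have "1 / \<kappa> = (1 - t) * (1 / \<kappa>) + t * (1 / \<kappa>)" by (simp add: add_divide_distrib[symmetric])
      also have "\<dots> \<le> (1 - t) * 1 + t * R x"
        using t \<kappa> Rb by (intro add_mono mult_left_mono) auto
      finally show ?thesis by (simp add: den_def)
    qed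
    have \<kappa>i: "0 < 1 / \<kappa>" using \<kappa> by simp
    have den0: "0 < den x" for x using den[of x] \<kappa>i by linarith
    have iden: "1 / den x \<le> \<kappa>" for x
      using den[of x] den0[of x] \<kappa> by (simp add: divide_le_eq mult.commute)
    have Qeq: "(\<lambda>x. (deriv H x - deriv G x) / ((1 - t) * deriv G x + t * deriv H x)) = (\<lambda>x. (R x - 1) / den x)"
    proof
      fix x
      have Gx: "0 < deriv G x" by (rule diff_lift_deriv_pos[OF G])
      then have "deriv H x = deriv G x * R x" by (simp add: R_def)
      then have "deriv H x - deriv G x = deriv G x * (R x - 1)" "(1 - t) * deriv G x + t * deriv H x = deriv G x * den x"
        by (simp_all add: den_def algebra_simps)
      then show "(deriv H x - deriv G x) / ((1 - t) * deriv G x + t * deriv H x) = (R x - 1) / den x" using Gx by simp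
    qed
    have "W_norm_S1 P s p ?X \<le> ennreal (C0 * (K powr (p - 1) * (V powr \<alpha> * \<nu> powr (1 - \<alpha>))) powr (1 / p))"
    proof (rule W[OF F(1)])
      show "\<bar>?X x\<bar> \<le> K" for x using HG[of "inv ?\<psi> x"] \<nu> K1 by linarith
      show "\<bar>?X x\<bar> \<le> \<nu>" for x by (rule HG)
      show "\<bar>deriv ?X x\<bar> \<le> K" for x
      proof -
        let ?z = "inv ?\<psi> x"
        have "\<bar>R ?z - 1\<bar> \<le> \<kappa>" using Rb(1)[of ?z] Rpos[of ?z] \<kappa> by linarith
        then have "\<bar>R ?z - 1\<bar> * (1 / den ?z) \<le> \<kappa> * \<kappa>" using iden[of ?z] den0[of ?z] \<kappa> by (intro mult_mono) auto
        then have "\<bar>(R ?z - 1) / den ?z\<bar> \<le> K" using den0[of ?z] by (simp add: K_def power2_eq_square)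
        then show ?thesis unfolding F(2) using fun_cong[OF Qeq, of ?z] by simp
      qed
      show "integral {0..1} (\<lambda>x. \<bar>deriv ?X x\<bar>) \<le> \<nu>" unfolding F(3) by (rule NI)
      have dQ: "\<bar>deriv (\<lambda>x. (R x - 1) / den x) x\<bar> \<le> \<kappa>\<^sup>2 * \<bar>deriv R x\<bar>" for x
      proof -
        have DR: "(R has_real_derivative deriv R x) (at x)" by (rule smooth_DERIV[OF smooth_periodicD(1)[OF sR]])
        have Dn: "((\<lambda>x. R x - 1) has_real_derivative deriv R x - 0) (at x)" by (intro DERIV_diff DR DERIV_const)
        have Dd: "(den has_real_derivative 0 + t * deriv R x) (at x)"
          unfolding den_def[abs_def] by (intro DERIV_add DERIV_const DERIV_cmult DR)
        have "den x \<noteq> 0" using den0[of x] by simp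
        from DERIV_divide[OF Dn Dd this]
        have "deriv (\<lambda>x. (R x - 1) / den x) x = ((deriv R x - 0) * den x - (R x - 1) * (0 + t * deriv R x)) / (den x * den x)"
          by (rule DERIV_imp_deriv)
        also have "(deriv R x - 0) * den x - (R x - 1) * (0 + t * deriv R x) = deriv R x"
          by (simp add: den_def algebra_simps)
        finally have "\<bar>deriv (\<lambda>x. (R x - 1) / den x) x\<bar> = \<bar>deriv R x\<bar> * ((1 / den x) * (1 / den x))"
          using den0[of x] by (simp add: abs_mult)
        also have "\<dots> \<le> \<bar>deriv R x\<bar> * (\<kappa> * \<kappa>)" using iden[of x] den0[of x] \<kappa> by (intro mult_left_mono mult_mono) auto
        finally show ?thesis by (simp add: power2_eq_square mult.commute)
      qed
      have "integral {0..1} (\<lambda>x. \<bar>deriv (\<lambda>x. (R x - 1) / den x) x\<bar>) \<le> integral {0..1} (\<lambda>x. \<kappa>\<^sup>2 * \<bar>deriv R x\<bar>)"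
      proof (rule integral_le)
        show "(\<lambda>x. \<bar>deriv (\<lambda>x. (R x - 1) / den x) x\<bar>) integrable_on {0..1}"
          using smooth_periodic_deriv[OF F(5)] unfolding Qeq
          by (intro integrable_continuous_real continuous_on_rabs smooth_periodicD)
        show "(\<lambda>x. \<kappa>\<^sup>2 * \<bar>deriv R x\<bar>) integrable_on {0..1}"
          by (intro integrable_continuous_real continuous_on_mult_left continuous_on_rabs smooth_periodicD[OF smooth_periodic_deriv[OF sR]])
      qed (rule dQ)
      also have "\<dots> = \<kappa>\<^sup>2 * integral {0..1} (\<lambda>x. \<bar>deriv R x\<bar>)" by simp
      also have "\<dots> \<le> \<kappa>\<^sup>2 * (c1 + c2 / m\<^sup>2)" by (intro mult_left_mono VR) auto
      also have "\<dots> \<le> V" by (simp add: V_def)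
      finally show "integral {0..1} (\<lambda>x. \<bar>deriv (deriv ?X) x\<bar>) \<le> V" unfolding F(4) Qeq .
    qed (use K1 \<nu> V1 in auto)
    also have "\<dots> \<le> ennreal r" by (intro ennreal_leI \<nu>r)
    finally show "W_norm_S1 P s p ?X \<le> ennreal r" .
  qed (simp_all add: nn_integral_cmult_indicator)
  then show ?thesis using that[OF c uni] by (simp add: G_def[abs_def] H_def[abs_def])
qed

text \<open>The route is: rotate \<open>g\<close> so that 0 goes to an integer, concentrate by
  \<open>c\<close>, cross over to the concentrated target, undo the concentration, rotate back. The
  lift \<open>c\<close> depends on \<open>g\<close> and \<open>h\<close>, but the cost of
  concentrating does not depend on \<open>c\<close>.\<close>

lemma diff_diam_less_top:
  assumes p: "1 < p" and s: "0 \<le> s" "s < 1 + 1 / p" and P: "admissible_pu P"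
  shows "diff_diam P s p < \<infinity>"
proof -
  have p0: "0 < p" using p by simp
  obtain C1 where C1: "0 < C1" "\<And>g a. diff_lift g \<Longrightarrow> \<bar>a\<bar> \<le> 1 \<Longrightarrow> reach P s p g (\<lambda>x. g x + a) (ennreal C1)"
    by (rule reach_rotation[OF p s P]) blast
  obtain C2 where C2: "0 < C2"
    "\<And>c g. diff_lift c \<Longrightarrow> c 0 = 0 \<Longrightarrow> (\<And>x. 0 \<le> x \<Longrightarrow> x \<le> 1/2 \<Longrightarrow> deriv (deriv c) x \<le> 0) \<Longrightarrow>
      (\<And>x. 1/2 \<le> x \<Longrightarrow> x \<le> 1 \<Longrightarrow> 0 \<le> deriv (deriv c) x) \<Longrightarrow> diff_lift g \<Longrightarrow> reach P s p g (\<lambda>x. c (g x)) (ennreal C2)"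
    by (rule reach_unimodal[OF p s P]) blast
  define L where "L = ennreal C1 + (ennreal C2 + (ennreal 1 + (ennreal C2 + ennreal C1)))"
  have "diff_dist P s p g h \<le> L" if g: "diff_lift g" and h: "diff_lift h" for g h
  proof -
    define k where "k = \<lfloor>g 0\<rfloor>"
    define g1 where "g1 x = g x + - frac (g 0)" for x
    \<comment> \<open>The integer offset makes \<open>h1 0\<close> equal to \<open>g1 0\<close>, as
      the comparison requires; it reappears as the integer by which the final lift differs from
      \<open>h\<close>.\<close>
    define h1 where "h1 x = h x + (real_of_int (k - \<lfloor>h 0\<rfloor>) - frac (h 0))" for x
    have g1: "diff_lift g1" "g1 0 = real_of_int k"
      unfolding g1_def by (rule diff_lift_add_const[OF g], simp add: frac_def k_def)
    have h1: "diff_lift h1" "h1 0 = real_of_int k"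
      unfolding h1_def by (rule diff_lift_add_const[OF h], simp add: frac_def k_def)
    obtain c where c: "diff_lift c" "c 0 = 0"
      "\<And>x. 0 \<le> x \<Longrightarrow> x \<le> 1/2 \<Longrightarrow> deriv (deriv c) x \<le> 0" "\<And>x. 1/2 \<le> x \<Longrightarrow> x \<le> 1 \<Longrightarrow> 0 \<le> deriv (deriv c) x"
      "reach P s p (\<lambda>x. c (g1 x)) (\<lambda>x. c (h1 x)) (ennreal 1)"
      by (rule reach_concentrated[OF p s P g1 h1 zero_less_one]) blast
    have f01: "\<bar>- frac u\<bar> \<le> 1" "\<bar>frac u\<bar> \<le> 1" for u :: real
      using frac_ge_0[of u] frac_lt_1[of u] by simp_all
    have 1: "reach P s p g g1 (ennreal C1)" unfolding g1_def[abs_def] by (rule C1(2)[OF g f01(1)])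
    have 2: "reach P s p g1 (\<lambda>x. c (g1 x)) (ennreal C2)" by (rule C2(2)[OF c(1-4) g1(1)])
    have 3: "reach P s p (\<lambda>x. c (h1 x)) h1 (ennreal C2)" by (rule reach_sym[OF P p0 C2(2)[OF c(1-4) h1(1)]])
    have 4: "reach P s p h1 (\<lambda>x. h1 x + frac (h 0)) (ennreal C1)" by (rule C1(2)[OF h1(1) f01(2)])
    have "reach P s p g (\<lambda>x. h1 x + frac (h 0)) L"
      unfolding L_def by (rule reach_trans[OF P p0 1 reach_trans[OF P p0 2 reach_trans[OF P p0 c(5) reach_trans[OF P p0 3 4]]]])
    then have "reach P s p g (\<lambda>x. h x + real_of_int (k - \<lfloor>h 0\<rfloor>)) L" by (simp add: h1_def)
    then show ?thesis by (rule diff_dist_le_reach)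
  qed
  then have "diff_diam P s p \<le> L" unfolding diff_diam_def by (intro SUP_least) fastforce
  also have "L < \<infinity>" by (simp add: L_def)
  finally show ?thesis .
qed

section \<open>Lower bounds\<close>

lemma enn_rpow_le_imp_le:
  assumes "enn_rpow x (1 / p) \<le> ennreal w" "0 < p" "0 \<le> w"
  shows "x \<le> ennreal (w powr p)"
proof (cases x rule: ennreal_cases_real)
  case (real r)
  then have "r powr (1 / p) \<le> w" using assms by (simp add: enn_rpow_ennreal)
  then have "(r powr (1 / p)) powr p \<le> w powr p" using assms by (intro powr_mono2) auto
  then show ?thesis using real assms by (simp add: powr_powr ennreal_leI)
next
  case inf
  then show ?thesis using assms by (simp add: top_unique)
qed

text \<open>Stands in for Jensen's inequality, at the price of a factor 2.\<close>

lemma abs_le_powr_add: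
  fixes t l p :: real
  assumes "0 < l" "1 < p"
  shows "\<bar>t\<bar> \<le> l powr (1 - p) * \<bar>t\<bar> powr p + l"
proof (cases "\<bar>t\<bar> \<le> l")
  case False
  then have "l powr (p - 1) \<le> \<bar>t\<bar> powr (p - 1)" using assms by (intro powr_mono2) auto
  then have "l powr (1 - p) * l powr (p - 1) * \<bar>t\<bar> \<le> l powr (1 - p) * \<bar>t\<bar> powr (p - 1) * \<bar>t\<bar>"
    by (intro mult_right_mono mult_left_mono) auto
  moreover have "l powr (1 - p) * l powr (p - 1) = 1" using assms by (simp flip: powr_add)
  moreover have "\<bar>t\<bar> powr (p - 1) * \<bar>t\<bar> = \<bar>t\<bar> powr p" using False assms by (simp add: powr_diff)
  ultimately show ?thesis using assms by (simp add: mult.assoc)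
qed (simp add: add_increasing)

lemma abs_integral_le:
  fixes f :: "real \<Rightarrow> real"
  assumes "continuous_on UNIV f"
  shows "\<bar>integral {a..b} f\<bar> \<le> integral {a..b} (\<lambda>x. \<bar>f x\<bar>)"
proof -
  have "norm (integral {a..b} f) \<le> integral {a..b} (\<lambda>x. \<bar>f x\<bar>)"
    by (rule integral_norm_bound_integral) (auto intro!: integrable_continuous_real continuous_on_rabs continuous_on_subset[OF assms])
  then show ?thesis by simp
qed

text \<open>\<open>abs_le_powr_add\<close> with threshold \<open>w\<close>: both of its terms then
  contribute at most \<open>w\<close>.\<close>

lemma integral_abs_le_Lp:
  fixes f :: "real \<Rightarrow> real"
  assumes f: "continuous_on UNIV f" and p: "1 < p" and w: "0 < w"
    and B: "(\<integral>\<^sup>+x. ennreal (\<bar>f x\<bar> powr p) \<partial>lborel) \<le> ennreal (w powr p)" and ab: "a \<le> b" "b \<le> a + 1"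
  shows "integral {a..b} (\<lambda>x. \<bar>f x\<bar>) \<le> 2 * w"
proof -
  have [measurable]: "f \<in> borel_measurable borel" using f by (rule borel_measurable_continuous_onI)
  have "ennreal (integral {a..b} (\<lambda>x. \<bar>f x\<bar>)) = (\<integral>\<^sup>+x. ennreal \<bar>f x\<bar> * indicator {a..b} x \<partial>lborel)"
    by (rule nn_integral_continuous_Icc[symmetric]) (auto intro: continuous_on_rabs f)
  also have "\<dots> \<le> (\<integral>\<^sup>+x. ennreal (w powr (1 - p)) * ennreal (\<bar>f x\<bar> powr p) + ennreal w * indicator {a..b} x \<partial>lborel)"
  proof (rule nn_integral_mono)
    fix x
    have "ennreal \<bar>f x\<bar> \<le> ennreal (w powr (1 - p)) * ennreal (\<bar>f x\<bar> powr p) + ennreal w"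
      using ennreal_leI[OF abs_le_powr_add[OF w p, of "f x"]] w by (simp add: ennreal_mult)
    then show "ennreal \<bar>f x\<bar> * indicator {a..b} x \<le> ennreal (w powr (1 - p)) * ennreal (\<bar>f x\<bar> powr p) + ennreal w * indicator {a..b} x"
      by (auto split: split_indicator)
  qed
  also have "\<dots> = ennreal (w powr (1 - p)) * (\<integral>\<^sup>+x. ennreal (\<bar>f x\<bar> powr p) \<partial>lborel) + ennreal w * ennreal (b - a)"
    using ab by (subst nn_integral_add) (auto simp: nn_integral_cmult nn_integral_cmult_indicator)
  also have "\<dots> \<le> ennreal (w powr (1 - p)) * ennreal (w powr p) + ennreal w * ennreal 1"
    using ab by (intro add_mono mult_left_mono B ennreal_leI) auto
  also have "\<dots> = ennreal (2 * w)"
  proof -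
    have "w powr (1 - p) * w powr p = w" using w by (simp flip: powr_add)
    then show ?thesis using w by (simp flip: ennreal_mult ennreal_plus)
  qed
  finally show ?thesis using w by (subst (asm) ennreal_le_iff) auto
qed

text \<open>The difference of the averages over the left half and over the whole interval is a
  double average of \<open>f x - f y\<close>. There \<open>\<bar>x - y\<bar> \<le> l\<close>, so the
  Gagliardo kernel is at least \<open>l powr (- 1 - q)\<close> and the double integral controls the
  \<open>p\<close>-th powers.\<close>

lemma dyadic_average_diff:
  fixes f F :: "real \<Rightarrow> real"
  assumes F: "\<And>x. (F has_real_derivative f x) (at x)" and f: "continuous_on UNIV f" and p: "1 < p" and w: "0 < w"
    and q: "1 \<le> q" and l: "0 < l" "l \<le> 1"
    and G: "(\<integral>\<^sup>+ z. ennreal (\<bar>f (fst z) - f (snd z)\<bar> powr p / \<bar>fst z - snd z\<bar> powr (1 + q)) \<partial>(lborel \<Otimes>\<^sub>M lborel)) \<le> ennreal (w powr p)"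
  shows "\<bar>(F (a + l / 2) - F a) / (l / 2) - (F (a + l) - F a) / l\<bar> \<le> 3 * (w * l powr ((q - 1) / p))"
proof -
  have [measurable]: "f \<in> borel_measurable borel" using f by (rule borel_measurable_continuous_onI)
  \<comment> \<open>The threshold that balances the two terms of \<open>abs_le_powr_add\<close>:
    they contribute \<open>u * l^2\<close> and \<open>u * l^2 / 2\<close>. Division by
    \<open>l^2 / 2\<close> then gives the factor 3.\<close>
  define u where "u = w * l powr ((q - 1) / p)"
  have u: "0 < u" using w l by (simp add: u_def)
  let ?J = "{a..a + l / 2}" and ?I = "{a..a + l}"
  define D where "D = (F (a + l / 2) - F a) / (l / 2) - (F (a + l) - F a) / l"
  let ?g = "\<lambda>x. l * f x - (F (a + l) - F a)"
  have I: "(f has_integral F (a + l) - F a) ?I" "(f has_integral F (a + l / 2) - F a) ?J"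
    using l by (intro integral_DERIV F; simp)+
  have cg: "continuous_on UNIV ?g" by (intro continuous_on_diff continuous_on_mult_left continuous_on_const f)
  have cd: "continuous_on UNIV (\<lambda>y. \<bar>f x - f y\<bar>)" for x by (intro continuous_on_rabs continuous_on_diff continuous_on_const f)
  have "(?g has_integral l * (F (a + l / 2) - F a) - l / 2 * (F (a + l) - F a)) ?J"
    using has_integral_diff[OF has_integral_mult_right[OF I(2), of l] has_integral_const_real[of "F (a + l) - F a" a "a + l / 2"]] l
    by simp
  moreover have "l * (F (a + l / 2) - F a) - l / 2 * (F (a + l) - F a) = l\<^sup>2 / 2 * D"
    using l by (simp add: D_def power2_eq_square field_simps)
  ultimately have gI: "(?g has_integral l\<^sup>2 / 2 * D) ?J" by (simp only:)
  have "\<bar>l\<^sup>2 / 2 * D\<bar> \<le> integral ?J (\<lambda>x. \<bar>?g x\<bar>)"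
    using abs_integral_le[OF cg, of a "a + l / 2"] by (simp only: integral_unique[OF gI])
  then have "ennreal (l\<^sup>2 / 2 * \<bar>D\<bar>) \<le> ennreal (integral ?J (\<lambda>x. \<bar>?g x\<bar>))" by (intro ennreal_leI) (simp add: abs_mult)
  also have "\<dots> = (\<integral>\<^sup>+x. ennreal \<bar>?g x\<bar> * indicator ?J x \<partial>lborel)"
    by (rule nn_integral_continuous_Icc[symmetric]) (auto intro: continuous_on_rabs cg)
  also have "\<dots> \<le> (\<integral>\<^sup>+x. (\<integral>\<^sup>+y. ennreal \<bar>f x - f y\<bar> * indicator ?I y \<partial>lborel) * indicator ?J x \<partial>lborel)"
  proof (intro nn_integral_mono mult_right_mono)
    fix x
    have "((\<lambda>y. f x - f y) has_integral ?g x) ?I"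
      using has_integral_diff[OF has_integral_const_real[of "f x" a "a + l"] I(1)] l by simp
    then have "\<bar>?g x\<bar> \<le> integral ?I (\<lambda>y. \<bar>f x - f y\<bar>)"
      using abs_integral_le[of "\<lambda>y. f x - f y" a "a + l"] f by (simp add: integral_unique continuous_on_diff)
    then have "ennreal \<bar>?g x\<bar> \<le> ennreal (integral ?I (\<lambda>y. \<bar>f x - f y\<bar>))" by (rule ennreal_leI)
    also have "\<dots> = (\<integral>\<^sup>+y. ennreal \<bar>f x - f y\<bar> * indicator ?I y \<partial>lborel)"
      by (rule nn_integral_continuous_Icc[symmetric, OF cd]) simp
    finally show "ennreal \<bar>?g x\<bar> \<le> (\<integral>\<^sup>+y. ennreal \<bar>f x - f y\<bar> * indicator ?I y \<partial>lborel)" .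
  qed simp
  also have "\<dots> = (\<integral>\<^sup>+x. \<integral>\<^sup>+y. ennreal \<bar>f x - f y\<bar> * indicator ?I y * indicator ?J x \<partial>lborel \<partial>lborel)"
    by (intro nn_integral_cong nn_integral_multc[symmetric]) simp
  also have "\<dots> \<le> (\<integral>\<^sup>+x. \<integral>\<^sup>+y. ennreal (u powr (1 - p) * l powr (1 + q)) * ennreal (\<bar>f x - f y\<bar> powr p / \<bar>x - y\<bar> powr (1 + q))
        + ennreal u * indicator ?I y * indicator ?J x \<partial>lborel \<partial>lborel)"
  proof (intro nn_integral_mono)
    fix x y
    show "ennreal \<bar>f x - f y\<bar> * indicator ?I y * indicator ?J x \<le> ennreal (u powr (1 - p) * l powr (1 + q)) * ennreal (\<bar>f x - f y\<bar> powr p / \<bar>x - y\<bar> powr (1 + q))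
        + ennreal u * indicator ?I y * indicator ?J x"
    proof (cases "y \<in> ?I \<and> x \<in> ?J")
      case True
      have "\<bar>f x - f y\<bar> powr p \<le> l powr (1 + q) * (\<bar>f x - f y\<bar> powr p / \<bar>x - y\<bar> powr (1 + q))"
      proof (cases "x = y")
        case False
        have "\<bar>x - y\<bar> \<le> l" using True l by auto
        then have "\<bar>x - y\<bar> powr (1 + q) \<le> l powr (1 + q)" using q by (intro powr_mono2) auto
        then have "1 \<le> l powr (1 + q) / \<bar>x - y\<bar> powr (1 + q)" using False by simp
        then have "\<bar>f x - f y\<bar> powr p * 1 \<le> \<bar>f x - f y\<bar> powr p * (l powr (1 + q) / \<bar>x - y\<bar> powr (1 + q))"
          by (intro mult_left_mono) auto
        then show ?thesis by (simp add: mult.commute)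
      qed (use p in simp)
      then have "u powr (1 - p) * \<bar>f x - f y\<bar> powr p \<le> u powr (1 - p) * (l powr (1 + q) * (\<bar>f x - f y\<bar> powr p / \<bar>x - y\<bar> powr (1 + q)))"
        by (intro mult_left_mono) auto
      then have "\<bar>f x - f y\<bar> \<le> u powr (1 - p) * l powr (1 + q) * (\<bar>f x - f y\<bar> powr p / \<bar>x - y\<bar> powr (1 + q)) + u"
        using abs_le_powr_add[OF u p, of "f x - f y"] by (simp only: mult.assoc)
      then have "ennreal \<bar>f x - f y\<bar> \<le> ennreal (u powr (1 - p) * l powr (1 + q) * (\<bar>f x - f y\<bar> powr p / \<bar>x - y\<bar> powr (1 + q)) + u)"
        by (rule ennreal_leI)
      also have "\<dots> = ennreal (u powr (1 - p) * l powr (1 + q) * (\<bar>f x - f y\<bar> powr p / \<bar>x - y\<bar> powr (1 + q))) + ennreal u"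
        using u by (intro ennreal_plus) auto
      also have "ennreal (u powr (1 - p) * l powr (1 + q) * (\<bar>f x - f y\<bar> powr p / \<bar>x - y\<bar> powr (1 + q)))
         = ennreal (u powr (1 - p) * l powr (1 + q)) * ennreal (\<bar>f x - f y\<bar> powr p / \<bar>x - y\<bar> powr (1 + q))"
        by (intro ennreal_mult) auto
      finally show ?thesis using True by simp
    qed auto
  qed
  also have "\<dots> = ennreal (u powr (1 - p) * l powr (1 + q)) * (\<integral>\<^sup>+x. \<integral>\<^sup>+y. ennreal (\<bar>f x - f y\<bar> powr p / \<bar>x - y\<bar> powr (1 + q)) \<partial>lborel \<partial>lborel)
        + ennreal u * ennreal l * ennreal (l / 2)"
    using l by (simp add: nn_integral_add nn_integral_cmult nn_integral_multc nn_integral_cmult_indicator mult.assoc)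
  also have "(\<integral>\<^sup>+x. \<integral>\<^sup>+y. ennreal (\<bar>f x - f y\<bar> powr p / \<bar>x - y\<bar> powr (1 + q)) \<partial>lborel \<partial>lborel)
     = (\<integral>\<^sup>+ z. ennreal (\<bar>f (fst z) - f (snd z)\<bar> powr p / \<bar>fst z - snd z\<bar> powr (1 + q)) \<partial>(lborel \<Otimes>\<^sub>M lborel))"
    by (subst lborel.nn_integral_fst[symmetric]) auto
  also have "ennreal (u powr (1 - p) * l powr (1 + q)) * \<dots> + ennreal u * ennreal l * ennreal (l / 2)
      \<le> ennreal (u powr (1 - p) * l powr (1 + q)) * ennreal (w powr p) + ennreal u * ennreal l * ennreal (l / 2)"
    by (intro add_mono mult_left_mono G) auto
  also have "\<dots> = ennreal (3 / 2 * u * l\<^sup>2)"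
  proof -
    have "u powr p = w powr p * l powr (q - 1)" using p by (simp add: u_def powr_mult powr_powr)
    then have "w powr p = u powr p * l powr (1 - q)" using l by (simp add: mult.assoc flip: powr_add)
    then have "u powr (1 - p) * l powr (1 + q) * w powr p = (u powr (1 - p) * u powr p) * (l powr (1 + q) * l powr (1 - q))"
      by simp
    also have "\<dots> = u * l\<^sup>2" using u l by (simp flip: powr_add powr_numeral)
    finally show ?thesis using u l by (simp add: power2_eq_square algebra_simps flip: ennreal_mult ennreal_plus)
  qed
  finally have "l\<^sup>2 / 2 * \<bar>D\<bar> \<le> 3 / 2 * u * l\<^sup>2" using u l by (subst (asm) ennreal_le_iff) auto
  then have "\<bar>D\<bar> \<le> 3 * u" using l by (simp add: field_simps)
  then show ?thesis by (simp add: D_def u_def)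
qed

text \<open>The interval is doubled, with fixed left end, until its length exceeds
  \<open>1/2\<close>; the changes of the average form a geometric sum. It converges for
  \<open>q > 1\<close> and has \<open>n\<close> equal terms for \<open>q = 1\<close>, and this is
  the source of the thresholds and of the logarithm.\<close>

lemma dyadic_average_bound:
  fixes f F :: "real \<Rightarrow> real"
  assumes F: "\<And>x. (F has_real_derivative f x) (at x)" and f: "continuous_on UNIV f" and p: "1 < p" and w: "0 < w" and q: "1 \<le> q"
    and G: "(\<integral>\<^sup>+ z. ennreal (\<bar>f (fst z) - f (snd z)\<bar> powr p / \<bar>fst z - snd z\<bar> powr (1 + q)) \<partial>(lborel \<Otimes>\<^sub>M lborel)) \<le> ennreal (w powr p)"
    and B: "(\<integral>\<^sup>+x. ennreal (\<bar>f x\<bar> powr p) \<partial>lborel) \<le> ennreal (w powr p)"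
    and l: "0 < l" "2 ^ n * l \<le> 1" "1 < 2 ^ Suc n * l"
  shows "\<bar>(F (a + l) - F a) / l\<bar> \<le> w * (4 + 3 * (\<Sum>k<n. (2 powr (- ((q - 1) / p))) ^ k))"
  using l
proof (induction n arbitrary: l)
  case 0
  have "(f has_integral F (a + l) - F a) {a..a + l}" by (rule integral_DERIV[OF F]) (use 0 in simp)
  then have "\<bar>F (a + l) - F a\<bar> \<le> integral {a..a + l} (\<lambda>x. \<bar>f x\<bar>)"
    using abs_integral_le[OF f, of a "a + l"] by (simp add: integral_unique)
  also have "\<dots> \<le> 2 * w" using 0 by (intro integral_abs_le_Lp[OF f p w B]) auto
  \<comment> \<open>At the coarsest scale \<open>l > 1/2\<close>; this accounts for the summand
    4.\<close>
  also have "2 * w \<le> 4 * w * l" using 0 w by (simp add: mult_left_mono)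
  finally show ?case using 0 by (simp add: divide_le_eq mult.commute mult.left_commute)
next
  case (Suc n)
  let ?\<theta> = "(q - 1) / p"
  have IH: "\<bar>(F (a + 2 * l) - F a) / (2 * l)\<bar> \<le> w * (4 + 3 * (\<Sum>k<n. (2 powr (- ?\<theta>)) ^ k))"
    using Suc.prems by (intro Suc.IH) auto
  have "2 * l \<le> 1 / 2 ^ n" using Suc.prems by (simp add: field_simps)
  moreover have "1 / 2 ^ n \<le> (1::real)" by simp
  ultimately have l1: "2 * l \<le> 1" by linarith
  have "0 < 2 * l" using Suc.prems by simp
  from dyadic_average_diff[OF F f p w q this l1 G, of a]
  have "\<bar>(F (a + l) - F a) / l - (F (a + 2 * l) - F a) / (2 * l)\<bar> \<le> 3 * (w * (2 * l) powr ?\<theta>)"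
    by (simp only: nonzero_mult_div_cancel_left[OF zero_neq_numeral[symmetric]])
  moreover have "(2 * l) powr ?\<theta> \<le> (2 powr (- ?\<theta>)) ^ n"
  proof -
    have "(2 * l) powr ?\<theta> \<le> (1 / 2 ^ n) powr ?\<theta>" using \<open>2 * l \<le> 1 / 2 ^ n\<close> Suc.prems q p by (intro powr_mono2) auto
    also have "\<dots> = (2 powr (- real n)) powr ?\<theta>" by (simp add: powr_minus_divide powr_realpow)
    also have "\<dots> = (2 powr (- ?\<theta>)) ^ n" by (simp add: powr_powr powr_power mult.commute)
    finally show ?thesis .
  qed
  then have "3 * (w * (2 * l) powr ?\<theta>) \<le> 3 * (w * (2 powr (- ?\<theta>)) ^ n)" using w by simp
  ultimately have "\<bar>(F (a + l) - F a) / l\<bar> \<le> w * (4 + 3 * (\<Sum>k<n. (2 powr (- ?\<theta>)) ^ k)) + 3 * (w * (2 powr (- ?\<theta>)) ^ n)"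
    using IH by linarith
  then show ?case by (simp add: algebra_simps)
qed

lemma dyadic_exponent:
  fixes l :: real
  assumes "0 < l" "l \<le> 1"
  obtains n where "2 ^ n * l \<le> 1" "1 < 2 ^ Suc n * l" "real n \<le> 2 * ln (1 / l)"
proof -
  define n where "n = nat \<lfloor>log 2 (1 / l)\<rfloor>"
  have L: "0 \<le> log 2 (1 / l)" using assms by simp
  have eq: "real n = real_of_int \<lfloor>log 2 (1 / l)\<rfloor>" using L by (simp add: n_def)
  have n: "real n \<le> log 2 (1 / l)" "log 2 (1 / l) < real (Suc n)"
    unfolding of_nat_Suc using eq of_int_floor_le[of "log 2 (1 / l)"] real_of_int_floor_add_one_gt[of "log 2 (1 / l)"] by linarith+
  have "2 powr real n \<le> 1 / l" using n(1) assms by (subst (asm) le_log_iff) auto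
  then have 1: "2 ^ n * l \<le> 1" using assms by (simp add: powr_realpow field_simps)
  have "1 / l < 2 powr real (Suc n)" using n(2) assms by (subst (asm) log_less_iff) auto
  then have "1 / l < 2 ^ Suc n" by (simp only: powr_realpow[OF zero_less_numeral])
  then have 2: "1 < 2 ^ Suc n * l" using assms by (simp add: field_simps)
  \<comment> \<open>The factor 2 in the conclusion stands for \<open>1 / ln 2\<close>.\<close>
  have "1 / 2 \<le> ln (2::real)" using ln_2_less_1 ln_ge_iff[of 2 "1/2"] exp_half_le2 by simp
  then have "log 2 (1 / l) \<le> ln (1 / l) / (1 / 2)" unfolding log_def using assms by (intro divide_left_mono) auto
  then show ?thesis using that[OF 1 2] n(1) by simp
qed

section \<open>Lower bounds for the norm in one chart\<close>

lemma W_norm_R_ge_Lp: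
  assumes "j \<le> nat \<lfloor>s\<rfloor>"
  shows "Lp_norm p ((deriv ^^ j) f) \<le> W_norm_R s p f"
proof -
  have "Lp_norm p ((deriv ^^ j) f) \<le> (\<Sum>j\<le>nat \<lfloor>s\<rfloor>. Lp_norm p ((deriv ^^ j) f))"
    by (rule member_le_sum) (use assms in auto)
  then show ?thesis unfolding W_norm_R_def Let_def by (rule add_increasing2[OF zero_le])
qed

lemma W_norm_R_ge_gagliardo:
  assumes "nat \<lfloor>s\<rfloor> = k" "s \<noteq> real k"
  shows "enn_rpow (\<integral>\<^sup>+ z. ennreal (\<bar>(deriv ^^ k) f (fst z) - (deriv ^^ k) f (snd z)\<bar> powr p
     / \<bar>fst z - snd z\<bar> powr (1 + (s - real k) * p)) \<partial>(lborel \<Otimes>\<^sub>M lborel)) (1 / p) \<le> W_norm_R s p f"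
  using assms by (simp add: W_norm_R_def Let_def add_increasing)

lemma W_norm_R_le_imp_Lp:
  assumes "W_norm_R s p f \<le> ennreal w" "j \<le> nat \<lfloor>s\<rfloor>" "0 < p" "0 \<le> w"
  shows "(\<integral>\<^sup>+ x. ennreal (\<bar>(deriv ^^ j) f x\<bar> powr p) \<partial>lborel) \<le> ennreal (w powr p)"
  using order_trans[OF W_norm_R_ge_Lp[OF assms(2)] assms(1)] assms(3,4)
  unfolding Lp_norm_def by (rule enn_rpow_le_imp_le)

lemma abs_le_of_zero:
  fixes u :: "real \<Rightarrow> real"
  assumes u: "smooth u" and p: "1 < p" and w: "0 < w"
    and B: "(\<integral>\<^sup>+ x. ennreal (\<bar>deriv u x\<bar> powr p) \<partial>lborel) \<le> ennreal (w powr p)"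
    and y: "u y = 0" "x \<le> y" "y \<le> x + 1"
  shows "\<bar>u x\<bar> \<le> 2 * w"
proof -
  have c: "continuous_on UNIV (deriv u)" by (intro smooth_continuous_on smooth_deriv u)
  have "(deriv u has_integral u y - u x) {x..y}" by (rule integral_DERIV[OF smooth_DERIV[OF u] y(2)])
  then have "\<bar>u x\<bar> \<le> integral {x..y} (\<lambda>x. \<bar>deriv u x\<bar>)"
    using abs_integral_le[OF c, of x y] y(1) by (simp add: integral_unique)
  also have "\<dots> \<le> 2 * w" by (rule integral_abs_le_Lp[OF c p w B y(2,3)])
  finally show ?thesis .
qed

lemma geometric_sum_le:
  fixes t :: real
  assumes "0 \<le> t" "t < 1"
  shows "(\<Sum>k<n. t ^ k) \<le> 1 / (1 - t)"
proof -
  have "(1 - t) * (\<Sum>k<n. t ^ k) = 1 - t ^ n" by (rule one_diff_power_eq[symmetric])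
  also have "\<dots> \<le> 1" using assms by simp
  finally show ?thesis using assms by (simp add: le_divide_eq mult.commute)
qed

text \<open>For \<open>s \<ge> 1\<close> one integrates the derivative from a zero at distance at
  most 1; such zeros exist because a cut-off field vanishes outside a ball of diameter at most 1.
  For \<open>s < 1\<close> the averages over shrinking intervals stay bounded, since
  \<open>s * p > 1\<close> makes the geometric sum converge.\<close>

lemma chart_sup_bound:
  assumes p: "1 < p" and s: "1 / p < s"
  obtains K where "0 < K"
    "\<And>u w x. smooth u \<Longrightarrow> 0 < w \<Longrightarrow> W_norm_R s p u \<le> ennreal w \<Longrightarrow> (\<And>x. \<exists>y. x \<le> y \<and> y \<le> x + 1 \<and> u y = 0) \<Longrightarrow> \<bar>u x\<bar> \<le> K * w"
proof (cases "1 \<le> s")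
  case True
  have "\<bar>u x\<bar> \<le> 2 * w" if u: "smooth u" "0 < w" "W_norm_R s p u \<le> ennreal w" "\<And>x. \<exists>y. x \<le> y \<and> y \<le> x + 1 \<and> u y = 0" for u w x
  proof -
    have "1 \<le> nat \<lfloor>s\<rfloor>" using True by linarith
    from W_norm_R_le_imp_Lp[OF u(3) this] have "(\<integral>\<^sup>+ x. ennreal (\<bar>deriv u x\<bar> powr p) \<partial>lborel) \<le> ennreal (w powr p)"
      using p u(2) by simp
    moreover obtain y where "x \<le> y" "y \<le> x + 1" "u y = 0" using u(4) by blast
    ultimately show ?thesis using abs_le_of_zero[OF u(1) p u(2)] by blast
  qed
  then show ?thesis using that[of 2] by simp
next
  case False
  define t where "t = 2 powr (- ((s * p - 1) / p))"
  have q: "1 < s * p" using p s by (simp add: divide_less_eq)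
  then have "- ((s * p - 1) / p) < 0" using p by simp
  then have t: "0 \<le> t" "t < 1" unfolding t_def by (simp, metis less_numeral_extra(4) one_less_numeral_iff powr_less_one semiring_norm(76))
  define K where "K = 4 + 3 * (1 / (1 - t))"
  have s0: "0 < s" using s p by (meson divide_pos_pos less_trans zero_less_one)
  have fl: "nat \<lfloor>s\<rfloor> = 0" using s0 False by linarith
  have "\<bar>u x\<bar> \<le> K * w" if u: "smooth u" "0 < w" "W_norm_R s p u \<le> ennreal w" for u w x
  proof -
    have uc: "continuous_on UNIV u" by (rule smooth_continuous_on[OF u(1)])
    obtain F where F: "\<And>x. (F has_real_derivative u x) (at x)" by (rule continuous_antiderivative[OF uc]) blast
    have B: "(\<integral>\<^sup>+ x. ennreal (\<bar>u x\<bar> powr p) \<partial>lborel) \<le> ennreal (w powr p)"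
      using W_norm_R_le_imp_Lp[OF u(3), of 0] p u(2) by simp
    have "enn_rpow (\<integral>\<^sup>+ z. ennreal (\<bar>u (fst z) - u (snd z)\<bar> powr p / \<bar>fst z - snd z\<bar> powr (1 + s * p)) \<partial>(lborel \<Otimes>\<^sub>M lborel)) (1 / p) \<le> ennreal w"
      using order_trans[OF W_norm_R_ge_gagliardo[OF fl] u(3)] s0 by simp
    then have G: "(\<integral>\<^sup>+ z. ennreal (\<bar>u (fst z) - u (snd z)\<bar> powr p / \<bar>fst z - snd z\<bar> powr (1 + s * p)) \<partial>(lborel \<Otimes>\<^sub>M lborel)) \<le> ennreal (w powr p)"
      by (rule enn_rpow_le_imp_le) (use p u in auto)
    \<comment> \<open>The averages over \<open>[x, x + l n]\<close> are difference quotients of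
      \<open>F\<close> and converge to \<open>u x\<close>.\<close>
    define l :: "nat \<Rightarrow> real" where "l n = (1 / 2) ^ n" for n
    have D: "\<bar>(F (x + l n) - F x) / l n\<bar> \<le> K * w" for n
    proof -
      have "2 ^ n * l n = 1" by (simp add: l_def power_divide)
      then have "\<bar>(F (x + l n) - F x) / l n\<bar> \<le> w * (4 + 3 * (\<Sum>k<n. t ^ k))"
        unfolding t_def by (intro dyadic_average_bound[OF F uc p u(2) less_imp_le[OF q] G B]) (auto simp: l_def)
      also have "\<dots> \<le> w * K" unfolding K_def using u(2) by (intro mult_left_mono add_left_mono geometric_sum_le t) auto
      finally show ?thesis by (simp add: mult.commute)
    qed
    have "filterlim l (at 0) sequentially"
      unfolding l_def by (intro filterlim_atI LIMSEQ_power_zero) auto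
    then have "(\<lambda>n. (F (x + l n) - F x) / l n) \<longlonglongrightarrow> u x"
      using F[of x] unfolding DERIV_def by (rule filterlim_compose[rotated])
    then have "(\<lambda>n. \<bar>(F (x + l n) - F x) / l n\<bar>) \<longlonglongrightarrow> \<bar>u x\<bar>" by (rule tendsto_rabs)
    then show ?thesis by (rule LIMSEQ_le_const2) (use D in blast)
  qed
  moreover have "0 < K" using t by (simp add: K_def add_pos_pos)
  ultimately show ?thesis using that by blast
qed

text \<open>The difference quotient of \<open>u\<close> is an average of \<open>deriv u\<close>, so
  the dyadic bound applies one order higher. At the threshold none of its terms decays and their
  number is of order \<open>ln (1 / l)\<close>; bounding each by 1 covers all \<open>s\<close> below
  2. From \<open>s = 2\<close> on, \<open>deriv u\<close> itself is bounded.\<close>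

lemma chart_modulus_bound:
  assumes p: "1 < p" and s: "1 + 1 / p \<le> s" and u: "smooth u" and w: "0 < w" "W_norm_R s p u \<le> ennreal w"
    and z: "\<And>x. \<exists>y. x \<le> y \<and> y \<le> x + 1 \<and> deriv u y = 0" and l: "0 < l" "l \<le> 1"
  shows "\<bar>u (x + l) - u x\<bar> \<le> 6 * (w * (l * (1 - ln l)))"
proof (cases "2 \<le> s")
  case True
  then have "2 \<le> nat \<lfloor>s\<rfloor>" by linarith
  from W_norm_R_le_imp_Lp[OF w(2) this] have B: "(\<integral>\<^sup>+ x. ennreal (\<bar>deriv (deriv u) x\<bar> powr p) \<partial>lborel) \<le> ennreal (w powr p)"
    using p w by (simp add: numeral_2_eq_2)
  have "\<bar>deriv u x\<bar> \<le> 2 * w" for x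
    using abs_le_of_zero[OF smooth_deriv[OF u] p w(1) B] z[of x] by blast
  then have "\<bar>u (x + l) - u x\<bar> \<le> 2 * w * \<bar>(x + l) - x\<bar>" by (rule smooth_DERIV_lipschitz[OF u])
  also have "\<dots> = 2 * (w * (l * 1))" using l by simp
  also have "\<dots> \<le> 6 * (w * (l * (1 - ln l)))" using w l by (intro mult_mono) auto
  finally show ?thesis .
next
  case False
  have p1: "0 < 1 / p" using p by simp
  have fl: "nat \<lfloor>s\<rfloor> = 1" using False s p1 by linarith
  have q: "1 \<le> (s - 1) * p" using s p by (simp add: field_simps)
  have "(\<integral>\<^sup>+ x. ennreal (\<bar>(deriv ^^ 1) u x\<bar> powr p) \<partial>lborel) \<le> ennreal (w powr p)"
    by (rule W_norm_R_le_imp_Lp[OF w(2)]) (use fl p w in auto)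
  then have B: "(\<integral>\<^sup>+ x. ennreal (\<bar>deriv u x\<bar> powr p) \<partial>lborel) \<le> ennreal (w powr p)" by simp
  have "s \<noteq> real 1" using s p1 by linarith
  from order_trans[OF W_norm_R_ge_gagliardo[OF fl this] w(2)]
  have "enn_rpow (\<integral>\<^sup>+ z. ennreal (\<bar>deriv u (fst z) - deriv u (snd z)\<bar> powr p / \<bar>fst z - snd z\<bar> powr (1 + (s - 1) * p)) \<partial>(lborel \<Otimes>\<^sub>M lborel)) (1 / p) \<le> ennreal w"
    by simp
  then have G: "(\<integral>\<^sup>+ z. ennreal (\<bar>deriv u (fst z) - deriv u (snd z)\<bar> powr p / \<bar>fst z - snd z\<bar> powr (1 + (s - 1) * p)) \<partial>(lborel \<Otimes>\<^sub>M lborel)) \<le> ennreal (w powr p)"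
    by (rule enn_rpow_le_imp_le) (use p w in auto)
  obtain n where n: "2 ^ n * l \<le> 1" "1 < 2 ^ Suc n * l" "real n \<le> 2 * ln (1 / l)" by (rule dyadic_exponent[OF l]) blast
  let ?t = "2 powr (- (((s - 1) * p - 1) / p)) :: real"
  have "0 \<le> ((s - 1) * p - 1) / p" using q p by simp
  then have t: "?t \<le> 1" using powr_mono[of "- (((s - 1) * p - 1) / p)" 0 2] by simp
  have "\<bar>(u (x + l) - u x) / l\<bar> \<le> w * (4 + 3 * (\<Sum>k<n. ?t ^ k))"
    by (rule dyadic_average_bound[OF smooth_DERIV[OF u] _ p w(1) q G B l(1) n(1,2)]) (intro smooth_continuous_on smooth_deriv u)
  also have "(\<Sum>k<n. ?t ^ k) \<le> (\<Sum>k<n. 1)" using t by (intro sum_mono power_le_one) auto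
  also have "\<dots> = real n" by simp
  also have "w * (4 + 3 * real n) \<le> w * (6 * (1 - ln l))"
  proof (rule mult_left_mono)
    have "ln (1 / l) = - ln l" using l by (simp add: ln_div)
    then have "real n \<le> 2 * (- ln l)" using n(3) by (simp only:)
    then have "3 * real n \<le> 3 * (2 * (- ln l))" by (rule mult_left_mono) simp
    then show "4 + 3 * real n \<le> 6 * (1 - ln l)" by simp
  qed (use w in simp)
  finally have *: "\<bar>(u (x + l) - u x) / l\<bar> \<le> w * (6 * (1 - ln l))" using w by simp
  have "\<bar>u (x + l) - u x\<bar> = l * \<bar>(u (x + l) - u x) / l\<bar>" using l by simp
  also have "\<dots> \<le> l * (w * (6 * (1 - ln l)))" using * l by (intro mult_left_mono) auto
  finally show ?thesis by (simp only: ac_simps)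
qed

section \<open>From the charts to the circle\<close>

lemma smooth_periodic_diff_of_int: "smooth_periodic X \<Longrightarrow> X (x - real_of_int n) = X x"
  using periodic_of_int[of X 0 x "- n"] smooth_periodicD(2)[of X] by simp

lemma cutoff_zero: "0 < r \<Longrightarrow> r \<le> 1/2 \<Longrightarrow> \<exists>y. x \<le> y \<and> y \<le> x + 1 \<and> cutoff c r Z y = 0"
proof (cases "\<bar>x - c\<bar> < r")
  case True
  assume "0 < r" "r \<le> 1/2"
  then have "x \<le> c + r" "c + r \<le> x + 1" "cutoff c r Z (c + r) = 0" using True by (auto simp: cutoff_def)
  then show ?thesis by blast
next
  case False
  then show ?thesis by (intro exI[of _ x]) (simp add: cutoff_def)
qed

lemma local_rep_zero: "0 < r \<Longrightarrow> r \<le> 1/2 \<Longrightarrow> \<exists>y. x \<le> y \<and> y \<le> x + 1 \<and> local_rep c r \<rho> X y = 0"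
  unfolding local_rep_cutoff by (rule cutoff_zero)

text \<open>If \<open>\<rho> x\<close> is nonzero, an integer translate of \<open>x\<close> lies in
  the ball, and the local representative takes the value \<open>\<rho> x * X x\<close>
  there.\<close>

lemma chart_term_sup_bound:
  assumes P: "admissible_pu P" "(c, r, \<rho>) \<in> set P" and X: "smooth_periodic X"
    and K: "\<And>x. \<bar>local_rep c r \<rho> X x\<bar> \<le> M"
  shows "\<bar>\<rho> x * X x\<bar> \<le> M"
proof (cases "\<rho> x = 0")
  case True
  then show ?thesis using K[of 0] by simp
next
  case False
  obtain \<delta> where \<delta>: "0 < \<delta>" "\<And>x. \<rho> x \<noteq> 0 \<Longrightarrow> \<exists>n::int. \<bar>x - c - real_of_int n\<bar> \<le> r - \<delta>" and \<rho>: "smooth_periodic \<rho>"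
    by (rule admissible_puD[OF P]) blast
  from \<delta>(2)[OF False] obtain n :: int where n: "\<bar>x - c - real_of_int n\<bar> \<le> r - \<delta>" by blast
  then have "\<bar>x - real_of_int n - c\<bar> < r" using \<delta>(1) by linarith
  then have "local_rep c r \<rho> X (x - real_of_int n) = \<rho> x * X x"
    by (simp add: local_rep_def smooth_periodic_diff_of_int \<rho> X)
  then show ?thesis using K by metis
qed

lemma sum_list_abs_le:
  fixes f :: "'a \<Rightarrow> real"
  assumes "\<And>a. a \<in> set L \<Longrightarrow> \<bar>f a\<bar> \<le> B"
  shows "\<bar>\<Sum>a\<leftarrow>L. f a\<bar> \<le> real (length L) * B"
  using assms
proof (induction L)
  case (Cons a L)
  have "\<bar>f a\<bar> \<le> B" "\<bar>\<Sum>a\<leftarrow>L. f a\<bar> \<le> real (length L) * B" using Cons by simp_all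
  then show ?case by (simp add: distrib_right)
qed simp

lemma sum_list_partition_of_unity:
  assumes "admissible_pu P"
  shows "(\<Sum>(c, r, \<rho>)\<leftarrow>P. \<rho> x * X x) = X x"
proof -
  have "(\<Sum>(c, r, \<rho>)\<leftarrow>P. \<rho> x * X x) = (\<Sum>a\<leftarrow>P. (case a of (c, r, \<rho>) \<Rightarrow> \<rho> x) * X x)"
    by (intro arg_cong[of _ _ sum_list] map_cong) auto
  also have "\<dots> = (\<Sum>(c, r, \<rho>)\<leftarrow>P. \<rho> x) * X x" by (rule sum_list_mult_const)
  finally show ?thesis using assms by (simp add: admissible_pu_def)
qed

text \<open>The chart estimates work with a strictly positive bound \<open>w\<close> of the norm.
  Letting \<open>w\<close> decrease to \<open>W\<close> turns them into one inequality that includes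
  \<open>W = 0\<close> and \<open>W = \<infinity>\<close>.\<close>

lemma ennreal_le_of_homogeneous_bound:
  assumes "0 < C" "\<And>w. 0 < w \<Longrightarrow> W \<le> ennreal w \<Longrightarrow> y \<le> C * w"
  shows "ennreal (y / C) \<le> W"
proof (cases W rule: ennreal_cases_real)
  case (real r)
  have "y / C \<le> r + e" if "0 < e" for e
  proof -
    have "y \<le> C * (r + e)" using real that by (intro assms(2)) (auto simp: ennreal_leI)
    then show ?thesis using assms(1) by (simp add: divide_le_eq mult.commute)
  qed
  then have "y / C \<le> r" by (rule field_le_epsilon)
  then show ?thesis using real by (simp add: ennreal_leI)
qed simp

lemma W_norm_S1_ge_sup:
  assumes p: "1 < p" and s: "1 / p < s" and P: "admissible_pu P"
  obtains C where "0 < C" "\<And>X x. smooth_periodic X \<Longrightarrow> ennreal (\<bar>X x\<bar> / C) \<le> W_norm_S1 P s p X"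
proof -
  obtain K where K: "0 < K" "\<And>u w x. smooth u \<Longrightarrow> 0 < w \<Longrightarrow> W_norm_R s p u \<le> ennreal w \<Longrightarrow>
      (\<And>x. \<exists>y. x \<le> y \<and> y \<le> x + 1 \<and> u y = 0) \<Longrightarrow> \<bar>u x\<bar> \<le> K * w"
    by (rule chart_sup_bound[OF p s]) blast
  define C where "C = real (length P) * K + 1"
  have C: "0 < C" using K(1) by (simp add: C_def add_nonneg_pos)
  have "ennreal (\<bar>X x\<bar> / C) \<le> W_norm_S1 P s p X" if X: "smooth_periodic X" for X x
  proof (rule ennreal_le_of_homogeneous_bound[OF C])
    fix w assume w: "0 < w" "W_norm_S1 P s p X \<le> ennreal w"
    have "\<bar>case a of (c, r, \<rho>) \<Rightarrow> \<rho> x * X x\<bar> \<le> K * w" if "a \<in> set P" for a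
    proof -
      obtain c r \<rho> where a: "a = (c, r, \<rho>)" by (cases a)
      have m: "(c, r, \<rho>) \<in> set P" using that a by simp
      have r: "0 < r" "r \<le> 1/2" by (rule admissible_puD[OF P m], assumption)+
      have "\<bar>local_rep c r \<rho> X x\<bar> \<le> K * w" for x
        by (rule K(2)[OF local_rep_smooth[OF P m smooth_periodicD(1)[OF X]] w(1) order_trans[OF W_norm_S1_ge[OF m] w(2)] local_rep_zero[OF r]])
      then show ?thesis unfolding a using chart_term_sup_bound[OF P m X] by simp
    qed
    then have "\<bar>\<Sum>a\<leftarrow>P. case a of (c, r, \<rho>) \<Rightarrow> \<rho> x * X x\<bar> \<le> real (length P) * (K * w)" by (rule sum_list_abs_le)
    then have "\<bar>X x\<bar> \<le> real (length P) * (K * w)" by (simp add: sum_list_partition_of_unity[OF P])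
    also have "\<dots> \<le> C * w" using w by (simp add: C_def distrib_right)
    finally show "\<bar>X x\<bar> \<le> C * w" .
  qed
  then show ?thesis using that C by blast
qed

text \<open>Points closer than \<open>\<delta>\<close> lie in a common translate of the chart ball
  as soon as \<open>\<rho>\<close> is nonzero at one of them, and the modulus of the local
  representative applies. For \<open>l \<ge> \<delta>\<close> the sup bound is enough.\<close>

lemma W_norm_S1_ge_modulus:
  assumes p: "1 < p" and s: "1 + 1 / p \<le> s" and P: "admissible_pu P"
  obtains C where "0 < C" "\<And>X x l. smooth_periodic X \<Longrightarrow> 0 < l \<Longrightarrow> l \<le> 1 \<Longrightarrow>
    ennreal (\<bar>X (x + l) - X x\<bar> / (l * (1 - ln l)) / C) \<le> W_norm_S1 P s p X"
proof -
  have s1: "1 / p < s" using s by linarith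
  obtain K where K: "0 < K" "\<And>u w x. smooth u \<Longrightarrow> 0 < w \<Longrightarrow> W_norm_R s p u \<le> ennreal w \<Longrightarrow>
      (\<And>x. \<exists>y. x \<le> y \<and> y \<le> x + 1 \<and> u y = 0) \<Longrightarrow> \<bar>u x\<bar> \<le> K * w"
    by (rule chart_sup_bound[OF p s1]) blast
  define Q where "Q a C \<longleftrightarrow> (\<forall>X w x l. smooth_periodic X \<longrightarrow> 0 < w \<longrightarrow> W_norm_S1 P s p X \<le> ennreal w \<longrightarrow> 0 < l \<longrightarrow> l \<le> 1 \<longrightarrow>
     \<bar>(case a of (c, r, \<rho>) \<Rightarrow> \<rho> (x + l) * X (x + l)) - (case a of (c, r, \<rho>) \<Rightarrow> \<rho> x * X x)\<bar> \<le> C * (w * (l * (1 - ln l))))" for a :: "real \<times> real \<times> (real \<Rightarrow> real)" and C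
  have "\<exists>C>0. \<forall>a\<in>set P. Q a C"
  proof (rule finite_uniform_constant)
    fix a assume "a \<in> set P"
    moreover obtain c r \<rho> where a: "a = (c, r, \<rho>)" by (cases a)
    ultimately have m: "(c, r, \<rho>) \<in> set P" by simp
    obtain \<delta> where \<delta>: "0 < \<delta>" "vanishes_near c r \<delta> \<rho>" "\<And>x. \<rho> x \<noteq> 0 \<Longrightarrow> \<exists>n::int. \<bar>x - c - real_of_int n\<bar> \<le> r - \<delta>"
      and r: "0 < r" "r \<le> 1/2" and \<rho>: "smooth_periodic \<rho>"
      by (rule admissible_puD[OF P m]) blast
    have "Q (c, r, \<rho>) (6 + 2 * K / \<delta>)"
      unfolding Q_def prod.case
    proof (intro allI impI)
      fix X w x l assume X: "smooth_periodic X" and w: "0 < w" "W_norm_S1 P s p X \<le> ennreal w" and l: "0 < l" "(l::real) \<le> 1"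
      let ?u = "local_rep c r \<rho> X"
      have u: "smooth ?u" by (rule local_rep_smooth[OF P m smooth_periodicD(1)[OF X]])
      have uw: "W_norm_R s p ?u \<le> ennreal w" by (rule order_trans[OF W_norm_S1_ge[OF m] w(2)])
      have l1: "0 \<le> w * (l * 1)" "w * (l * 1) \<le> w * (l * (1 - ln l))" using w l by (auto intro!: mult_left_mono)
      show "\<bar>\<rho> (x + l) * X (x + l) - \<rho> x * X x\<bar> \<le> (6 + 2 * K / \<delta>) * (w * (l * (1 - ln l)))"
      proof (cases "l < \<delta>")
        case True
        have "\<bar>\<rho> (x + l) * X (x + l) - \<rho> x * X x\<bar> \<le> 6 * (w * (l * (1 - ln l)))"
        proof (cases "\<rho> (x + l) = 0 \<and> \<rho> x = 0")
          case True
          then show ?thesis using l1 by simp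
        next
          case False
          obtain n :: int where n: "\<bar>x - c - real_of_int n\<bar> < r" "\<bar>x + l - c - real_of_int n\<bar> < r"
          proof (cases "\<rho> x = 0")
            case True
            with False obtain n :: int where "\<bar>x + l - c - real_of_int n\<bar> \<le> r - \<delta>" using \<delta>(3) by blast
            then show ?thesis using that[of n] \<open>l < \<delta>\<close> l \<delta>(1) by linarith
          next
            case False
            then obtain n :: int where "\<bar>x - c - real_of_int n\<bar> \<le> r - \<delta>" using \<delta>(3) by blast
            then show ?thesis using that[of n] \<open>l < \<delta>\<close> l \<delta>(1) by linarith
          qed
          have n': "\<bar>x - real_of_int n - c\<bar> < r" "\<bar>x - real_of_int n + l - c\<bar> < r" using n by linarith+
          have eq: "x - real_of_int n + l = (x + l) - real_of_int n" by simp
          have "?u (x - real_of_int n) = \<rho> x * X x" using n'(1) by (simp add: local_rep_def smooth_periodic_diff_of_int \<rho> X)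
          moreover have "?u (x - real_of_int n + l) = \<rho> (x + l) * X (x + l)"
            using n'(2) unfolding eq by (simp add: local_rep_def smooth_periodic_diff_of_int \<rho> X)
          \<comment> \<open>The derivative of a local representative is again a cut-off function, so
            it too has a zero in every interval of length 1.\<close>
          moreover have "\<exists>y. x \<le> y \<and> y \<le> x + 1 \<and> deriv ?u y = 0" for x
          proof -
            have "smooth (\<lambda>x. \<rho> x * X x)" using \<rho> X by (intro smooth_mult smooth_periodicD(1))
            then have "deriv ?u = cutoff c r (deriv (\<lambda>x. \<rho> x * X x))"
              unfolding local_rep_cutoff using cutoff_funpow_deriv[of _ c r \<delta> 1] vanishes_near_mult[OF \<delta>(2)] \<delta>(1) by simp
            then show ?thesis using cutoff_zero[OF r] by simp
          qed
          ultimately show ?thesis using chart_modulus_bound[OF p s u w(1) uw _ l, of "x - real_of_int n"] by simp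
        qed
        also have "\<dots> \<le> (6 + 2 * K / \<delta>) * (w * (l * (1 - ln l)))" using l1 K(1) \<delta>(1) by (intro mult_right_mono) auto
        finally show ?thesis .
      next
        case False
        have "\<bar>?u x\<bar> \<le> K * w" for x by (rule K(2)[OF u w(1) uw local_rep_zero[OF r]])
        then have b: "\<bar>\<rho> x * X x\<bar> \<le> K * w" for x by (rule chart_term_sup_bound[OF P m X])
        have "\<bar>\<rho> (x + l) * X (x + l) - \<rho> x * X x\<bar> \<le> 2 * (K * w) * 1" using b[of "x + l"] b[of x] by linarith
        also have "\<dots> \<le> 2 * (K * w) * (l / \<delta>)" using False \<delta> K w by (intro mult_left_mono) auto
        also have "\<dots> = 2 * K / \<delta> * (w * (l * 1))" by simp
        also have "\<dots> \<le> (6 + 2 * K / \<delta>) * (w * (l * (1 - ln l)))"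
          by (rule mult_mono[OF _ l1(2) _ l1(1)]) (use K(1) \<delta>(1) in auto)
        finally show ?thesis .
      qed
    qed
    then show "\<exists>C. Q a C" unfolding a by blast
  next
    fix a C C' assume Q: "Q a C" "C \<le> C'"
    show "Q a C'"
      unfolding Q_def
    proof (intro allI impI)
      fix X w x l assume X: "smooth_periodic X" "0 < w" "W_norm_S1 P s p X \<le> ennreal w" "0 < l" "(l::real) \<le> 1"
      have "\<bar>(case a of (c, r, \<rho>) \<Rightarrow> \<rho> (x + l) * X (x + l)) - (case a of (c, r, \<rho>) \<Rightarrow> \<rho> x * X x)\<bar> \<le> C * (w * (l * (1 - ln l)))"
        using Q(1) X unfolding Q_def by blast
      also have "\<dots> \<le> C' * (w * (l * (1 - ln l)))"
      proof (rule mult_right_mono[OF Q(2)])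
        have "ln l \<le> 0" using X by simp
        then show "0 \<le> w * (l * (1 - ln l))" using X(2,4) by (intro mult_nonneg_nonneg) linarith+
      qed
      finally show "\<bar>(case a of (c, r, \<rho>) \<Rightarrow> \<rho> (x + l) * X (x + l)) - (case a of (c, r, \<rho>) \<Rightarrow> \<rho> x * X x)\<bar> \<le> C' * (w * (l * (1 - ln l)))" .
    qed
  qed simp
  then obtain C1 where C1: "0 < C1" "\<And>a. a \<in> set P \<Longrightarrow> Q a C1" by blast
  define C where "C = real (length P) * C1 + 1"
  have C: "0 < C" using C1(1) by (simp add: C_def add_nonneg_pos)
  have "ennreal (\<bar>X (x + l) - X x\<bar> / (l * (1 - ln l)) / C) \<le> W_norm_S1 P s p X"
    if X: "smooth_periodic X" and l: "0 < l" "l \<le> 1" for X x l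
  proof (rule ennreal_le_of_homogeneous_bound[OF C])
    fix w assume w: "0 < w" "W_norm_S1 P s p X \<le> ennreal w"
    have ln0: "ln l \<le> 0" using l by simp
    have l0: "0 < l * (1 - ln l)" using l ln0 by (intro mult_pos_pos) linarith+
    let ?f = "\<lambda>x a. case a of (c, r, \<rho>) \<Rightarrow> \<rho> x * X x"
    have "\<bar>?f (x + l) a - ?f x a\<bar> \<le> C1 * (w * (l * (1 - ln l)))" if "a \<in> set P" for a
      using C1(2)[OF that] X w l unfolding Q_def by blast
    then have "\<bar>\<Sum>a\<leftarrow>P. ?f (x + l) a - ?f x a\<bar> \<le> real (length P) * (C1 * (w * (l * (1 - ln l))))" by (rule sum_list_abs_le)
    then have "\<bar>X (x + l) - X x\<bar> \<le> real (length P) * (C1 * (w * (l * (1 - ln l))))"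
      by (simp only: sum_list_subtractf sum_list_partition_of_unity[OF P])
    also have "\<dots> = real (length P) * C1 * w * (l * (1 - ln l))" by (simp only: ac_simps)
    also have "\<dots> \<le> C * w * (l * (1 - ln l))" using w l0 by (intro mult_right_mono) (auto simp: C_def)
    finally show "\<bar>X (x + l) - X x\<bar> / (l * (1 - ln l)) \<le> C * w" using l0 by (simp only: pos_divide_le_eq)
  qed
  then show ?thesis using that C by blast
qed

section \<open>Lower bounds for the length of paths\<close>

lemma path_velocity_at:
  assumes "diff_path \<Phi>" "t \<in> {0..1}"
  shows "path_velocity \<Phi> t (\<Phi> t x) = deriv (\<lambda>\<tau>. \<Phi> \<tau> x) t"
  using diff_path_diff_lift[OF assms] by (simp add: path_velocity_def)

text \<open>Differentiates \<open>\<Phi> \<tau> (z + 1) = \<Phi> \<tau> z + 1\<close> in time. This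
  identity is known for times in \<open>[0, 1]\<close> only, hence the restriction to interior
  \<open>t\<close>.\<close>

lemma path_velocity_periodic:
  assumes \<Phi>: "diff_path \<Phi>" and t: "0 < t" "t < 1"
  shows "smooth_periodic (path_velocity \<Phi> t)"
proof -
  have t': "t \<in> {0..1}" using t by simp
  have "path_velocity \<Phi> t (y + 1) = path_velocity \<Phi> t y" for y
  proof -
    define z where "z = inv (\<Phi> t) y"
    have y: "y = \<Phi> t z" unfolding z_def using diff_lift_bij[OF diff_path_diff_lift[OF \<Phi> t']] by (simp add: bij_is_surj surj_f_inv_f)
    have sh: "\<Phi> \<tau> (z + 1) = \<Phi> \<tau> z + 1" if "\<tau> \<in> {0..1}" for \<tau>
      using diff_path_diff_lift[OF \<Phi> that] by (simp add: diff_lift_def)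
    have "((\<lambda>\<tau>. \<Phi> \<tau> z + 1) has_real_derivative deriv (\<lambda>\<tau>. \<Phi> \<tau> z) t + 0) (at t)"
      by (intro DERIV_add DERIV_const diff_path_DERIV[OF \<Phi>])
    then have "((\<lambda>\<tau>. \<Phi> \<tau> (z + 1)) has_real_derivative deriv (\<lambda>\<tau>. \<Phi> \<tau> z) t + 0) (at t)"
      by (rule has_field_derivative_transform_within_open[of _ _ _ "{0<..<1}"]) (use t sh in auto)
    then have "deriv (\<lambda>\<tau>. \<Phi> \<tau> (z + 1)) t = deriv (\<lambda>\<tau>. \<Phi> \<tau> z) t" using DERIV_imp_deriv by fastforce
    then show ?thesis using path_velocity_at[OF \<Phi> t', of z] path_velocity_at[OF \<Phi> t', of "z + 1"] sh[OF t'] y by simp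
  qed
  then show ?thesis using smooth_path_velocity[OF \<Phi> t'] by (simp add: smooth_periodic_def)
qed

text \<open>A scalar quantity \<open>\<phi>\<close> whose rate of change is at most \<open>C\<close>
  times the speed cannot change by more than \<open>C\<close> times the length. It is applied to the
  position of a point and to the iterated logarithm of the length of an arc.\<close>

lemma path_length_ge:
  assumes C: "0 < C" and D: "\<And>t. t \<in> {0..1} \<Longrightarrow> (\<phi> has_real_derivative \<phi>' t) (at t)" and c: "continuous_on {0..1} \<phi>'"
    and W: "\<And>t. 0 < t \<Longrightarrow> t < 1 \<Longrightarrow> ennreal (\<bar>\<phi>' t\<bar> / C) \<le> W_norm_S1 P s p (path_velocity \<Phi> t)"
  shows "ennreal (\<bar>\<phi> 1 - \<phi> 0\<bar> / C) \<le> path_length P s p \<Phi>"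
proof -
  \<comment> \<open>Clamping the time extends the rate continuously to the whole line, the form in
    which the integral lemmas are stated.\<close>
  define g where "g t = \<phi>' (max 0 (min 1 t))" for t :: real
  have cg: "continuous_on UNIV g"
    unfolding g_def by (rule continuous_on_compose2[OF c]) (auto intro!: continuous_intros)
  have g: "g t = \<phi>' t" if "t \<in> {0..1}" for t using that by (simp add: g_def)
  have "(\<phi>' has_integral \<phi> 1 - \<phi> 0) {0..1}"
    by (rule fundamental_theorem_of_calculus)
       (use D in \<open>auto simp: has_real_derivative_iff_has_vector_derivative intro: has_vector_derivative_at_within\<close>)
  then have "(g has_integral \<phi> 1 - \<phi> 0) {0..1}" using g by (subst has_integral_cong[of _ g \<phi>']) auto
  then have "\<bar>\<phi> 1 - \<phi> 0\<bar> \<le> integral {0..1} (\<lambda>t. \<bar>g t\<bar>)" using abs_integral_le[OF cg, of 0 1] by (simp add: integral_unique)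
  then have "\<bar>\<phi> 1 - \<phi> 0\<bar> / C \<le> integral {0..1} (\<lambda>t. \<bar>g t\<bar>) / C" using C by (intro divide_right_mono) auto
  also have "\<dots> = integral {0..1} (\<lambda>t. \<bar>g t\<bar> / C)" by simp
  finally have "ennreal (\<bar>\<phi> 1 - \<phi> 0\<bar> / C) \<le> ennreal (integral {0..1} (\<lambda>t. \<bar>g t\<bar> / C))" by (rule ennreal_leI)
  also have "\<dots> = (\<integral>\<^sup>+t. ennreal (\<bar>g t\<bar> / C) * indicator {0..1} t \<partial>lborel)"
    by (rule nn_integral_continuous_Icc[symmetric]) (use C cg in \<open>auto intro!: continuous_on_divide continuous_on_rabs\<close>)
  also have "\<dots> \<le> (\<integral>\<^sup>+t. indicator {0..1} t * W_norm_S1 P s p (path_velocity \<Phi> t) \<partial>lborel)"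
  proof (rule nn_integral_mono_AE)
    have "AE t in lborel. t \<noteq> (0::real)" "AE t in lborel. t \<noteq> (1::real)" by (rule AE_lborel_singleton)+
    then show "AE t in lborel. ennreal (\<bar>g t\<bar> / C) * indicator {0..1} t \<le> indicator {0..1} t * W_norm_S1 P s p (path_velocity \<Phi> t)"
    proof eventually_elim
      case (elim t)
      then show ?case using W[of t] g[of t] by (auto simp: indicator_def)
    qed
  qed
  finally show ?thesis by (simp add: path_length_def)
qed

lemma continuous_path_velocity_at:
  assumes "diff_path \<Phi>"
  shows "continuous_on S (\<lambda>t. deriv (\<lambda>\<tau>. \<Phi> \<tau> x) t)"
proof -
  have "smooth (\<lambda>t. (\<lambda>a b. deriv (\<lambda>\<tau>. \<Phi> \<tau> b) a) t ((\<lambda>_. x) t))"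
    by (rule smooth_compose2[OF smooth_partial_smooth]) (use assms in \<open>auto simp: diff_path_def\<close>)
  then show ?thesis using smooth_continuous_on by simp
qed

lemma diff_diam_ge:
  assumes "diff_lift g" "diff_lift h"
    and "\<And>\<Phi> n. diff_path \<Phi> \<Longrightarrow> \<Phi> 0 = g \<Longrightarrow> \<Phi> 1 = (\<lambda>x. h x + real_of_int n) \<Longrightarrow> L \<le> path_length P s p \<Phi>"
  shows "L \<le> diff_diam P s p"
proof -
  have "L \<le> diff_dist P s p g h" unfolding diff_dist_def by (rule INF_greatest) (use assms(3) in blast)
  also have "\<dots> \<le> diff_diam P s p"
    unfolding diff_diam_def using SUP_upper[of "(g, h)" "{(g, h). diff_lift g \<and> diff_lift h}" "\<lambda>(g, h). diff_dist P s p g h"] assms by simp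
  finally show ?thesis .
qed

text \<open>The half turn is the rotation farthest from the identity: each of its lifts moves the
  point 0 by at least \<open>1/2\<close>, and the sup norm of the velocity dominates the speed of
  that point.\<close>

lemma diff_diam_pos:
  assumes p: "1 < p" and s: "1 / p < s" and P: "admissible_pu P"
  shows "0 < diff_diam P s p"
proof -
  obtain C where C: "0 < C" "\<And>X x. smooth_periodic X \<Longrightarrow> ennreal (\<bar>X x\<bar> / C) \<le> W_norm_S1 P s p X"
    by (rule W_norm_S1_ge_sup[OF p s P]) blast
  have "0 < ennreal (1 / 2 / C)" using C by simp
  also have "\<dots> \<le> diff_diam P s p"
  proof (rule diff_diam_ge[OF diff_lift_ident diff_lift_add_const[OF diff_lift_ident, of "1/2"]])
    fix \<Phi> and n :: int assume \<Phi>: "diff_path \<Phi>" "\<Phi> 0 = (\<lambda>x. x)" "\<Phi> 1 = (\<lambda>x. x + 1 / 2 + real_of_int n)"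
    have "ennreal (\<bar>deriv (\<lambda>\<tau>. \<Phi> \<tau> 0) t\<bar> / C) \<le> W_norm_S1 P s p (path_velocity \<Phi> t)" if "0 < t" "t < 1" for t
      using C(2)[OF path_velocity_periodic[OF \<Phi>(1) that], of "\<Phi> t 0"] path_velocity_at[OF \<Phi>(1), of t 0] that by simp
    then have "ennreal (\<bar>\<Phi> 1 0 - \<Phi> 0 0\<bar> / C) \<le> path_length P s p \<Phi>"
      using path_length_ge[OF C(1) diff_path_DERIV[OF \<Phi>(1), of 0] continuous_path_velocity_at[OF \<Phi>(1)]] by blast
    moreover have "1 / 2 \<le> \<bar>\<Phi> 1 0 - \<Phi> 0 0\<bar>"
    proof -
      have "1 / 2 \<le> \<bar>1 / 2 + real_of_int n\<bar>"
      proof (cases "0 \<le> n")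
        case False
        then have "real_of_int n \<le> -1" by linarith
        then show ?thesis by linarith
      qed simp
      then show ?thesis by (simp add: \<Phi>)
    qed
    ultimately show "ennreal (1 / 2 / C) \<le> path_length P s p \<Phi>"
      using C(1) by (meson divide_right_mono ennreal_leI less_imp_le order_trans)
  qed
  finally show ?thesis .
qed

text \<open>Along a path, the logarithmic modulus of continuity of the velocity keeps \<open>ln (1 - ln \<Delta>)\<close> Lipschitz,
  where \<open>\<Delta>\<close> is the length of the image of a fixed arc.\<close>

lemma diff_diam_eq_top:
  assumes p: "1 < p" and s: "1 + 1 / p \<le> s" and P: "admissible_pu P"
  shows "diff_diam P s p = \<infinity>"
proof -
  obtain C where C: "0 < C" "\<And>X x l. smooth_periodic X \<Longrightarrow> 0 < l \<Longrightarrow> l \<le> 1 \<Longrightarrow>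
    ennreal (\<bar>X (x + l) - X x\<bar> / (l * (1 - ln l)) / C) \<le> W_norm_S1 P s p X"
    by (rule W_norm_S1_ge_modulus[OF p s P]) blast
  have ge: "ennreal B \<le> diff_diam P s p" for B
  proof -
    \<comment> \<open>\<open>B\<close> is the length to be exceeded. The second summand is the value
      of the iterated logarithm at the start, where the arc has length \<open>1/4\<close>;
      \<open>e\<close> is then so small that \<open>Z \<ge> exp (exp L)\<close>.\<close>
    define L where "L = C * B + ln (1 - ln (1 / 4))"
    define e where "e = 2 / exp (4 * exp (exp L))"
    have e: "0 < e" by (simp add: e_def)
    obtain c Z where c: "diff_lift c" and Z: "0 < Z" "ln (1 + 2 / e) / 4 \<le> Z"
      and dc: "\<And>x. deriv c x = (e\<^sup>2 + (sin (pi * x))\<^sup>2) powr (- 1 / 2) / Z"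
      by (rule logarithmic_density[OF e]) blast
    have ZL: "exp (exp L) \<le> Z"
    proof -
      have "4 * exp (exp L) = ln (2 / e)" by (simp add: e_def)
      also have "\<dots> \<le> ln (1 + 2 / e)" using e by (intro ln_mono) auto
      finally show ?thesis using Z(2) by linarith
    qed
    \<comment> \<open>The arc from \<open>1/4\<close> to \<open>1/2\<close> keeps away from the
      integers, so the density there is at most \<open>4 / Z\<close>. Its image under
      \<open>c\<close> has length at most \<open>1 / Z\<close>, which gives
      \<open>ln (1 - ln d) \<ge> L\<close>.\<close>
    define d where "d = c (1/2) - c (1/4)"
    have d0: "0 < d" using diff_lift_less_iff[OF c, of "1/4" "1/2"] by (simp add: d_def)
    have "d \<le> 1 / Z"
    proof -
      have "\<exists>z. 1/4 < z \<and> z < 1/2 \<and> c (1/2) - c (1/4) = (1/2 - 1/4) * deriv c z"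
        by (rule MVT2) (auto intro: diff_lift_DERIV[OF c])
      then obtain z where z: "1/4 < z" "z < 1/2" "d = 1/4 * deriv c z" by (auto simp: d_def)
      have "1 * \<bar>z\<bar> \<le> \<bar>sin (pi * z)\<bar>"
        by (rule abs_sin_pi_diff_lift_ge[OF diff_lift_ident, of 0]) (use z in auto)
      then have "(1/4)\<^sup>2 \<le> \<bar>sin (pi * z)\<bar>\<^sup>2" using z by (intro power_mono) auto
      then have q: "(1/4)\<^sup>2 \<le> e\<^sup>2 + (sin (pi * z))\<^sup>2" by (simp add: add_increasing)
      have "(e\<^sup>2 + (sin (pi * z))\<^sup>2) powr (- 1 / 2) \<le> ((1/4)\<^sup>2) powr (- 1 / 2)"
        by (rule powr_mono2') (use q in auto)
      also have "\<dots> = (1/4) powr (- 1)" by (simp add: powr_powr flip: powr_numeral)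
      also have "\<dots> = 4" by (simp add: powr_minus)
      finally have "deriv c z \<le> 4 / Z" unfolding dc using Z by (intro divide_right_mono) auto
      then show ?thesis using z(3) by simp
    qed
    then have "ln d \<le> ln (1 / Z)" using d0 by (intro ln_mono) auto
    also have "\<dots> = - ln Z" using Z by (simp add: ln_div)
    finally have "ln Z \<le> - ln d" by simp
    moreover have "exp L \<le> ln Z" using ZL Z(1) by (simp add: ln_ge_iff)
    ultimately have "exp L \<le> 1 - ln d" by linarith
    moreover from this have "0 < 1 - ln d" using exp_gt_zero[of L] by linarith
    ultimately have Ld: "L \<le> ln (1 - ln d)" by (simp only: ln_ge_iff)
    show ?thesis
    proof (rule diff_diam_ge[OF diff_lift_ident c])
      fix \<Phi> and n :: int assume \<Phi>: "diff_path \<Phi>" "\<Phi> 0 = (\<lambda>x. x)" "\<Phi> 1 = (\<lambda>x. c x + real_of_int n)"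
      define \<Delta> where "\<Delta> t = \<Phi> t (1/2) - \<Phi> t (1/4)" for t
      define \<Delta>' where "\<Delta>' t = deriv (\<lambda>\<tau>. \<Phi> \<tau> (1/2)) t - deriv (\<lambda>\<tau>. \<Phi> \<tau> (1/4)) t" for t
      \<comment> \<open>Osgood's substitution: up to sign, the antiderivative of
        \<open>1 / (\<Delta> * (1 - ln \<Delta>))\<close>, the reciprocal of the modulus that bounds
        the rate of \<open>\<Delta>\<close>.\<close>
      define \<phi> where "\<phi> t = ln (1 - ln (\<Delta> t))" for t
      define \<phi>' where "\<phi>' t = 1 / (1 - ln (\<Delta> t)) * (0 - 1 / \<Delta> t * \<Delta>' t)" for t
      have D\<Delta>: "(\<Delta> has_real_derivative \<Delta>' t) (at t)" for t
        unfolding \<Delta>_def[abs_def] \<Delta>'_def by (intro DERIV_diff diff_path_DERIV \<Phi>)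
      have \<Delta>: "0 < \<Delta> t" "\<Delta> t < 1" "ln (\<Delta> t) < 0" if "t \<in> {0..1}" for t
      proof -
        have g: "diff_lift (\<Phi> t)" by (rule diff_path_diff_lift[OF \<Phi>(1) that])
        have "\<Phi> t (1/4 + 1) = \<Phi> t (1/4) + 1" using g unfolding diff_lift_def by blast
        then show 1: "0 < \<Delta> t" "\<Delta> t < 1"
          using diff_lift_less_iff[OF g, of "1/4" "1/2"] diff_lift_less_iff[OF g, of "1/2" "1/4 + 1"] by (auto simp: \<Delta>_def)
        then show "ln (\<Delta> t) < 0" by simp
      qed
      have D\<phi>: "(\<phi> has_real_derivative \<phi>' t) (at t)" if "t \<in> {0..1}" for t
      proof -
        have "((\<lambda>t. 1 - ln (\<Delta> t)) has_real_derivative 0 - 1 / \<Delta> t * \<Delta>' t) (at t)"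
          by (intro DERIV_diff DERIV_const DERIV_chain2[OF DERIV_ln_divide D\<Delta>] \<Delta> that)
        moreover have "0 < 1 - ln (\<Delta> t)" using \<Delta>(3)[OF that] by linarith
        ultimately show ?thesis
          unfolding \<phi>_def[abs_def] \<phi>'_def by (intro DERIV_chain2[OF DERIV_ln_divide])
      qed
      have c\<Delta>: "continuous_on {0..1} \<Delta>" by (intro continuous_at_imp_continuous_on ballI DERIV_isCont[OF D\<Delta>])
      have c\<Delta>': "continuous_on {0..1} \<Delta>'" unfolding \<Delta>'_def by (intro continuous_on_diff continuous_path_velocity_at \<Phi>)
      have ne: "\<forall>t\<in>{0..1}. \<Delta> t \<noteq> 0" "\<forall>t\<in>{0..1}. 1 - ln (\<Delta> t) \<noteq> 0" using \<Delta> by (simp add: less_imp_neq[symmetric], fastforce)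
      have c\<phi>': "continuous_on {0..1} \<phi>'"
        unfolding \<phi>'_def
        by (intro continuous_on_mult continuous_on_divide continuous_on_diff continuous_on_const continuous_on_ln c\<Delta> c\<Delta>' ne)
      have "ennreal (\<bar>\<phi>' t\<bar> / C) \<le> W_norm_S1 P s p (path_velocity \<Phi> t)" if t: "0 < t" "t < 1" for t
      proof -
        have t': "t \<in> {0..1}" using t by simp
        have eq: "\<Phi> t (1/4) + \<Delta> t = \<Phi> t (1/2)" by (simp add: \<Delta>_def)
        have "0 < 1 - ln (\<Delta> t)" using \<Delta>(3)[OF t'] by linarith
        then have "\<bar>\<phi>' t\<bar> = \<bar>\<Delta>' t\<bar> / (\<Delta> t * (1 - ln (\<Delta> t)))"
          using \<Delta>(1)[OF t'] abs_of_pos[of "1 - ln (\<Delta> t)"] by (simp add: \<phi>'_def abs_mult)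
        then show ?thesis
          using C(2)[OF path_velocity_periodic[OF \<Phi>(1) t] \<Delta>(1)[OF t'] less_imp_le[OF \<Delta>(2)[OF t']], of "\<Phi> t (1/4)"]
          unfolding eq path_velocity_at[OF \<Phi>(1) t'] \<Delta>'_def by simp
      qed
      from path_length_ge[OF C(1) D\<phi> c\<phi>' this] have "ennreal (\<bar>\<phi> 1 - \<phi> 0\<bar> / C) \<le> path_length P s p \<Phi>" by simp
      moreover have "B \<le> \<bar>\<phi> 1 - \<phi> 0\<bar> / C"
      proof -
        have "\<phi> 1 = ln (1 - ln d)" "\<phi> 0 = ln (1 - ln (1 / 4))" by (simp_all add: \<phi>_def \<Delta>_def d_def \<Phi>)
        then have "C * B \<le> \<phi> 1 - \<phi> 0" using Ld by (simp add: L_def)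
        then have "B * C \<le> \<bar>\<phi> 1 - \<phi> 0\<bar>" by (simp add: mult.commute)
        then show ?thesis using C(1) by (simp only: pos_le_divide_eq)
      qed
      ultimately show "ennreal B \<le> path_length P s p \<Phi>" by (meson ennreal_leI order_trans)
    qed
  qed
  show ?thesis
  proof (cases "diff_diam P s p" rule: ennreal_cases_real)
    case (real r)
    then show ?thesis using ge[of "r + 1"] by simp
  qed simp
qed

theorem theorem3p1:
  fixes p s :: real and P :: "(real \<times> real \<times> (real \<Rightarrow> real)) list"
  assumes "1 < p" and "0 \<le> s" and "admissible_pu P"
  shows "(s \<le> 1 / p \<longrightarrow> diff_diam P s p = 0)
       \<and> (1 / p < s \<and> s < 1 + 1 / p \<longrightarrow> 0 < diff_diam P s p \<and> diff_diam P s p < \<infinity>)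
       \<and> (1 + 1 / p \<le> s \<longrightarrow> diff_diam P s p = \<infinity>)"
  using assms diff_diam_eq_0 diff_diam_pos diff_diam_less_top diff_diam_eq_top by blast

end
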